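(* Let $\Omega\subset\mathbb{R}^n$ be a bounded open domain with smooth boundary. Then the operator matrix $\mathcal{A}$ associated with the abstract version of the wave equation with acoustic boundary conditions on $\Omega$ has compact resolvent if and only if $n=1$.
   Context: The wave equation with acoustic boundary conditions is $\ddot\phi=c^2\Delta\phi$ in $\Omega$, $m\ddot\delta=-d\dot\delta-k\delta-\rho\dot\phi$ and $\dot\delta=\frac{\partial\phi}{\partial\nu}$ on $\partial\Omega$. Here $c>0$ is a constant, $\rho,m,d,k\in L^\infty(\partial\Omega)$, $\rho$ and $m$ are real valued, and $\inf_{\partial\Omega}m>0$. The associated operators are: $X=L^2(\Omega)$, $Y=H^1(\Omega)$, $\partial X=L^2(\partial\Omega)$; $A=c^2\Delta$ with $D(A)=\{u\in H^{3/2}(\Omega):\Delta u\in L^2(\Omega)\}$; $Lu=\frac{\partial u}{\partial\nu}$ and $Ru=\frac{\partial u}{\partial\nu}+\frac{\rho}{m}u|_{\partial\Omega}$ for $u\in D(A)$; $B_1=0$, $B_2u=-\frac{\rho}{m}u|_{\partial\Omega}$ for $u\in H^1(\Omega)$; $B_3g=-\frac{k}{m}g$, $B_4g=-\frac{d}{m}g$ for $g\in L^2(\partial\Omega)$. The operator matrix $\mathcal{A}$ acts on $\mathcal{X}=Y\times X\times\partial X\times\partial X$ by $$\mathcal{A}\begin{pmatrix} u \\ v \\ x \\ y \end{pmatrix}=\begin{pmatrix} v \\ Au \\ Lu \\ (B_1+B_4B_2)u+B_3x+B_4y \end{pmatrix},\quad D(\mathcal{A})=\{(u,v,x,y)\in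 D(A)\times Y\times\partial X\times\partial X: Ru=y\}.$$ *)

theory Defs
  imports "HOL-Analysis.Analysis" "HOL-Library.Function_Algebras"
begin

text \<open>
  Elements of the function spaces below are represented by functions; two representatives are
  the same element when the norm of their difference is zero, i.e. when they agree almost
  everywhere.  Accordingly the norms are seminorms on functions, and an equation between elements
  of a space is expressed by a vanishing norm or by equality almost everywhere.  Only the values on
  the domain (respectively on its boundary) matter.
\<close>

section \<open>Resolvents\<close>

text \<open>
  \<open>X\<close> is the carrier of the Banach space, \<open>N\<close> its norm, \<open>sc\<close> the multiplication by complex
  scalars, and \<open>T\<close> a linear operator with domain \<open>D\<close>.  The estimate in the second clause says that
  \<open>z - T\<close> is injective modulo null elements and that its inverse is bounded.
\<close>

definition resolvent_set ::
    "'s::ab_group_add set \<Rightarrow> ('s \<Rightarrow> real) \<Rightarrow> (complex \<Rightarrow> 's \<Rightarrow> 's) \<Rightarrow> 's set \<Rightarrow> ('s \<Rightarrow> 's) \<Rightarrow> complex set"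
  where "resolvent_set X N sc D T =
    {z. (\<forall>F\<in>X. \<exists>U\<in>D. N (sc z U - T U - F) = 0) \<and>
         (\<exists>C. \<forall>U\<in>D. N U \<le> C * N (sc z U - T U))}"

definition is_resolvent_value ::
    "('s::ab_group_add \<Rightarrow> real) \<Rightarrow> (complex \<Rightarrow> 's \<Rightarrow> 's) \<Rightarrow> 's set \<Rightarrow> ('s \<Rightarrow> 's) \<Rightarrow> complex \<Rightarrow> 's \<Rightarrow> 's \<Rightarrow> bool"
  \<comment> \<open>\<open>U = R(z, T) F\<close>\<close>
  where "is_resolvent_value N sc D T z F U \<longleftrightarrow> U \<in> D \<and> N (sc z U - T U - F) = 0"

definition has_compact_resolvent ::
    "'s::ab_group_add set \<Rightarrow> ('s \<Rightarrow> real) \<Rightarrow> (complex \<Rightarrow> 's \<Rightarrow> 's) \<Rightarrow> 's set \<Rightarrow> ('s \<Rightarrow> 's) \<Rightarrow> bool"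
  where "has_compact_resolvent X N sc D T \<longleftrightarrow>
    resolvent_set X N sc D T \<noteq> {} \<and>
    (\<forall>z\<in>resolvent_set X N sc D T. \<forall>F U.
       (\<forall>j::nat. F j \<in> X \<and> is_resolvent_value N sc D T z (F j) (U j)) \<and> (\<exists>B. \<forall>j. N (F j) \<le> B)
       \<longrightarrow> (\<exists>V\<in>X. \<exists>r. strict_mono r \<and> (\<lambda>j. N (U (r j) - V)) \<longlonglongrightarrow> 0))"


section \<open>Smooth functions and domains with smooth boundary\<close>

definition pd :: "'a::euclidean_space \<Rightarrow> ('a \<Rightarrow> 'b::real_normed_vector) \<Rightarrow> 'a \<Rightarrow> 'b"
  where "pd b f x = frechet_derivative f (at x) b"

fun Ck_on :: "nat \<Rightarrow> 'a::euclidean_space set \<Rightarrow> ('a \<Rightarrow> 'b::real_normed_vector) \<Rightarrow> bool"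
  \<comment> \<open>intended for open \<open>S\<close>\<close>
  where
    "Ck_on 0 S f \<longleftrightarrow> continuous_on S f"
  | "Ck_on (Suc k) S f \<longleftrightarrow> (\<forall>x\<in>S. f differentiable (at x)) \<and> (\<forall>b\<in>Basis. Ck_on k S (pd b f))"

definition smooth_on :: "'a::euclidean_space set \<Rightarrow> ('a \<Rightarrow> 'b::real_normed_vector) \<Rightarrow> bool"
  where "smooth_on S f \<longleftrightarrow> (\<forall>k. Ck_on k S f)"

definition local_defining_function ::
    "'a::euclidean_space set \<Rightarrow> 'a \<Rightarrow> 'a set \<Rightarrow> ('a \<Rightarrow> real) \<Rightarrow> bool"
  where "local_defining_function \<Omega> p W \<psi> \<longleftrightarrow>
    open W \<and> p \<in> W \<and> smooth_on W \<psi> \<and> (\<forall>x\<in>W. \<not> (GDERIV \<psi> x :> 0)) \<and>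
    \<Omega> \<inter> W = {x\<in>W. \<psi> x < 0}"

definition smooth_boundary :: "'a::euclidean_space set \<Rightarrow> bool"
  where "smooth_boundary \<Omega> \<longleftrightarrow> (\<forall>p\<in>frontier \<Omega>. \<exists>W \<psi>. local_defining_function \<Omega> p W \<psi>)"

definition outer_normal :: "'a::euclidean_space set \<Rightarrow> 'a \<Rightarrow> 'a"
  where "outer_normal \<Omega> p =
    (SOME \<nu>. \<exists>W \<psi> G. local_defining_function \<Omega> p W \<psi> \<and> (GDERIV \<psi> p :> G) \<and> \<nu> = sgn G)"


section \<open>Surface measure\<close>

text \<open>
  The \<open>s\<close>-dimensional Hausdorff measure, normalised to agree with Lebesgue measure in dimension
  \<open>s\<close>; for \<open>s = 0\<close> it is the counting measure.  The empty set has to be treated separately since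
  \<open>0 ^ 0 = 1\<close>.  The set function \<open>hausdorff_outer\<close> is a metric outer measure, hence countably
  additive on the Borel sets.
\<close>

definition hausdorff_content :: "nat \<Rightarrow> real \<Rightarrow> 'a::euclidean_space set \<Rightarrow> ennreal"
  where "hausdorff_content s \<delta> E =
    (INF C\<in>{C::nat \<Rightarrow> 'a set. E \<subseteq> (\<Union>i. C i) \<and> (\<forall>i. bounded (C i) \<and> diameter (C i) \<le> \<delta>)}.
       \<Sum>i. if C i = {} then 0
            else ennreal (unit_ball_vol (real s) * (diameter (C i) / 2) ^ s))"

definition hausdorff_outer :: "nat \<Rightarrow> 'a::euclidean_space set \<Rightarrow> ennreal"
  where "hausdorff_outer s E = (SUP \<delta>\<in>{0<..}. hausdorff_content s \<delta> E)"

definition hausdorff_measure :: "nat \<Rightarrow> 'a::euclidean_space measure"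
  where "hausdorff_measure s = measure_of UNIV (sets borel) (hausdorff_outer s)"

definition surface_measure :: "'a::euclidean_space set \<Rightarrow> 'a measure"
  where "surface_measure \<Omega> = restrict_space (hausdorff_measure (DIM('a) - 1)) (frontier \<Omega>)"


section \<open>Function spaces\<close>

definition L2 :: "'a measure \<Rightarrow> ('a \<Rightarrow> complex) set"
  where "L2 M = {f \<in> borel_measurable M. integrable M (\<lambda>x. (cmod (f x))\<^sup>2)}"

definition L2_norm :: "'a measure \<Rightarrow> ('a \<Rightarrow> complex) \<Rightarrow> real"
  where "L2_norm M f = sqrt (LINT x|M. (cmod (f x))\<^sup>2)"

definition Linf :: "'a measure \<Rightarrow> ('a \<Rightarrow> 'b::{real_normed_vector,second_countable_topology}) set"
  where "Linf M = {f \<in> borel_measurable M. \<exists>C. AE x in M. norm (f x) \<le> C}"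

definition test_function :: "'a::euclidean_space set \<Rightarrow> ('a \<Rightarrow> real) \<Rightarrow> bool"
  where "test_function \<Omega> \<eta> \<longleftrightarrow>
    smooth_on UNIV \<eta> \<and> compact (closure {x. \<eta> x \<noteq> 0}) \<and> closure {x. \<eta> x \<noteq> 0} \<subseteq> \<Omega>"

definition has_weak_pd ::
    "'a::euclidean_space set \<Rightarrow> 'a \<Rightarrow> ('a \<Rightarrow> complex) \<Rightarrow> ('a \<Rightarrow> complex) \<Rightarrow> bool"
  where "has_weak_pd \<Omega> b u g \<longleftrightarrow> g \<in> L2 (lebesgue_on \<Omega>) \<and>
    (\<forall>\<eta>. test_function \<Omega> \<eta> \<longrightarrow>
       (LINT x|lebesgue_on \<Omega>. pd b \<eta> x *\<^sub>R u x) = - (LINT x|lebesgue_on \<Omega>. \<eta> x *\<^sub>R g x))"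

definition weak_pd :: "'a::euclidean_space set \<Rightarrow> 'a \<Rightarrow> ('a \<Rightarrow> complex) \<Rightarrow> 'a \<Rightarrow> complex"
  where "weak_pd \<Omega> b u = (SOME g. has_weak_pd \<Omega> b u g)"

definition has_weak_laplacian ::
    "'a::euclidean_space set \<Rightarrow> ('a \<Rightarrow> complex) \<Rightarrow> ('a \<Rightarrow> complex) \<Rightarrow> bool"
  where "has_weak_laplacian \<Omega> u f \<longleftrightarrow> f \<in> L2 (lebesgue_on \<Omega>) \<and>
    (\<forall>\<eta>. test_function \<Omega> \<eta> \<longrightarrow>
       (LINT x|lebesgue_on \<Omega>. (\<Sum>b\<in>Basis. pd b (pd b \<eta>) x) *\<^sub>R u x) =
       (LINT x|lebesgue_on \<Omega>. \<eta> x *\<^sub>R f x))"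

definition weak_laplacian :: "'a::euclidean_space set \<Rightarrow> ('a \<Rightarrow> complex) \<Rightarrow> 'a \<Rightarrow> complex"
  where "weak_laplacian \<Omega> u = (SOME f. has_weak_laplacian \<Omega> u f)"

definition H1 :: "'a::euclidean_space set \<Rightarrow> ('a \<Rightarrow> complex) set"
  where "H1 \<Omega> = {u \<in> L2 (lebesgue_on \<Omega>). \<forall>b\<in>Basis. \<exists>g. has_weak_pd \<Omega> b u g}"

definition H1_norm :: "'a::euclidean_space set \<Rightarrow> ('a \<Rightarrow> complex) \<Rightarrow> real"
  where "H1_norm \<Omega> u =
    sqrt ((L2_norm (lebesgue_on \<Omega>) u)\<^sup>2 +
          (\<Sum>b\<in>Basis. (L2_norm (lebesgue_on \<Omega>) (weak_pd \<Omega> b u))\<^sup>2))"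

text \<open>
  \<open>H\<^sup>3\<^sup>/\<^sup>2\<close> is the Sobolev-Slobodeckij space: the first derivatives have finite
  Gagliardo seminorm of order \<open>1/2\<close>, whose kernel is \<open>\<bar>x - y\<bar>\<close> to the power \<open>n + 2 \<cdot> 1/2\<close>.
\<close>

definition gagliardo_half :: "'a::euclidean_space set \<Rightarrow> ('a \<Rightarrow> complex) \<Rightarrow> ennreal"
  where "gagliardo_half \<Omega> g =
    (\<integral>\<^sup>+x. (\<integral>\<^sup>+y. ennreal ((cmod (g x - g y))\<^sup>2 / norm (x - y) ^ (DIM('a) + 1))
       \<partial>lebesgue_on \<Omega>) \<partial>lebesgue_on \<Omega>)"

definition H32 :: "'a::euclidean_space set \<Rightarrow> ('a \<Rightarrow> complex) set"
  where "H32 \<Omega> = {u \<in> H1 \<Omega>. \<forall>b\<in>Basis. gagliardo_half \<Omega> (weak_pd \<Omega> b u) < \<infinity>}"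

definition H32_norm :: "'a::euclidean_space set \<Rightarrow> ('a \<Rightarrow> complex) \<Rightarrow> real"
  where "H32_norm \<Omega> u =
    sqrt ((H1_norm \<Omega> u)\<^sup>2 + (\<Sum>b\<in>Basis. enn2real (gagliardo_half \<Omega> (weak_pd \<Omega> b u))))"


section \<open>Trace and normal derivative\<close>

text \<open>
  Both are the extensions by continuity from the restrictions to the closure of \<open>\<Omega>\<close> of smooth
  functions on the whole space: the trace with respect to the norm of \<open>H\<^sup>1\<close>, the normal derivative
  with respect to the graph norm of \<open>\<Delta>\<close> on \<open>{u \<in> H\<^sup>3\<^sup>/\<^sup>2. \<Delta>u \<in> L\<^sup>2}\<close> (Lions-Magenes).
  On a bounded domain with smooth boundary they exist, and are unique up to null sets, for all
  \<open>u\<close> in these two spaces; elsewhere the value is \<open>0\<close> by convention.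
\<close>

definition has_trace ::
    "'a::euclidean_space set \<Rightarrow> ('a \<Rightarrow> complex) \<Rightarrow> ('a \<Rightarrow> complex) \<Rightarrow> bool"
  where "has_trace \<Omega> u g \<longleftrightarrow> u \<in> H1 \<Omega> \<and> g \<in> L2 (surface_measure \<Omega>) \<and>
    (\<exists>w::nat \<Rightarrow> 'a \<Rightarrow> complex. (\<forall>j. smooth_on UNIV (w j)) \<and>
       (\<lambda>j. H1_norm \<Omega> (w j - u)) \<longlonglongrightarrow> 0 \<and>
       (\<lambda>j. L2_norm (surface_measure \<Omega>) (w j - g)) \<longlonglongrightarrow> 0)"

definition boundary_trace :: "'a::euclidean_space set \<Rightarrow> ('a \<Rightarrow> complex) \<Rightarrow> 'a \<Rightarrow> complex"
  where "boundary_trace \<Omega> u =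
    (if \<exists>g. has_trace \<Omega> u g then SOME g. has_trace \<Omega> u g else (\<lambda>p. 0))"

definition H32_laplacian :: "'a::euclidean_space set \<Rightarrow> ('a \<Rightarrow> complex) set"
  where "H32_laplacian \<Omega> = {u \<in> H32 \<Omega>. \<exists>f. has_weak_laplacian \<Omega> u f}"

definition has_normal_derivative ::
    "'a::euclidean_space set \<Rightarrow> ('a \<Rightarrow> complex) \<Rightarrow> ('a \<Rightarrow> complex) \<Rightarrow> bool"
  where "has_normal_derivative \<Omega> u g \<longleftrightarrow> u \<in> H32_laplacian \<Omega> \<and> g \<in> L2 (surface_measure \<Omega>) \<and>
    (\<exists>w::nat \<Rightarrow> 'a \<Rightarrow> complex. (\<forall>j. smooth_on UNIV (w j)) \<and>
       (\<lambda>j. H32_norm \<Omega> (w j - u)) \<longlonglongrightarrow> 0 \<and>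
       (\<lambda>j. L2_norm (lebesgue_on \<Omega>) (weak_laplacian \<Omega> (w j - u))) \<longlonglongrightarrow> 0 \<and>
       (\<lambda>j. L2_norm (surface_measure \<Omega>)
               (\<lambda>p. frechet_derivative (w j) (at p) (outer_normal \<Omega> p) - g p)) \<longlonglongrightarrow> 0)"

definition normal_derivative :: "'a::euclidean_space set \<Rightarrow> ('a \<Rightarrow> complex) \<Rightarrow> 'a \<Rightarrow> complex"
  where "normal_derivative \<Omega> u =
    (if \<exists>g. has_normal_derivative \<Omega> u g then SOME g. has_normal_derivative \<Omega> u g else (\<lambda>p. 0))"


section \<open>The operators of the wave equation with acoustic boundary conditions\<close>

definition A_op :: "'a::euclidean_space set \<Rightarrow> real \<Rightarrow> ('a \<Rightarrow> complex) \<Rightarrow> 'a \<Rightarrow> complex"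
  where "A_op \<Omega> c u = (\<lambda>x. of_real (c\<^sup>2) * weak_laplacian \<Omega> u x)"

definition A_dom :: "'a::euclidean_space set \<Rightarrow> ('a \<Rightarrow> complex) set"
  where "A_dom \<Omega> = H32_laplacian \<Omega>"

definition L_op :: "'a::euclidean_space set \<Rightarrow> ('a \<Rightarrow> complex) \<Rightarrow> 'a \<Rightarrow> complex"
  where "L_op \<Omega> u = normal_derivative \<Omega> u"

definition R_op ::
    "'a::euclidean_space set \<Rightarrow> ('a \<Rightarrow> real) \<Rightarrow> ('a \<Rightarrow> real) \<Rightarrow> ('a \<Rightarrow> complex) \<Rightarrow> 'a \<Rightarrow> complex"
  where "R_op \<Omega> \<rho> m u = (\<lambda>p. normal_derivative \<Omega> u p + of_real (\<rho> p / m p) * boundary_trace \<Omega> u p)"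

definition B1_op :: "('a \<Rightarrow> complex) \<Rightarrow> 'a \<Rightarrow> complex"
  where "B1_op u = (\<lambda>p. 0)"

definition B2_op ::
    "'a::euclidean_space set \<Rightarrow> ('a \<Rightarrow> real) \<Rightarrow> ('a \<Rightarrow> real) \<Rightarrow> ('a \<Rightarrow> complex) \<Rightarrow> 'a \<Rightarrow> complex"
  where "B2_op \<Omega> \<rho> m u = (\<lambda>p. - of_real (\<rho> p / m p) * boundary_trace \<Omega> u p)"

definition B3_op :: "('a \<Rightarrow> complex) \<Rightarrow> ('a \<Rightarrow> real) \<Rightarrow> ('a \<Rightarrow> complex) \<Rightarrow> 'a \<Rightarrow> complex"
  where "B3_op k m g = (\<lambda>p. - (k p / of_real (m p)) * g p)"

definition B4_op :: "('a \<Rightarrow> complex) \<Rightarrow> ('a \<Rightarrow> real) \<Rightarrow> ('a \<Rightarrow> complex) \<Rightarrow> 'a \<Rightarrow> complex"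
  where "B4_op d m g = (\<lambda>p. - (d p / of_real (m p)) * g p)"

type_synonym 'a state = "('a \<Rightarrow> complex) \<times> ('a \<Rightarrow> complex) \<times> ('a \<Rightarrow> complex) \<times> ('a \<Rightarrow> complex)"

definition state_space :: "'a::euclidean_space set \<Rightarrow> 'a state set"
  where "state_space \<Omega> =
    H1 \<Omega> \<times> L2 (lebesgue_on \<Omega>) \<times> L2 (surface_measure \<Omega>) \<times> L2 (surface_measure \<Omega>)"

fun state_norm :: "'a::euclidean_space set \<Rightarrow> 'a state \<Rightarrow> real"
  where "state_norm \<Omega> (u, v, x, y) =
    sqrt ((H1_norm \<Omega> u)\<^sup>2 + (L2_norm (lebesgue_on \<Omega>) v)\<^sup>2 +
          (L2_norm (surface_measure \<Omega>) x)\<^sup>2 + (L2_norm (surface_measure \<Omega>) y)\<^sup>2)"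

fun state_scale :: "complex \<Rightarrow> 'a state \<Rightarrow> 'a state"
  where "state_scale z (u, v, x, y) =
    ((\<lambda>t. z * u t), (\<lambda>t. z * v t), (\<lambda>t. z * x t), (\<lambda>t. z * y t))"

fun acoustic_op ::
    "'a::euclidean_space set \<Rightarrow> real \<Rightarrow> ('a \<Rightarrow> real) \<Rightarrow> ('a \<Rightarrow> real) \<Rightarrow> ('a \<Rightarrow> complex) \<Rightarrow> ('a \<Rightarrow> complex)
      \<Rightarrow> 'a state \<Rightarrow> 'a state"
  where "acoustic_op \<Omega> c \<rho> m d k (u, v, x, y) =
    (v, A_op \<Omega> c u, L_op \<Omega> u,
     (B1_op u + B4_op d m (B2_op \<Omega> \<rho> m u)) + B3_op k m x + B4_op d m y)"

definition acoustic_dom ::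
    "'a::euclidean_space set \<Rightarrow> ('a \<Rightarrow> real) \<Rightarrow> ('a \<Rightarrow> real) \<Rightarrow> 'a state set"
  where "acoustic_dom \<Omega> \<rho> m =
    {(u, v, x, y). u \<in> A_dom \<Omega> \<and> v \<in> H1 \<Omega> \<and>
       x \<in> L2 (surface_measure \<Omega>) \<and> y \<in> L2 (surface_measure \<Omega>) \<and>
       (AE p in surface_measure \<Omega>. R_op \<Omega> \<rho> m u p = y p)}"

end

theory Submission
  imports Defs "HOL-Complex_Analysis.Great_Picard"
begin

text \<open>
  The statement turns on the two components \<open>x\<close> and \<open>y\<close> of a state, which live on the boundary.

  In dimension at least two \<open>L\<^sup>2(\<partial>\<Omega>)\<close> has infinite dimension.  To see this for the Hausdorff measure,
  \<open>metric_outer_measure_borel\<close> shows that it is a measure on the Borel sets, and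
  \<open>frontier_infinitely_many_pieces\<close> cuts the boundary near one of its points, where it is a Lipschitz
  graph, into infinitely many disjoint pieces of positive finite measure; their normalised indicators
  \<open>e\<^sub>j\<close> are orthonormal.  The domain puts no condition on \<open>x\<close>, and the operator depends on \<open>x\<close> only through
  the bounded multiplication by \<open>- k / m\<close>.  The vectors \<open>(0, 0, e\<^sub>j, y)\<close> are thus resolvent values of a
  bounded sequence without having a convergent subsequence (\<open>acoustic_resolvent_not_compact\<close>).

  In dimension one \<open>\<Omega>\<close> is a bounded interval, the boundary consists of two points with counting measure,
  and everything reduces to absolutely continuous functions: an element of \<open>H\<^sup>1\<close> has a representative
  that is the primitive of a square integrable function (\<open>has_weak_pd_imp_primitive\<close>), its trace
  is given by the values of this representative (\<open>has_trace_represented\<close>), and for \<open>u\<close> in the domain of the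
  Laplacian the derivative is such a representative too, with the normal derivative given by its values
  (\<open>has_normal_derivative_represented2\<close>).  That the weak Laplacian is square integrable already implies the
  condition of \<open>H\<^sup>3\<^sup>/\<^sup>2\<close>, by an estimate of the Gagliardo seminorm (\<open>gagliardo_primitive_on\<close>).

  The resolvent equation for a large real \<open>\<zeta>\<close> is then a two-point boundary value problem for
  \<open>u'' = (\<zeta> / c)\<^sup>2 u + q\<close>.  Its solutions split into two parts that decay from one end to the other, so the
  two boundary conditions are nearly decoupled; this gives existence and an estimate
  (\<open>boundary_value_exists\<close>, \<open>boundary_value_estimate\<close>), and \<open>resolvent_set_nonempty\<close> follows.

  For every \<open>z\<close> in the resolvent set, bounded right-hand sides give solutions for which \<open>u\<close>, \<open>u'\<close> and \<open>v\<close>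
  are primitives of functions bounded in \<open>L\<^sup>2\<close>.  By the theorem of Arzela and Ascoli a subsequence of
  these functions converges uniformly, along with the four boundary values of \<open>x\<close> and \<open>y\<close>
  (\<open>primitives_convergent_subsequence\<close>).  This is convergence in the norm of the state space.
\<close>

section \<open>Hausdorff measures are Borel measures\<close>

text \<open>
  Caratheodory's criterion.  The layers of \<open>E - A\<close> whose distance to \<open>A\<close> lies between
  consecutive terms of \<open>1 / (n + 1)\<close> are separated from all layers but their neighbours, so the
  outer measures of the even layers, and of the odd ones, have sum at most \<open>\<mu> E\<close>.  Their total \<open>S\<close>
  is therefore finite, and can be cancelled from \<open>\<mu> (E \<inter> A) + \<mu> (E - A) + S \<le> \<mu> E + S\<close>.
\<close>

lemma metric_outer_measure_closed:
  fixes \<mu> :: "'a::metric_space set \<Rightarrow> ennreal"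
  assumes oms: "outer_measure_space UNIV \<mu>"
    and metric: "\<And>A B \<eta>. \<eta> > 0 \<Longrightarrow> (\<And>x y. x \<in> A \<Longrightarrow> y \<in> B \<Longrightarrow> \<eta> \<le> dist x y) \<Longrightarrow> \<mu> A + \<mu> B \<le> \<mu> (A \<union> B)"
    and A: "closed A"
  shows "\<mu> (E \<inter> A) + \<mu> (E - A) \<le> \<mu> E"
proof (cases "A = {} \<or> \<mu> E = \<infinity>")
  case True
  then show ?thesis using oms
    by (auto simp: outer_measure_space_def positive_def)
next
  case False
  have mono: "\<mu> X \<le> \<mu> Y" if "X \<subseteq> Y" for X Y
    using oms that by (auto simp: outer_measure_space_def increasing_def)
  have empty: "\<mu> {} = 0"
    using oms by (auto simp: outer_measure_space_def positive_def)
  have csub: "\<mu> (\<Union>i. X i) \<le> (\<Sum>i. \<mu> (X i))" for X :: "nat \<Rightarrow> 'a set"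
  proof -
    have "\<mu> (\<Union>i. X i) = \<mu> (\<Union>i. disjointed X i)" by (simp add: UN_disjointed_eq)
    also have "\<dots> \<le> (\<Sum>i. \<mu> (disjointed X i))"
      using oms disjoint_family_disjointed[of X]
      by (auto simp: outer_measure_space_def countably_subadditive_def)
    also have "\<dots> \<le> (\<Sum>i. \<mu> (X i))"
      by (intro suminf_le mono disjointed_subset) auto
    finally show ?thesis .
  qed
  have sub: "\<mu> (X \<union> Y) \<le> \<mu> X + \<mu> Y" for X Y
  proof -
    have "\<mu> (X \<union> Y) = \<mu> (\<Union>i. binaryset X Y i)" by (simp add: UN_binaryset_eq)
    also have "\<dots> \<le> (\<Sum>i. \<mu> (binaryset X Y i))" by (rule csub)
    also have "\<dots> = \<mu> X + \<mu> Y"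
      by (rule suminf_binaryset_eq) (simp add: empty)
    finally show ?thesis .
  qed
  define B where "B n = {x\<in>E. 1 / (real n + 1) \<le> infdist x A}" for n :: nat
  define D where "D n = B (Suc n) - B n" for n
  have BE: "B n \<subseteq> E - A" for n
  proof -
    have "infdist x A = 0" if "x \<in> A" for x using that by simp
    moreover have "0 < 1 / (real n + 1)" by simp
    ultimately show ?thesis by (fastforce simp: B_def)
  qed
  have Bmono: "B n \<subseteq> B (Suc n)" for n
  proof -
    have "1 / (real (Suc n) + 1) \<le> 1 / (real n + 1)" by (simp add: field_simps)
    then show ?thesis by (auto simp: B_def)
  qed
  have DE: "D n \<subseteq> E" for n using BE by (auto simp: D_def)
  have Bsep: "\<mu> (E \<inter> A) + \<mu> (B n) \<le> \<mu> E" for n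
  proof -
    have "\<mu> (E \<inter> A) + \<mu> (B n) \<le> \<mu> (E \<inter> A \<union> B n)"
    proof (rule metric)
      fix x y assume "x \<in> E \<inter> A" "y \<in> B n"
      then show "1 / (real n + 1) \<le> dist x y"
        using infdist_le[of x A y] by (auto simp: B_def dist_commute)
    qed auto
    also have "\<dots> \<le> \<mu> E" using BE by (intro mono) auto
    finally show ?thesis .
  qed
  have layers: "(\<Sum>i<N. \<mu> (D (2 * i + k))) \<le> \<mu> (\<Union>i<N. D (2 * i + k))" for N k
  proof (induction N)
    case 0 then show ?case by (simp add: empty)
  next
    case (Suc N)
    have "(\<Sum>i<Suc N. \<mu> (D (2 * i + k))) \<le> \<mu> (\<Union>i<N. D (2 * i + k)) + \<mu> (D (2 * N + k))"
      using Suc by (simp add: add_right_mono)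
    also have "\<dots> \<le> \<mu> ((\<Union>i<N. D (2 * i + k)) \<union> D (2 * N + k))"
    proof (cases "N = 0")
      case True then show ?thesis by (simp add: empty)
    next
      case False
      show ?thesis
      proof (rule metric)
        have "real (2 * N + k - 2) + 2 < real (2 * N + k) + 1" using False by simp
        then have "1 / (real (2 * N + k) + 1) < 1 / (real (2 * N + k - 2) + 2)"
          by (intro divide_strict_left_mono) auto
        then show "0 < 1 / (real (2 * N + k - 2) + 2) - 1 / (real (2 * N + k) + 1)"
          by simp
        fix x y assume "x \<in> (\<Union>i<N. D (2 * i + k))" and y: "y \<in> D (2 * N + k)"
        then obtain i where i: "i < N" and x: "x \<in> D (2 * i + k)" by auto
        have "1 / (real (2 * N + k - 2) + 2) \<le> 1 / (real (Suc (2 * i + k)) + 1)"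
          using i by (intro divide_left_mono) auto
        also have "\<dots> \<le> infdist x A" using x by (auto simp: D_def B_def)
        also have "\<dots> \<le> infdist y A + dist x y" by (rule infdist_triangle)
        also have "infdist y A \<le> 1 / (real (2 * N + k) + 1)"
          using y by (auto simp: D_def B_def)
        finally show "1 / (real (2 * N + k - 2) + 2) - 1 / (real (2 * N + k) + 1) \<le> dist x y"
          by simp
      qed
    qed
    also have "((\<Union>i<N. D (2 * i + k)) \<union> D (2 * N + k)) = (\<Union>i<Suc N. D (2 * i + k))"
      by (auto simp: less_Suc_eq)
    finally show ?case .
  qed
  have layersE: "(\<Sum>i<N. \<mu> (D (2 * i + k))) \<le> \<mu> E" for N k
    by (rule order_trans[OF layers mono]) (use DE in auto)
  have "(\<Sum>i<M. \<mu> (D i)) \<le> \<mu> E + \<mu> E" for M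
  proof -
    have "(\<Sum>i<M. \<mu> (D i)) \<le> (\<Sum>i<2 * M. \<mu> (D i))" by (rule sum_mono2) auto
    also have "\<dots> = (\<Sum>i<M. \<mu> (D (2 * i + 0))) + (\<Sum>i<M. \<mu> (D (2 * i + 1)))"
      by (induction M) (auto simp: ac_simps)
    also have "\<dots> \<le> \<mu> E + \<mu> E" by (intro add_mono layersE)
    finally show ?thesis .
  qed
  then have "(\<Sum>i. \<mu> (D i)) \<le> \<mu> E + \<mu> E"
    by (simp add: suminf_eq_SUP SUP_least)
  then have fin: "(\<Sum>i. \<mu> (D i)) < \<infinity>"
    using False by (auto simp: top.not_eq_extremum intro: le_less_trans)
  have cover: "E - A \<subseteq> B n \<union> (\<Union>i. D (i + n))" for n
  proof
    fix x assume x: "x \<in> E - A"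
    then have "infdist x A > 0"
      using A False in_closed_iff_infdist_zero[of A x] infdist_nonneg[of x A] by fastforce
    then obtain j where "inverse (real (Suc j)) < infdist x A" using reals_Archimedean by blast
    then have ex: "x \<in> B j" using x by (auto simp: B_def field_simps)
    define l where "l = (LEAST j. x \<in> B j)"
    have l: "x \<in> B l" unfolding l_def using ex by (rule LeastI)
    show "x \<in> B n \<union> (\<Union>i. D (i + n))"
    proof (cases "l \<le> n")
      case True
      then have "B l \<subseteq> B n" using lift_Suc_mono_le[of B l n] Bmono by simp
      then show ?thesis using l by auto
    next
      case False
      then obtain l' where l': "l = Suc l'" "n \<le> l'" by (cases l) auto
      then have "x \<notin> B l'" using not_less_Least[of l' "\<lambda>j. x \<in> B j"] unfolding l_def by linarith
      then have "x \<in> D ((l' - n) + n)" using l l' by (auto simp: D_def)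
      then show ?thesis by blast
    qed
  qed
  have step: "\<mu> (E \<inter> A) + \<mu> (E - A) + (\<Sum>i<n. \<mu> (D i)) \<le> \<mu> E + (\<Sum>i. \<mu> (D i))" for n
  proof -
    have "\<mu> (E - A) \<le> \<mu> (B n) + (\<Sum>i. \<mu> (D (i + n)))"
      by (rule order_trans[OF order_trans[OF mono[OF cover[of n]] sub]]) (intro add_left_mono csub)
    then have "\<mu> (E \<inter> A) + \<mu> (E - A) + (\<Sum>i<n. \<mu> (D i))
       \<le> \<mu> (E \<inter> A) + (\<mu> (B n) + (\<Sum>i. \<mu> (D (i + n)))) + (\<Sum>i<n. \<mu> (D i))"
      by (intro add_mono order_refl)
    also have "\<dots> = (\<mu> (E \<inter> A) + \<mu> (B n)) + ((\<Sum>i. \<mu> (D (i + n))) + (\<Sum>i<n. \<mu> (D i)))"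
      by (simp add: ac_simps)
    also have "\<dots> \<le> \<mu> E + (\<Sum>i. \<mu> (D i))"
      unfolding suminf_offset[of "\<lambda>i. \<mu> (D i)" n, OF summableI, symmetric]
      using Bsep[of n] by (rule add_right_mono)
    finally show ?thesis .
  qed
  have "\<mu> (E \<inter> A) + \<mu> (E - A) + (\<Sum>i. \<mu> (D i)) \<le> \<mu> E + (\<Sum>i. \<mu> (D i))"
    unfolding suminf_eq_SUP[of "\<lambda>i. \<mu> (D i)"]
    by (subst ennreal_SUP_add_right) (auto intro!: SUP_least step[unfolded suminf_eq_SUP])
  then have "(\<Sum>i. \<mu> (D i)) + (\<mu> (E \<inter> A) + \<mu> (E - A)) \<le> (\<Sum>i. \<mu> (D i)) + \<mu> E"
    by (simp add: add.commute)
  then show ?thesis using fin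
    unfolding ennreal_add_left_cancel_le by auto
qed

lemma metric_outer_measure_borel:
  fixes \<mu> :: "'a::metric_space set \<Rightarrow> ennreal"
  assumes oms: "outer_measure_space UNIV \<mu>"
    and metric: "\<And>A B \<eta>. \<eta> > 0 \<Longrightarrow> (\<And>x y. x \<in> A \<Longrightarrow> y \<in> B \<Longrightarrow> \<eta> \<le> dist x y) \<Longrightarrow> \<mu> A + \<mu> B \<le> \<mu> (A \<union> B)"
  shows "measure_space UNIV (sets borel) \<mu>"
proof -
  interpret P: sigma_algebra UNIV "Pow UNIV :: 'a set set" by (rule sigma_algebra_Pow)
  let ?L = "lambda_system UNIV (Pow UNIV) \<mu>"
  have ms: "measure_space UNIV ?L \<mu>" using P.caratheodory_lemma oms by simp
  then interpret L: sigma_algebra UNIV ?L by (simp add: measure_space_def)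
  have le: "\<mu> E \<le> \<mu> (E \<inter> A) + \<mu> (E - A)" for E A
  proof -
    have "subadditive UNIV \<mu>"
      using P.countably_subadditive_subadditive[of \<mu>] oms by (simp add: outer_measure_space_def)
    from subadditiveD[OF this, of "E \<inter> A" "E - A"] show ?thesis
      by (simp add: Int_Diff_Un Int_Diff_disjoint)
  qed
  have "A \<in> ?L" if "closed A" for A
    using antisym[OF metric_outer_measure_closed[OF oms _ that] le] metric
    unfolding P.lambda_system_eq by blast
  then have "sigma_sets UNIV (Collect closed) \<subseteq> ?L"
    by (intro L.sigma_sets_subset) auto
  then have "sets borel \<subseteq> ?L" by (simp add: borel_eq_closed)
  then show ?thesis
    using ms measure_down sets.sigma_algebra_axioms[of borel] by fastforce
qed

definition hausdorff_size :: "nat \<Rightarrow> 'a::euclidean_space set \<Rightarrow> ennreal"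
  where "hausdorff_size s X = (if X = {} then 0 else ennreal (unit_ball_vol (real s) * (diameter X / 2) ^ s))"

lemma hausdorff_size_empty [simp]: "hausdorff_size s {} = 0"
  by (simp add: hausdorff_size_def)

lemma hausdorff_content_alt: "hausdorff_content s \<delta> E =
    (INF C\<in>{C::nat \<Rightarrow> 'a::euclidean_space set. E \<subseteq> (\<Union>i. C i) \<and> (\<forall>i. bounded (C i) \<and> diameter (C i) \<le> \<delta>)}.
       \<Sum>i. hausdorff_size s (C i))"
  by (simp add: hausdorff_content_def hausdorff_size_def)

lemma hausdorff_content_mono:
  "A \<subseteq> B \<Longrightarrow> hausdorff_content s \<delta> A \<le> hausdorff_content s \<delta> B"
  unfolding hausdorff_content_def by (rule INF_superset_mono) auto

lemma hausdorff_content_antimono: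
  "\<delta> \<le> \<epsilon> \<Longrightarrow> hausdorff_content s \<epsilon> A \<le> hausdorff_content s \<delta> A"
  unfolding hausdorff_content_def by (rule INF_superset_mono) (auto intro: order_trans)

lemma hausdorff_content_le_outer:
  "\<delta> > 0 \<Longrightarrow> hausdorff_content s \<delta> A \<le> hausdorff_outer s A"
  unfolding hausdorff_outer_def by (rule SUP_upper) auto

lemma hausdorff_content_UN_le:
  fixes A :: "nat \<Rightarrow> 'a::euclidean_space set"
  shows "hausdorff_content s \<delta> (\<Union>n. A n) \<le> (\<Sum>n. hausdorff_content s \<delta> (A n))"
proof (rule ennreal_le_epsilon)
  let ?H = "hausdorff_content s \<delta>"
  let ?c = "hausdorff_size s :: 'a set \<Rightarrow> ennreal"
  fix e :: real assume "0 < e" "(\<Sum>n. ?H (A n)) < top"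
  then have *: "?H (A n) < ?H (A n) + e * (1/2)^Suc n" for n
    by (auto simp add: less_top dest!: ennreal_suminf_lessD)
  have "\<exists>C. A n \<subseteq> (\<Union>i. C i) \<and> (\<forall>i. bounded (C i) \<and> diameter (C i) \<le> \<delta>) \<and>
           (\<Sum>i. ?c (C i)) \<le> ?H (A n) + e * (1/2)^Suc n" for n
  proof -
    from *[of n] obtain C where C: "C \<in> {C. A n \<subseteq> (\<Union>i. C i) \<and> (\<forall>i. bounded (C i) \<and> diameter (C i) \<le> \<delta>)}"
      and less: "(\<Sum>i. ?c (C i)) < ?H (A n) + e * (1/2)^Suc n"
      unfolding hausdorff_content_alt INF_less_iff by blast
    from C less_imp_le[OF less] show ?thesis by blast
  qed
  then obtain C where CC: "\<And>n. A n \<subseteq> (\<Union>i. C n i) \<and> (\<forall>i. bounded (C n i) \<and> diameter (C n i) \<le> \<delta>) \<and>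
           (\<Sum>i. ?c (C n i)) \<le> ?H (A n) + e * (1/2)^Suc n"
    using choice[of "\<lambda>n C. A n \<subseteq> (\<Union>i. C i) \<and> (\<forall>i. bounded (C i) \<and> diameter (C i) \<le> \<delta>) \<and>
           (\<Sum>i. ?c (C i)) \<le> ?H (A n) + e * (1/2)^Suc n"] by blast
  then have C: "\<And>n. A n \<subseteq> (\<Union>i. C n i)" "\<And>n i. bounded (C n i)" "\<And>n i. diameter (C n i) \<le> \<delta>"
      and le: "\<And>n. (\<Sum>i. ?c (C n i)) \<le> ?H (A n) + e * (1/2)^Suc n"
    by simp_all
  define C' where "C' i = (case prod_decode i of (n, j) \<Rightarrow> C n j)" for i
  have cover: "(\<Union>n. A n) \<subseteq> (\<Union>i. C' i)"
  proof
    fix x assume "x \<in> (\<Union>n. A n)"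
    then obtain n j where "x \<in> C n j" using C(1) by blast
    then have "x \<in> C' (prod_encode (n, j))" by (simp add: C'_def)
    then show "x \<in> (\<Union>i. C' i)" by blast
  qed
  have "?H (\<Union>n. A n) \<le> (\<Sum>i. ?c (C' i))"
    unfolding hausdorff_content_alt
    by (rule INF_lower) (use cover C(2,3) in \<open>auto simp: C'_def split: prod.split\<close>)
  also have "\<dots> = (\<Sum>i. case_prod (\<lambda>n j. ?c (C n j)) (prod_decode i))"
    by (simp add: C'_def split_def)
  also have "\<dots> = (\<Sum>n. \<Sum>i. ?c (C n i))"
    by (rule suminf_ennreal_2dimen) simp
  also have "\<dots> \<le> (\<Sum>n. ?H (A n) + e * (1/2) ^ Suc n)"
    by (intro suminf_le allI le) auto
  also have "\<dots> = (\<Sum>n. ?H (A n)) + (\<Sum>n. ennreal e * ennreal ((1/2) ^ Suc n))"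
    using \<open>0 < e\<close> by (subst suminf_add[symmetric])
                     (auto simp del: ennreal_suminf_cmult simp add: ennreal_mult[symmetric])
  also have "\<dots> = (\<Sum>n. ?H (A n)) + e"
    unfolding ennreal_suminf_cmult
    by (subst suminf_ennreal_eq[OF zero_le_power power_half_series]) auto
  finally show "?H (\<Union>n. A n) \<le> (\<Sum>n. ?H (A n)) + e" .
qed

lemma hausdorff_outer_empty: "hausdorff_outer s {} = 0"
proof -
  have "hausdorff_content s \<delta> {} \<le> 0" if "\<delta> > 0" for \<delta> :: real
    unfolding hausdorff_content_alt using that
    by (intro INF_lower2[of "\<lambda>_. {}"]) (auto simp: diameter_empty)
  then show ?thesis unfolding hausdorff_outer_def by (intro antisym SUP_least) auto
qed

lemma outer_measure_space_hausdorff: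
  "outer_measure_space UNIV (hausdorff_outer s :: 'a::euclidean_space set \<Rightarrow> ennreal)"
  unfolding outer_measure_space_def
proof (intro conjI)
  show "positive UNIV (hausdorff_outer s)" by (simp add: positive_def hausdorff_outer_empty)
  show "increasing UNIV (hausdorff_outer s)"
    unfolding increasing_def hausdorff_outer_def by (auto intro!: SUP_mono' hausdorff_content_mono)
  show "countably_subadditive UNIV (hausdorff_outer s :: 'a set \<Rightarrow> ennreal)"
    unfolding countably_subadditive_def
  proof (intro allI impI)
    fix A :: "nat \<Rightarrow> 'a set"
    show "hausdorff_outer s (\<Union>i. A i) \<le> (\<Sum>i. hausdorff_outer s (A i))"
      unfolding hausdorff_outer_def[of s "\<Union>i. A i"]
      by (intro SUP_least order_trans[OF hausdorff_content_UN_le] suminf_le hausdorff_content_le_outer) auto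
  qed
qed

text \<open>
  A set whose diameter is smaller than the distance of \<open>A\<close> and \<open>B\<close> meets at most one of them, so
  that a fine cover of \<open>A \<union> B\<close> splits into covers of \<open>A\<close> and of \<open>B\<close>.
\<close>

lemma hausdorff_outer_separated:
  fixes A B :: "'a::euclidean_space set"
  assumes \<eta>: "\<eta> > 0" "\<And>x y. x \<in> A \<Longrightarrow> y \<in> B \<Longrightarrow> \<eta> \<le> dist x y"
  shows "hausdorff_outer s A + hausdorff_outer s B \<le> hausdorff_outer s (A \<union> B)"
proof -
  let ?c = "hausdorff_size s :: 'a set \<Rightarrow> ennreal"
  have small: "hausdorff_content s \<delta> A + hausdorff_content s \<delta> B \<le> hausdorff_content s \<delta> (A \<union> B)"
    if "0 < \<delta>" "\<delta> < \<eta>" for \<delta>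
    unfolding hausdorff_content_alt[of s \<delta> "A \<union> B"]
  proof (rule INF_greatest, clarify)
    fix C :: "nat \<Rightarrow> 'a set"
    assume C: "A \<union> B \<subseteq> (\<Union>i. C i)" and bd: "\<forall>i. bounded (C i) \<and> diameter (C i) \<le> \<delta>"
    define C1 where "C1 X i = (if C i \<inter> X = {} then {} else C i)" for X i
    have le: "hausdorff_content s \<delta> X \<le> (\<Sum>i. ?c (C1 X i))" if "X \<subseteq> A \<union> B" for X
      unfolding hausdorff_content_alt
    proof (rule INF_lower, clarify, intro conjI allI)
      show "X \<subseteq> (\<Union>i. C1 X i)" using C that by (fastforce simp: C1_def)
      show "bounded (C1 X i)" "diameter (C1 X i) \<le> \<delta>" for i
        using bd \<open>0 < \<delta>\<close> by (auto simp: C1_def diameter_empty)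
    qed
    have "C i \<inter> A = {} \<or> C i \<inter> B = {}" for i
    proof (rule ccontr)
      assume "\<not> ?thesis"
      then obtain x y where "x \<in> C i" "x \<in> A" "y \<in> C i" "y \<in> B" by blast
      then show False
        using \<eta>(2)[of x y] diameter_bounded_bound[of "C i" x y] bd \<open>\<delta> < \<eta>\<close> by (smt (verit))
    qed
    then have "?c (C1 A i) + ?c (C1 B i) \<le> ?c (C i)" for i
      by (auto simp: C1_def)
    then have "(\<Sum>i. ?c (C1 A i) + ?c (C1 B i)) \<le> (\<Sum>i. ?c (C i))"
      by (intro suminf_le) auto
    moreover have "(\<Sum>i. ?c (C1 A i) + ?c (C1 B i)) = (\<Sum>i. ?c (C1 A i)) + (\<Sum>i. ?c (C1 B i))"
      by (rule suminf_add[symmetric]) auto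
    ultimately show "hausdorff_content s \<delta> A + hausdorff_content s \<delta> B \<le> (\<Sum>i. ?c (C i))"
      using add_mono[OF le[of A] le[of B]] by auto
  qed
  have "hausdorff_outer s A + hausdorff_outer s B =
      (SUP \<delta>\<in>{0<..}. hausdorff_content s \<delta> A + hausdorff_content s \<delta> B)"
    unfolding hausdorff_outer_def
  proof (rule SUP_add_directed_ennreal[symmetric])
    fix i j :: real assume "i \<in> {0<..}" "j \<in> {0<..}"
    then show "\<exists>k\<in>{0<..}. hausdorff_content s i A + hausdorff_content s j B
       \<le> hausdorff_content s k A + hausdorff_content s k B"
      by (intro bexI[of _ "min i j"] add_mono hausdorff_content_antimono) auto
  qed
  also have "\<dots> \<le> hausdorff_outer s (A \<union> B)"
  proof (rule SUP_least)
    fix \<delta> :: real assume \<delta>: "\<delta> \<in> {0<..}"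
    have "hausdorff_content s \<delta> A + hausdorff_content s \<delta> B
       \<le> hausdorff_content s (min \<delta> (\<eta> / 2)) A + hausdorff_content s (min \<delta> (\<eta> / 2)) B"
      by (intro add_mono hausdorff_content_antimono) auto
    also have "\<dots> \<le> hausdorff_content s (min \<delta> (\<eta> / 2)) (A \<union> B)"
      using \<delta> \<eta>(1) by (intro small) auto
    also have "\<dots> \<le> hausdorff_outer s (A \<union> B)"
      using \<delta> \<eta>(1) by (intro hausdorff_content_le_outer) auto
    finally show "hausdorff_content s \<delta> A + hausdorff_content s \<delta> B \<le> hausdorff_outer s (A \<union> B)" .
  qed
  finally show ?thesis .
qed

lemma sets_hausdorff_measure [simp]: "sets (hausdorff_measure s) = sets borel"
  and space_hausdorff_measure [simp]: "space (hausdorff_measure s) = UNIV"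
  unfolding hausdorff_measure_def
  using sets.sigma_sets_eq[of borel] by (simp_all add: space_measure_of_conv)

lemma emeasure_hausdorff_measure:
  assumes "A \<in> sets borel"
  shows "emeasure (hausdorff_measure s) A = hausdorff_outer s A"
proof -
  have "measure_space UNIV (sets borel) (hausdorff_outer s :: 'a set \<Rightarrow> ennreal)"
    by (rule metric_outer_measure_borel[OF outer_measure_space_hausdorff hausdorff_outer_separated])
  then show ?thesis using assms sets.sigma_sets_eq[of "borel :: 'a measure"]
    unfolding hausdorff_measure_def
    by (intro emeasure_measure_of) (auto simp: measure_space_def)
qed

section \<open>The surface measure of a smooth boundary\<close>

text \<open>
  A set that projects along a basis vector \<open>b\<close> onto a set with interior has positive measure: sweeping
  the sets of a cover along \<open>b\<close> gives boxes of volume proportional to a power of their diameters,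
  and these boxes cover a fixed box.
\<close>

lemma hausdorff_outer_pos_if_projection:
  fixes E :: "'a::euclidean_space set"
  assumes b: "b \<in> Basis" and box: "box l u \<noteq> {}"
    and proj: "\<And>x. x \<in> box l u \<Longrightarrow> \<exists>t. x + t *\<^sub>R b \<in> E"
  shows "hausdorff_outer (DIM('a) - 1) E > 0"
proof (rule ccontr)
  assume "\<not> ?thesis"
  let ?s = "DIM('a) - 1"
  let ?c = "hausdorff_size ?s :: 'a set \<Rightarrow> ennreal"
  define w where "w = unit_ball_vol (real ?s)"
  have w: "w > 0" unfolding w_def by (rule unit_ball_vol_pos) simp
  define v where "v = (\<Prod>i\<in>Basis. (u - l) \<bullet> i)"
  define h where "h = (u - l) \<bullet> b"
  have lu: "\<And>i. i \<in> Basis \<Longrightarrow> l \<bullet> i < u \<bullet> i" using box by (simp add: box_ne_empty)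
  have v: "v > 0" unfolding v_def using lu by (intro prod_pos) (auto simp: inner_diff_left)
  have h: "h > 0" unfolding h_def using lu b by (auto simp: inner_diff_left)
  \<comment> \<open>A box of height \<open>h\<close> and width \<open>2 D\<close> has \<open>K\<close> times the size \<open>w (D / 2) ^ (n - 1)\<close> of a set of diameter \<open>D\<close>.\<close>
  define K where "K = h * 4 ^ ?s / w"
  have K: "K > 0" using h w by (simp add: K_def)
  from \<open>\<not> ?thesis\<close> have "hausdorff_content ?s 1 E < ennreal (v / K)"
    using hausdorff_content_le_outer[of 1 ?s E] v K by (auto simp: not_less)
  then obtain C where C: "E \<subseteq> (\<Union>i. C i)" "\<And>i. bounded (C i)"
      and sum: "(\<Sum>i. ?c (C i)) < ennreal (v / K)"
    unfolding hausdorff_content_alt INF_less_iff by blast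
  define S where "S i = {x \<in> box l u. \<exists>t. x + t *\<^sub>R b \<in> C i}" for i
  have Sle: "\<exists>T\<in>sets lborel. S i \<subseteq> T \<and> emeasure lborel T \<le> ennreal K * ?c (C i)" for i
  proof (cases "C i = {}")
    case True
    then show ?thesis by (intro bexI[of _ "{}"]) (auto simp: S_def)
  next
    case False
    then obtain q where q: "q \<in> C i" by blast
    define D where "D = diameter (C i)"
    have D: "D \<ge> 0" unfolding D_def by (rule diameter_ge_0[OF C(2)])
    define l' u' where "l' = (\<Sum>j\<in>Basis. (if j = b then l \<bullet> b else q \<bullet> j - D) *\<^sub>R j)"
      and "u' = (\<Sum>j\<in>Basis. (if j = b then u \<bullet> b else q \<bullet> j + D) *\<^sub>R j)"
    have l': "l' \<bullet> j = (if j = b then l \<bullet> b else q \<bullet> j - D)"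
      and u': "u' \<bullet> j = (if j = b then u \<bullet> b else q \<bullet> j + D)" if "j \<in> Basis" for j
      using that by (simp_all add: l'_def u'_def)
    have sub: "S i \<subseteq> cbox l' u'"
    proof
      fix x assume "x \<in> S i"
      then obtain t where x: "x \<in> box l u" and t: "x + t *\<^sub>R b \<in> C i" by (auto simp: S_def)
      have "\<bar>(x - q) \<bullet> j\<bar> \<le> D" if j: "j \<in> Basis" "j \<noteq> b" for j
      proof -
        have "(x - q) \<bullet> j = (x + t *\<^sub>R b - q) \<bullet> j"
          using j b by (simp add: inner_left_distrib inner_diff_left inner_not_same_Basis)
        also have "\<bar>\<dots>\<bar> \<le> norm (x + t *\<^sub>R b - q)" using j by (intro Basis_le_norm)
        also have "\<dots> \<le> D" unfolding D_def
          using diameter_bounded_bound[OF C(2) t q] by (simp add: dist_norm)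
        finally show ?thesis .
      qed
      then show "x \<in> cbox l' u'"
        using x unfolding mem_box by (auto simp: l' u' inner_diff_left abs_le_iff less_imp_le algebra_simps)
    qed
    have "emeasure lborel (cbox l' u') = ennreal (\<Prod>j\<in>Basis. (u' - l') \<bullet> j)"
      using lu b D by (intro emeasure_lborel_cbox) (auto simp: l' u' less_imp_le)
    also have "(\<Prod>j\<in>Basis. (u' - l') \<bullet> j) = (\<Prod>j\<in>Basis. if j = b then h else 2 * D)"
      by (intro prod.cong) (auto simp: l' u' inner_diff_left h_def)
    also have "\<dots> = h * (2 * D) ^ ?s"
      using b by (subst prod.remove[of _ b]) auto
    also have "\<dots> = K * (w * (D / 2) ^ ?s)"
    proof -
      have "(2 * D) ^ ?s = 4 ^ ?s * (D / 2) ^ ?s"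
        unfolding power_mult_distrib[symmetric] by simp
      then show ?thesis using w unfolding K_def by simp
    qed
    also have "ennreal \<dots> = ennreal K * ?c (C i)"
      using False K unfolding hausdorff_size_def w_def D_def by (subst ennreal_mult') auto
    finally have "emeasure lborel (cbox l' u') \<le> ennreal K * ?c (C i)" by simp
    then show ?thesis using sub by (intro bexI[of _ "cbox l' u'"]) auto
  qed
  then obtain T where T: "\<And>i. T i \<in> sets lborel" "\<And>i. S i \<subseteq> T i"
      "\<And>i. emeasure lborel (T i) \<le> ennreal K * ?c (C i)" by metis
  have "box l u \<subseteq> (\<Union>i. T i)"
  proof
    fix x assume x: "x \<in> box l u"
    then obtain t where "x + t *\<^sub>R b \<in> E" using proj by blast
    then obtain i where "x + t *\<^sub>R b \<in> C i" using C(1) by blast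
    then have "x \<in> S i" using x by (auto simp: S_def)
    then show "x \<in> (\<Union>i. T i)" using T(2) by blast
  qed
  then have "emeasure lborel (box l u) \<le> emeasure lborel (\<Union>i. T i)"
    using T(1) by (intro emeasure_mono) auto
  also have "\<dots> \<le> (\<Sum>i. emeasure lborel (T i))"
    using T(1) by (intro emeasure_subadditive_countably) auto
  also have "\<dots> \<le> (\<Sum>i. ennreal K * ?c (C i))"
    by (intro suminf_le T(3)) auto
  also have "\<dots> = ennreal K * (\<Sum>i. ?c (C i))" by simp
  also have "\<dots> < ennreal K * ennreal (v / K)"
    using sum K by (intro ennreal_mult_strict_left_mono) auto
  also have "\<dots> = ennreal v" using K v by (simp flip: ennreal_mult)
  also have "\<dots> = emeasure lborel (box l u)"
    using lu by (simp add: v_def emeasure_lborel_box less_imp_le)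
  finally show False by simp
qed

text \<open>
  A bounded Lipschitz graph over the hyperplane orthogonal to \<open>b\<close> has finite measure: the \<open>N ^ (n - 1)\<close>
  pieces above the cells of a grid of mesh \<open>s / N\<close> have diameter at most a constant times \<open>s / N\<close>.
\<close>

lemma hausdorff_outer_lipschitz_graph_finite:
  fixes E :: "'a::euclidean_space set"
  assumes b: "b \<in> Basis" and s: "s > 0" and M: "M \<ge> 0"
    and cube: "\<And>x i. x \<in> E \<Longrightarrow> i \<in> Basis \<Longrightarrow> a \<bullet> i \<le> x \<bullet> i \<and> x \<bullet> i < a \<bullet> i + s"
    and lip: "\<And>x y. x \<in> E \<Longrightarrow> y \<in> E \<Longrightarrow> \<bar>(x - y) \<bullet> b\<bar> \<le> M * (\<Sum>i\<in>Basis - {b}. \<bar>(x - y) \<bullet> i\<bar>)"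
  shows "hausdorff_outer (DIM('a) - 1) E < \<infinity>"
proof -
  let ?s = "DIM('a) - 1"
  define w where "w = unit_ball_vol (real ?s)"
  have w: "w > 0" unfolding w_def by (rule unit_ball_vol_pos) simp
  let ?c = "hausdorff_size ?s :: 'a set \<Rightarrow> ennreal"
  define K where "K = (M + 1) * real ?s * s"
  have K: "K \<ge> 0" using M s by (simp add: K_def)
  have "hausdorff_content ?s \<delta> E \<le> ennreal (w * (K / 2) ^ ?s)" if \<delta>: "\<delta> > 0" for \<delta>
  proof -
    obtain N :: nat where N: "real N > K / \<delta>" using reals_Archimedean2 by blast
    have N0: "N > 0" using N K \<delta> by (cases N) (auto simp: divide_less_0_iff)
    define I where "I = (PiE (Basis - {b}) (\<lambda>_. {..<N}) :: ('a \<Rightarrow> nat) set)"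
    have I: "finite I" "card I = N ^ ?s"
      unfolding I_def using b by (auto simp: finite_PiE card_PiE)
    define cell where "cell f = {x \<in> E. \<forall>i\<in>Basis - {b}. f i = nat \<lfloor>(x \<bullet> i - a \<bullet> i) * N / s\<rfloor>}" for f :: "'a \<Rightarrow> nat"
    have cov: "\<exists>f\<in>I. x \<in> cell f" if x: "x \<in> E" for x
    proof (intro bexI)
      let ?f = "restrict (\<lambda>i. nat \<lfloor>(x \<bullet> i - a \<bullet> i) * N / s\<rfloor>) (Basis - {b})"
      show "x \<in> cell ?f" using x by (simp add: cell_def)
      have "nat \<lfloor>(x \<bullet> i - a \<bullet> i) * N / s\<rfloor> < N" if "i \<in> Basis" for i
      proof -
        have "(x \<bullet> i - a \<bullet> i) * N / s < N" "0 \<le> (x \<bullet> i - a \<bullet> i) * N / s"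
          using cube[OF x that] s N0 by (auto simp: divide_simps)
        then show ?thesis by (simp add: floor_less_iff nat_less_iff)
      qed
      then show "?f \<in> I" by (auto simp: I_def)
    qed
    have dist: "dist x y \<le> K / N" if "x \<in> cell f" "y \<in> cell f" for x y f
    proof -
      have xy: "x \<in> E" "y \<in> E" using that by (auto simp: cell_def)
      have co: "\<bar>(x - y) \<bullet> i\<bar> \<le> s / N" if i: "i \<in> Basis - {b}" for i
      proof -
        have "0 \<le> (x \<bullet> i - a \<bullet> i) * N / s" "0 \<le> (y \<bullet> i - a \<bullet> i) * N / s"
          using cube[OF xy(1)] cube[OF xy(2)] i s by auto
        moreover have "nat \<lfloor>(x \<bullet> i - a \<bullet> i) * N / s\<rfloor> = nat \<lfloor>(y \<bullet> i - a \<bullet> i) * N / s\<rfloor>"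
          using that i \<open>x \<in> cell f\<close> \<open>y \<in> cell f\<close> by (simp add: cell_def)
        ultimately have "\<lfloor>(x \<bullet> i - a \<bullet> i) * N / s\<rfloor> = \<lfloor>(y \<bullet> i - a \<bullet> i) * N / s\<rfloor>"
          by (simp add: eq_nat_nat_iff)
        then have "\<bar>(x \<bullet> i - a \<bullet> i) * N / s - (y \<bullet> i - a \<bullet> i) * N / s\<bar> < 1" by linarith
        moreover have "(x \<bullet> i - a \<bullet> i) * N / s - (y \<bullet> i - a \<bullet> i) * N / s = ((x - y) \<bullet> i) * N / s"
          by (simp add: inner_diff_left algebra_simps flip: diff_divide_distrib)
        ultimately have "\<bar>(x - y) \<bullet> i\<bar> * N / s < 1" using s by (simp add: abs_mult)
        then show ?thesis using s N0 by (simp add: field_simps)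
      qed
      have "norm (x - y) \<le> (\<Sum>i\<in>Basis. \<bar>(x - y) \<bullet> i\<bar>)" by (rule norm_le_l1)
      also have "\<dots> = \<bar>(x - y) \<bullet> b\<bar> + (\<Sum>i\<in>Basis - {b}. \<bar>(x - y) \<bullet> i\<bar>)"
        using b by (intro sum.remove) auto
      also have "\<dots> \<le> (M + 1) * (\<Sum>i\<in>Basis - {b}. \<bar>(x - y) \<bullet> i\<bar>)"
        using lip[OF xy] by (simp add: algebra_simps)
      also have "\<dots> \<le> (M + 1) * (\<Sum>i\<in>Basis - {b}. s / N)"
        using M by (intro mult_left_mono sum_mono co) auto
      also have "\<dots> = K / N" using b by (simp add: K_def)
      finally show ?thesis by (simp add: dist_norm)
    qed
    have bd: "bounded (cell f) \<and> diameter (cell f) \<le> K / N" for f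
    proof
      show "diameter (cell f) \<le> K / N"
        using dist K by (intro diameter_le) (auto simp: dist_norm)
      show "bounded (cell f)"
      proof (cases "cell f = {}")
        case False
        then obtain x where "x \<in> cell f" by blast
        then show ?thesis unfolding bounded_def using dist by blast
      qed auto
    qed
    obtain f where f: "bij_betw f {..<N ^ ?s} I"
      using ex_bij_betw_nat_finite[OF I(1)] I(2) by (auto simp: atLeast0LessThan)
    define C where "C i = (if i < N ^ ?s then cell (f i) else {})" for i
    have "hausdorff_content ?s \<delta> E \<le> (\<Sum>i. ?c (C i))"
      unfolding hausdorff_content_alt
    proof (rule INF_lower, clarify, intro conjI allI)
      show "E \<subseteq> (\<Union>i. C i)"
      proof
        fix x assume "x \<in> E"
        then obtain g where "g \<in> I" "x \<in> cell g" using cov by blast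
        moreover from \<open>g \<in> I\<close> obtain i where "i < N ^ ?s" "f i = g"
          using f by (auto simp: bij_betw_def)
        ultimately have "x \<in> C i" by (simp add: C_def)
        then show "x \<in> (\<Union>i. C i)" by blast
      qed
      have "K / N \<le> \<delta>" using N N0 \<delta> by (simp add: field_simps)
      then show "diameter (C i) \<le> \<delta>" for i
        using bd[of "f i"] \<delta> by (auto simp: C_def diameter_empty)
      show "bounded (C i)" for i using bd by (simp add: C_def)
    qed
    also have "\<dots> = (\<Sum>i<N ^ ?s. ?c (C i))"
      by (intro suminf_finite) (auto simp: C_def)
    also have "\<dots> \<le> (\<Sum>i<N ^ ?s. ennreal (w * (K / N / 2) ^ ?s))"
    proof (intro sum_mono)
      fix i
      have "0 \<le> diameter (C i)" by (rule diameter_ge_0) (use bd in \<open>auto simp: C_def\<close>)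
      moreover have "diameter (C i) \<le> K / N" using bd[of "f i"] K by (auto simp: C_def diameter_empty)
      ultimately have "w * (diameter (C i) / 2) ^ ?s \<le> w * (K / N / 2) ^ ?s"
        using w by (intro mult_left_mono power_mono) auto
      then show "?c (C i) \<le> ennreal (w * (K / N / 2) ^ ?s)"
        by (auto simp: hausdorff_size_def w_def intro: ennreal_leI)
    qed
    also have "\<dots> = ennreal (real (N ^ ?s) * (w * (K / N / 2) ^ ?s))"
      using w K by (simp add: ennreal_of_nat_eq_real_of_nat ennreal_mult' flip: of_nat_power)
    also have "real (N ^ ?s) * (w * (K / N / 2) ^ ?s) = w * (real N * (K / N / 2)) ^ ?s"
      by (simp only: of_nat_power power_mult_distrib mult_ac)
    also have "real N * (K / N / 2) = K / 2" using N0 by simp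
    finally show ?thesis .
  qed
  then have "hausdorff_outer ?s E \<le> ennreal (w * (K / 2) ^ ?s)"
    unfolding hausdorff_outer_def by (intro SUP_least) auto
  then show ?thesis by (auto intro: le_less_trans)
qed

lemma smooth_onD:
  assumes "smooth_on S f" "x \<in> S"
  shows "f differentiable (at x)"
  using assms Ck_on.simps(2)[of 0 S f] by (auto simp: smooth_on_def)

lemma smooth_on_pd_continuous:
  assumes "smooth_on S f" "b \<in> Basis"
  shows "continuous_on S (pd b f)"
proof -
  have "Ck_on (Suc 0) S f" using assms(1) unfolding smooth_on_def by blast
  then show ?thesis using assms(2) by simp
qed

lemma frechet_derivative_eq_sum_pd:
  fixes f :: "'a::euclidean_space \<Rightarrow> 'b::real_normed_vector"
  assumes "f differentiable (at x)"
  shows "frechet_derivative f (at x) h = (\<Sum>i\<in>Basis. (h \<bullet> i) *\<^sub>R pd i f x)"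
proof -
  interpret linear "frechet_derivative f (at x)"
    using assms by (rule linear_frechet_derivative)
  have "frechet_derivative f (at x) (\<Sum>i\<in>Basis. (h \<bullet> i) *\<^sub>R i) = (\<Sum>i\<in>Basis. (h \<bullet> i) *\<^sub>R pd i f x)"
    by (simp add: sum scale pd_def)
  then show ?thesis by (simp add: euclidean_representation)
qed

lemma DERIV_along_basis:
  fixes f :: "'a::euclidean_space \<Rightarrow> real"
  assumes "f differentiable (at x)"
  shows "((\<lambda>t. f (x + t *\<^sub>R b)) has_real_derivative pd b f x) (at 0)"
proof -
  have f: "(f has_derivative frechet_derivative f (at x)) (at (x + 0 *\<^sub>R b))"
    using assms by (simp add: frechet_derivative_works)
  interpret linear "frechet_derivative f (at x)"
    using assms by (rule linear_frechet_derivative)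
  have "((\<lambda>t. x + t *\<^sub>R b) has_derivative (\<lambda>t. t *\<^sub>R b)) (at 0)"
    by (auto intro!: derivative_eq_intros)
  from diff_chain_at[OF this f]
  have "((\<lambda>t. f (x + t *\<^sub>R b)) has_derivative (\<lambda>t. frechet_derivative f (at x) (t *\<^sub>R b))) (at 0)"
    by (simp add: o_def)
  moreover have "(\<lambda>t. frechet_derivative f (at x) (t *\<^sub>R b)) = (*) (pd b f x)"
    by (auto simp: fun_eq_iff scale pd_def)
  ultimately show ?thesis by (simp add: has_field_derivative_def)
qed

lemma sign_change_along_basis:
  fixes f :: "'a::euclidean_space \<Rightarrow> real"
  assumes "f differentiable (at x)" "f x = 0" "pd b f x \<noteq> 0"
  obtains d where "d > 0" "\<And>t. 0 < t \<Longrightarrow> t < d \<Longrightarrow> f (x + t *\<^sub>R b) * f (x - t *\<^sub>R b) < 0"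
proof -
  define \<sigma> where "\<sigma> = sgn (pd b f x)"
  let ?g = "\<lambda>t. \<sigma> * f (x + t *\<^sub>R b)"
  have D: "(?g has_real_derivative \<sigma> * pd b f x) (at 0)"
    by (intro DERIV_cmult DERIV_along_basis assms)
  have pos: "\<sigma> * pd b f x > 0"
    using assms(3) by (simp add: \<sigma>_def sgn_if)
  obtain d1 where d1: "d1 > 0" "\<And>h. 0 < h \<Longrightarrow> h < d1 \<Longrightarrow> ?g 0 < ?g (0 + h)"
    using DERIV_pos_inc_right[OF D pos] by blast
  obtain d2 where d2: "d2 > 0" "\<And>h. 0 < h \<Longrightarrow> h < d2 \<Longrightarrow> ?g (0 - h) < ?g 0"
    using DERIV_pos_inc_left[OF D pos] by blast
  show thesis
  proof (rule that[of "min d1 d2"])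
    fix t assume "0 < t" "t < min d1 d2"
    then have "0 < \<sigma> * f (x + t *\<^sub>R b)" "\<sigma> * f (x - t *\<^sub>R b) < 0"
      using d1(2)[of t] d2(2)[of t] assms(2) by auto
    then show "f (x + t *\<^sub>R b) * f (x - t *\<^sub>R b) < 0"
      by (auto simp: zero_less_mult_iff mult_less_0_iff)
  qed (use d1 d2 in auto)
qed

context
  fixes \<Omega> W :: "'a::euclidean_space set" and p \<psi>
  assumes ldf: "local_defining_function \<Omega> p W \<psi>"
begin

lemma local_defining_pd_nonzero:
  assumes "x \<in> W"
  obtains b where "b \<in> Basis" "pd b \<psi> x \<noteq> 0"
proof -
  have "\<exists>b\<in>Basis. pd b \<psi> x \<noteq> 0"
  proof (rule ccontr)
    assume "\<not> ?thesis"
    moreover have diff: "\<psi> differentiable (at x)"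
      using ldf assms by (auto simp: local_defining_function_def intro: smooth_onD)
    ultimately have "frechet_derivative \<psi> (at x) = (\<lambda>h. h \<bullet> 0)"
      by (intro ext) (simp add: frechet_derivative_eq_sum_pd)
    then have "GDERIV \<psi> x :> 0"
      using diff unfolding frechet_derivative_works gderiv_def by metis
    then show False using ldf assms by (auto simp: local_defining_function_def)
  qed
  then show ?thesis using that by blast
qed

lemma local_defining_frontier_iff:
  assumes op: "open \<Omega>" and x: "x \<in> W"
  shows "x \<in> frontier \<Omega> \<longleftrightarrow> \<psi> x = 0"
proof -
  have W: "open W" "smooth_on W \<psi>" "\<Omega> \<inter> W = {x\<in>W. \<psi> x < 0}"
    using ldf by (auto simp: local_defining_function_def)
  have diff: "\<psi> differentiable (at y)" if "y \<in> W" for y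
    using W(2) that by (rule smooth_onD)
  then have cont: "continuous_on W \<psi>"
    by (intro continuous_at_imp_continuous_on ballI differentiable_imp_continuous_within)
  have fr: "frontier \<Omega> = closure \<Omega> - \<Omega>" using op by (simp add: frontier_def interior_open)
  show ?thesis
  proof
    assume "x \<in> frontier \<Omega>"
    then have "x \<notin> \<Omega>" "x \<in> closure \<Omega>" by (auto simp: fr)
    then have "\<not> \<psi> x < 0" using W(3) x by blast
    moreover have "\<not> \<psi> x > 0"
    proof
      assume "\<psi> x > 0"
      have "open (W \<inter> \<psi> -` {0<..})"
        by (rule continuous_open_preimage[OF cont W(1)]) simp
      moreover have "x \<in> W \<inter> \<psi> -` {0<..}" using x \<open>\<psi> x > 0\<close> by simp
      ultimately have "(W \<inter> \<psi> -` {0<..}) \<inter> \<Omega> \<noteq> {}"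
        using \<open>x \<in> closure \<Omega>\<close> open_Int_closure_eq_empty[of "W \<inter> \<psi> -` {0<..}" \<Omega>] by blast
      then obtain y where "y \<in> \<Omega>" "y \<in> W" "\<psi> y > 0" by auto
      then show False using W(3) by force
    qed
    ultimately show "\<psi> x = 0" by simp
  next
    assume zero: "\<psi> x = 0"
    then have "x \<notin> \<Omega>" using W(3) x by force
    moreover have "x \<in> closure \<Omega>"
    proof -
      obtain b where b: "b \<in> Basis" "pd b \<psi> x \<noteq> 0" by (rule local_defining_pd_nonzero[OF x])
      obtain d where d: "d > 0" "\<And>t. 0 < t \<Longrightarrow> t < d \<Longrightarrow> \<psi> (x + t *\<^sub>R b) * \<psi> (x - t *\<^sub>R b) < 0"
        using sign_change_along_basis[OF diff[OF x] zero b(2)] by blast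
      obtain r where r: "r > 0" "ball x r \<subseteq> W" using W(1) x openE by blast
      show ?thesis unfolding closure_approachable
      proof (intro allI impI)
        fix \<epsilon> :: real assume "0 < \<epsilon>"
        define t where "t = min d (min r \<epsilon>) / 2"
        have t: "0 < t" "t < d" "t < r" "t < \<epsilon>" using d(1) r(1) \<open>0 < \<epsilon>\<close> by (auto simp: t_def)
        have near: "x + t *\<^sub>R b \<in> W" "x - t *\<^sub>R b \<in> W"
          using r(2) t b by (auto simp: dist_norm subset_iff)
        have "\<psi> (x + t *\<^sub>R b) < 0 \<or> \<psi> (x - t *\<^sub>R b) < 0"
          using d(2)[OF t(1,2)] by (auto simp: mult_less_0_iff)
        then have "x + t *\<^sub>R b \<in> \<Omega> \<or> x - t *\<^sub>R b \<in> \<Omega>" using near W(3) by blast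
        moreover have "dist (x + t *\<^sub>R b) x < \<epsilon>" "dist (x - t *\<^sub>R b) x < \<epsilon>"
          using t b by (auto simp: dist_norm)
        ultimately show "\<exists>y\<in>\<Omega>. dist y x < \<epsilon>" by blast
      qed
    qed
    ultimately show "x \<in> frontier \<Omega>" by (simp add: fr)
  qed
qed

end

text \<open>
  Near a boundary point some partial derivative of the defining function \<open>\<psi>\<close>, in a direction \<open>b\<close>
  say, does not vanish.  By the mean value theorem the boundary is there a Lipschitz graph over the
  hyperplane orthogonal to \<open>b\<close>, and by the intermediate value theorem it lies above a whole
  neighbourhood in that hyperplane.  Slicing it along a second basis vector, which exists in dimension at
  least two, gives the pieces.
\<close>

lemma frontier_infinitely_many_pieces:
  fixes \<Omega> :: "'a::euclidean_space set"
  assumes op: "open \<Omega>" and sb: "smooth_boundary \<Omega>" and p: "p \<in> frontier \<Omega>" and dim: "DIM('a) \<ge> 2"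
  obtains E :: "nat \<Rightarrow> 'a set" where "disjoint_family E" "\<And>i. E i \<in> sets borel"
    "\<And>i. E i \<subseteq> frontier \<Omega>" "\<And>i. 0 < hausdorff_outer (DIM('a) - 1) (E i)"
    "\<And>i. hausdorff_outer (DIM('a) - 1) (E i) < \<infinity>"
proof -
  obtain W \<psi> where ldf: "local_defining_function \<Omega> p W \<psi>"
    using sb p by (auto simp: smooth_boundary_def)
  then have W: "open W" "p \<in> W" "smooth_on W \<psi>" by (auto simp: local_defining_function_def)
  have fr: "x \<in> frontier \<Omega> \<longleftrightarrow> \<psi> x = 0" if "x \<in> W" for x
    by (rule local_defining_frontier_iff[OF ldf op that])
  have diff: "\<psi> differentiable (at y)" if "y \<in> W" for y
    using W(3) that by (rule smooth_onD)
  then have cont: "continuous_on W \<psi>"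
    by (intro continuous_at_imp_continuous_on ballI differentiable_imp_continuous_within)
  obtain b where b: "b \<in> Basis" "pd b \<psi> p \<noteq> 0" by (rule local_defining_pd_nonzero[OF ldf W(2)])
  define g where "g x = (\<Sum>i\<in>Basis. \<bar>pd i \<psi> x\<bar>)" for x
  have cpd: "continuous_on W (pd i \<psi>)" if "i \<in> Basis" for i
    using W(3) that by (rule smooth_on_pd_continuous)
  have cg: "continuous_on W g" unfolding g_def by (intro continuous_intros cpd)
  define \<alpha> where "\<alpha> = \<bar>pd b \<psi> p\<bar> / 2"
  define L where "L = g p + 1"
  have \<alpha>: "\<alpha> > 0" using b by (simp add: \<alpha>_def)
  have L: "L > 0" unfolding L_def g_def by (intro add_nonneg_pos sum_nonneg) auto
  have "open ((W \<inter> (\<lambda>x. \<bar>pd b \<psi> x\<bar>) -` {\<alpha><..}) \<inter> (W \<inter> g -` {..<L}))"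
    by (intro open_Int continuous_open_preimage[OF continuous_on_rabs[OF cpd[OF b(1)]] W(1)]
          continuous_open_preimage[OF cg W(1)]) auto
  moreover have "p \<in> (W \<inter> (\<lambda>x. \<bar>pd b \<psi> x\<bar>) -` {\<alpha><..}) \<inter> (W \<inter> g -` {..<L})"
    using W(2) b by (auto simp: \<alpha>_def L_def)
  ultimately obtain r where r: "r > 0"
    and ball: "ball p r \<subseteq> (W \<inter> (\<lambda>x. \<bar>pd b \<psi> x\<bar>) -` {\<alpha><..}) \<inter> (W \<inter> g -` {..<L})"
    by (meson openE)
  have bW: "ball p r \<subseteq> W" using ball by blast
  define Z where "Z = frontier \<Omega> \<inter> ball p r"
  have lip: "\<bar>(x - y) \<bullet> b\<bar> \<le> L / \<alpha> * (\<Sum>i\<in>Basis - {b}. \<bar>(x - y) \<bullet> i\<bar>)" if xy: "x \<in> Z" "y \<in> Z" for x y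
  proof -
    have in_ball: "x \<in> ball p r" "y \<in> ball p r" using xy by (auto simp: Z_def)
    then have zero: "\<psi> x = 0" "\<psi> y = 0" using xy fr bW by (auto simp: Z_def)
    have seg: "y + t *\<^sub>R (x - y) \<in> ball p r" if "0 \<le> t" "t \<le> 1" for t
      using convexD_alt[OF convex_ball in_ball(2,1) that] by (simp add: algebra_simps)
    let ?h = "\<lambda>t. \<psi> (y + t *\<^sub>R (x - y))"
    have D: "(?h has_derivative (\<lambda>s. frechet_derivative \<psi> (at (y + t *\<^sub>R (x - y))) (s *\<^sub>R (x - y)))) (at t)"
      if "0 \<le> t" "t \<le> 1" for t
    proof -
      have "(\<psi> has_derivative frechet_derivative \<psi> (at (y + t *\<^sub>R (x - y)))) (at (y + t *\<^sub>R (x - y)))"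
        using diff[of "y + t *\<^sub>R (x - y)"] seg[OF that] bW by (auto simp: frechet_derivative_works)
      moreover have "((\<lambda>t. y + t *\<^sub>R (x - y)) has_derivative (\<lambda>s. s *\<^sub>R (x - y))) (at t)"
        by (auto intro!: derivative_eq_intros)
      ultimately show ?thesis using diff_chain_at by (fastforce simp: o_def)
    qed
    have "\<exists>t\<in>{0<..<1}. ?h 1 - ?h 0 = frechet_derivative \<psi> (at (y + t *\<^sub>R (x - y))) ((1 - 0) *\<^sub>R (x - y))"
      by (rule mvt_simple) (auto intro: has_derivative_at_withinI D)
    then obtain t where t: "0 < t" "t < 1"
      and eq: "?h 1 - ?h 0 = frechet_derivative \<psi> (at (y + t *\<^sub>R (x - y))) ((1 - 0) *\<^sub>R (x - y))"
      by auto
    define \<xi> where "\<xi> = y + t *\<^sub>R (x - y)"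
    have \<xi>: "\<xi> \<in> ball p r" using seg[of t] t by (simp add: \<xi>_def)
    have "0 = (\<Sum>i\<in>Basis. ((x - y) \<bullet> i) * pd i \<psi> \<xi>)"
      using eq zero frechet_derivative_eq_sum_pd[OF diff, of \<xi> "x - y"] \<xi> bW by (auto simp: \<xi>_def[symmetric])
    then have "((x - y) \<bullet> b) * pd b \<psi> \<xi> = - (\<Sum>i\<in>Basis - {b}. ((x - y) \<bullet> i) * pd i \<psi> \<xi>)"
      using sum.remove[OF finite_Basis b(1), of "\<lambda>i. ((x - y) \<bullet> i) * pd i \<psi> \<xi>"] by linarith
    then have "\<bar>(x - y) \<bullet> b\<bar> * \<bar>pd b \<psi> \<xi>\<bar> = \<bar>\<Sum>i\<in>Basis - {b}. ((x - y) \<bullet> i) * pd i \<psi> \<xi>\<bar>"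
      unfolding abs_mult[symmetric] by simp
    also have "\<dots> \<le> (\<Sum>i\<in>Basis - {b}. \<bar>((x - y) \<bullet> i) * pd i \<psi> \<xi>\<bar>)"
      by (rule sum_abs)
    also have "\<dots> \<le> (\<Sum>i\<in>Basis - {b}. \<bar>(x - y) \<bullet> i\<bar> * L)"
    proof (rule sum_mono)
      fix i assume i: "i \<in> Basis - {b}"
      have "\<bar>pd i \<psi> \<xi>\<bar> \<le> g \<xi>" unfolding g_def
        using i by (intro member_le_sum) auto
      also have "g \<xi> < L" using \<xi> ball by auto
      finally show "\<bar>((x - y) \<bullet> i) * pd i \<psi> \<xi>\<bar> \<le> \<bar>(x - y) \<bullet> i\<bar> * L"
        by (simp add: abs_mult mult_left_mono)
    qed
    finally have "\<bar>(x - y) \<bullet> b\<bar> * \<bar>pd b \<psi> \<xi>\<bar> \<le> L * (\<Sum>i\<in>Basis - {b}. \<bar>(x - y) \<bullet> i\<bar>)"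
      by (simp add: sum_distrib_left mult.commute)
    moreover have "\<bar>(x - y) \<bullet> b\<bar> * \<alpha> \<le> \<bar>(x - y) \<bullet> b\<bar> * \<bar>pd b \<psi> \<xi>\<bar>"
      using \<xi> ball by (intro mult_left_mono) auto
    ultimately show ?thesis using \<alpha> by (simp add: field_simps)
  qed
  define a where "a = p - (\<Sum>i\<in>Basis. r *\<^sub>R i)"
  have cube: "a \<bullet> i \<le> x \<bullet> i \<and> x \<bullet> i < a \<bullet> i + 2 * r" if "x \<in> Z" "i \<in> Basis" for x i
  proof -
    have "\<bar>(x - p) \<bullet> i\<bar> < r"
      using Basis_le_norm[OF that(2), of "x - p"] that(1) by (auto simp: Z_def dist_norm norm_minus_commute)
    moreover have "a \<bullet> i = p \<bullet> i - r" using that(2) by (simp add: a_def inner_diff_left)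
    ultimately show ?thesis by (auto simp: inner_diff_left)
  qed
  have finZ: "hausdorff_outer (DIM('a) - 1) E < \<infinity>" if "E \<subseteq> Z" for E
  proof (rule hausdorff_outer_lipschitz_graph_finite[OF b(1)])
    show "2 * r > 0" "L / \<alpha> \<ge> 0" using r L \<alpha> by auto
    show "a \<bullet> i \<le> x \<bullet> i \<and> x \<bullet> i < a \<bullet> i + 2 * r" if "x \<in> E" "i \<in> Basis" for x i
      using cube that \<open>E \<subseteq> Z\<close> by blast
    show "\<bar>(x - y) \<bullet> b\<bar> \<le> L / \<alpha> * (\<Sum>i\<in>Basis - {b}. \<bar>(x - y) \<bullet> i\<bar>)" if "x \<in> E" "y \<in> E" for x y
      using lip that \<open>E \<subseteq> Z\<close> by blast
  qed
  \<comment> \<open>The segments in direction \<open>b\<close> through points near \<open>p\<close> cross the boundary.\<close>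
  have zp: "\<psi> p = 0" using fr W(2) p by blast
  obtain d where d: "d > 0" "\<And>t. 0 < t \<Longrightarrow> t < d \<Longrightarrow> \<psi> (p + t *\<^sub>R b) * \<psi> (p - t *\<^sub>R b) < 0"
    using sign_change_along_basis[OF diff[OF W(2)] zp b(2)] by blast
  define t where "t = min d r / 2"
  have t: "0 < t" "t < d" "t < r" using d(1) r by (auto simp: t_def)
  have nb: "norm b = 1" using b by simp
  define q where "q x = \<psi> (x + t *\<^sub>R b) * \<psi> (x - t *\<^sub>R b)" for x
  have cq: "continuous_on (ball p (r - t)) q"
    unfolding q_def
  proof (intro continuous_intros continuous_on_compose2[OF cont])
    have "dist p (x + t *\<^sub>R b) < r" "dist p (x - t *\<^sub>R b) < r" if "x \<in> ball p (r - t)" for x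
    proof -
      have "dist x (x + t *\<^sub>R b) = t" "dist x (x - t *\<^sub>R b) = t" using nb t by (auto simp: dist_norm)
      then show "dist p (x + t *\<^sub>R b) < r" "dist p (x - t *\<^sub>R b) < r"
        using that dist_triangle[of p "x + t *\<^sub>R b" x] dist_triangle[of p "x - t *\<^sub>R b" x] by auto
    qed
    then show "(\<lambda>x. x + t *\<^sub>R b) ` ball p (r - t) \<subseteq> W" "(\<lambda>x. x - t *\<^sub>R b) ` ball p (r - t) \<subseteq> W"
      using bW by auto
  qed
  have "open (ball p (r - t) \<inter> q -` {..<0})"
    by (rule continuous_open_preimage[OF cq]) auto
  moreover have "p \<in> ball p (r - t) \<inter> q -` {..<0}" using t d(2)[OF t(1,2)] by (simp add: q_def)
  ultimately obtain \<eta>0 where \<eta>0: "\<eta>0 > 0" "ball p \<eta>0 \<subseteq> ball p (r - t) \<inter> q -` {..<0}"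
    by (meson openE)
  have cross: "\<exists>s. x + s *\<^sub>R b \<in> Z" if x: "x \<in> ball p \<eta>0" for x
  proof -
    have x': "dist p x < r - t" "q x < 0" using x \<eta>0 by auto
    have inb: "x + s *\<^sub>R b \<in> ball p r" if "s \<in> {-t..t}" for s
    proof -
      have "dist x (x + s *\<^sub>R b) \<le> t" using nb that by (auto simp: dist_norm)
      then show ?thesis using x' dist_triangle[of p "x + s *\<^sub>R b" x] by auto
    qed
    have c: "continuous_on {-t..t} (\<lambda>s. \<psi> (x + s *\<^sub>R b))"
      by (intro continuous_intros continuous_on_compose2[OF cont]) (use inb bW in auto)
    have "\<exists>s\<in>{-t..t}. \<psi> (x + s *\<^sub>R b) = 0"
    proof (cases "\<psi> (x + t *\<^sub>R b) < 0")
      case True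
      then have "\<psi> (x - t *\<^sub>R b) > 0" using x'(2) by (auto simp: q_def mult_less_0_iff)
      then show ?thesis
        using IVT2'[of "\<lambda>s. \<psi> (x + s *\<^sub>R b)" t 0 "-t"] True c t by auto
    next
      case False
      then have "\<psi> (x - t *\<^sub>R b) < 0" "\<psi> (x + t *\<^sub>R b) > 0"
        using x'(2) by (auto simp: q_def mult_less_0_iff)
      then show ?thesis
        using IVT'[of "\<lambda>s. \<psi> (x + s *\<^sub>R b)" "-t" 0 t] c t by auto
    qed
    then show ?thesis using fr inb bW unfolding Z_def by blast
  qed
  define \<eta> where "\<eta> = \<eta>0 / (real DIM('a) + 1)"
  have \<eta>: "\<eta> > 0" using \<eta>0 by (simp add: \<eta>_def)
  have near: "x \<in> ball p \<eta>0" if "\<And>i. i \<in> Basis \<Longrightarrow> \<bar>(x - p) \<bullet> i\<bar> \<le> \<eta>" for x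
  proof -
    have "norm (x - p) \<le> (\<Sum>i\<in>(Basis::'a set). \<eta>)"
      using that by (intro order_trans[OF norm_le_l1] sum_mono)
    also have "\<dots> = DIM('a) * \<eta>" by simp
    also have "\<dots> < \<eta>0" using \<eta>0 by (simp add: \<eta>_def field_simps)
    finally show ?thesis by (simp add: dist_norm norm_minus_commute)
  qed
  obtain b' where b': "b' \<in> Basis" "b' \<noteq> b"
  proof -
    have "\<not> Basis \<subseteq> {b}" using card_mono[of "{b}" "Basis :: 'a set"] dim by auto
    then show ?thesis using that by blast
  qed
  \<comment> \<open>Slabs in a direction \<open>b'\<close> orthogonal to \<open>b\<close>: they are disjoint, and each contains whole segments parallel to \<open>b\<close>.\<close>
  define E where "E i = Z \<inter> {x. \<eta> / (real i + 2) < (x - p) \<bullet> b' \<and> (x - p) \<bullet> b' < \<eta> / (real i + 1)}" for i :: nat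
  show thesis
  proof (rule that[of E])
    show "disjoint_family E"
      unfolding disjoint_family_on_def
    proof (intro ballI impI)
      have lt: "E i \<inter> E j = {}" if "i < j" for i j
      proof -
        have "\<eta> / (real j + 1) \<le> \<eta> / (real i + 2)" using that \<eta> by (intro divide_left_mono) auto
        then show ?thesis by (auto simp: E_def)
      qed
      show "E i \<inter> E j = {}" if "i \<noteq> j" for i j
        using that lt[of i j] lt[of j i] by (cases i j rule: linorder_cases) auto
    qed
    show "E i \<in> sets borel" for i
    proof -
      have "open {x. \<eta> / (real i + 2) < (x - p) \<bullet> b'}" "open {x. (x - p) \<bullet> b' < \<eta> / (real i + 1)}"
        by (intro open_Collect_less continuous_intros)+
      then have "open {x. \<eta> / (real i + 2) < (x - p) \<bullet> b' \<and> (x - p) \<bullet> b' < \<eta> / (real i + 1)}"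
        by (rule open_Collect_conj)
      then show ?thesis unfolding E_def Z_def by (intro sets.Int) (auto intro: borel_closed)
    qed
    show "E i \<subseteq> frontier \<Omega>" for i by (auto simp: E_def Z_def)
    show "hausdorff_outer (DIM('a) - 1) (E i) < \<infinity>" for i
      by (rule finZ) (auto simp: E_def)
    show "0 < hausdorff_outer (DIM('a) - 1) (E i)" for i
    proof -
      define l u where "l = (\<Sum>j\<in>Basis. (if j = b' then p \<bullet> j + \<eta> / (real i + 2) else p \<bullet> j - \<eta>) *\<^sub>R j)"
        and "u = (\<Sum>j\<in>Basis. (if j = b' then p \<bullet> j + \<eta> / (real i + 1) else p \<bullet> j + \<eta>) *\<^sub>R j)"
      have l: "l \<bullet> j = (if j = b' then p \<bullet> j + \<eta> / (real i + 2) else p \<bullet> j - \<eta>)"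
        and u: "u \<bullet> j = (if j = b' then p \<bullet> j + \<eta> / (real i + 1) else p \<bullet> j + \<eta>)" if "j \<in> Basis" for j
        using that by (simp_all add: l_def u_def)
      have i12: "\<eta> / (real i + 2) < \<eta> / (real i + 1)" "0 < \<eta> / (real i + 2)" "\<eta> / (real i + 1) \<le> \<eta>"
        using \<eta> by (auto simp: field_simps)
      show ?thesis
      proof (rule hausdorff_outer_pos_if_projection[OF b(1), of l u])
        show "box l u \<noteq> {}" using i12 \<eta> by (auto simp: box_ne_empty l u)
        fix x assume x: "x \<in> box l u"
        have "\<bar>(x - p) \<bullet> j\<bar> \<le> \<eta>" if "j \<in> Basis" for j
        proof (cases "j = b'")
          case True
          then have "p \<bullet> j + \<eta> / (real i + 2) < x \<bullet> j" "x \<bullet> j < p \<bullet> j + \<eta> / (real i + 1)"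
            using x that unfolding mem_box by (auto simp: l u)
          then show ?thesis using i12 by (auto simp: inner_diff_left)
        next
          case False
          then have "p \<bullet> j - \<eta> < x \<bullet> j" "x \<bullet> j < p \<bullet> j + \<eta>"
            using x that unfolding mem_box by (auto simp: l u)
          then show ?thesis by (auto simp: inner_diff_left)
        qed
        then obtain s where s: "x + s *\<^sub>R b \<in> Z" using cross[OF near] by blast
        have "(x + s *\<^sub>R b - p) \<bullet> b' = (x - p) \<bullet> b'"
          using b b' by (simp add: inner_diff_left inner_add_left inner_not_same_Basis)
        moreover have "p \<bullet> b' + \<eta> / (real i + 2) < x \<bullet> b'" "x \<bullet> b' < p \<bullet> b' + \<eta> / (real i + 1)"
          using x b' unfolding mem_box by (auto simp: l u)
        ultimately have "x + s *\<^sub>R b \<in> E i" using s by (auto simp: E_def inner_diff_left)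
        then show "\<exists>t. x + t *\<^sub>R b \<in> E i" by blast
      qed
    qed
  qed
qed

section \<open>The spaces of square integrable functions\<close>

lemma L2_measurable: "f \<in> L2 M \<Longrightarrow> f \<in> borel_measurable M"
  and L2_integrable: "f \<in> L2 M \<Longrightarrow> integrable M (\<lambda>x. (cmod (f x))\<^sup>2)"
  by (auto simp: L2_def)

lemma L2_norm_nonneg [simp]: "0 \<le> L2_norm M f"
  by (simp add: L2_norm_def)

lemma L2_norm_square: "(L2_norm M f)\<^sup>2 = (LINT x|M. (cmod (f x))\<^sup>2)"
  by (simp add: L2_norm_def)

lemma L2_zero [simp]: "(\<lambda>x. 0) \<in> L2 M"
  by (simp add: L2_def)

lemma L2_norm_zero [simp]: "L2_norm M (\<lambda>x. 0) = 0"
  by (simp add: L2_norm_def)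

lemma L2_dominated:
  assumes f: "f \<in> L2 M" and g: "g \<in> borel_measurable M" and le: "AE x in M. cmod (g x) \<le> C * cmod (f x)"
  shows "g \<in> L2 M" and "C \<ge> 0 \<Longrightarrow> L2_norm M g \<le> C * L2_norm M f"
proof -
  have le2: "AE x in M. (cmod (g x))\<^sup>2 \<le> C\<^sup>2 * (cmod (f x))\<^sup>2"
    using le by eventually_elim (metis norm_ge_zero power_mono power_mult_distrib)
  have int: "integrable M (\<lambda>x. C\<^sup>2 * (cmod (f x))\<^sup>2)" using L2_integrable[OF f] by simp
  have "integrable M (\<lambda>x. (cmod (g x))\<^sup>2)"
    by (rule Bochner_Integration.integrable_bound[OF int]) (use g le2 in auto)
  then show gL: "g \<in> L2 M" using g by (simp add: L2_def)
  assume C: "C \<ge> 0"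
  have "(L2_norm M g)\<^sup>2 \<le> (C * L2_norm M f)\<^sup>2"
    unfolding power_mult_distrib L2_norm_square
    using integral_mono_AE[OF L2_integrable[OF gL] int le2] by simp
  then show "L2_norm M g \<le> C * L2_norm M f"
    by (rule power2_le_imp_le) (use C in simp)
qed

lemma L2_mult_bounded:
  assumes "f \<in> L2 M" "h \<in> borel_measurable M" "AE x in M. cmod (h x) \<le> C"
  shows "(\<lambda>x. h x * f x) \<in> L2 M" and "C \<ge> 0 \<Longrightarrow> L2_norm M (\<lambda>x. h x * f x) \<le> C * L2_norm M f"
proof -
  have le: "AE x in M. cmod (h x * f x) \<le> C * cmod (f x)"
    using assms(3) by eventually_elim (simp add: norm_mult mult_right_mono)
  have "(\<lambda>x. h x * f x) \<in> borel_measurable M"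
    using assms(2) L2_measurable[OF assms(1)] by simp
  from L2_dominated[OF assms(1) this le]
  show "(\<lambda>x. h x * f x) \<in> L2 M" and "C \<ge> 0 \<Longrightarrow> L2_norm M (\<lambda>x. h x * f x) \<le> C * L2_norm M f"
    by auto
qed

lemma L2_scale: "f \<in> L2 M \<Longrightarrow> (\<lambda>x. z * f x) \<in> L2 M"
  using L2_mult_bounded(1)[of f M "\<lambda>_. z" "cmod z"] by simp

lemma L2_norm_scale: "L2_norm M (\<lambda>x. z * f x) = cmod z * L2_norm M f"
  by (simp add: L2_norm_def norm_mult power_mult_distrib real_sqrt_mult)

lemma L2_add:
  assumes "f \<in> L2 M" "g \<in> L2 M"
  shows "f + g \<in> L2 M"
proof -
  have m: "(\<lambda>x. f x + g x) \<in> borel_measurable M"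
    using assms[THEN L2_measurable] by simp
  have "integrable M (\<lambda>x. (cmod (f x + g x))\<^sup>2)"
  proof (rule Bochner_Integration.integrable_bound)
    show "integrable M (\<lambda>x. 2 * (cmod (f x))\<^sup>2 + 2 * (cmod (g x))\<^sup>2)"
      using assms[THEN L2_integrable] by simp
    have "(cmod (f x + g x))\<^sup>2 \<le> 2 * (cmod (f x))\<^sup>2 + 2 * (cmod (g x))\<^sup>2" for x
    proof -
      have "(cmod (f x + g x))\<^sup>2 \<le> (cmod (f x) + cmod (g x))\<^sup>2"
        by (intro power_mono norm_triangle_ineq) auto
      also have "\<dots> \<le> 2 * (cmod (f x))\<^sup>2 + 2 * (cmod (g x))\<^sup>2"
        using zero_le_power2[of "cmod (f x) - cmod (g x)"] by (simp add: power2_eq_square algebra_simps)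
      finally show ?thesis .
    qed
    then show "AE x in M. norm ((cmod (f x + g x))\<^sup>2) \<le> norm (2 * (cmod (f x))\<^sup>2 + 2 * (cmod (g x))\<^sup>2)"
      by auto
  qed (use m in simp)
  then show ?thesis using m by (simp add: L2_def plus_fun_def)
qed

lemma L2_uminus: "f \<in> L2 M \<Longrightarrow> - f \<in> L2 M"
  using L2_scale[of f M "-1"] by (simp add: fun_Compl_def)

lemma L2_diff: "f \<in> L2 M \<Longrightarrow> g \<in> L2 M \<Longrightarrow> f - g \<in> L2 M"
  using L2_add[OF _ L2_uminus, of f M g] by simp

lemma L2_norm_uminus [simp]: "L2_norm M (- f) = L2_norm M f"
  by (simp add: L2_norm_def)

lemma L2_norm_triangle:
  assumes f: "f \<in> L2 M" and g: "g \<in> L2 M"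
  shows "L2_norm M (f + g) \<le> L2_norm M f + L2_norm M g"
proof (rule field_le_epsilon)
  fix e :: real assume "e > 0"
  define A B where "A = L2_norm M f + e / 2" and "B = L2_norm M g + e / 2"
  have pos: "A > 0" "B > 0" using \<open>e > 0\<close> by (auto simp: A_def B_def add_nonneg_pos)
  have "(cmod (f x + g x))\<^sup>2 \<le> (A + B) / A * (cmod (f x))\<^sup>2 + (A + B) / B * (cmod (g x))\<^sup>2" for x
  proof -
    define s t where "s = cmod (f x)" and "t = cmod (g x)"
    have "(cmod (f x + g x))\<^sup>2 \<le> (s + t)\<^sup>2"
      unfolding s_def t_def by (intro power_mono norm_triangle_ineq) auto
    also have "\<dots> \<le> (s + t)\<^sup>2 + (s * B - t * A)\<^sup>2 / (A * B)"
      using pos by simp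
    also have "\<dots> = (A + B) / A * s\<^sup>2 + (A + B) / B * t\<^sup>2"
      using pos by (simp add: power2_eq_square divide_simps) (simp add: algebra_simps)
    finally show ?thesis by (simp add: s_def t_def)
  qed
  then have "(LINT x|M. (cmod (f x + g x))\<^sup>2) \<le>
      (LINT x|M. (A + B) / A * (cmod (f x))\<^sup>2 + (A + B) / B * (cmod (g x))\<^sup>2)"
    using L2_integrable[OF L2_add[OF f g]] f g by (intro integral_mono) (auto simp: L2_integrable)
  then have "(L2_norm M (f + g))\<^sup>2 \<le> (A + B) / A * (L2_norm M f)\<^sup>2 + (A + B) / B * (L2_norm M g)\<^sup>2"
    using f g by (simp add: L2_norm_square L2_integrable)
  also have "\<dots> \<le> (A + B) / A * A\<^sup>2 + (A + B) / B * B\<^sup>2"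
    using pos \<open>e > 0\<close> by (intro add_mono mult_left_mono power_mono) (auto simp: A_def B_def)
  also have "\<dots> = (A + B)\<^sup>2" using pos by (simp add: power2_eq_square field_simps)
  finally have "L2_norm M (f + g) \<le> A + B" by (rule power2_le_imp_le) (use pos in simp)
  then show "L2_norm M (f + g) \<le> L2_norm M f + L2_norm M g + e" by (simp add: A_def B_def)
qed

lemma L2_norm_triangle_diff:
  "f \<in> L2 M \<Longrightarrow> g \<in> L2 M \<Longrightarrow> L2_norm M (f - g) \<le> L2_norm M f + L2_norm M g"
  using L2_norm_triangle[OF _ L2_uminus, of f M g] by simp

lemma L2_norm_cong_AE:
  assumes "f \<in> borel_measurable M" "g \<in> borel_measurable M" "AE x in M. f x = g x"
  shows "L2_norm M f = L2_norm M g"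
proof -
  have "(LINT x|M. (cmod (f x))\<^sup>2) = (LINT x|M. (cmod (g x))\<^sup>2)"
    using assms by (intro integral_cong_AE) auto
  then show ?thesis by (simp add: L2_norm_def)
qed

lemma L2_norm_eq_0_iff:
  assumes "f \<in> L2 M"
  shows "L2_norm M f = 0 \<longleftrightarrow> (AE x in M. f x = 0)"
  using integral_nonneg_eq_0_iff_AE[OF L2_integrable[OF assms]] by (simp add: L2_norm_def)

lemma L2_cong_AE:
  assumes "f \<in> L2 M" "g \<in> borel_measurable M" "AE x in M. f x = g x"
  shows "g \<in> L2 M"
  by (rule L2_dominated(1)[OF assms(1,2), of 1]) (use assms(3) in eventually_elim, simp)

section \<open>Weak derivatives\<close>

lemma test_function_smooth: "test_function \<Omega> \<eta> \<Longrightarrow> smooth_on UNIV \<eta>"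
  by (simp add: test_function_def)

lemma has_weak_pdD: "has_weak_pd \<Omega> b u g \<Longrightarrow> g \<in> L2 (lebesgue_on \<Omega>)"
  by (simp add: has_weak_pd_def)

lemma H1_L2: "u \<in> H1 \<Omega> \<Longrightarrow> u \<in> L2 (lebesgue_on \<Omega>)"
  by (simp add: H1_def)

lemma has_weak_pd_weak_pd: "has_weak_pd \<Omega> b u g \<Longrightarrow> has_weak_pd \<Omega> b u (weak_pd \<Omega> b u)"
  unfolding weak_pd_def by (rule someI[where P = "has_weak_pd \<Omega> b u"])

lemma H1_has_weak_pd: "u \<in> H1 \<Omega> \<Longrightarrow> b \<in> Basis \<Longrightarrow> has_weak_pd \<Omega> b u (weak_pd \<Omega> b u)"
  by (auto simp: H1_def intro: has_weak_pd_weak_pd)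

lemma H1_zero: "0 \<in> H1 \<Omega>"
  unfolding H1_def has_weak_pd_def by (auto simp: zero_fun_def intro!: exI[of _ "\<lambda>x. 0"])

lemma H1_norm_nonneg [simp]: "0 \<le> H1_norm \<Omega> u"
  unfolding H1_norm_def by (auto intro!: add_nonneg_nonneg sum_nonneg)

lemma L2_norm_le_H1_norm: "L2_norm (lebesgue_on \<Omega>) u \<le> H1_norm \<Omega> u"
  unfolding H1_norm_def by (rule real_le_rsqrt) (auto intro!: sum_nonneg)

lemma L2_norm_weak_pd_le_H1_norm:
  assumes "b \<in> Basis"
  shows "L2_norm (lebesgue_on \<Omega>) (weak_pd \<Omega> b u) \<le> H1_norm \<Omega> u"
proof -
  have "(L2_norm (lebesgue_on \<Omega>) (weak_pd \<Omega> b u))\<^sup>2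
      \<le> (\<Sum>b\<in>Basis. (L2_norm (lebesgue_on \<Omega>) (weak_pd \<Omega> b u))\<^sup>2)"
    using assms by (intro member_le_sum) auto
  then show ?thesis unfolding H1_norm_def by (intro real_le_rsqrt) (simp add: add_increasing)
qed

lemma has_weak_laplacian_weak_laplacian:
  "has_weak_laplacian \<Omega> u f \<Longrightarrow> has_weak_laplacian \<Omega> u (weak_laplacian \<Omega> u)"
  unfolding weak_laplacian_def by (rule someI[where P = "has_weak_laplacian \<Omega> u"])

lemma continuous_measurable_lebesgue_on:
  fixes f :: "'a::euclidean_space \<Rightarrow> 'b::topological_space"
  assumes "continuous_on UNIV f"
  shows "f \<in> borel_measurable (lebesgue_on S)"
proof -
  have "f \<in> borel_measurable lborel"
    using borel_measurable_continuous_onI[OF assms] by simp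
  then have "f \<in> borel_measurable lebesgue" by (rule measurable_completion)
  then show ?thesis by (rule measurable_restrict_space1)
qed

lemma has_weak_pd_cong:
  assumes b: "b \<in> Basis" and m: "u \<in> L2 (lebesgue_on \<Omega>)" "u' \<in> L2 (lebesgue_on \<Omega>)"
    and eq: "AE x in lebesgue_on \<Omega>. u x = u' x"
  shows "has_weak_pd \<Omega> b u = has_weak_pd \<Omega> b u'"
proof -
  have "(LINT x|lebesgue_on \<Omega>. pd b \<eta> x *\<^sub>R u x) = (LINT x|lebesgue_on \<Omega>. pd b \<eta> x *\<^sub>R u' x)"
    if "test_function \<Omega> \<eta>" for \<eta>
  proof (rule integral_cong_AE)
    have "pd b \<eta> \<in> borel_measurable (lebesgue_on \<Omega>)"
      using that b by (intro continuous_measurable_lebesgue_on smooth_on_pd_continuous test_function_smooth)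
    then show "(\<lambda>x. pd b \<eta> x *\<^sub>R u x) \<in> borel_measurable (lebesgue_on \<Omega>)"
      "(\<lambda>x. pd b \<eta> x *\<^sub>R u' x) \<in> borel_measurable (lebesgue_on \<Omega>)"
      using m[THEN L2_measurable] by simp_all
    show "AE x in lebesgue_on \<Omega>. pd b \<eta> x *\<^sub>R u x = pd b \<eta> x *\<^sub>R u' x"
      using eq by eventually_elim simp
  qed
  then show ?thesis by (intro ext) (auto simp: has_weak_pd_def)
qed

section \<open>The state space\<close>

lemma state_norm_nonneg: "0 \<le> state_norm \<Omega> U"
  by (cases U) simp

lemma state_norm_components:
  assumes "U = (u, v, x, y)"
  shows "H1_norm \<Omega> u \<le> state_norm \<Omega> U" "L2_norm (lebesgue_on \<Omega>) v \<le> state_norm \<Omega> U"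
    "L2_norm (surface_measure \<Omega>) x \<le> state_norm \<Omega> U" "L2_norm (surface_measure \<Omega>) y \<le> state_norm \<Omega> U"
  using assms by (auto intro!: real_le_rsqrt)

lemma state_norm_le_sum:
  "state_norm \<Omega> (u, v, x, y) \<le> H1_norm \<Omega> u + L2_norm (lebesgue_on \<Omega>) v
     + L2_norm (surface_measure \<Omega>) x + L2_norm (surface_measure \<Omega>) y"
proof -
  have "sqrt (a\<^sup>2 + b\<^sup>2 + c\<^sup>2 + d\<^sup>2) \<le> a + b + c + d" if "0 \<le> a" "0 \<le> b" "0 \<le> c" "0 \<le> d" for a b c d :: real
  proof (rule real_le_lsqrt)
    show "a\<^sup>2 + b\<^sup>2 + c\<^sup>2 + d\<^sup>2 \<le> (a + b + c + d)\<^sup>2"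
      using that by (simp add: power2_eq_square algebra_simps)
  qed (use that in auto)
  then show ?thesis by simp
qed

lemma state_space_zero: "0 \<in> state_space \<Omega>"
  using H1_zero L2_zero by (auto simp: state_space_def zero_prod_def zero_fun_def)

section \<open>The case of dimension at least two\<close>

lemma sets_surface_measure: "sets (surface_measure \<Omega>) = sets (restrict_space borel (frontier \<Omega>))"
  unfolding surface_measure_def by (rule sets_restrict_space_cong) simp

lemma space_surface_measure [simp]: "space (surface_measure \<Omega>) = frontier \<Omega>"
  by (simp add: surface_measure_def space_restrict_space)

lemma emeasure_surface_measure:
  fixes \<Omega> :: "'a::euclidean_space set"
  assumes "E \<in> sets borel" "E \<subseteq> frontier \<Omega>"
  shows "emeasure (surface_measure \<Omega>) E = hausdorff_outer (DIM('a) - 1) E"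
  using assms unfolding surface_measure_def
  by (subst emeasure_restrict_space) (auto simp: emeasure_hausdorff_measure borel_closed)

lemma boundary_trace_L2: "boundary_trace \<Omega> u \<in> L2 (surface_measure \<Omega>)"
proof (cases "\<exists>g. has_trace \<Omega> u g")
  case True
  then have "has_trace \<Omega> u (boundary_trace \<Omega> u)"
    unfolding boundary_trace_def by (simp add: someI_ex[OF True])
  then show ?thesis by (simp add: has_trace_def)
qed (simp add: boundary_trace_def)

lemma normal_derivative_L2: "normal_derivative \<Omega> u \<in> L2 (surface_measure \<Omega>)"
proof (cases "\<exists>g. has_normal_derivative \<Omega> u g")
  case True
  then have "has_normal_derivative \<Omega> u (normal_derivative \<Omega> u)"
    unfolding normal_derivative_def by (simp add: someI_ex[OF True])
  then show ?thesis by (simp add: has_normal_derivative_def)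
qed (simp add: normal_derivative_def)

lemma LinfD:
  assumes "f \<in> Linf M"
  obtains C where "C \<ge> 0" "f \<in> borel_measurable M" "AE x in M. norm (f x) \<le> C"
proof -
  obtain C where C: "f \<in> borel_measurable M" "AE x in M. norm (f x) \<le> C"
    using assms by (auto simp: Linf_def)
  moreover have "AE x in M. norm (f x) \<le> max C 0" using C(2) by eventually_elim simp
  ultimately show ?thesis using that[of "max C 0"] by simp
qed

lemma Linf_divide:
  fixes f :: "'a \<Rightarrow> complex" and m :: "'a \<Rightarrow> real"
  assumes f: "f \<in> Linf M" and m: "m \<in> Linf M" and m0: "m0 > 0" "AE p in M. m0 \<le> m p"
  shows "(\<lambda>p. f p / of_real (m p)) \<in> Linf M"
proof -
  obtain C where C: "C \<ge> 0" "f \<in> borel_measurable M" "AE x in M. norm (f x) \<le> C" by (rule LinfD[OF f])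
  have "m \<in> borel_measurable M" using m by (auto simp: Linf_def)
  then have meas: "(\<lambda>p. f p / of_real (m p)) \<in> borel_measurable M" using C(2) by simp
  have "AE p in M. norm (f p / of_real (m p)) \<le> C / m0"
    using C(3) m0(2)
  proof eventually_elim
    case (elim p)
    then show ?case using m0(1) C(1) by (auto simp: norm_divide intro!: frac_le)
  qed
  then show ?thesis using meas by (auto simp: Linf_def)
qed

lemma L2_mult_Linf:
  assumes h: "h \<in> Linf M"
  obtains C where "C \<ge> 0" "\<And>f. f \<in> L2 M \<Longrightarrow> (\<lambda>x. h x * f x) \<in> L2 M"
    "\<And>f. f \<in> L2 M \<Longrightarrow> L2_norm M (\<lambda>x. h x * f x) \<le> C * L2_norm M f"
proof -
  obtain C where C: "C \<ge> 0" "h \<in> borel_measurable M" "AE x in M. norm (h x) \<le> C" by (rule LinfD[OF h])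
  show thesis using that[of C] L2_mult_bounded C by blast
qed

lemma Linf_of_real: "f \<in> Linf M \<Longrightarrow> (\<lambda>x. complex_of_real (f x)) \<in> Linf M"
  by (auto simp: Linf_def)

text \<open>
  Some vector of the domain has image \<open>0\<close> modulo null elements; the first component \<open>w\<close> of the
  equation is a null function, and the weak derivative chosen for \<open>w\<close> is the one chosen for \<open>0\<close>.
\<close>

lemma H1_norm_zero_if_resolvent:
  fixes \<Omega> :: "'a::euclidean_space set"
  assumes z: "z \<in> resolvent_set (state_space \<Omega>) (state_norm \<Omega>) state_scale
           (acoustic_dom \<Omega> \<rho> m) (acoustic_op \<Omega> c \<rho> m d k)"
  shows "H1_norm \<Omega> 0 = 0"
proof -
  obtain u v x y where U: "(u, v, x, y) \<in> acoustic_dom \<Omega> \<rho> m"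
    and N: "state_norm \<Omega> (state_scale z (u, v, x, y) - acoustic_op \<Omega> c \<rho> m d k (u, v, x, y) - 0) = 0"
    using z state_space_zero[of \<Omega>] unfolding resolvent_set_def by fast
  define w where "w = (\<lambda>t. z * u t) - v"
  have uv: "u \<in> L2 (lebesgue_on \<Omega>)" "v \<in> L2 (lebesgue_on \<Omega>)"
    using U by (auto simp: acoustic_dom_def A_dom_def H32_laplacian_def H32_def H1_def)
  then have wL: "w \<in> L2 (lebesgue_on \<Omega>)" unfolding w_def by (intro L2_diff L2_scale)
  have "H1_norm \<Omega> w \<le> state_norm \<Omega> (state_scale z (u, v, x, y) - acoustic_op \<Omega> c \<rho> m d k (u, v, x, y) - 0)"
    by (rule state_norm_components(1)) (simp add: w_def)
  then have w0: "H1_norm \<Omega> w = 0" using N H1_norm_nonneg[of \<Omega> w] by linarith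
  then have "L2_norm (lebesgue_on \<Omega>) w = 0"
    using L2_norm_le_H1_norm[of \<Omega> w] L2_norm_nonneg[of "lebesgue_on \<Omega>" w] by linarith
  then have "AE t in lebesgue_on \<Omega>. w t = 0" using wL by (simp add: L2_norm_eq_0_iff)
  then have eq: "has_weak_pd \<Omega> b w = has_weak_pd \<Omega> b 0" if "b \<in> Basis" for b
    using that wL by (intro has_weak_pd_cong) (auto simp: zero_fun_def)
  have "L2_norm (lebesgue_on \<Omega>) (weak_pd \<Omega> b 0) = 0" if "b \<in> Basis" for b
  proof -
    have "weak_pd \<Omega> b 0 = weak_pd \<Omega> b w" by (simp add: weak_pd_def eq[OF that])
    then show ?thesis
      using L2_norm_weak_pd_le_H1_norm[OF that, of \<Omega> w] w0
        L2_norm_nonneg[of "lebesgue_on \<Omega>" "weak_pd \<Omega> b w"] by (metis order_antisym)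
  qed
  then show ?thesis by (simp add: H1_norm_def zero_fun_def)
qed

lemma H32_laplacian_zero:
  fixes \<Omega> :: "'a::euclidean_space set"
  assumes "H1_norm \<Omega> 0 = 0"
  shows "0 \<in> H32_laplacian \<Omega>"
proof -
  have "gagliardo_half \<Omega> (weak_pd \<Omega> b 0) = 0" if b: "b \<in> Basis" for b
  proof -
    have "L2_norm (lebesgue_on \<Omega>) (weak_pd \<Omega> b 0) = 0"
      using L2_norm_weak_pd_le_H1_norm[OF b, of \<Omega> 0] assms
        L2_norm_nonneg[of "lebesgue_on \<Omega>" "weak_pd \<Omega> b 0"] by linarith
    then have ae: "AE t in lebesgue_on \<Omega>. weak_pd \<Omega> b 0 t = 0"
      using has_weak_pdD[OF H1_has_weak_pd[OF H1_zero b]] by (simp add: L2_norm_eq_0_iff)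
    have "(\<integral>\<^sup>+y. ennreal ((cmod (weak_pd \<Omega> b 0 x - weak_pd \<Omega> b 0 y))\<^sup>2 / norm (x - y) ^ (DIM('a) + 1))
        \<partial>lebesgue_on \<Omega>) = 0" if x: "weak_pd \<Omega> b 0 x = 0" for x
    proof -
      have "(\<integral>\<^sup>+y. ennreal ((cmod (weak_pd \<Omega> b 0 x - weak_pd \<Omega> b 0 y))\<^sup>2 / norm (x - y) ^ (DIM('a) + 1))
        \<partial>lebesgue_on \<Omega>) = (\<integral>\<^sup>+y. 0 \<partial>lebesgue_on \<Omega>)"
        by (intro nn_integral_cong_AE) (use ae in eventually_elim, use x in simp)
      then show ?thesis by simp
    qed
    then have "gagliardo_half \<Omega> (weak_pd \<Omega> b 0) = (\<integral>\<^sup>+x. 0 \<partial>lebesgue_on \<Omega>)"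
      unfolding gagliardo_half_def by (intro nn_integral_cong_AE) (use ae in eventually_elim, simp)
    then show ?thesis by simp
  qed
  moreover have "has_weak_laplacian \<Omega> 0 (\<lambda>x. 0)"
    by (simp add: has_weak_laplacian_def)
  ultimately show ?thesis using H1_zero[of \<Omega>]
    by (auto simp: H32_laplacian_def H32_def)
qed

text \<open>Normalised indicator functions of disjoint sets are orthonormal, hence not close to each other.\<close>

lemma L2_separated_sequence:
  fixes E :: "nat \<Rightarrow> 'a set"
  assumes E: "\<And>i. E i \<in> sets M" "\<And>i. 0 < emeasure M (E i)" "\<And>i. emeasure M (E i) < \<infinity>"
    and disj: "disjoint_family E"
  obtains e :: "nat \<Rightarrow> 'a \<Rightarrow> complex" where "\<And>i. e i \<in> L2 M" "\<And>i. L2_norm M (e i) = 1"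
    "\<And>i j. i \<noteq> j \<Longrightarrow> L2_norm M (e i - e j) \<ge> 1"
proof -
  define e where "e i = (\<lambda>p. complex_of_real (indicator (E i) p / sqrt (measure M (E i))))" for i
  have pos: "measure M (E i) > 0" for i
    using E(2,3)[of i] by (simp add: measure_def enn2real_positive_iff)
  have sq: "(cmod (e i p))\<^sup>2 = indicator (E i) p / measure M (E i)" for i p
    using pos[of i] by (simp add: e_def norm_divide power_divide indicator_def)
  have int: "integrable M (\<lambda>p. indicator (E i) p / measure M (E i) :: real)" for i
    using E by simp
  have L: "e i \<in> L2 M" for i
  proof -
    have "e i \<in> borel_measurable M" unfolding e_def using E(1)[of i] by simp
    then show ?thesis using int[of i] by (simp add: L2_def sq)
  qed
  have n: "L2_norm M (e i) = 1" for i
    using E pos[of i] by (simp add: L2_norm_def sq)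
  have "L2_norm M (e i - e j) \<ge> 1" if ij: "i \<noteq> j" for i j
  proof -
    have "(cmod (e i p))\<^sup>2 \<le> (cmod ((e i - e j) p))\<^sup>2" for p
    proof (cases "p \<in> E i")
      case True
      then have "p \<notin> E j" using disj ij by (auto simp: disjoint_family_on_def)
      then show ?thesis by (simp add: e_def)
    next
      case False then show ?thesis by (simp add: e_def)
    qed
    then have "(L2_norm M (e i))\<^sup>2 \<le> (L2_norm M (e i - e j))\<^sup>2"
      unfolding L2_norm_square
      by (intro integral_mono L2_integrable L2_diff L)
    then show ?thesis using power2_le_imp_le[OF _ L2_norm_nonneg] n[of i] by fastforce
  qed
  then show thesis using that[of e] L n by blast
qed

text \<open>
  The vectors \<open>(0, 0, e\<^sub>j, y)\<close> with \<open>y = R 0\<close> lie in the domain whatever the \<open>e\<^sub>j\<close>, and both they and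
  their images stay bounded with \<open>e\<^sub>j\<close>.  A compact resolvent would thus make the
  unit ball of \<open>L\<^sup>2(\<partial>\<Omega>)\<close> precompact.
\<close>

lemma acoustic_resolvent_not_compact:
  fixes \<Omega> :: "'a::euclidean_space set" and d k :: "'a \<Rightarrow> complex" and \<rho> m :: "'a \<Rightarrow> real"
  assumes "open \<Omega>" "\<Omega> \<noteq> {}" "bounded \<Omega>" "smooth_boundary \<Omega>" and dim: "DIM('a) \<ge> 2"
    and \<rho>: "\<rho> \<in> Linf (surface_measure \<Omega>)" and m: "m \<in> Linf (surface_measure \<Omega>)"
    and d: "d \<in> Linf (surface_measure \<Omega>)" and k: "k \<in> Linf (surface_measure \<Omega>)"
    and m0: "m0 > 0" "AE p in surface_measure \<Omega>. m0 \<le> m p"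
  shows "\<not> has_compact_resolvent (state_space \<Omega>) (state_norm \<Omega>) state_scale
           (acoustic_dom \<Omega> \<rho> m) (acoustic_op \<Omega> c \<rho> m d k)"
proof
  let ?M = "surface_measure \<Omega>"
  let ?T = "acoustic_op \<Omega> c \<rho> m d k"
  assume compact: "has_compact_resolvent (state_space \<Omega>) (state_norm \<Omega>) state_scale (acoustic_dom \<Omega> \<rho> m) ?T"
  then obtain z where z: "z \<in> resolvent_set (state_space \<Omega>) (state_norm \<Omega>) state_scale (acoustic_dom \<Omega> \<rho> m) ?T"
    unfolding has_compact_resolvent_def by blast
  have H0: "H1_norm \<Omega> 0 = 0" by (rule H1_norm_zero_if_resolvent[OF z])
  have "\<Omega> \<noteq> UNIV" using \<open>bounded \<Omega>\<close> not_bounded_UNIV by blast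
  then have "frontier \<Omega> \<noteq> {}" using \<open>\<Omega> \<noteq> {}\<close> by (simp add: frontier_eq_empty)
  then obtain p where p: "p \<in> frontier \<Omega>" by blast
  obtain E :: "nat \<Rightarrow> 'a set" where E: "disjoint_family E" "\<And>i. E i \<in> sets borel" "\<And>i. E i \<subseteq> frontier \<Omega>"
    "\<And>i. 0 < hausdorff_outer (DIM('a) - 1) (E i)" "\<And>i. hausdorff_outer (DIM('a) - 1) (E i) < \<infinity>"
    using frontier_infinitely_many_pieces[OF \<open>open \<Omega>\<close> \<open>smooth_boundary \<Omega>\<close> p dim] by blast
  obtain e :: "nat \<Rightarrow> 'a \<Rightarrow> complex" where e: "\<And>i. e i \<in> L2 ?M" "\<And>i. L2_norm ?M (e i) = 1"
    and sep: "\<And>i j. i \<noteq> j \<Longrightarrow> L2_norm ?M (e i - e j) \<ge> 1"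
  proof (rule L2_separated_sequence[of E ?M])
    show "E i \<in> sets ?M" for i
      using E(2,3) by (auto simp: sets_surface_measure sets_restrict_space)
  qed (use E in \<open>auto simp: emeasure_surface_measure\<close>)
  \<comment> \<open>The traces are chosen only up to null sets, so \<open>y\<close> need not be the function \<open>0\<close>.\<close>
  define y where "y = R_op \<Omega> \<rho> m 0"
  have "(\<lambda>p. complex_of_real (\<rho> p) / of_real (m p)) \<in> Linf ?M"
    by (rule Linf_divide[OF Linf_of_real[OF \<rho>] m m0])
  then have r: "(\<lambda>p. complex_of_real (\<rho> p / m p) * g p) \<in> L2 ?M" if "g \<in> L2 ?M" for g
    using that by (auto elim: L2_mult_Linf)
  have y: "y \<in> L2 ?M"
    using L2_add[OF normal_derivative_L2[of \<Omega> 0] r[OF boundary_trace_L2[of \<Omega> 0]]]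
    by (simp add: y_def R_op_def plus_fun_def)
  have dm: "(\<lambda>p. d p / of_real (m p)) \<in> Linf ?M" by (rule Linf_divide[OF d m m0])
  have km: "(\<lambda>p. k p / of_real (m p)) \<in> Linf ?M" by (rule Linf_divide[OF k m m0])
  have B4: "B4_op d m g \<in> L2 ?M" if "g \<in> L2 ?M" for g
    using L2_uminus[of "\<lambda>p. d p / of_real (m p) * g p" ?M] that L2_mult_Linf[OF dm]
    by (auto simp: B4_op_def fun_Compl_def)
  obtain C where C: "C \<ge> 0" "\<And>f. f \<in> L2 ?M \<Longrightarrow> (\<lambda>p. k p / of_real (m p) * f p) \<in> L2 ?M"
    "\<And>f. f \<in> L2 ?M \<Longrightarrow> L2_norm ?M (\<lambda>p. k p / of_real (m p) * f p) \<le> C * L2_norm ?M f"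
    using L2_mult_Linf[OF km] by blast
  have B3: "B3_op k m g \<in> L2 ?M" "L2_norm ?M (B3_op k m g) \<le> C * L2_norm ?M g" if "g \<in> L2 ?M" for g
  proof -
    have "B3_op k m g = - (\<lambda>p. k p / of_real (m p) * g p)" by (simp add: B3_op_def fun_eq_iff)
    then show "B3_op k m g \<in> L2 ?M" "L2_norm ?M (B3_op k m g) \<le> C * L2_norm ?M g"
      using L2_uminus[OF C(2)[OF that]] C(3)[OF that] by simp_all
  qed
  have B2: "B2_op \<Omega> \<rho> m 0 \<in> L2 ?M"
    using L2_uminus[OF r[OF boundary_trace_L2]] by (simp add: B2_op_def fun_Compl_def)
  have H32: "0 \<in> H32_laplacian \<Omega>" by (rule H32_laplacian_zero[OF H0])
  have A: "A_op \<Omega> c 0 \<in> L2 (lebesgue_on \<Omega>)"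
  proof -
    have "has_weak_laplacian \<Omega> 0 (weak_laplacian \<Omega> 0)"
      using H32 by (auto simp: H32_laplacian_def intro: has_weak_laplacian_weak_laplacian)
    then show ?thesis unfolding A_op_def by (intro L2_scale) (simp add: has_weak_laplacian_def)
  qed
  define w where "w = (\<lambda>t. z * y t) - ((B1_op 0 + B4_op d m (B2_op \<Omega> \<rho> m 0)) + B4_op d m y)"
  have w: "w \<in> L2 ?M"
    unfolding w_def by (intro L2_diff L2_add L2_scale B4 B2 y) (simp add: B1_op_def)
  define U :: "nat \<Rightarrow> 'a state" where "U j = (0, 0, e j, y)" for j
  define F where "F j = state_scale z (U j) - ?T (U j)" for j
  have F: "F j = (0, - A_op \<Omega> c 0, (\<lambda>t. z * e j t) - L_op \<Omega> 0, w - B3_op k m (e j))" for j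
    by (simp add: F_def U_def w_def zero_fun_def fun_eq_iff)
  have U: "U j \<in> acoustic_dom \<Omega> \<rho> m" for j
    using H32 H1_zero[of \<Omega>] e y by (auto simp: U_def acoustic_dom_def A_dom_def y_def)
  have N0: "state_norm \<Omega> 0 = 0"
    using H0 by (simp add: zero_prod_def) (simp add: zero_fun_def)
  have res: "is_resolvent_value (state_norm \<Omega>) state_scale (acoustic_dom \<Omega> \<rho> m) ?T z (F j) (U j)" for j
    using U[of j] N0 by (simp add: is_resolvent_value_def F_def)
  have FX: "F j \<in> state_space \<Omega>" for j
    unfolding F state_space_def L_op_def
    by (auto intro!: H1_zero L2_uminus A L2_diff L2_scale e normal_derivative_L2 w B3)
  have FB: "state_norm \<Omega> (F j) \<le> L2_norm (lebesgue_on \<Omega>) (A_op \<Omega> c 0)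
      + (cmod z + L2_norm ?M (L_op \<Omega> 0)) + (L2_norm ?M w + C)" for j
  proof -
    have "L2_norm ?M ((\<lambda>t. z * e j t) - L_op \<Omega> 0) \<le> cmod z + L2_norm ?M (L_op \<Omega> 0)"
      using L2_norm_triangle_diff[OF L2_scale[OF e(1)[of j], of z] normal_derivative_L2[of \<Omega> 0]] e(2)[of j]
      by (simp add: L_op_def L2_norm_scale)
    moreover have "L2_norm ?M (w - B3_op k m (e j)) \<le> L2_norm ?M w + C"
      using L2_norm_triangle_diff[OF w B3(1)[OF e(1)[of j]]] B3(2)[OF e(1)[of j]] e(2)[of j] by simp
    ultimately show ?thesis
      using state_norm_le_sum[of \<Omega> 0 "- A_op \<Omega> c 0" "(\<lambda>t. z * e j t) - L_op \<Omega> 0" "w - B3_op k m (e j)"] H0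
      unfolding F by simp
  qed
  have "\<exists>V\<in>state_space \<Omega>. \<exists>r. strict_mono r \<and> (\<lambda>j. state_norm \<Omega> (U (r j) - V)) \<longlonglongrightarrow> 0"
    using compact z FX res FB unfolding has_compact_resolvent_def by blast
  then obtain V r where V: "V \<in> state_space \<Omega>" "strict_mono r"
    and lim: "(\<lambda>j. state_norm \<Omega> (U (r j) - V)) \<longlonglongrightarrow> 0" by blast
  obtain v1 v2 \<xi> v4 where V': "V = (v1, v2, \<xi>, v4)" by (cases V)
  have \<xi>: "\<xi> \<in> L2 ?M" using V(1) by (simp add: V' state_space_def)
  obtain n where n: "\<And>j. j \<ge> n \<Longrightarrow> norm (state_norm \<Omega> (U (r j) - V)) < 1 / 2"
    using LIMSEQ_D[OF lim, of "1/2"] by auto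
  have close: "L2_norm ?M (e (r j) - \<xi>) < 1 / 2" if "j \<ge> n" for j
  proof -
    have "L2_norm ?M (e (r j) - \<xi>) \<le> state_norm \<Omega> (U (r j) - V)"
      by (rule state_norm_components(3)) (simp add: U_def V')
    then show ?thesis using n[OF that] by simp
  qed
  have "r n \<noteq> r (Suc n)" using V(2) by (simp add: strict_mono_eq)
  then have "1 \<le> L2_norm ?M (e (r n) - e (r (Suc n)))" by (rule sep)
  also have "e (r n) - e (r (Suc n)) = (e (r n) - \<xi>) - (e (r (Suc n)) - \<xi>)" by simp
  also have "L2_norm ?M \<dots> \<le> L2_norm ?M (e (r n) - \<xi>) + L2_norm ?M (e (r (Suc n)) - \<xi>)"
    by (intro L2_norm_triangle_diff L2_diff e \<xi>)
  also have "\<dots> < 1" using close[of n] close[of "Suc n"] by simp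
  finally show False by simp
qed

section \<open>Square integrable functions on an interval and their primitives\<close>

lemma L2_Cauchy_Schwarz:
  assumes f: "f \<in> L2 M" and g: "g \<in> L2 M"
  shows "integrable M (\<lambda>x. f x * g x)" and "cmod (LINT x|M. f x * g x) \<le> L2_norm M f * L2_norm M g"
proof -
  have bound: "cmod (f x * g x) \<le> s / 2 * (cmod (f x))\<^sup>2 + 1 / (2 * s) * (cmod (g x))\<^sup>2" if "s > 0" for s :: real and x
  proof -
    have "s / 2 * (cmod (f x))\<^sup>2 + 1 / (2 * s) * (cmod (g x))\<^sup>2 - cmod (f x) * cmod (g x)
        = (s * cmod (f x) - cmod (g x))\<^sup>2 / (2 * s)"
      using that by (simp add: power2_eq_square field_simps)
    also have "\<dots> \<ge> 0" using that by simp
    finally show ?thesis by (simp add: norm_mult)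
  qed
  have int: "integrable M (\<lambda>x. s / 2 * (cmod (f x))\<^sup>2 + 1 / (2 * s) * (cmod (g x))\<^sup>2)" for s :: real
    using f g by (simp add: L2_integrable)
  show i: "integrable M (\<lambda>x. f x * g x)"
  proof (rule Bochner_Integration.integrable_bound[OF int[of 1]])
    show "(\<lambda>x. f x * g x) \<in> borel_measurable M" using L2_measurable[OF f] L2_measurable[OF g] by simp
    have "norm (f x * g x) \<le> norm (1 / 2 * (cmod (f x))\<^sup>2 + 1 / (2 * 1) * (cmod (g x))\<^sup>2)" for x
      using bound[of 1 x] by (simp add: abs_le_iff)
    then show "AE x in M. norm (f x * g x) \<le> norm (1 / 2 * (cmod (f x))\<^sup>2 + 1 / (2 * 1) * (cmod (g x))\<^sup>2)"
      by simp
  qed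
  have le: "cmod (LINT x|M. f x * g x) \<le> s / 2 * (L2_norm M f)\<^sup>2 + 1 / (2 * s) * (L2_norm M g)\<^sup>2" if "s > 0" for s
  proof -
    have "cmod (LINT x|M. f x * g x) \<le> (LINT x|M. cmod (f x * g x))"
      by (rule integral_norm_bound)
    also have "\<dots> \<le> (LINT x|M. s / 2 * (cmod (f x))\<^sup>2 + 1 / (2 * s) * (cmod (g x))\<^sup>2)"
      using i int bound[OF that] by (intro integral_mono) auto
    also have "\<dots> = s / 2 * (L2_norm M f)\<^sup>2 + 1 / (2 * s) * (L2_norm M g)\<^sup>2"
      using f g by (simp add: L2_norm_square L2_integrable)
    finally show ?thesis .
  qed
  have "cmod (LINT x|M. f x * g x) \<le> (L2_norm M f + e) * (L2_norm M g + e)" if e: "e > 0" for e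
  proof -
    define A B where "A = L2_norm M f + e" and "B = L2_norm M g + e"
    have pos: "A > 0" "B > 0" using e by (auto simp: A_def B_def add_nonneg_pos)
    have "cmod (LINT x|M. f x * g x) \<le> (B / A) / 2 * (L2_norm M f)\<^sup>2 + 1 / (2 * (B / A)) * (L2_norm M g)\<^sup>2"
      using pos by (intro le) simp
    also have "\<dots> \<le> (B / A) / 2 * A\<^sup>2 + 1 / (2 * (B / A)) * B\<^sup>2"
      using pos e by (intro add_mono mult_left_mono power_mono) (auto simp: A_def B_def)
    also have "\<dots> = A * B" using pos by (simp add: power2_eq_square field_simps)
    finally show ?thesis by (simp add: A_def B_def)
  qed
  then have "\<forall>\<^sub>F e in at_right 0. cmod (LINT x|M. f x * g x) \<le> (L2_norm M f + e) * (L2_norm M g + e)"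
    by (auto simp: eventually_at_filter)
  moreover have "((\<lambda>e. (L2_norm M f + e) * (L2_norm M g + e)) \<longlongrightarrow> (L2_norm M f + 0) * (L2_norm M g + 0)) (at_right 0)"
    by (intro tendsto_intros)
  ultimately show "cmod (LINT x|M. f x * g x) \<le> L2_norm M f * L2_norm M g"
    using tendsto_lowerbound[of _ "(L2_norm M f + 0) * (L2_norm M g + 0)" "at_right (0::real)"] by simp
qed

lemma L2_bounded:
  assumes M: "finite_measure M" and f: "f \<in> borel_measurable M" "AE x in M. cmod (f x) \<le> C" and C: "C \<ge> 0"
  shows "f \<in> L2 M" and "L2_norm M f \<le> C * sqrt (measure M (space M))"
proof -
  interpret finite_measure M by (rule M)
  have one: "(\<lambda>x. 1) \<in> L2 M" by (simp add: L2_def)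
  have "L2_norm M (\<lambda>x. 1) = sqrt (measure M (space M))" by (simp add: L2_norm_def)
  then show "f \<in> L2 M" "L2_norm M f \<le> C * sqrt (measure M (space M))"
    using L2_dominated[OF one f(1), of C] f(2) C by auto
qed

lemma L2_norm_tendsto_0:
  assumes m: "\<And>j. f j \<in> borel_measurable M" and w: "w \<in> L2 M"
    and le: "\<And>j. AE x in M. cmod (f j x) \<le> cmod (w x)" and lim: "AE x in M. (\<lambda>j. f j x) \<longlonglongrightarrow> 0"
  shows "(\<lambda>j. L2_norm M (f j)) \<longlonglongrightarrow> 0"
proof -
  have "(\<lambda>j. LINT x|M. (cmod (f j x))\<^sup>2) \<longlonglongrightarrow> (LINT x|M. 0)"
  proof (rule integral_dominated_convergence)
    show "integrable M (\<lambda>x. (cmod (w x))\<^sup>2)" using w by (rule L2_integrable)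
    show "AE x in M. (\<lambda>j. (cmod (f j x))\<^sup>2) \<longlonglongrightarrow> 0"
      using lim
    proof eventually_elim
      case (elim x)
      then have "(\<lambda>j. (cmod (f j x))\<^sup>2) \<longlonglongrightarrow> (cmod 0)\<^sup>2" by (intro tendsto_intros)
      then show ?case by simp
    qed
    show "AE x in M. norm ((cmod (f j x))\<^sup>2) \<le> (cmod (w x))\<^sup>2" for j
      using le[of j] by eventually_elim (simp add: power_mono)
  qed (use m in auto)
  then have "(\<lambda>j. sqrt (LINT x|M. (cmod (f j x))\<^sup>2)) \<longlonglongrightarrow> sqrt (LINT x|M. 0)"
    by (rule tendsto_real_sqrt)
  then show ?thesis by (simp add: L2_norm_def)
qed

lemma tendsto_0_ex_less:
  fixes X :: "nat \<Rightarrow> real"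
  assumes "X \<longlonglongrightarrow> 0" "e > 0"
  shows "\<exists>j. X j < e"
  using order_tendstoD(2)[OF assms] eventually_happens[of _ sequentially] by auto

abbreviation LI :: "real \<Rightarrow> real \<Rightarrow> real measure" where "LI a b \<equiv> lebesgue_on {a<..<b}"

lemma finite_measure_LI: "finite_measure (LI a b)"
  by (rule finite_measure_lebesgue_on) auto

lemma measure_LI: "a \<le> b \<Longrightarrow> measure (LI a b) {a<..<b} = b - a"
  by (simp add: measure_restrict_space)

text \<open>Truncation, approximation by continuous functions, and the Weierstrass theorem.\<close>

lemma L2_polynomial_dense:
  assumes f: "f \<in> L2 (LI a b)" and e: "e > 0"
  obtains p :: "real \<Rightarrow> complex" where "polynomial_function p" "L2_norm (LI a b) (p - f) < e"
proof -
  let ?M = "LI a b"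
  interpret finite_measure ?M by (rule finite_measure_LI)
  have fm: "f \<in> borel_measurable ?M" using f by (rule L2_measurable)
  define F where "F n = (\<lambda>x. if cmod (f x) \<le> real n then f x else 0)" for n :: nat
  have Fm: "F n \<in> borel_measurable ?M" for n
    unfolding F_def using fm by measurable
  have "(\<lambda>n. L2_norm ?M (F n - f)) \<longlonglongrightarrow> 0"
  proof (rule L2_norm_tendsto_0[OF _ f])
    show "AE x in ?M. (\<lambda>n. (F n - f) x) \<longlonglongrightarrow> 0"
    proof (rule AE_I2)
      fix x
      have "\<forall>\<^sub>F n in sequentially. (F n - f) x = 0"
        using eventually_ge_at_top[of "nat \<lceil>cmod (f x)\<rceil>"]
        by eventually_elim (auto simp: F_def nat_le_iff ceiling_le_iff)
      then show "(\<lambda>n. (F n - f) x) \<longlonglongrightarrow> 0" by (rule tendsto_eventually)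
    qed
    show "F n - f \<in> borel_measurable ?M" for n
      using Fm[of n] fm unfolding fun_diff_def by (rule borel_measurable_diff)
  qed (auto simp: F_def)
  then obtain n where n: "L2_norm ?M (F n - f) < e / 3"
    using tendsto_0_ex_less[of _ "e / 3"] e by auto
  have FL: "F n \<in> L2 ?M"
    using L2_bounded(1)[OF finite_measure_LI Fm[of n], of "real n"] by (auto simp: F_def)
  have "F n measurable_on {a<..<b}"
    using Fm[of n] by (simp add: measurable_on_iff_borel_measurable)
  then obtain N g where N: "negligible N" and g: "\<And>j. continuous_on UNIV (g j)"
    and lim: "\<And>x. x \<notin> N \<Longrightarrow> (\<lambda>j. g j x) \<longlonglongrightarrow> (if x \<in> {a<..<b} then F n x else 0)"
    unfolding measurable_on_def by blast
  let ?B = "cball (0::complex) (real n)"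
  have ne: "?B \<noteq> {}" by simp
  define h where "h j x = closest_point ?B (g j x)" for j :: nat and x
  have hc: "continuous_on UNIV (h j)" for j
    unfolding h_def
    by (rule continuous_on_compose2[OF continuous_on_closest_point[of ?B UNIV] g]) auto
  have hb: "cmod (h j x) \<le> n" for j x
    using closest_point_in_set[of ?B "g j x"] by (simp add: h_def)
  have hm: "h j \<in> borel_measurable ?M" for j
    by (rule continuous_measurable_lebesgue_on[OF hc])
  have "(\<lambda>j. L2_norm ?M (h j - F n)) \<longlonglongrightarrow> 0"
  proof (rule L2_norm_tendsto_0[where w = "\<lambda>x. of_real (2 * real n)"])
    show "(\<lambda>x. complex_of_real (2 * real n)) \<in> L2 ?M" by (simp add: L2_def)
    show "h j - F n \<in> borel_measurable ?M" for j
      using hm[of j] Fm[of n] unfolding fun_diff_def by (rule borel_measurable_diff)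
    have "cmod ((h j - F n) x) \<le> 2 * real n" for j x
      using norm_triangle_ineq4[of "h j x" "F n x"] hb[of j x] by (auto simp: F_def)
    then show "AE x in ?M. cmod ((h j - F n) x) \<le> cmod (complex_of_real (2 * real n))" for j by simp
    have "AE x in lebesgue. x \<notin> N"
      using N by (intro AE_not_in) (simp add: negligible_iff_null_sets)
    then have "AE x in ?M. x \<notin> N" by (simp add: AE_restrict_space_iff) (auto elim: eventually_mono)
    moreover have "AE x in ?M. x \<in> {a<..<b}" by (rule AE_I2) simp
    ultimately show "AE x in ?M. (\<lambda>j. (h j - F n) x) \<longlonglongrightarrow> 0"
    proof eventually_elim
      case (elim x)
      have FB: "F n x \<in> ?B" by (simp add: F_def)
      have "(\<lambda>j. g j x) \<longlonglongrightarrow> F n x" using lim[of x] elim by simp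
      then have "(\<lambda>j. closest_point ?B (g j x)) \<longlonglongrightarrow> closest_point ?B (F n x)"
        by (intro isCont_tendsto_compose[OF continuous_at_closest_point]) auto
      then have "(\<lambda>j. h j x - F n x) \<longlonglongrightarrow> F n x - F n x"
        unfolding h_def closest_point_self[OF FB] by (intro tendsto_intros)
      then show ?case by simp
    qed
  qed
  then obtain j where j: "L2_norm ?M (h j - F n) < e / 3"
    using tendsto_0_ex_less[of _ "e / 3"] e by auto
  have hL: "h j \<in> L2 ?M"
    using L2_bounded(1)[OF finite_measure_LI hm[of j], of "real n"] hb by simp
  define \<epsilon> where "\<epsilon> = e / (3 * (sqrt (measure ?M (space ?M)) + 1))"
  have \<epsilon>: "\<epsilon> > 0" unfolding \<epsilon>_def using e by (simp add: add_nonneg_pos)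
  obtain p :: "real \<Rightarrow> complex" where p: "polynomial_function p" "\<And>x. x \<in> {a..b} \<Longrightarrow> norm (h j x - p x) < \<epsilon>"
    using Stone_Weierstrass_polynomial_function[OF compact_Icc continuous_on_subset[OF hc subset_UNIV] \<epsilon>, of a b j]
    by blast
  have pm: "p \<in> borel_measurable ?M"
    using p(1) by (intro continuous_measurable_lebesgue_on continuous_on_polymonial_function)
  have ph: "p - h j \<in> borel_measurable ?M" "AE x in ?M. cmod ((p - h j) x) \<le> \<epsilon>"
  proof -
    show "p - h j \<in> borel_measurable ?M"
      using pm hm[of j] unfolding fun_diff_def by (rule borel_measurable_diff)
    show "AE x in ?M. cmod ((p - h j) x) \<le> \<epsilon>"
    proof (rule AE_I2)
      fix x assume "x \<in> space ?M"
      then show "cmod ((p - h j) x) \<le> \<epsilon>"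
        using p(2)[of x] by (simp add: norm_minus_commute less_imp_le)
    qed
  qed
  have pL: "p \<in> L2 ?M"
    using L2_add[OF hL L2_bounded(1)[OF finite_measure_LI ph]] \<epsilon> by (simp add: plus_fun_def)
  have "L2_norm ?M (p - h j) \<le> \<epsilon> * sqrt (measure ?M (space ?M))"
    using \<epsilon> by (intro L2_bounded(2)[OF finite_measure_LI ph]) simp
  also have "\<dots> < \<epsilon> * (sqrt (measure ?M (space ?M)) + 1)"
    using \<epsilon> by simp
  also have "\<dots> = e / 3"
  proof -
    have "sqrt (measure ?M (space ?M)) + 1 \<noteq> 0"
      using real_sqrt_ge_zero[OF measure_nonneg, of ?M "space ?M"] by linarith
    moreover have "e / (3 * S) * S = e / 3" if "S \<noteq> 0" for S using that by simp
    ultimately show ?thesis unfolding \<epsilon>_def by blast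
  qed
  finally have close: "L2_norm ?M (p - h j) < e / 3" .
  have "L2_norm ?M (p - f) = L2_norm ?M ((p - h j) + ((h j - F n) + (F n - f)))" by simp
  then have "L2_norm ?M (p - f) \<le> L2_norm ?M (p - h j) + (L2_norm ?M (h j - F n) + L2_norm ?M (F n - f))"
    using L2_norm_triangle[OF L2_diff[OF pL hL] L2_add[OF L2_diff[OF hL FL] L2_diff[OF FL f]]]
      L2_norm_triangle[OF L2_diff[OF hL FL] L2_diff[OF FL f]] by linarith
  also have "\<dots> < e" using close j n by simp
  finally show thesis using that p(1) by blast
qed

text \<open>
  The absolutely continuous functions with square integrable derivative.
\<close>

definition primitive_on :: "real \<Rightarrow> real \<Rightarrow> (real \<Rightarrow> complex) \<Rightarrow> (real \<Rightarrow> complex) \<Rightarrow> bool"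
  where "primitive_on a b F f \<longleftrightarrow> f \<in> L2 (LI a b) \<and>
    (\<forall>t\<in>{a..b}. F t = F a + (LINT s|LI a b. indicator {a..t} s *\<^sub>R f s))"

lemma primitive_onD: "primitive_on a b F f \<Longrightarrow> f \<in> L2 (LI a b)"
  by (simp add: primitive_on_def)

lemma primitive_on_eq:
  "primitive_on a b F f \<Longrightarrow> t \<in> {a..b} \<Longrightarrow> F t = F a + (LINT s|LI a b. indicator {a..t} s *\<^sub>R f s)"
  unfolding primitive_on_def by blast

lemma primitive_onI:
  assumes "f \<in> L2 (LI a b)" "\<And>t. t \<in> {a..b} \<Longrightarrow> F t = F a + (LINT s|LI a b. indicator {a..t} s *\<^sub>R f s)"
  shows "primitive_on a b F f"
  using assms unfolding primitive_on_def by blast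

lemma L2_LI_integrable:
  assumes "f \<in> L2 (LI a b)"
  shows "integrable (LI a b) f"
  using L2_Cauchy_Schwarz(1)[OF assms, of "\<lambda>x. 1"] finite_measure_LI[of a b]
  by (simp add: L2_def finite_measure.integrable_const)

lemma indicator_measurable_LI:
  "A \<in> sets lebesgue \<Longrightarrow> (indicator A :: real \<Rightarrow> real) \<in> borel_measurable (LI a b)"
  by (intro measurable_restrict_space1 borel_measurable_indicator)

lemma integrable_indicator_LI:
  assumes f: "f \<in> L2 (LI a b)" and A: "A \<in> sets lebesgue"
  shows "integrable (LI a b) (\<lambda>s. indicator A s *\<^sub>R f s)"
proof (rule Bochner_Integration.integrable_bound[OF L2_LI_integrable[OF f]])
  show "(\<lambda>s. indicator A s *\<^sub>R f s) \<in> borel_measurable (LI a b)"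
    by (rule borel_measurable_scaleR[OF indicator_measurable_LI[OF A] L2_measurable[OF f]])
qed (simp add: indicator_def)

lemma integrable_indicator_interval:
  assumes "f \<in> L2 (LI a b)"
  shows "integrable (LI a b) (\<lambda>s. indicator {c..d} s *\<^sub>R f s)"
  by (rule integrable_indicator_LI[OF assms]) simp

lemma primitive_on_diff_eq:
  assumes F: "primitive_on a b F f" and st: "a \<le> s" "s \<le> t" "t \<le> b"
  shows "F t - F s = (LINT r|LI a b. indicator {s<..t} r *\<^sub>R f r)"
proof -
  have f: "f \<in> L2 (LI a b)" using F by (rule primitive_onD)
  have "F t - F s = (LINT r|LI a b. indicator {a..t} r *\<^sub>R f r) - (LINT r|LI a b. indicator {a..s} r *\<^sub>R f r)"
  proof -
    have eq: "F s = F a + (LINT r|LI a b. indicator {a..s} r *\<^sub>R f r)"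
      "F t = F a + (LINT r|LI a b. indicator {a..t} r *\<^sub>R f r)" using st by (auto intro: primitive_on_eq[OF F])
    show ?thesis unfolding eq by (rule add_diff_cancel_left)
  qed
  also have "\<dots> = (LINT r|LI a b. indicator {a..t} r *\<^sub>R f r - indicator {a..s} r *\<^sub>R f r)"
    by (intro Bochner_Integration.integral_diff[symmetric] integrable_indicator_interval f)
  also have "\<dots> = (LINT r|LI a b. indicator {s<..t} r *\<^sub>R f r)"
    using st by (intro Bochner_Integration.integral_cong) (auto simp: indicator_def)
  finally show ?thesis .
qed

lemma norm_interval_integral_le:
  assumes f: "f \<in> L2 (LI a b)" and st: "a \<le> s" "s \<le> t" "t \<le> b"
  shows "(cmod (LINT r|LI a b. indicator {s<..t} r *\<^sub>R f r))\<^sup>2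
      \<le> (t - s) * (LINT r|LI a b. indicator {s<..t} r * (cmod (f r))\<^sup>2)"
proof -
  let ?M = "LI a b"
  have m: "(\<lambda>r. indicator {s<..t} r :: complex) \<in> borel_measurable ?M"
    "(\<lambda>r. indicator {s<..t} r * f r) \<in> borel_measurable ?M"
  proof -
    have "(\<lambda>r. indicator {s<..t} r :: complex) \<in> borel_measurable lebesgue"
      by (intro borel_measurable_indicator) auto
    then show "(\<lambda>r. indicator {s<..t} r :: complex) \<in> borel_measurable ?M"
      by (rule measurable_restrict_space1)
    then show "(\<lambda>r. indicator {s<..t} r * f r) \<in> borel_measurable ?M"
      using L2_measurable[OF f] by simp
  qed
  have i1: "(\<lambda>r. indicator {s<..t} r) \<in> L2 ?M"
    by (rule L2_bounded(1)[OF finite_measure_LI m(1), of 1]) (auto simp: indicator_def)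
  have i2: "(\<lambda>r. indicator {s<..t} r * f r) \<in> L2 ?M"
    by (rule L2_dominated(1)[OF f m(2), of 1]) (auto simp: indicator_def)
  have "(LINT r|?M. indicator {s<..t} r *\<^sub>R f r) = (LINT r|?M. indicator {s<..t} r * (indicator {s<..t} r * f r))"
    by (intro Bochner_Integration.integral_cong) (auto simp: indicator_def)
  then have "cmod (LINT r|?M. indicator {s<..t} r *\<^sub>R f r)
      \<le> L2_norm ?M (\<lambda>r. indicator {s<..t} r) * L2_norm ?M (\<lambda>r. indicator {s<..t} r * f r)"
    using L2_Cauchy_Schwarz(2)[OF i1 i2] by simp
  then have "(cmod (LINT r|?M. indicator {s<..t} r *\<^sub>R f r))\<^sup>2
      \<le> (L2_norm ?M (\<lambda>r. indicator {s<..t} r))\<^sup>2 * (L2_norm ?M (\<lambda>r. indicator {s<..t} r * f r))\<^sup>2"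
    unfolding power_mult_distrib[symmetric] by (intro power_mono) auto
  also have "(L2_norm ?M (\<lambda>r. indicator {s<..t} r))\<^sup>2 \<le> t - s"
  proof -
    have "(L2_norm ?M (\<lambda>r. indicator {s<..t} r))\<^sup>2 = (LINT r|?M. indicator {s<..t} r)"
      unfolding L2_norm_square by (intro Bochner_Integration.integral_cong) (auto simp: indicator_def)
    also have "\<dots> = (LINT r|lebesgue. indicator {a<..<b} r *\<^sub>R indicator {s<..t} r)"
      by (subst integral_restrict_space) auto
    also have "\<dots> = (LINT r|lebesgue. indicator ({a<..<b} \<inter> {s<..t}) r)"
      by (intro Bochner_Integration.integral_cong) (auto simp: indicator_def)
    also have "\<dots> = measure lebesgue ({a<..<b} \<inter> {s<..t})" by simp
    also have "\<dots> \<le> measure lebesgue {s..t}"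
      by (intro measure_mono_fmeasurable) auto
    also have "\<dots> = t - s" using st by simp
    finally show ?thesis .
  qed
  also have "(L2_norm ?M (\<lambda>r. indicator {s<..t} r * f r))\<^sup>2 = (LINT r|?M. indicator {s<..t} r * (cmod (f r))\<^sup>2)"
    unfolding L2_norm_square by (intro Bochner_Integration.integral_cong) (auto simp: indicator_def)
  finally show ?thesis using st by (simp add: mult_right_mono)
qed

lemma primitive_on_increment:
  assumes F: "primitive_on a b F f" and st: "s \<in> {a..b}" "t \<in> {a..b}"
  shows "cmod (F t - F s) \<le> sqrt \<bar>t - s\<bar> * L2_norm (LI a b) f"
proof -
  have *: "cmod (F t - F s) \<le> sqrt (t - s) * L2_norm (LI a b) f" if "a \<le> s" "s \<le> t" "t \<le> b" for s t
  proof -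
    have f: "f \<in> L2 (LI a b)" using F by (rule primitive_onD)
    have "(cmod (F t - F s))\<^sup>2 \<le> (t - s) * (LINT r|LI a b. indicator {s<..t} r * (cmod (f r))\<^sup>2)"
      using norm_interval_integral_le[OF f that] primitive_on_diff_eq[OF F that] by simp
    also have "(LINT r|LI a b. indicator {s<..t} r * (cmod (f r))\<^sup>2) \<le> (LINT r|LI a b. (cmod (f r))\<^sup>2)"
      by (intro integral_mono_AE' L2_integrable[OF f]) (auto simp: indicator_def)
    finally have "(cmod (F t - F s))\<^sup>2 \<le> (t - s) * (L2_norm (LI a b) f)\<^sup>2"
      using that by (simp add: L2_norm_square mult_left_mono)
    also have "\<dots> = (sqrt (t - s) * L2_norm (LI a b) f)\<^sup>2" using that by (simp add: power_mult_distrib)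
    finally show ?thesis by (rule power2_le_imp_le) (use that in simp)
  qed
  show ?thesis
    using st *[of s t] *[of t s] by (cases "s \<le> t") (auto simp: norm_minus_commute)
qed

lemma primitive_on_continuous:
  assumes F: "primitive_on a b F f"
  shows "continuous_on {a..b} F"
  unfolding continuous_on_iff
proof (intro ballI allI impI)
  fix s e :: real assume s: "s \<in> {a..b}" and e: "0 < e"
  define n where "n = L2_norm (LI a b) f + 1"
  have n: "n > 0" unfolding n_def by (simp add: add_nonneg_pos)
  show "\<exists>d>0. \<forall>t\<in>{a..b}. dist t s < d \<longrightarrow> dist (F t) (F s) < e"
  proof (intro exI[of _ "(e / n)\<^sup>2"] conjI ballI impI)
    show "0 < (e / n)\<^sup>2" using e n by simp
    fix t assume t: "t \<in> {a..b}" "dist t s < (e / n)\<^sup>2"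
    have "cmod (F t - F s) \<le> sqrt \<bar>t - s\<bar> * L2_norm (LI a b) f"
      by (rule primitive_on_increment[OF F s t(1)])
    also have "\<dots> \<le> sqrt \<bar>t - s\<bar> * n" by (intro mult_left_mono) (auto simp: n_def)
    also have "sqrt \<bar>t - s\<bar> < e / n"
      using t(2) e n by (intro real_less_lsqrt) (auto simp: dist_real_def)
    finally show "dist (F t) (F s) < e" using n by (simp add: dist_norm)
  qed
qed

lemma continuous_LI_measurable:
  fixes F :: "real \<Rightarrow> complex"
  assumes "continuous_on {a..b} F"
  shows "F \<in> borel_measurable (LI a b)"
  by (rule continuous_imp_measurable_on_sets_lebesgue[OF continuous_on_subset[OF assms]]) auto

lemma L2_LI_sup_le:
  assumes F: "continuous_on {a..b} F" and C: "\<And>t. t \<in> {a..b} \<Longrightarrow> cmod (F t) \<le> C" "C \<ge> 0" and ab: "a \<le> b"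
  shows "F \<in> L2 (LI a b)" and "L2_norm (LI a b) F \<le> C * sqrt (b - a)"
proof -
  have "AE x in LI a b. cmod (F x) \<le> C" using C(1) by (intro AE_I2) simp
  from L2_bounded[OF finite_measure_LI continuous_LI_measurable[OF F] this C(2)]
  show "F \<in> L2 (LI a b)" "L2_norm (LI a b) F \<le> C * sqrt (b - a)"
    by (simp_all add: measure_LI[OF ab])
qed

lemma continuous_L2:
  assumes "continuous_on {a..b} F" "a \<le> b"
  shows "F \<in> L2 (LI a b)"
proof -
  have "bounded (F ` {a..b})"
    using assms(1) by (intro compact_imp_bounded compact_continuous_image) auto
  then obtain C where "C > 0" "\<And>t. t \<in> {a..b} \<Longrightarrow> cmod (F t) \<le> C"
    unfolding bounded_pos by auto
  then show ?thesis using L2_LI_sup_le(1)[OF assms(1), of C] assms(2) by simp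
qed

lemma primitive_on_L2: "primitive_on a b F f \<Longrightarrow> a \<le> b \<Longrightarrow> F \<in> L2 (LI a b)"
  by (rule continuous_L2[OF primitive_on_continuous])

text \<open>The embedding of \<open>H\<^sup>1\<close> of an interval into the bounded functions: compare \<open>F t\<close> with the mean.\<close>

lemma primitive_on_sup_le:
  assumes F: "primitive_on a b F f" and ab: "a < b" and t: "t \<in> {a..b}"
  shows "cmod (F t) \<le> L2_norm (LI a b) F / sqrt (b - a) + sqrt (b - a) * L2_norm (LI a b) f"
proof (rule ccontr)
  assume neg: "\<not> ?thesis"
  define c where "c = cmod (F t) - sqrt (b - a) * L2_norm (LI a b) f"
  have c: "c > L2_norm (LI a b) F / sqrt (b - a)" using neg by (simp add: c_def)
  have "0 \<le> L2_norm (LI a b) F / sqrt (b - a)" using ab by (intro divide_nonneg_nonneg) auto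
  then have c0: "c \<ge> 0" using c by linarith
  have ge: "c \<le> cmod (F s)" if s: "s \<in> {a..b}" for s
  proof -
    have "cmod (F t) \<le> cmod (F s) + cmod (F t - F s)"
      using norm_triangle_ineq[of "F s" "F t - F s"] by simp
    also have "cmod (F t - F s) \<le> sqrt \<bar>t - s\<bar> * L2_norm (LI a b) f"
      by (rule primitive_on_increment[OF F s t])
    also have "\<dots> \<le> sqrt (b - a) * L2_norm (LI a b) f"
      using s t by (intro mult_right_mono) auto
    finally show ?thesis by (simp add: c_def)
  qed
  interpret finite_measure "LI a b" by (rule finite_measure_LI)
  have "(b - a) * c\<^sup>2 = (LINT s|LI a b. c\<^sup>2)"
    using measure_LI[of a b] ab by simp
  also have "\<dots> \<le> (LINT s|LI a b. (cmod (F s))\<^sup>2)"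
    using ge c0 L2_integrable[OF primitive_on_L2[OF F]] ab
    by (intro integral_mono) (auto intro!: power_mono)
  also have "\<dots> = (L2_norm (LI a b) F)\<^sup>2" by (simp add: L2_norm_square)
  finally have "(sqrt (b - a) * c)\<^sup>2 \<le> (L2_norm (LI a b) F)\<^sup>2" using ab by (simp add: power_mult_distrib)
  then have "sqrt (b - a) * c \<le> L2_norm (LI a b) F" by (rule power2_le_imp_le) simp
  then show False using c ab by (simp add: field_simps)
qed

lemma primitive_on_add:
  assumes F: "primitive_on a b F f" and G: "primitive_on a b G g"
  shows "primitive_on a b (\<lambda>t. F t + G t) (\<lambda>t. f t + g t)"
proof (rule primitive_onI)
  have L: "f \<in> L2 (LI a b)" "g \<in> L2 (LI a b)" using F G by (auto dest: primitive_onD)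
  show "(\<lambda>t. f t + g t) \<in> L2 (LI a b)" using L2_add[OF L] by (simp add: plus_fun_def)
  fix t assume t: "t \<in> {a..b}"
  show "F t + G t = F a + G a + (LINT s|LI a b. indicator {a..t} s *\<^sub>R (f s + g s))"
    unfolding primitive_on_eq[OF F t] primitive_on_eq[OF G t] scaleR_add_right
    by (subst Bochner_Integration.integral_add) (use L in \<open>auto intro: integrable_indicator_interval\<close>)
qed

lemma primitive_on_scale:
  assumes F: "primitive_on a b F f"
  shows "primitive_on a b (\<lambda>t. z * F t) (\<lambda>t. z * f t)"
proof (rule primitive_onI)
  show "(\<lambda>t. z * f t) \<in> L2 (LI a b)" using L2_scale[OF primitive_onD[OF F]] .
  fix t assume t: "t \<in> {a..b}"
  show "z * F t = z * F a + (LINT s|LI a b. indicator {a..t} s *\<^sub>R (z * f s))"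
    unfolding primitive_on_eq[OF F t] by (simp add: distrib_left flip: mult_scaleR_right)
qed

lemma primitive_on_uminus:
  "primitive_on a b F f \<Longrightarrow> primitive_on a b (\<lambda>t. - F t) (\<lambda>t. - f t)"
  using primitive_on_scale[of a b F f "-1"] by simp

lemma primitive_on_minus:
  "primitive_on a b F f \<Longrightarrow> primitive_on a b G g \<Longrightarrow> primitive_on a b (\<lambda>t. F t - G t) (\<lambda>t. f t - g t)"
  using primitive_on_add[OF _ primitive_on_uminus, of a b F f G g] by simp

lemma primitive_on_const: "primitive_on a b (\<lambda>t. z) (\<lambda>t. 0)"
  by (simp add: primitive_on_def)

lemma primitive_on_cong:
  assumes "primitive_on a b F f" "\<And>t. t \<in> {a..b} \<Longrightarrow> F t = G t"
    "g \<in> borel_measurable (LI a b)" "AE t in LI a b. f t = g t" "a \<le> b"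
  shows "primitive_on a b G g"
proof -
  have f: "f \<in> L2 (LI a b)" using assms(1) by (rule primitive_onD)
  have g: "g \<in> L2 (LI a b)" using L2_cong_AE[OF f assms(3,4)] .
  have "(LINT s|LI a b. indicator {a..t} s *\<^sub>R f s) = (LINT s|LI a b. indicator {a..t} s *\<^sub>R g s)" for t
    using integrable_indicator_interval[OF f, THEN borel_measurable_integrable]
      integrable_indicator_interval[OF g, THEN borel_measurable_integrable] assms(4)
    by (intro integral_cong_AE) (auto elim: eventually_mono)
  then have eq: "(LINT s|LI a b. indicator {a..t} s *\<^sub>R f s) = (LINT s|LI a b. indicator {a..t} s *\<^sub>R g s)" for t .
  show ?thesis
  proof (rule primitive_onI[OF g])
    fix t assume t: "t \<in> {a..b}"
    then show "G t = G a + (LINT s|LI a b. indicator {a..t} s *\<^sub>R g s)"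
      using primitive_on_eq[OF assms(1) t] assms(2)[of t] assms(2)[of a] assms(5) unfolding eq by simp
  qed
qed

lemma primitive_on_exists:
  assumes "f \<in> L2 (LI a b)" "a \<le> b"
  obtains F where "primitive_on a b F f" "F a = z"
proof
  have "(LINT s|LI a b. indicator {a..a} s *\<^sub>R f s) = (LINT s|LI a b. 0)"
    by (intro Bochner_Integration.integral_cong) auto
  then show "primitive_on a b (\<lambda>t. z + (LINT s|LI a b. indicator {a..t} s *\<^sub>R f s)) f"
    "z + (LINT s|LI a b. indicator {a..a} s *\<^sub>R f s) = z"
    using assms unfolding primitive_on_def by simp_all
qed

lemma primitive_on_C1:
  assumes D: "\<And>t. t \<in> {a..b} \<Longrightarrow> (F has_vector_derivative f t) (at t within {a..b})"
    and c: "continuous_on {a..b} f" and ab: "a \<le> b"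
  shows "primitive_on a b F f"
  unfolding primitive_on_def
proof (intro conjI ballI)
  show f: "f \<in> L2 (LI a b)" by (rule continuous_L2[OF c ab])
  fix t assume t: "t \<in> {a..b}"
  have "(f has_integral (F t - F a)) {a..t}"
  proof (rule fundamental_theorem_of_calculus)
    show "(F has_vector_derivative f s) (at s within {a..t})" if "s \<in> {a..t}" for s
      by (rule has_vector_derivative_within_subset[OF D]) (use t that in auto)
  qed (use t in simp)
  then have h: "(f has_integral (F t - F a)) {a<..<t}" by (simp add: has_integral_Icc_iff_Ioo)
  have i: "integrable lebesgue (\<lambda>s. indicator {a<..<b} s *\<^sub>R (indicator {a..t} s *\<^sub>R f s))"
    using integrable_indicator_interval[OF f, of a t] by (subst (asm) integrable_restrict_space) auto
  have i': "integrable lebesgue (\<lambda>s. indicator {a<..<t} s *\<^sub>R f s)"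
  proof -
    have "integrable lebesgue (\<lambda>s. indicator {a<..<t} s *\<^sub>R (indicator {a<..<b} s *\<^sub>R (indicator {a..t} s *\<^sub>R f s)))"
      by (rule integrable_mult_indicator[OF _ i]) auto
    also have "(\<lambda>s. indicator {a<..<t} s *\<^sub>R (indicator {a<..<b} s *\<^sub>R (indicator {a..t} s *\<^sub>R f s)))
        = (\<lambda>s. indicator {a<..<t} s *\<^sub>R f s)" using t by (auto simp: indicator_def fun_eq_iff)
    finally show ?thesis .
  qed
  then have "integrable (lebesgue_on {a<..<t}) f" by (subst integrable_restrict_space) auto
  then have "(f has_integral (integral\<^sup>L (lebesgue_on {a<..<t}) f)) {a<..<t}"
    by (rule has_integral_integral_lebesgue_on) auto
  then have "F t - F a = integral\<^sup>L (lebesgue_on {a<..<t}) f" using h by (rule has_integral_unique[rotated])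
  also have "\<dots> = (LINT s|lebesgue. indicator {a<..<t} s *\<^sub>R f s)" by (subst integral_restrict_space) auto
  also have "\<dots> = (LINT s|lebesgue. indicator {a<..<b} s *\<^sub>R (indicator {a..t} s *\<^sub>R f s))"
  proof (rule integral_cong_AE)
    have "AE s in lebesgue. s \<notin> {t}" by (rule AE_not_in) auto
    then show "AE s in lebesgue. indicator {a<..<t} s *\<^sub>R f s = indicator {a<..<b} s *\<^sub>R (indicator {a..t} s *\<^sub>R f s)"
      by eventually_elim (use t in \<open>auto simp: indicator_def\<close>)
  qed (use i i' in \<open>auto dest: borel_measurable_integrable\<close>)
  also have "\<dots> = (LINT s|LI a b. indicator {a..t} s *\<^sub>R f s)" by (subst integral_restrict_space) auto
  finally show "F t = F a + (LINT s|LI a b. indicator {a..t} s *\<^sub>R f s)" by (simp add: algebra_simps)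
qed

lemma norm_integral_indicator_le:
  assumes h: "h \<in> L2 (LI a b)" and t: "t \<in> {a..b}"
  shows "cmod (LINT s|LI a b. indicator {a..t} s *\<^sub>R h s) \<le> sqrt (b - a) * L2_norm (LI a b) h"
proof -
  obtain H where H: "primitive_on a b H h" "H a = 0" using primitive_on_exists[OF h, of 0] t by auto
  have "cmod (H t - H a) \<le> sqrt \<bar>t - a\<bar> * L2_norm (LI a b) h"
    using t by (intro primitive_on_increment[OF H(1)]) auto
  also have "\<dots> \<le> sqrt (b - a) * L2_norm (LI a b) h"
    using t by (intro mult_right_mono) auto
  finally show ?thesis using primitive_on_eq[OF H(1) t] H(2) by simp
qed

lemma primitive_on_limit:
  assumes F: "\<And>j. primitive_on a b (F j) (f j)" and lim: "\<And>t. t \<in> {a..b} \<Longrightarrow> (\<lambda>j. F j t) \<longlonglongrightarrow> G t"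
    and g: "g \<in> L2 (LI a b)" and fg: "(\<lambda>j. L2_norm (LI a b) (f j - g)) \<longlonglongrightarrow> 0" and ab: "a \<le> b"
  shows "primitive_on a b G g"
proof (rule primitive_onI[OF g])
  fix t assume t: "t \<in> {a..b}"
  let ?I = "\<lambda>h. LINT s|LI a b. indicator {a..t} s *\<^sub>R h s"
  have f: "f j \<in> L2 (LI a b)" for j using F by (rule primitive_onD)
  have "(\<lambda>j. ?I (f j) - ?I g) \<longlonglongrightarrow> 0"
  proof (rule Lim_null_comparison)
    show "\<forall>\<^sub>F j in sequentially. norm (?I (f j) - ?I g) \<le> sqrt (b - a) * L2_norm (LI a b) (f j - g)"
    proof (intro always_eventually allI)
      fix j
      have "?I (f j) - ?I g = ?I (f j - g)"
        by (simp add: scaleR_diff_right Bochner_Integration.integral_diff integrable_indicator_interval f g)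
      then show "norm (?I (f j) - ?I g) \<le> sqrt (b - a) * L2_norm (LI a b) (f j - g)"
        using norm_integral_indicator_le[OF L2_diff[OF f g] t] by simp
    qed
    show "(\<lambda>j. sqrt (b - a) * L2_norm (LI a b) (f j - g)) \<longlonglongrightarrow> 0"
      using tendsto_mult_left[OF fg] by simp
  qed
  then have "(\<lambda>j. ?I (f j)) \<longlonglongrightarrow> ?I g" by (rule LIM_zero_cancel)
  then have "(\<lambda>j. F j a + ?I (f j)) \<longlonglongrightarrow> G a + ?I g"
    using ab by (intro tendsto_add lim) auto
  moreover have "(\<lambda>j. F j a + ?I (f j)) = (\<lambda>j. F j t)"
    using primitive_on_eq[OF F t] by simp
  ultimately show "G t = G a + ?I g" using LIMSEQ_unique[OF lim[OF t]] by simp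
qed

lemma real_polynomial_antiderivative:
  assumes "real_polynomial_function p"
  obtains P where "real_polynomial_function P" "\<And>x. (P has_real_derivative p x) (at x)"
proof -
  obtain c n where p: "p = (\<lambda>x. \<Sum>i\<le>n. c i * x ^ i)"
    using assms by (auto simp: real_polynomial_function_iff_sum)
  define P where "P = (\<lambda>x::real. \<Sum>i\<le>n. c i / real (Suc i) * x ^ Suc i)"
  have 1: "real_polynomial_function P" unfolding P_def
    by (intro real_polynomial_function_sum real_polynomial_function.intros real_polynomial_function_power
          bounded_linear_ident) auto
  have 2: "(P has_real_derivative p x) (at x)" for x
  proof -
    have "((\<lambda>x. c i / real (Suc i) * x ^ Suc i) has_real_derivative c i * x ^ i) (at x)" for i
    proof -
      have "((\<lambda>x. c i / real (Suc i) * x ^ Suc i) has_real_derivative c i / real (Suc i) * (real (Suc i) * x ^ i)) (at x)"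
        using DERIV_pow[of "Suc i" x UNIV] by (intro DERIV_cmult) simp
      then show ?thesis by simp
    qed
    then show ?thesis unfolding P_def p by (intro DERIV_sum)
  qed
  show thesis by (rule that[OF 1 2])
qed

lemma polynomial_antiderivative:
  fixes p :: "real \<Rightarrow> complex"
  assumes p: "polynomial_function p"
  obtains P where "polynomial_function P" "\<And>x. (P has_vector_derivative p x) (at x)" "P a = z"
proof -
  have "real_polynomial_function (\<lambda>x. p x \<bullet> 1)" "real_polynomial_function (\<lambda>x. p x \<bullet> \<i>)"
    using p by (auto simp: polynomial_function_iff_Basis_inner Basis_complex_def)
  then have re: "real_polynomial_function (\<lambda>x. Re (p x))" and im: "real_polynomial_function (\<lambda>x. Im (p x))"
    by (simp_all add: inner_complex_def)
  obtain P1 where P1: "real_polynomial_function P1" "\<And>x. (P1 has_real_derivative Re (p x)) (at x)"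
    using real_polynomial_antiderivative[OF re] by blast
  obtain P2 where P2: "real_polynomial_function P2" "\<And>x. (P2 has_real_derivative Im (p x)) (at x)"
    using real_polynomial_antiderivative[OF im] by blast
  define Q where "Q x = Complex (P1 x) (P2 x)" for x
  define P where "P x = Q x + (z - Q a)" for x
  have "polynomial_function Q"
    using P1(1) P2(1) by (auto simp: polynomial_function_iff_Basis_inner Basis_complex_def inner_complex_def Q_def)
  then have "polynomial_function P" unfolding P_def
    by (intro polynomial_function_add polynomial_function_const)
  moreover have "(P has_vector_derivative p x) (at x)" for x
  proof -
    have "((\<lambda>x. complex_of_real (P1 x) + \<i> * complex_of_real (P2 x) + (z - Q a)) has_vector_derivative
        complex_of_real (Re (p x)) + \<i> * complex_of_real (Im (p x)) + 0) (at x)"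
      using P1(2)[of x] P2(2)[of x]
      by (intro has_vector_derivative_add has_vector_derivative_of_real has_vector_derivative_mult_right
            has_vector_derivative_const)
    moreover have "P = (\<lambda>x. complex_of_real (P1 x) + \<i> * complex_of_real (P2 x) + (z - Q a))"
      by (simp add: P_def Q_def fun_eq_iff Complex_eq)
    moreover have "complex_of_real (Re (p x)) + \<i> * complex_of_real (Im (p x)) + 0 = p x"
      using complex_eq[of "p x"] by simp
    ultimately show ?thesis by simp
  qed
  ultimately show thesis using that by (simp add: P_def)
qed

lemma continuous_on_polynomial:
  fixes p :: "real \<Rightarrow> complex"
  shows "polynomial_function p \<Longrightarrow> continuous_on S p"
  by (rule continuous_on_polymonial_function)

text \<open>
  Approximate the derivative by polynomials in \<open>L\<^sup>2\<close> and integrate; the bound for increments makes the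
  convergence uniform.
\<close>

lemma primitive_on_polynomial_approx:
  assumes F: "primitive_on a b F f" and ab: "a \<le> b"
  obtains P p :: "nat \<Rightarrow> real \<Rightarrow> complex"
  where "\<And>j. polynomial_function (P j)" "\<And>j. polynomial_function (p j)"
    "\<And>j x. (P j has_vector_derivative p j x) (at x)"
    "\<And>j. primitive_on a b (P j) (p j)"
    "(\<lambda>j. L2_norm (LI a b) (p j - f)) \<longlonglongrightarrow> 0"
    "\<And>j t. t \<in> {a..b} \<Longrightarrow> cmod (P j t - F t) \<le> sqrt (b - a) * L2_norm (LI a b) (p j - f)"
proof -
  have f: "f \<in> L2 (LI a b)" using F by (rule primitive_onD)
  have "\<exists>p. polynomial_function p \<and> L2_norm (LI a b) (p - f) < 1 / real (Suc j)" for j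
    by (rule L2_polynomial_dense[OF f, of "1 / real (Suc j)"]) auto
  then obtain p where p: "\<And>j. polynomial_function (p j)" "\<And>j. L2_norm (LI a b) (p j - f) < 1 / real (Suc j)"
    by metis
  have "\<exists>P. polynomial_function P \<and> (\<forall>x. (P has_vector_derivative p j x) (at x)) \<and> P a = F a" for j
    by (rule polynomial_antiderivative[OF p(1), of j a "F a"]) blast
  then obtain P where P: "\<And>j. polynomial_function (P j)" "\<And>j x. (P j has_vector_derivative p j x) (at x)"
    "\<And>j. P j a = F a" by metis
  have prim: "primitive_on a b (P j) (p j)" for j
    by (rule primitive_on_C1[OF has_vector_derivative_at_within[OF P(2)] continuous_on_polynomial[OF p(1)] ab])
  have "(\<lambda>j. L2_norm (LI a b) (p j - f)) \<longlonglongrightarrow> 0"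
  proof (rule tendsto_sandwich[OF _ _ tendsto_const LIMSEQ_inverse_real_of_nat])
    show "\<forall>\<^sub>F j in sequentially. L2_norm (LI a b) (p j - f) \<le> inverse (real (Suc j))"
      using p(2) by (intro always_eventually allI) (simp add: inverse_eq_divide less_imp_le)
  qed simp
  moreover have "cmod (P j t - F t) \<le> sqrt (b - a) * L2_norm (LI a b) (p j - f)" if t: "t \<in> {a..b}" for j t
  proof -
    have "primitive_on a b (\<lambda>t. P j t - F t) (\<lambda>t. p j t - f t)" by (rule primitive_on_minus[OF prim F])
    from primitive_on_increment[OF this, of a t] t ab
    have "cmod (P j t - F t) \<le> sqrt (t - a) * L2_norm (LI a b) (p j - f)"
      by (simp add: P(3) fun_diff_def)
    also have "\<dots> \<le> sqrt (b - a) * L2_norm (LI a b) (p j - f)" using t by (intro mult_right_mono) auto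
    finally show ?thesis .
  qed
  ultimately show thesis using that P p prim by blast
qed

lemma L2_norm_mult_continuous_le:
  assumes h: "h \<in> L2 (LI a b)" and G: "continuous_on {a..b} G" "\<And>t. t \<in> {a..b} \<Longrightarrow> cmod (G t) \<le> C"
  shows "(\<lambda>t. G t * h t) \<in> L2 (LI a b)" "C \<ge> 0 \<Longrightarrow> L2_norm (LI a b) (\<lambda>t. G t * h t) \<le> C * L2_norm (LI a b) h"
proof -
  have "AE t in LI a b. cmod (G t) \<le> C" by (rule AE_I2) (use G(2) in simp)
  from L2_mult_bounded[OF h continuous_LI_measurable[OF G(1)] this]
  show "(\<lambda>t. G t * h t) \<in> L2 (LI a b)" "C \<ge> 0 \<Longrightarrow> L2_norm (LI a b) (\<lambda>t. G t * h t) \<le> C * L2_norm (LI a b) h"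
    by simp_all
qed

lemma primitive_on_mult_C1:
  assumes F: "primitive_on a b F f" and ab: "a \<le> b"
    and D: "\<And>t. t \<in> {a..b} \<Longrightarrow> (G has_vector_derivative g t) (at t within {a..b})"
    and g: "continuous_on {a..b} g"
  shows "primitive_on a b (\<lambda>t. G t * F t) (\<lambda>t. G t * f t + g t * F t)"
proof -
  have f: "f \<in> L2 (LI a b)" using F by (rule primitive_onD)
  have G: "continuous_on {a..b} G"
    using D has_vector_derivative_continuous unfolding continuous_on_eq_continuous_within by blast
  have bd: "\<exists>C\<ge>0. \<forall>t\<in>{a..b}. cmod (K t) \<le> C" if "continuous_on {a..b} K" for K :: "real \<Rightarrow> complex"
  proof -
    have "bounded (K ` {a..b})" using that by (intro compact_imp_bounded compact_continuous_image) auto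
    then show ?thesis unfolding bounded_pos by (auto intro: less_imp_le)
  qed
  obtain C where C: "C \<ge> 0" "\<And>t. t \<in> {a..b} \<Longrightarrow> cmod (G t) \<le> C" using bd[OF G] by blast
  obtain C' where C': "C' \<ge> 0" "\<And>t. t \<in> {a..b} \<Longrightarrow> cmod (g t) \<le> C'" using bd[OF g] by blast
  obtain P p :: "nat \<Rightarrow> real \<Rightarrow> complex" where P: "\<And>j. polynomial_function (p j)"
    "\<And>j x. (P j has_vector_derivative p j x) (at x)" "\<And>j. primitive_on a b (P j) (p j)"
    and lim: "(\<lambda>j. L2_norm (LI a b) (p j - f)) \<longlonglongrightarrow> 0"
    and close: "\<And>j t. t \<in> {a..b} \<Longrightarrow> cmod (P j t - F t) \<le> sqrt (b - a) * L2_norm (LI a b) (p j - f)"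
    by (rule primitive_on_polynomial_approx[OF F ab]) blast
  have p: "p j \<in> L2 (LI a b)" for j using P(3) by (rule primitive_onD)
  have FL: "F \<in> L2 (LI a b)" by (rule primitive_on_L2[OF F ab])
  have PL: "P j \<in> L2 (LI a b)" for j by (rule primitive_on_L2[OF P(3) ab])
  have prod: "primitive_on a b (\<lambda>t. G t * P j t) (\<lambda>t. G t * p j t + g t * P j t)" for j
  proof (rule primitive_on_C1[OF _ _ ab])
    show "((\<lambda>t. G t * P j t) has_vector_derivative G t * p j t + g t * P j t) (at t within {a..b})"
      if "t \<in> {a..b}" for t
      by (rule has_vector_derivative_mult[OF D[OF that] has_vector_derivative_at_within[OF P(2)]])
    show "continuous_on {a..b} (\<lambda>t. G t * p j t + g t * P j t)"
      by (intro continuous_intros G g continuous_on_polynomial P(1) primitive_on_continuous[OF P(3)])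
  qed
  show ?thesis
  proof (rule primitive_on_limit[OF prod _ _ _ ab])
    fix t assume t: "t \<in> {a..b}"
    have "(\<lambda>j. P j t - F t) \<longlonglongrightarrow> 0"
    proof (rule Lim_null_comparison)
      show "(\<lambda>j. sqrt (b - a) * L2_norm (LI a b) (p j - f)) \<longlonglongrightarrow> 0"
        using tendsto_mult_left[OF lim] by simp
    qed (use close[OF t] in simp)
    then have "(\<lambda>j. P j t) \<longlonglongrightarrow> F t" by (rule LIM_zero_cancel)
    then show "(\<lambda>j. G t * P j t) \<longlonglongrightarrow> G t * F t" by (intro tendsto_intros)
  next
    show "(\<lambda>t. G t * f t + g t * F t) \<in> L2 (LI a b)"
      using L2_add[OF L2_norm_mult_continuous_le(1)[OF f G C(2)] L2_norm_mult_continuous_le(1)[OF FL g C'(2)]]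
      by (simp add: plus_fun_def)
    show "(\<lambda>j. L2_norm (LI a b) ((\<lambda>t. G t * p j t + g t * P j t) - (\<lambda>t. G t * f t + g t * F t))) \<longlonglongrightarrow> 0"
    proof (rule Lim_null_comparison)
      show "(\<lambda>j. (C + C' * (sqrt (b - a) * sqrt (b - a))) * L2_norm (LI a b) (p j - f)) \<longlonglongrightarrow> 0"
        using tendsto_mult_left[OF lim] by simp
      show "\<forall>\<^sub>F j in sequentially. norm (L2_norm (LI a b) ((\<lambda>t. G t * p j t + g t * P j t) - (\<lambda>t. G t * f t + g t * F t)))
          \<le> (C + C' * (sqrt (b - a) * sqrt (b - a))) * L2_norm (LI a b) (p j - f)"
      proof (intro always_eventually allI)
        fix j
        let ?n = "L2_norm (LI a b) (p j - f)"
        have eq: "(\<lambda>t. G t * p j t + g t * P j t) - (\<lambda>t. G t * f t + g t * F t)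
            = (\<lambda>t. G t * (p j - f) t) + (\<lambda>t. g t * (P j - F) t)"
          by (auto simp: fun_eq_iff algebra_simps)
        have m: "(\<lambda>t. G t * (p j - f) t) \<in> L2 (LI a b)" "(\<lambda>t. g t * (P j - F) t) \<in> L2 (LI a b)"
          by (rule L2_norm_mult_continuous_le(1)[OF L2_diff[OF p f] G C(2)], assumption)
             (rule L2_norm_mult_continuous_le(1)[OF L2_diff[OF PL FL] g C'(2)], assumption)
        have 1: "L2_norm (LI a b) (\<lambda>t. G t * (p j - f) t) \<le> C * ?n"
          by (rule L2_norm_mult_continuous_le(2)[OF L2_diff[OF p f] G C(2,1)])
        have 2: "L2_norm (LI a b) (\<lambda>t. g t * (P j - F) t) \<le> C' * L2_norm (LI a b) (P j - F)"
          by (rule L2_norm_mult_continuous_le(2)[OF L2_diff[OF PL FL] g C'(2,1)])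
        have "L2_norm (LI a b) (P j - F) \<le> (sqrt (b - a) * ?n) * sqrt (b - a)"
        proof (rule L2_LI_sup_le(2)[OF _ _ _ ab])
          show "continuous_on {a..b} (P j - F)" unfolding fun_diff_def
            by (intro continuous_intros primitive_on_continuous[OF P(3)] primitive_on_continuous[OF F])
        qed (use close ab in auto)
        then have 3: "C' * L2_norm (LI a b) (P j - F) \<le> C' * ((sqrt (b - a) * ?n) * sqrt (b - a))"
          using C'(1) by (rule mult_left_mono)
        have "L2_norm (LI a b) ((\<lambda>t. G t * (p j - f) t) + (\<lambda>t. g t * (P j - F) t))
            \<le> C * ?n + C' * ((sqrt (b - a) * ?n) * sqrt (b - a))"
          using L2_norm_triangle[OF m] 1 2 3 by linarith
        also have "\<dots> = (C + C' * (sqrt (b - a) * sqrt (b - a))) * ?n" by (simp add: algebra_simps)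
        finally show "norm (L2_norm (LI a b) ((\<lambda>t. G t * p j t + g t * P j t) - (\<lambda>t. G t * f t + g t * F t)))
          \<le> (C + C' * (sqrt (b - a) * sqrt (b - a))) * ?n" unfolding eq by simp
      qed
    qed
  qed
qed

lemma nn_integral_inverse_sqrt_distance:
  assumes s: "s \<in> {a<..<b}"
  shows "(\<integral>\<^sup>+x. indicator {a<..<b} x * ennreal (1 / sqrt \<bar>s - x\<bar>) \<partial>lborel) \<le> ennreal (4 * sqrt (b - a))"
proof -
  let ?k = "\<lambda>x. 1 / sqrt \<bar>s - x\<bar>"
  have "(?k has_integral (- 2 * sqrt (s - s) - (- 2 * sqrt (s - a)))) {a..s}"
  proof (rule fundamental_theorem_of_calculus_interior)
    fix x assume x: "x \<in> {a<..<s}"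
    have "((\<lambda>x. - 2 * sqrt (s - x)) has_real_derivative ?k x) (at x)"
      using x by (auto intro!: derivative_eq_intros simp: divide_simps)
    then show "((\<lambda>x. - 2 * sqrt (s - x)) has_vector_derivative ?k x) (at x)"
      by (simp add: has_real_derivative_iff_has_vector_derivative)
  qed (use s in \<open>auto intro!: continuous_intros\<close>)
  moreover have "(?k has_integral (2 * sqrt (b - s) - 2 * sqrt (s - s))) {s..b}"
  proof (rule fundamental_theorem_of_calculus_interior)
    fix x assume x: "x \<in> {s<..<b}"
    have "((\<lambda>x. 2 * sqrt (x - s)) has_real_derivative ?k x) (at x)"
      using x by (auto intro!: derivative_eq_intros simp: divide_simps)
    then show "((\<lambda>x. 2 * sqrt (x - s)) has_vector_derivative ?k x) (at x)"
      by (simp add: has_real_derivative_iff_has_vector_derivative)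
  qed (use s in \<open>auto intro!: continuous_intros\<close>)
  ultimately have "(?k has_integral (2 * sqrt (s - a) + 2 * sqrt (b - s))) {a..b}"
    using has_integral_combine[of a s b ?k] s by fastforce
  then have "(?k has_integral (2 * sqrt (s - a) + 2 * sqrt (b - s))) {a<..<b}"
    by (simp add: has_integral_Icc_iff_Ioo)
  then have "(\<integral>\<^sup>+x. ennreal (?k x) * indicator {a<..<b} x \<partial>lborel) = ennreal (2 * sqrt (s - a) + 2 * sqrt (b - s))"
    by (rule nn_integral_has_integral_lebesgue'[rotated]) simp
  also have "\<dots> \<le> ennreal (4 * sqrt (b - a))"
  proof (rule ennreal_leI)
    have "sqrt (s - a) \<le> sqrt (b - a)" "sqrt (b - s) \<le> sqrt (b - a)" using s by auto
    then show "2 * sqrt (s - a) + 2 * sqrt (b - s) \<le> 4 * sqrt (b - a)" by linarith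
  qed
  finally show ?thesis by (simp add: mult.commute)
qed

text \<open>
  For \<open>x < s < y\<close> the inequality between the means bounds \<open>1 / (y - x)\<close> by the product of the integrable
  kernels \<open>\<bar>s - x\<bar>\<close> and \<open>\<bar>s - y\<bar>\<close> to the power \<open>- 1/2\<close>.  Together with the Cauchy-Schwarz bound for
  \<open>F x - F y\<close> this lets the double integral factor for each \<open>s\<close>.
\<close>

lemma gagliardo_primitive_on:
  assumes F: "primitive_on a b F f" and ab: "a \<le> b"
  shows "(\<integral>\<^sup>+x. (\<integral>\<^sup>+y. indicator {a<..<b} x * indicator {a<..<b} y * ennreal ((cmod (F x - F y))\<^sup>2 / (x - y)\<^sup>2)
     \<partial>lborel) \<partial>lborel) \<le> ennreal (16 * (b - a) * (L2_norm (LI a b) f)\<^sup>2)"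
proof -
  let ?I = "{a<..<b}"
  have f: "f \<in> L2 (LI a b)" using F by (rule primitive_onD)
  define \<psi> where "\<psi> s = indicator ?I s * ennreal ((cmod (f s))\<^sup>2)" for s
  have "(\<lambda>s. ennreal ((cmod (f s))\<^sup>2)) \<in> borel_measurable (LI a b)"
    using L2_measurable[OF f] by simp
  then have \<psi>m: "\<psi> \<in> borel_measurable lebesgue"
    unfolding \<psi>_def by (subst (asm) borel_measurable_restrict_space_iff_ennreal) (auto simp: mult.commute)
  then obtain \<psi>' where \<psi>': "\<psi>' \<in> borel_measurable lborel" and eq: "AE s in lborel. \<psi> s = \<psi>' s"
    using completion_ex_borel_measurable by blast
  have \<psi>'b[measurable]: "\<psi>' \<in> borel_measurable borel" using \<psi>' by simp
  have int: "(\<integral>\<^sup>+s. indicator A s * \<psi> s \<partial>lborel) = ennreal (LINT s|LI a b. indicator A s * (cmod (f s))\<^sup>2)"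
    if A: "A \<in> sets lebesgue" for A
  proof -
    have "integrable (LI a b) (\<lambda>s. indicator A s * (cmod (f s))\<^sup>2)"
    proof (rule Bochner_Integration.integrable_bound[OF L2_integrable[OF f]])
      show "(\<lambda>s. indicator A s * (cmod (f s))\<^sup>2) \<in> borel_measurable (LI a b)"
        using indicator_measurable_LI[OF A] L2_measurable[OF f] by simp
    qed (simp add: indicator_def)
    then have "ennreal (LINT s|LI a b. indicator A s * (cmod (f s))\<^sup>2)
        = (\<integral>\<^sup>+s. ennreal (indicator A s * (cmod (f s))\<^sup>2) \<partial>LI a b)"
      by (intro nn_integral_eq_integral[symmetric]) auto
    also have "\<dots> = (\<integral>\<^sup>+s. ennreal (indicator A s * (cmod (f s))\<^sup>2) * indicator ?I s \<partial>lebesgue)"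
      by (rule nn_integral_restrict_space) simp
    also have "\<dots> = (\<integral>\<^sup>+s. indicator A s * \<psi> s \<partial>lborel)"
      unfolding nn_integral_completion by (intro nn_integral_cong) (auto simp: \<psi>_def indicator_def)
    finally show ?thesis by simp
  qed
  define k where "k s x = ennreal (1 / sqrt \<bar>s - x\<bar>)" for s x :: real
  have k_meas[measurable]: "(\<lambda>(s, x). k s x) \<in> borel_measurable (borel \<Otimes>\<^sub>M borel)"
    unfolding k_def by measurable
  have point: "ennreal ((cmod (F x - F y))\<^sup>2 / (x - y)\<^sup>2) \<le> (\<integral>\<^sup>+s. k s x * k s y * \<psi>' s \<partial>lborel)"
    if xy: "x \<in> ?I" "y \<in> ?I" for x y
  proof -
    have *: "ennreal ((cmod (F y - F x))\<^sup>2 / (y - x)\<^sup>2) \<le> (\<integral>\<^sup>+s. k s x * k s y * \<psi>' s \<partial>lborel)"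
      if xy: "x \<in> ?I" "y \<in> ?I" "x < y" for x y
    proof -
      have "(cmod (F y - F x))\<^sup>2 \<le> (y - x) * (LINT r|LI a b. indicator {x<..y} r * (cmod (f r))\<^sup>2)"
        using norm_interval_integral_le[OF f, of x y] primitive_on_diff_eq[OF F, of x y] xy by simp
      then have "(cmod (F y - F x))\<^sup>2 / (y - x)\<^sup>2 \<le> 1 / (y - x) * (LINT r|LI a b. indicator {x<..y} r * (cmod (f r))\<^sup>2)"
        using xy by (simp add: divide_simps power2_eq_square mult.commute)
      then have "ennreal ((cmod (F y - F x))\<^sup>2 / (y - x)\<^sup>2)
          \<le> ennreal (1 / (y - x)) * ennreal (LINT r|LI a b. indicator {x<..y} r * (cmod (f r))\<^sup>2)"
        using xy by (subst ennreal_mult'[symmetric]) (auto intro: ennreal_leI)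
      also have "\<dots> = ennreal (1 / (y - x)) * (\<integral>\<^sup>+s. indicator {x<..y} s * \<psi> s \<partial>lborel)"
        by (subst int) auto
      also have "\<dots> = ennreal (1 / (y - x)) * (\<integral>\<^sup>+s. indicator {x<..y} s * \<psi>' s \<partial>lborel)"
        by (intro arg_cong2[where f="(*)"] refl nn_integral_cong_AE) (use eq in eventually_elim, simp)
      also have "\<dots> = (\<integral>\<^sup>+s. ennreal (1 / (y - x)) * (indicator {x<..y} s * \<psi>' s) \<partial>lborel)"
        by (intro nn_integral_cmult[symmetric]) measurable
      also have "\<dots> \<le> (\<integral>\<^sup>+s. k s x * k s y * \<psi>' s \<partial>lborel)"
      proof (rule nn_integral_mono_AE)
        have "AE s in lborel. s \<notin> {y}" by (rule AE_not_in) (simp add: finite_imp_null_set_lborel)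
        then show "AE s in lborel. ennreal (1 / (y - x)) * (indicator {x<..y} s * \<psi>' s) \<le> k s x * k s y * \<psi>' s"
        proof eventually_elim
          case (elim s)
          show ?case
          proof (cases "x < s \<and> s < y")
            case True
            then have pos: "0 < sqrt (s - x)" "0 < sqrt (y - s)" by auto
            have "0 \<le> (sqrt (s - x) - sqrt (y - s))\<^sup>2" by simp
            also have "\<dots> = y - x - 2 * (sqrt (s - x) * sqrt (y - s))"
              using True by (simp add: power2_diff)
            finally have "sqrt (s - x) * sqrt (y - s) \<le> y - x"
              using pos by (smt (verit) mult_pos_pos)
            then have "1 / (y - x) \<le> 1 / (sqrt (s - x) * sqrt (y - s))"
              using pos by (intro divide_left_mono) auto
            also have "\<dots> = (1 / sqrt \<bar>s - x\<bar>) * (1 / sqrt \<bar>s - y\<bar>)" using True by simp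
            finally have "ennreal (1 / (y - x)) \<le> k s x * k s y"
              unfolding k_def by (subst ennreal_mult[symmetric]) (auto intro: ennreal_leI)
            then show ?thesis using True by (simp add: mult_right_mono)
          next
            case False
            then have "s \<notin> {x<..y}" using elim by auto
            then show ?thesis by simp
          qed
        qed
      qed
      finally show ?thesis .
    qed
    show ?thesis
    proof (cases x y rule: linorder_cases)
      case less
      then show ?thesis using *[OF xy less] by (simp add: norm_minus_commute power2_commute)
    next
      case greater
      then show ?thesis using *[OF xy(2,1) greater] by (simp add: mult.commute)
    qed simp
  qed
  have K: "(\<integral>\<^sup>+x. indicator ?I x * k s x \<partial>lborel) \<le> ennreal (4 * sqrt (b - a))" if "s \<in> ?I" for s
    unfolding k_def by (rule nn_integral_inverse_sqrt_distance[OF that])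
  have "(\<integral>\<^sup>+x. (\<integral>\<^sup>+y. indicator ?I x * indicator ?I y * ennreal ((cmod (F x - F y))\<^sup>2 / (x - y)\<^sup>2) \<partial>lborel) \<partial>lborel)
      \<le> (\<integral>\<^sup>+x. (\<integral>\<^sup>+y. (\<integral>\<^sup>+s. (indicator ?I x * k s x) * ((indicator ?I y * k s y) * \<psi>' s) \<partial>lborel) \<partial>lborel) \<partial>lborel)"
  proof (intro nn_integral_mono)
    fix x y
    show "indicator ?I x * indicator ?I y * ennreal ((cmod (F x - F y))\<^sup>2 / (x - y)\<^sup>2)
        \<le> (\<integral>\<^sup>+s. (indicator ?I x * k s x) * ((indicator ?I y * k s y) * \<psi>' s) \<partial>lborel)"
      using point[of x y] by (auto simp: indicator_def mult.assoc)
  qed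
  also have "\<dots> = (\<integral>\<^sup>+x. (\<integral>\<^sup>+s. (\<integral>\<^sup>+y. (indicator ?I x * k s x) * ((indicator ?I y * k s y) * \<psi>' s) \<partial>lborel) \<partial>lborel) \<partial>lborel)"
    by (intro nn_integral_cong lborel_pair.Fubini') measurable
  also have "\<dots> = (\<integral>\<^sup>+s. (\<integral>\<^sup>+x. (\<integral>\<^sup>+y. (indicator ?I x * k s x) * ((indicator ?I y * k s y) * \<psi>' s) \<partial>lborel) \<partial>lborel) \<partial>lborel)"
    by (intro lborel_pair.Fubini') measurable
  also have "\<dots> = (\<integral>\<^sup>+s. (\<integral>\<^sup>+x. indicator ?I x * k s x \<partial>lborel) * ((\<integral>\<^sup>+y. indicator ?I y * k s y \<partial>lborel) * \<psi>' s) \<partial>lborel)"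
    by (intro nn_integral_cong) (simp add: nn_integral_cmult nn_integral_multc)
  also have "\<dots> \<le> (\<integral>\<^sup>+s. ennreal (4 * sqrt (b - a)) * (ennreal (4 * sqrt (b - a)) * \<psi>' s) \<partial>lborel)"
  proof (rule nn_integral_mono_AE)
    show "AE s in lborel. (\<integral>\<^sup>+x. indicator ?I x * k s x \<partial>lborel) * ((\<integral>\<^sup>+y. indicator ?I y * k s y \<partial>lborel) * \<psi>' s)
        \<le> ennreal (4 * sqrt (b - a)) * (ennreal (4 * sqrt (b - a)) * \<psi>' s)"
      using eq
    proof eventually_elim
      case (elim s)
      show ?case
      proof (cases "s \<in> ?I")
        case True
        then show ?thesis by (intro mult_mono K) auto
      next
        case False
        then have "\<psi>' s = 0" using elim by (simp add: \<psi>_def)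
        then show ?thesis by simp
      qed
    qed
  qed
  also have "\<dots> = ennreal (4 * sqrt (b - a)) * (ennreal (4 * sqrt (b - a)) * (\<integral>\<^sup>+s. \<psi>' s \<partial>lborel))"
    by (simp add: nn_integral_cmult)
  also have "(\<integral>\<^sup>+s. \<psi>' s \<partial>lborel) = (\<integral>\<^sup>+s. indicator UNIV s * \<psi> s \<partial>lborel)"
    by (intro nn_integral_cong_AE) (use eq in eventually_elim, simp)
  also have "\<dots> = ennreal ((L2_norm (LI a b) f)\<^sup>2)" by (subst int) (auto simp: L2_norm_square)
  also have "ennreal (4 * sqrt (b - a)) * (ennreal (4 * sqrt (b - a)) * ennreal ((L2_norm (LI a b) f)\<^sup>2))
      = ennreal (4 * sqrt (b - a) * (4 * sqrt (b - a) * (L2_norm (LI a b) f)\<^sup>2))"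
  proof -
    have "ennreal A * (ennreal A * ennreal n) = ennreal (A * (A * n))" if "A \<ge> 0" "n \<ge> 0" for A n
      by (simp add: ennreal_mult that)
    then show ?thesis using ab by simp
  qed
  also have "4 * sqrt (b - a) * (4 * sqrt (b - a) * (L2_norm (LI a b) f)\<^sup>2)
      = 16 * (sqrt (b - a) * sqrt (b - a)) * (L2_norm (LI a b) f)\<^sup>2" by (simp only: mult_ac)
  also have "sqrt (b - a) * sqrt (b - a) = b - a" using ab by simp
  finally show ?thesis .
qed

section \<open>Test functions\<close>

lemma Ck_on_imp_lower:
  fixes f :: "'a::euclidean_space \<Rightarrow> 'b::real_normed_vector"
  shows "Ck_on (Suc k) UNIV f \<Longrightarrow> Ck_on k UNIV f"
proof (induction k arbitrary: f)
  case 0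
  then show ?case
    by (auto intro!: continuous_at_imp_continuous_on differentiable_imp_continuous_within)
next
  case (Suc k)
  have "\<forall>x\<in>UNIV. f differentiable (at x)" and p: "\<And>b. b \<in> Basis \<Longrightarrow> Ck_on (Suc k) UNIV (pd b f)"
    using Suc.prems unfolding Ck_on.simps(2)[of "Suc k"] by blast+
  then show ?case unfolding Ck_on.simps(2)[of k] using Suc.IH[OF p] by blast
qed

lemma Ck_on_const: "Ck_on k UNIV (\<lambda>x::'a::euclidean_space. c :: 'b::real_normed_vector)"
proof (induction k arbitrary: c)
  case (Suc k)
  have "pd b (\<lambda>x::'a. c) = (\<lambda>x. 0)" for b by (simp add: pd_def fun_eq_iff)
  then show ?case using Suc[of 0] by simp
qed simp

lemma pd_add:
  assumes "\<And>x. f differentiable (at x)" "\<And>x. g differentiable (at x)"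
  shows "(\<lambda>x. f x + g x) differentiable (at x)"
    and "pd b (\<lambda>x. f x + g x) = (\<lambda>x. pd b f x + pd b g x)"
proof -
  have D: "((\<lambda>x. f x + g x) has_derivative
      (\<lambda>h. frechet_derivative f (at x) h + frechet_derivative g (at x) h)) (at x)" for x
    using assms unfolding frechet_derivative_works by (intro has_derivative_add) auto
  then show "(\<lambda>x. f x + g x) differentiable (at x)" unfolding differentiable_def by blast
  show "pd b (\<lambda>x. f x + g x) = (\<lambda>x. pd b f x + pd b g x)"
    unfolding pd_def by (rule ext) (simp add: frechet_derivative_at[OF D, symmetric])
qed

lemma Ck_on_add:
  fixes f g :: "'a::euclidean_space \<Rightarrow> 'b::real_normed_vector"
  shows "Ck_on k UNIV f \<Longrightarrow> Ck_on k UNIV g \<Longrightarrow> Ck_on k UNIV (\<lambda>x. f x + g x)"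
proof (induction k arbitrary: f g)
  case 0 then show ?case by (auto intro: continuous_on_add)
next
  case (Suc k)
  have d: "\<And>x. f differentiable (at x)" "\<And>x. g differentiable (at x)" using Suc.prems by auto
  have "Ck_on k UNIV (pd b (\<lambda>x. f x + g x))" if "b \<in> Basis" for b
    unfolding pd_add(2)[OF d] using Suc.IH Suc.prems that by simp
  then show ?case using pd_add(1)[OF d] by simp
qed

lemma pd_scaleR:
  fixes f :: "'a::euclidean_space \<Rightarrow> real" and g :: "'a \<Rightarrow> 'b::real_normed_vector"
  assumes "\<And>x. f differentiable (at x)" "\<And>x. g differentiable (at x)"
  shows "(\<lambda>x. f x *\<^sub>R g x) differentiable (at x)"
    and "pd b (\<lambda>x. f x *\<^sub>R g x) = (\<lambda>x. f x *\<^sub>R pd b g x + pd b f x *\<^sub>R g x)"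
proof -
  have D: "((\<lambda>x. f x *\<^sub>R g x) has_derivative
      (\<lambda>h. f x *\<^sub>R frechet_derivative g (at x) h + frechet_derivative f (at x) h *\<^sub>R g x)) (at x)" for x
    using assms unfolding frechet_derivative_works by (intro has_derivative_scaleR) auto
  then show "(\<lambda>x. f x *\<^sub>R g x) differentiable (at x)" unfolding differentiable_def by blast
  show "pd b (\<lambda>x. f x *\<^sub>R g x) = (\<lambda>x. f x *\<^sub>R pd b g x + pd b f x *\<^sub>R g x)"
    unfolding pd_def by (rule ext) (simp add: frechet_derivative_at[OF D, symmetric])
qed

lemma Ck_on_scaleR:
  fixes f :: "'a::euclidean_space \<Rightarrow> real" and g :: "'a \<Rightarrow> 'b::real_normed_vector"
  shows "Ck_on k UNIV f \<Longrightarrow> Ck_on k UNIV g \<Longrightarrow> Ck_on k UNIV (\<lambda>x. f x *\<^sub>R g x)"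
proof (induction k arbitrary: f g)
  case 0 then show ?case by (auto intro: continuous_on_scaleR)
next
  case (Suc k)
  have d: "\<And>x. f differentiable (at x)" "\<And>x. g differentiable (at x)" using Suc.prems by auto
  have "Ck_on k UNIV (pd b (\<lambda>x. f x *\<^sub>R g x))" if "b \<in> Basis" for b
  proof -
    have "Ck_on k UNIV (pd b g)" "Ck_on k UNIV (pd b f)" using Suc.prems that by auto
    then show ?thesis unfolding pd_scaleR(2)[OF d]
      using Ck_on_add Suc.IH Ck_on_imp_lower[OF Suc.prems(1)] Ck_on_imp_lower[OF Suc.prems(2)] by blast
  qed
  then show ?case using pd_scaleR(1)[OF d] by simp
qed

lemma smooth_on_scaleR:
  fixes f :: "'a::euclidean_space \<Rightarrow> real" and g :: "'a \<Rightarrow> 'b::real_normed_vector"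
  shows "smooth_on UNIV f \<Longrightarrow> smooth_on UNIV g \<Longrightarrow> smooth_on UNIV (\<lambda>x. f x *\<^sub>R g x)"
  by (simp add: smooth_on_def Ck_on_scaleR)

text \<open>A set of functions of one real variable closed under differentiation consists of smooth functions.\<close>

lemma pd_real:
  fixes h :: "real \<Rightarrow> 'b::real_normed_vector"
  assumes "\<And>t. (h has_vector_derivative h' t) (at t)"
  shows "h differentiable (at t)" "pd 1 h = h'"
proof -
  have D: "(h has_derivative (\<lambda>s. s *\<^sub>R h' t)) (at t)" for t
    using assms by (simp add: has_vector_derivative_def)
  then show "h differentiable (at t)" unfolding differentiable_def by blast
  show "pd 1 h = h'" unfolding pd_def
    by (rule ext) (simp add: frechet_derivative_at[OF D, symmetric])
qed

lemma smooth_on_derivative_closed: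
  fixes h :: "real \<Rightarrow> 'b::real_normed_vector"
  assumes closed: "\<And>h. h \<in> D \<Longrightarrow> \<exists>h'\<in>D. \<forall>t. (h has_vector_derivative h' t) (at t)" and h: "h \<in> D"
  shows "smooth_on UNIV h"
proof -
  have "Ck_on k UNIV h" if "h \<in> D" for k h
    using that
  proof (induction k arbitrary: h)
    case 0
    then obtain h' where "\<forall>t. (h has_vector_derivative h' t) (at t)" using closed by blast
    then show ?case
      by (auto intro!: continuous_at_imp_continuous_on has_vector_derivative_continuous)
  next
    case (Suc k)
    then obtain h' where h': "h' \<in> D" "\<And>t. (h has_vector_derivative h' t) (at t)" using closed by blast
    then show ?case using Suc.IH[OF h'(1)] pd_real[OF h'(2)] by simp
  qed
  then show ?thesis using h by (simp add: smooth_on_def)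
qed

lemma smooth_on_polynomial:
  fixes p :: "real \<Rightarrow> 'b::euclidean_space"
  assumes "polynomial_function p"
  shows "smooth_on UNIV p"
proof (rule smooth_on_derivative_closed[of "Collect polynomial_function"])
  fix h :: "real \<Rightarrow> 'b" assume "h \<in> Collect polynomial_function"
  then obtain h' where "polynomial_function h'" "\<And>t. (h has_vector_derivative h' t) (at t)"
    using has_vector_derivative_polynomial_function by blast
  then show "\<exists>h'\<in>Collect polynomial_function. \<forall>t. (h has_vector_derivative h' t) (at t)" by blast
qed (use assms in simp)

lemma smooth_on_real_derivative:
  fixes h :: "real \<Rightarrow> 'b::real_normed_vector"
  assumes "smooth_on UNIV h"
  shows "(h has_vector_derivative pd 1 h t) (at t)" and "smooth_on UNIV (pd 1 h)"
proof -
  have "h differentiable (at t)" using smooth_onD[OF assms] by simp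
  then have D: "(h has_derivative frechet_derivative h (at t)) (at t)"
    by (simp add: frechet_derivative_works)
  then interpret bounded_linear "frechet_derivative h (at t)" by (rule has_derivative_bounded_linear)
  have "frechet_derivative h (at t) s = s *\<^sub>R frechet_derivative h (at t) 1" for s
    using scaleR[of s 1] by (simp only: real_scaleR_def mult_1_right)
  then have "frechet_derivative h (at t) = (\<lambda>s. s *\<^sub>R pd 1 h t)"
    unfolding pd_def by (rule ext)
  then show "(h has_vector_derivative pd 1 h t) (at t)" using D by (simp add: has_vector_derivative_def)
  have "Ck_on (Suc k) UNIV h" for k using assms unfolding smooth_on_def by blast
  then show "smooth_on UNIV (pd 1 h)" by (simp add: smooth_on_def)
qed

lemma pd_lift:
  fixes h :: "real \<Rightarrow> 'b::real_normed_vector" and e :: "'a::euclidean_space"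
  assumes h: "\<And>t. (h has_vector_derivative h' t) (at t)"
  shows "(\<lambda>x. h (\<sigma> * (x \<bullet> e) + \<tau>)) differentiable (at x)"
    and "pd b (\<lambda>x. h (\<sigma> * (x \<bullet> e) + \<tau>)) = (\<lambda>x. (\<sigma> * (b \<bullet> e)) *\<^sub>R h' (\<sigma> * (x \<bullet> e) + \<tau>))"
proof -
  have D: "((\<lambda>x. h (\<sigma> * (x \<bullet> e) + \<tau>)) has_derivative (\<lambda>v. (\<sigma> * (v \<bullet> e)) *\<^sub>R h' (\<sigma> * (x \<bullet> e) + \<tau>))) (at x)" for x
  proof -
    have "((\<lambda>x. \<sigma> * (x \<bullet> e) + \<tau>) has_derivative (\<lambda>v. \<sigma> * (v \<bullet> e))) (at x)"
      by (auto intro!: derivative_eq_intros)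
    moreover have "(h has_derivative (\<lambda>s. s *\<^sub>R h' (\<sigma> * (x \<bullet> e) + \<tau>))) (at (\<sigma> * (x \<bullet> e) + \<tau>))"
      using h by (simp add: has_vector_derivative_def)
    ultimately show ?thesis using diff_chain_at by (fastforce simp: o_def)
  qed
  then show "(\<lambda>x. h (\<sigma> * (x \<bullet> e) + \<tau>)) differentiable (at x)" unfolding differentiable_def by blast
  show "pd b (\<lambda>x. h (\<sigma> * (x \<bullet> e) + \<tau>)) = (\<lambda>x. (\<sigma> * (b \<bullet> e)) *\<^sub>R h' (\<sigma> * (x \<bullet> e) + \<tau>))"
    unfolding pd_def by (rule ext) (simp add: frechet_derivative_at[OF D, symmetric])
qed

lemma smooth_on_lift:
  fixes h :: "real \<Rightarrow> 'b::real_normed_vector" and e :: "'a::euclidean_space"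
  assumes "smooth_on UNIV h"
  shows "smooth_on UNIV (\<lambda>x. h (\<sigma> * (x \<bullet> e) + \<tau>))"
proof -
  have "Ck_on k UNIV (\<lambda>x. h (\<sigma> * (x \<bullet> e) + \<tau>))" if "smooth_on UNIV h" for k and h :: "real \<Rightarrow> 'b"
    using that
  proof (induction k arbitrary: h)
    case 0
    then have "continuous_on UNIV h" by (auto simp: smooth_on_def intro: Ck_on.simps(1)[THEN iffD1])
    then show ?case by (auto intro!: continuous_on_compose2[of UNIV h] continuous_intros)
  next
    case (Suc k)
    note D = smooth_on_real_derivative[OF Suc.prems]
    have "Ck_on k UNIV (pd b (\<lambda>x. h (\<sigma> * (x \<bullet> e) + \<tau>)))" for b :: 'a
      unfolding pd_lift(2)[OF D(1)] by (intro Ck_on_scaleR Ck_on_const Suc.IH D(2))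
    then show ?case unfolding Ck_on.simps(2) by (intro conjI ballI pd_lift(1)[OF D(1)])
  qed
  then show ?thesis using assms by (simp add: smooth_on_def)
qed

subsection \<open>Flat functions\<close>

lemma poly_times_exp_tendsto_0:
  fixes p :: "real poly"
  assumes "\<epsilon> > 0"
  shows "((\<lambda>x. poly p x * exp (- \<epsilon> * x)) \<longlongrightarrow> 0) at_top"
proof -
  have "((\<lambda>x::real. x ^ k * exp (- \<epsilon> * x)) \<longlongrightarrow> 0) at_top" for k
    using assms by real_asymp
  then have "((\<lambda>x. \<Sum>i\<le>degree p. coeff p i * (x ^ i * exp (- \<epsilon> * x))) \<longlongrightarrow> (\<Sum>i\<le>degree p. coeff p i * 0)) at_top"
    by (intro tendsto_intros)
  then show ?thesis by (simp add: poly_altdef sum_distrib_right mult.assoc)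
qed

text \<open>
  The functions \<open>p(1/t) exp(- \<epsilon>/t)\<close>, extended by \<open>0\<close> to \<open>t \<le> 0\<close>: the polynomial \<open>p\<close> makes
  the family closed under differentiation, so that all its members are smooth.
\<close>

definition flat :: "real \<Rightarrow> real poly \<Rightarrow> real \<Rightarrow> real"
  where "flat \<epsilon> p t = (if t > 0 then poly p (1 / t) * exp (- \<epsilon> / t) else 0)"

lemma flat_has_derivative:
  assumes \<epsilon>: "\<epsilon> > 0"
  shows "(flat \<epsilon> p has_real_derivative flat \<epsilon> (monom 1 2 * (smult \<epsilon> p - pderiv p)) t) (at t)"
proof (cases t "0::real" rule: linorder_cases)
  case less
  have "((\<lambda>t. 0) has_real_derivative 0) (at t)" by simp
  then have "(flat \<epsilon> p has_real_derivative 0) (at t)"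
    by (rule has_field_derivative_transform_within_open[of _ _ _ "{..<0}"]) (use less in \<open>auto simp: flat_def\<close>)
  then show ?thesis using less by (simp add: flat_def)
next
  case greater
  have "((\<lambda>t. poly p (1 / t) * exp (- \<epsilon> / t)) has_real_derivative
      poly p (1 / t) * (exp (- \<epsilon> / t) * (\<epsilon> / t\<^sup>2)) + poly (pderiv p) (1 / t) * (- 1 / t\<^sup>2) * exp (- \<epsilon> / t)) (at t)"
    using greater
    by (auto intro!: derivative_eq_intros DERIV_chain2[OF poly_DERIV] simp: power2_eq_square)
  also have "poly p (1 / t) * (exp (- \<epsilon> / t) * (\<epsilon> / t\<^sup>2)) + poly (pderiv p) (1 / t) * (- 1 / t\<^sup>2) * exp (- \<epsilon> / t)
      = flat \<epsilon> (monom 1 2 * (smult \<epsilon> p - pderiv p)) t"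
    using greater by (simp add: flat_def poly_monom power_divide algebra_simps)
  finally show ?thesis
    by (rule has_field_derivative_transform_within_open[of _ _ _ "{0<..}"]) (use greater in \<open>auto simp: flat_def\<close>)
next
  case equal
  have "((\<lambda>h. flat \<epsilon> p h / h) \<longlongrightarrow> 0) (at 0)"
  proof (rule filterlim_split_at_real)
    have "((\<lambda>h. 0) \<longlongrightarrow> (0::real)) (at_left 0)" by simp
    then show "((\<lambda>h. flat \<epsilon> p h / h) \<longlongrightarrow> 0) (at_left 0)"
      by (rule Lim_transform_eventually) (auto simp: flat_def eventually_at_filter)
    have "((\<lambda>h. poly (pCons 0 p) (inverse h) * exp (- \<epsilon> * inverse h)) \<longlongrightarrow> 0) (at_right 0)"
      by (rule filterlim_compose[OF poly_times_exp_tendsto_0[OF \<epsilon>] filterlim_inverse_at_top_right])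
    then show "((\<lambda>h. flat \<epsilon> p h / h) \<longlongrightarrow> 0) (at_right 0)"
      by (rule Lim_transform_eventually) (auto simp: flat_def eventually_at_filter field_simps)
  qed
  then have "(flat \<epsilon> p has_real_derivative 0) (at 0)"
    by (simp add: has_field_derivative_iff flat_def)
  then show ?thesis using equal by (simp add: flat_def)
qed

lemma smooth_on_flat:
  assumes "\<epsilon> > 0"
  shows "smooth_on UNIV (flat \<epsilon> p)"
proof (rule smooth_on_derivative_closed[of "range (flat \<epsilon>)"])
  fix h assume "h \<in> range (flat \<epsilon>)"
  then show "\<exists>h'\<in>range (flat \<epsilon>). \<forall>t. (h has_vector_derivative h' t) (at t)"
    using flat_has_derivative[OF assms] by (auto simp: has_real_derivative_iff_has_vector_derivative)
qed simp

section \<open>Intervals in one-dimensional spaces\<close>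

lemma lebesgue_measure_preserving:
  fixes T :: "'a::euclidean_space \<Rightarrow> 'b::euclidean_space"
  assumes T[measurable]: "T \<in> borel \<rightarrow>\<^sub>M borel" and eq: "distr lborel borel T = lborel"
  shows "T \<in> lebesgue \<rightarrow>\<^sub>M lebesgue" and "distr lebesgue lebesgue T = lebesgue"
proof -
  have T': "T \<in> lborel \<rightarrow>\<^sub>M lborel" by simp
  have "distr lebesgue lborel T = distr lborel lborel T"
    by (rule distr_completion[OF T'])
  also have "\<dots> = distr lborel borel T" by (rule distr_cong) auto
  finally have d: "distr lebesgue lborel T = lborel" using eq by simp
  show "T \<in> lebesgue \<rightarrow>\<^sub>M lebesgue"
    by (rule completion.measurable_completion2[OF measurable_completion[OF T']]) (simp add: d)
  have "completion (distr lebesgue lborel T) = distr lebesgue lebesgue T"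
    by (rule completion.completion_distr_eq[OF measurable_completion[OF T']]) (simp add: d)
  then show "distr lebesgue lebesgue T = lebesgue" by (simp add: d)
qed

locale interval_domain =
  fixes e :: "'a::euclidean_space" and a b :: real and \<Omega> :: "'a set"
  assumes Basis: "Basis = {e}" and ab: "a < b" and \<Omega>: "\<Omega> = {x. a < x \<bullet> e \<and> x \<bullet> e < b}"
begin

abbreviation M where "M \<equiv> lebesgue_on \<Omega>"

lemma e_e [simp]: "e \<bullet> e = 1" and norm_e [simp]: "norm e = 1"
proof -
  have "e \<in> Basis" by (simp add: Basis)
  then show "e \<bullet> e = 1" "norm e = 1" by (simp_all only: inner_same_Basis norm_Basis)
qed

lemma scaleR_e [simp]: "(x \<bullet> e) *\<^sub>R e = x"
  using euclidean_representation[of x] by (simp add: Basis)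

lemma DIM: "DIM('a) = 1"
  by (simp add: Basis)

lemma norm_eq: "norm x = \<bar>x \<bullet> e\<bar>"
proof -
  have "norm ((x \<bullet> e) *\<^sub>R e) = \<bar>x \<bullet> e\<bar>" by (simp only: norm_scaleR norm_e mult_1_right)
  then show ?thesis by simp
qed

lemma open_\<Omega>: "open \<Omega>"
  unfolding \<Omega> by (intro open_Collect_conj open_Collect_less continuous_intros)

lemma \<Omega>_lebesgue: "\<Omega> \<in> sets lebesgue"
  using open_\<Omega> by auto

lemma distr_embed: "distr lborel borel (\<lambda>t. t *\<^sub>R e) = lborel"
proof (rule lborel_eqI[symmetric])
  fix l u :: 'a assume "\<And>b. b \<in> Basis \<Longrightarrow> l \<bullet> b \<le> u \<bullet> b"
  then have lu: "l \<bullet> e \<le> u \<bullet> e" by (simp add: Basis)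
  have "emeasure (distr lborel borel (\<lambda>t. t *\<^sub>R e)) (box l u) = emeasure lborel ((\<lambda>t. t *\<^sub>R e) -` box l u)"
    by (subst emeasure_distr) auto
  also have "(\<lambda>t. t *\<^sub>R e) -` box l u = {l \<bullet> e<..<u \<bullet> e}"
    by (auto simp: mem_box Basis)
  also have "emeasure lborel \<dots> = ennreal (u \<bullet> e - l \<bullet> e)" using lu by simp
  finally show "emeasure (distr lborel borel (\<lambda>t. t *\<^sub>R e)) (box l u) = ennreal (\<Prod>b\<in>Basis. (u - l) \<bullet> b)"
    by (simp add: Basis inner_diff_left)
qed simp

lemma distr_coord: "distr lborel borel (\<lambda>x. x \<bullet> e) = lborel"
proof -
  have "distr lborel borel (\<lambda>x. x \<bullet> e) = distr (distr lborel borel (\<lambda>t. t *\<^sub>R e)) borel (\<lambda>x. x \<bullet> e)"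
    by (simp add: distr_embed)
  also have "\<dots> = distr lborel borel ((\<lambda>x. x \<bullet> e) \<circ> (\<lambda>t. t *\<^sub>R e))"
    by (rule distr_distr) auto
  also have "(\<lambda>x. x \<bullet> e) \<circ> (\<lambda>t. t *\<^sub>R e) = (\<lambda>t. t)" by (auto simp: o_def)
  finally show ?thesis by (simp add: distr_id2)
qed

lemma measurable_embed: "(\<lambda>t. t *\<^sub>R e) \<in> LI a b \<rightarrow>\<^sub>M M"
  by (intro measurable_restrict_space3 lebesgue_measure_preserving(1)[OF _ distr_embed]) (auto simp: \<Omega>)

lemma measurable_coord: "(\<lambda>x. x \<bullet> e) \<in> M \<rightarrow>\<^sub>M LI a b"
  by (intro measurable_restrict_space3 lebesgue_measure_preserving(1)[OF _ distr_coord]) (auto simp: \<Omega>)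

lemma distr_LI: "distr (LI a b) M (\<lambda>t. t *\<^sub>R e) = M"
proof (rule measure_eqI)
  fix A assume "A \<in> sets (distr (LI a b) M (\<lambda>t. t *\<^sub>R e))"
  then have A: "A \<in> sets M" by simp
  then have A': "A \<in> sets lebesgue" "A \<subseteq> \<Omega>" using \<Omega>_lebesgue by (auto simp: sets_restrict_space_iff)
  have m: "(\<lambda>t. t *\<^sub>R e) \<in> lebesgue \<rightarrow>\<^sub>M lebesgue" "distr lebesgue lebesgue (\<lambda>t. t *\<^sub>R e) = (lebesgue :: 'a measure)"
    by (rule lebesgue_measure_preserving[OF _ distr_embed], simp)+
  have sub: "(\<lambda>t. t *\<^sub>R e) -` A \<subseteq> {a<..<b}" using A'(2) by (auto simp: \<Omega>)
  have "emeasure (distr (LI a b) M (\<lambda>t. t *\<^sub>R e)) A = emeasure (LI a b) ((\<lambda>t. t *\<^sub>R e) -` A)"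
    using A sub by (subst emeasure_distr[OF measurable_embed]) (auto intro!: arg_cong2[where f=emeasure])
  also have "\<dots> = emeasure lebesgue ((\<lambda>t. t *\<^sub>R e) -` A)"
    using sub by (intro emeasure_restrict_space) auto
  also have "\<dots> = emeasure (distr lebesgue lebesgue (\<lambda>t. t *\<^sub>R e)) A"
    using A' m(1) by (subst emeasure_distr) auto
  also have "\<dots> = emeasure M A" unfolding m(2)
    using A' \<Omega>_lebesgue by (intro emeasure_restrict_space[symmetric]) auto
  finally show "emeasure (distr (LI a b) M (\<lambda>t. t *\<^sub>R e)) A = emeasure M A" .
qed simp

lemma distr_M: "distr M (LI a b) (\<lambda>x. x \<bullet> e) = LI a b"
proof -
  have "distr M (LI a b) (\<lambda>x. x \<bullet> e) = distr (distr (LI a b) M (\<lambda>t. t *\<^sub>R e)) (LI a b) (\<lambda>x. x \<bullet> e)"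
    by (simp add: distr_LI)
  also have "\<dots> = distr (LI a b) (LI a b) ((\<lambda>x. x \<bullet> e) \<circ> (\<lambda>t. t *\<^sub>R e))"
    by (rule distr_distr[OF measurable_coord measurable_embed])
  also have "(\<lambda>x. x \<bullet> e) \<circ> (\<lambda>t. t *\<^sub>R e) = (\<lambda>t. t)" by (auto simp: o_def)
  finally show ?thesis by (simp add: distr_id2)
qed

lemma measurable_M_iff:
  "f \<in> borel_measurable M \<longleftrightarrow> (\<lambda>t. f (t *\<^sub>R e)) \<in> borel_measurable (LI a b)"
proof
  show "f \<in> borel_measurable M \<Longrightarrow> (\<lambda>t. f (t *\<^sub>R e)) \<in> borel_measurable (LI a b)"
    using measurable_compose[OF measurable_embed, of f borel] by simp
  show "(\<lambda>t. f (t *\<^sub>R e)) \<in> borel_measurable (LI a b) \<Longrightarrow> f \<in> borel_measurable M"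
    using measurable_compose[OF measurable_coord, of "\<lambda>t. f (t *\<^sub>R e)" borel] by simp
qed

lemma AE_M_iff: "(AE x in M. P x) \<longleftrightarrow> (AE t in LI a b. P (t *\<^sub>R e))"
proof
  assume "AE x in M. P x"
  then have "AE x in distr (LI a b) M (\<lambda>t. t *\<^sub>R e). P x" by (simp only: distr_LI)
  then show "AE t in LI a b. P (t *\<^sub>R e)" by (rule AE_distrD[OF measurable_embed])
next
  assume "AE t in LI a b. P (t *\<^sub>R e)"
  then have "AE t in distr M (LI a b) (\<lambda>x. x \<bullet> e). P (t *\<^sub>R e)" by (simp only: distr_M)
  from AE_distrD[OF measurable_coord this] show "AE x in M. P x" by simp
qed

lemma integral_M:
  fixes f :: "'a \<Rightarrow> 'b::{banach, second_countable_topology}"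
  assumes "f \<in> borel_measurable M"
  shows "(LINT x|M. f x) = (LINT t|LI a b. f (t *\<^sub>R e))"
  using integral_distr[OF measurable_embed assms] by (simp add: distr_LI)

lemma L2_M_iff: "f \<in> L2 M \<longleftrightarrow> (\<lambda>t. f (t *\<^sub>R e)) \<in> L2 (LI a b)"
proof (cases "f \<in> borel_measurable M")
  case True
  then have "integrable M (\<lambda>x. (cmod (f x))\<^sup>2) \<longleftrightarrow> integrable (LI a b) (\<lambda>t. (cmod (f (t *\<^sub>R e)))\<^sup>2)"
    using integrable_distr_eq[OF measurable_embed, of "\<lambda>x. (cmod (f x))\<^sup>2"] by (simp add: distr_LI)
  then show ?thesis using True by (simp add: L2_def measurable_M_iff[of f])
qed (simp add: L2_def measurable_M_iff[of f])

lemma L2_norm_M: "f \<in> borel_measurable M \<Longrightarrow> L2_norm M f = L2_norm (LI a b) (\<lambda>t. f (t *\<^sub>R e))"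
  using integral_M[of "\<lambda>x. (cmod (f x))\<^sup>2"] by (simp add: L2_norm_def)

lemma smooth_embed_derivative:
  fixes \<eta> :: "'a \<Rightarrow> 'b::real_normed_vector"
  assumes "smooth_on UNIV \<eta>"
  shows "((\<lambda>t. \<eta> (t *\<^sub>R e)) has_vector_derivative pd e \<eta> (t *\<^sub>R e)) (at t)"
    and "continuous_on UNIV (\<lambda>t. pd e \<eta> (t *\<^sub>R e))" and "smooth_on UNIV (pd e \<eta>)"
proof -
  have "(\<eta> has_derivative frechet_derivative \<eta> (at (t *\<^sub>R e))) (at (t *\<^sub>R e))"
    using smooth_onD[OF assms] by (simp add: frechet_derivative_works)
  moreover have "((\<lambda>t. t *\<^sub>R e) has_derivative (\<lambda>s. s *\<^sub>R e)) (at t)"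
    by (auto intro!: derivative_eq_intros)
  ultimately have "((\<lambda>t. \<eta> (t *\<^sub>R e)) has_derivative (\<lambda>s. frechet_derivative \<eta> (at (t *\<^sub>R e)) (s *\<^sub>R e))) (at t)"
    using diff_chain_at by (fastforce simp: o_def)
  moreover have "frechet_derivative \<eta> (at (t *\<^sub>R e)) (s *\<^sub>R e) = s *\<^sub>R pd e \<eta> (t *\<^sub>R e)" for s
    using linear_frechet_derivative[OF smooth_onD[OF assms]] by (simp add: pd_def linear_scale)
  ultimately show "((\<lambda>t. \<eta> (t *\<^sub>R e)) has_vector_derivative pd e \<eta> (t *\<^sub>R e)) (at t)"
    by (simp add: has_vector_derivative_def)
  show "continuous_on UNIV (\<lambda>t. pd e \<eta> (t *\<^sub>R e))"
    by (rule continuous_on_compose2[OF smooth_on_pd_continuous[OF assms]]) (auto simp: Basis intro!: continuous_intros)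
  have "Ck_on (Suc k) UNIV \<eta>" for k using assms unfolding smooth_on_def by blast
  then show "smooth_on UNIV (pd e \<eta>)" by (simp add: smooth_on_def Basis)
qed

lemma test_function_endpoints:
  assumes "test_function \<Omega> \<eta>" "t \<notin> {a<..<b}"
  shows "\<eta> (t *\<^sub>R e) = 0"
proof (rule ccontr)
  assume "\<eta> (t *\<^sub>R e) \<noteq> 0"
  then have "t *\<^sub>R e \<in> closure {x. \<eta> x \<noteq> 0}" by (intro subsetD[OF closure_subset]) simp
  then have "t *\<^sub>R e \<in> \<Omega>" using assms(1) unfolding test_function_def by blast
  then show False using assms(2) by (simp add: \<Omega>)
qed

lemma affine_about: "\<sigma> * X + (1 - \<sigma>) * \<mu> = \<sigma> * (X - \<mu>) + \<mu>" for X \<mu> \<sigma> :: real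
  by (simp add: algebra_simps)

text \<open>Shrinking the argument towards the midpoint makes the support compact.\<close>

lemma test_function_lift:
  assumes H: "smooth_on UNIV H" "\<And>t. t \<notin> {a<..<b} \<Longrightarrow> H t = 0" and \<sigma>: "\<sigma> > 1"
  shows "test_function \<Omega> (\<lambda>x. H (\<sigma> * (x \<bullet> e) + (1 - \<sigma>) * ((a + b) / 2)))"
  unfolding test_function_def
proof (intro conjI)
  let ?\<eta> = "\<lambda>x. H (\<sigma> * (x \<bullet> e) + (1 - \<sigma>) * ((a + b) / 2))"
  let ?K = "{x. \<bar>x \<bullet> e - (a + b) / 2\<bar> \<le> (b - a) / (2 * \<sigma>)}"
  show "smooth_on UNIV ?\<eta>" by (rule smooth_on_lift[OF H(1)])
  have "x \<in> ?K" if "?\<eta> x \<noteq> 0" for x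
  proof -
    define s where "s = x \<bullet> e - (a + b) / 2"
    have "\<sigma> * (x \<bullet> e) + (1 - \<sigma>) * ((a + b) / 2) \<in> {a<..<b}" using H(2) that by blast
    moreover have "\<sigma> * (x \<bullet> e) + (1 - \<sigma>) * ((a + b) / 2) = \<sigma> * s + (a + b) / 2"
      unfolding s_def by (rule affine_about)
    ultimately have "\<bar>\<sigma> * s\<bar> \<le> (b - a) / 2" by (auto simp: abs_le_iff field_simps)
    then have "\<bar>s\<bar> \<le> (b - a) / (2 * \<sigma>)" using \<sigma> by (simp add: abs_mult field_simps)
    then show ?thesis by (simp add: s_def)
  qed
  moreover have "closed ?K" by (intro closed_Collect_le continuous_intros)
  ultimately have cl: "closure {x. ?\<eta> x \<noteq> 0} \<subseteq> ?K" by (intro closure_minimal) auto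
  have "bounded ?K" unfolding bounded_iff
  proof (intro exI[of _ "\<bar>(a + b) / 2\<bar> + (b - a) / (2 * \<sigma>)"] ballI)
    fix x assume "x \<in> ?K"
    then show "norm x \<le> \<bar>(a + b) / 2\<bar> + (b - a) / (2 * \<sigma>)" unfolding mem_Collect_eq norm_eq by linarith
  qed
  then show "compact (closure {x. ?\<eta> x \<noteq> 0})"
    using cl by (simp add: compact_eq_bounded_closed bounded_subset)
  have "(b - a) / (2 * \<sigma>) < (b - a) / 2" using \<sigma> ab by (intro divide_strict_left_mono) auto
  then have "?K \<subseteq> {x. \<bar>x \<bullet> e - (a + b) / 2\<bar> < (b - a) / 2}"
    using le_less_trans by blast
  also have "\<dots> = \<Omega>" unfolding \<Omega> by (intro Collect_cong) (auto simp: abs_less_iff field_simps)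
  finally have "?K \<subseteq> \<Omega>" .
  then show "closure {x. ?\<eta> x \<noteq> 0} \<subseteq> \<Omega>" using cl by blast
qed

text \<open>
  A smooth function that vanishes outside the interval need not have compact support in it, but its
  contractions towards the midpoint do; the claim for these passes to the limit.
\<close>

lemma weak_derivative_zero_imp_orthogonal:
  fixes w :: "real \<Rightarrow> complex"
  assumes w: "w \<in> L2 (LI a b)"
    and zero: "\<And>\<eta>. test_function \<Omega> \<eta> \<Longrightarrow> (LINT t|LI a b. pd e \<eta> (t *\<^sub>R e) *\<^sub>R w t) = 0"
    and H: "smooth_on UNIV H" "\<And>t. t \<notin> {a<..<b} \<Longrightarrow> H t = 0"
  shows "(LINT t|LI a b. pd 1 H t *\<^sub>R w t) = 0"
proof -
  define \<sigma> where "\<sigma> n = 1 + 1 / real (Suc n)" for n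
  define T where "T n t = \<sigma> n * t + (1 - \<sigma> n) * ((a + b) / 2)" for n t
  have \<sigma>: "\<sigma> n > 1" "\<sigma> n \<le> 2" for n by (auto simp: \<sigma>_def)
  have \<sigma>lim: "\<sigma> \<longlonglongrightarrow> 1"
    using tendsto_add[OF tendsto_const[of 1] LIMSEQ_inverse_real_of_nat] by (simp add: \<sigma>_def[abs_def] inverse_eq_divide)
  have cH: "continuous_on UNIV (pd 1 H)"
    using smooth_on_pd_continuous[OF H(1), of 1] by simp
  have "bounded (pd 1 H ` {a - (b - a)..b + (b - a)})"
    by (intro compact_imp_bounded compact_continuous_image continuous_on_subset[OF cH]) auto
  then obtain C where "\<forall>y\<in>pd 1 H ` {a - (b - a)..b + (b - a)}. \<bar>y\<bar> \<le> C"
    unfolding bounded_real by blast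
  then have C: "\<And>t. t \<in> {a - (b - a)..b + (b - a)} \<Longrightarrow> \<bar>pd 1 H t\<bar> \<le> C" by blast
  have zero_n: "(LINT t|LI a b. (\<sigma> n * pd 1 H (T n t)) *\<^sub>R w t) = 0" for n
    using zero[OF test_function_lift[OF H \<sigma>(1)], of n]
    unfolding pd_lift(2)[OF smooth_on_real_derivative(1)[OF H(1)]] by (simp add: T_def)
  have meas: "(\<lambda>t. (\<sigma> n * pd 1 H (T n t)) *\<^sub>R w t) \<in> borel_measurable (LI a b)" for n
  proof (rule borel_measurable_scaleR[OF _ L2_measurable[OF w]])
    show "(\<lambda>t. \<sigma> n * pd 1 H (T n t)) \<in> borel_measurable (LI a b)"
      unfolding T_def
      by (intro continuous_measurable_lebesgue_on continuous_intros continuous_on_compose2[OF cH]) auto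
  qed
  have meas': "(\<lambda>t. pd 1 H t *\<^sub>R w t) \<in> borel_measurable (LI a b)"
    by (intro borel_measurable_scaleR[OF _ L2_measurable[OF w]] continuous_measurable_lebesgue_on cH)
  have "(\<lambda>n. LINT t|LI a b. (\<sigma> n * pd 1 H (T n t)) *\<^sub>R w t) \<longlonglongrightarrow> (LINT t|LI a b. pd 1 H t *\<^sub>R w t)"
  proof (rule integral_dominated_convergence[OF meas' meas])
    show "integrable (LI a b) (\<lambda>t. 2 * C * cmod (w t))"
      using integrable_norm[OF L2_LI_integrable[OF w]] by simp
    show "AE t in LI a b. (\<lambda>n. (\<sigma> n * pd 1 H (T n t)) *\<^sub>R w t) \<longlonglongrightarrow> pd 1 H t *\<^sub>R w t"
    proof (rule AE_I2)
      fix t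
      have "(\<lambda>n. T n t) \<longlonglongrightarrow> 1 * t + (1 - 1) * ((a + b) / 2)"
        unfolding T_def by (intro tendsto_intros \<sigma>lim)
      then have "(\<lambda>n. pd 1 H (T n t)) \<longlonglongrightarrow> pd 1 H t"
        using cH by (intro isCont_tendsto_compose[of t "pd 1 H"]) (auto simp: continuous_on_eq_continuous_at)
      then have "(\<lambda>n. (\<sigma> n * pd 1 H (T n t)) *\<^sub>R w t) \<longlonglongrightarrow> (1 * pd 1 H t) *\<^sub>R w t"
        by (intro tendsto_intros \<sigma>lim)
      then show "(\<lambda>n. (\<sigma> n * pd 1 H (T n t)) *\<^sub>R w t) \<longlonglongrightarrow> pd 1 H t *\<^sub>R w t" by simp
    qed
    show "AE t in LI a b. norm ((\<sigma> n * pd 1 H (T n t)) *\<^sub>R w t) \<le> 2 * C * cmod (w t)" for n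
    proof (rule AE_I2)
      fix t assume "t \<in> space (LI a b)"
      then have t: "a < t" "t < b" by auto
      define s where "s = t - (a + b) / 2"
      have s: "\<bar>s\<bar> \<le> (b - a) / 2" using t by (auto simp: s_def abs_le_iff field_simps)
      have Ts: "T n t = \<sigma> n * s + (a + b) / 2" unfolding T_def s_def by (rule affine_about)
      have "\<bar>\<sigma> n * s\<bar> \<le> 2 * ((b - a) / 2)"
        unfolding abs_mult using \<sigma>[of n] s by (intro mult_mono) auto
      then have "T n t \<in> {a - (b - a)..b + (b - a)}" unfolding Ts using ab by (auto simp: abs_le_iff field_simps)
      then have "\<bar>pd 1 H (T n t)\<bar> \<le> C" by (rule C)
      then have "\<bar>\<sigma> n * pd 1 H (T n t)\<bar> \<le> 2 * C"
        unfolding abs_mult using \<sigma>[of n] by (intro mult_mono) auto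
      then show "norm ((\<sigma> n * pd 1 H (T n t)) *\<^sub>R w t) \<le> 2 * C * cmod (w t)"
        by (simp add: mult_right_mono)
    qed
  qed
  then show ?thesis unfolding zero_n using LIMSEQ_unique tendsto_const by blast
qed

end

lemma L2_orthogonal_to_polynomials:
  assumes f: "f \<in> L2 (LI a b)" and ab: "a \<le> b"
    and orth: "\<And>p. real_polynomial_function p \<Longrightarrow> (LINT t|LI a b. p t *\<^sub>R f t) = 0"
  shows "AE t in LI a b. f t = 0"
proof -
  let ?n = "L2_norm (LI a b) f"
  have cf: "(\<lambda>t. cnj (f t)) \<in> L2 (LI a b)"
  proof -
    have "cnj \<in> borel_measurable borel" by (intro borel_measurable_continuous_onI continuous_intros)
    from measurable_compose[OF L2_measurable[OF f] this] show ?thesis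
      using L2_integrable[OF f] by (simp add: L2_def)
  qed
  have "?n\<^sup>2 \<le> d * ?n" if d: "d > 0" for d
  proof -
    obtain q where q: "polynomial_function q" "L2_norm (LI a b) (q - (\<lambda>t. cnj (f t))) < d"
      by (rule L2_polynomial_dense[OF cf d])
    have qL: "q \<in> L2 (LI a b)"
      by (intro continuous_L2 continuous_on_polynomial q ab)
    have "real_polynomial_function (\<lambda>x. q x \<bullet> 1)" "real_polynomial_function (\<lambda>x. q x \<bullet> \<i>)"
      using q(1) by (auto simp: polynomial_function_iff_Basis_inner Basis_complex_def)
    then have re: "real_polynomial_function (\<lambda>x. Re (q x))" and im: "real_polynomial_function (\<lambda>x. Im (q x))"
      by (simp_all add: inner_complex_def)
    have i: "integrable (LI a b) (\<lambda>t. h t *\<^sub>R f t)" if "real_polynomial_function h" for h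
    proof -
      have "continuous_on {a..b} (\<lambda>t. complex_of_real (h t))"
        using that by (intro continuous_intros continuous_on_polymonial_function) (simp add: real_polynomial_function_eq)
      then have "(\<lambda>t. complex_of_real (h t)) \<in> L2 (LI a b)" using ab by (rule continuous_L2)
      from L2_Cauchy_Schwarz(1)[OF this f] show ?thesis by (simp add: scaleR_conv_of_real)
    qed
    have "(LINT t|LI a b. q t * f t) = (LINT t|LI a b. Re (q t) *\<^sub>R f t + \<i> * (Im (q t) *\<^sub>R f t))"
    proof (rule Bochner_Integration.integral_cong[OF refl])
      fix t
      have "q t * f t = (complex_of_real (Re (q t)) + \<i> * complex_of_real (Im (q t))) * f t"
        using complex_eq[of "q t"] by simp
      then show "q t * f t = Re (q t) *\<^sub>R f t + \<i> * (Im (q t) *\<^sub>R f t)"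
        by (simp add: scaleR_conv_of_real distrib_right mult.assoc)
    qed
    also have "\<dots> = 0"
      by (simp only: Bochner_Integration.integral_add[OF i[OF re] integrable_mult_right[OF i[OF im]]]
            integral_mult_right_zero orth[OF re] orth[OF im] mult_zero_right add_0_right)
    finally have q0: "(LINT t|LI a b. q t * f t) = 0" .
    have "complex_of_real (?n\<^sup>2) = (LINT t|LI a b. complex_of_real ((cmod (f t))\<^sup>2))"
      unfolding L2_norm_square by (rule integral_complex_of_real[symmetric])
    also have "\<dots> = (LINT t|LI a b. cnj (f t) * f t)"
      by (intro Bochner_Integration.integral_cong refl) (simp only: complex_norm_square mult.commute)
    also have "\<dots> = (LINT t|LI a b. cnj (f t) * f t) - (LINT t|LI a b. q t * f t)" using q0 by simp
    also have "\<dots> = (LINT t|LI a b. cnj (f t) * f t - q t * f t)"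
      using L2_Cauchy_Schwarz(1)[OF cf f] L2_Cauchy_Schwarz(1)[OF qL f]
      by (intro Bochner_Integration.integral_diff[symmetric])
    also have "\<dots> = (LINT t|LI a b. - ((q - (\<lambda>t. cnj (f t))) t * f t))"
      by (intro Bochner_Integration.integral_cong refl) (simp add: algebra_simps)
    also have "\<dots> = - (LINT t|LI a b. (q - (\<lambda>t. cnj (f t))) t * f t)" by simp
    finally have "cmod (complex_of_real (?n\<^sup>2)) = cmod (LINT t|LI a b. (q - (\<lambda>t. cnj (f t))) t * f t)"
      by (simp only: norm_minus_cancel)
    then have "?n\<^sup>2 = cmod (LINT t|LI a b. (q - (\<lambda>t. cnj (f t))) t * f t)"
      unfolding norm_of_real by simp
    also have "\<dots> \<le> L2_norm (LI a b) (q - (\<lambda>t. cnj (f t))) * ?n"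
      by (rule L2_Cauchy_Schwarz(2)[OF L2_diff[OF qL cf] f])
    also have "\<dots> \<le> d * ?n" using q(2) by (intro mult_right_mono) auto
    finally show ?thesis .
  qed
  then have half: "?n\<^sup>2 \<le> ?n / 2 * ?n" if "?n > 0" using that by (metis half_gt_zero)
  have "?n = 0"
  proof (rule ccontr)
    assume "?n \<noteq> 0"
    then have "?n > 0" using L2_norm_nonneg[of "LI a b" f] by linarith
    then show False using half by (simp add: power2_eq_square)
  qed
  then show ?thesis using f by (simp add: L2_norm_eq_0_iff)
qed

lemma x_exp_minus_le: "x * exp (- x) \<le> 1" for x :: real
proof -
  have "x \<le> exp x" using exp_ge_add_one_self[of x] by linarith
  then show ?thesis by (simp add: exp_minus field_simps)
qed

context interval_domain
begin

text \<open>
  For a polynomial \<open>P\<close> that vanishes at both ends, multiply \<open>P\<close> by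
  \<open>exp (- \<epsilon> / (t - a)) * exp (- \<epsilon> / (b - t))\<close> and let \<open>\<epsilon>\<close> tend to \<open>0\<close>.  The derivatives
  converge to \<open>P'\<close> and stay bounded, since \<open>\<bar>P t\<bar>\<close> is at most a multiple of the distance to the
  ends and \<open>x exp (- x)\<close> is bounded.
\<close>

lemma weak_derivative_zero_orthogonal_polynomial:
  fixes w :: "real \<Rightarrow> complex"
  assumes w: "w \<in> L2 (LI a b)"
    and zero: "\<And>\<eta>. test_function \<Omega> \<eta> \<Longrightarrow> (LINT t|LI a b. pd e \<eta> (t *\<^sub>R e) *\<^sub>R w t) = 0"
    and P: "real_polynomial_function P" "\<And>t. (P has_real_derivative p t) (at t)" "P a = 0" "P b = 0"
    and p: "real_polynomial_function p"
  shows "(LINT t|LI a b. p t *\<^sub>R w t) = 0"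
proof -
  have pc: "continuous_on S p" "continuous_on S P" for S
    using p P(1) continuous_on_polymonial_function by (auto simp: real_polynomial_function_eq)
  have "bounded (p ` {a..b})" by (intro compact_imp_bounded compact_continuous_image pc) auto
  then obtain L where "\<forall>y\<in>p ` {a..b}. \<bar>y\<bar> \<le> L" unfolding bounded_real by blast
  then have L: "\<bar>p t\<bar> \<le> L" if "t \<in> {a..b}" for t using that by blast
  have L0: "L \<ge> 0" using L[of a] ab by force
  have lip: "\<bar>P t - P s\<bar> \<le> L * \<bar>t - s\<bar>" if "t \<in> {a..b}" "s \<in> {a..b}" for t s
    using field_differentiable_bound[of "{a..b}" P p L t s] has_field_derivative_at_within[OF P(2)] L that by auto
  define \<epsilon> where "\<epsilon> n = 1 / real (Suc n)" for n
  have \<epsilon>: "\<epsilon> n > 0" for n by (simp add: \<epsilon>_def)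
  have \<epsilon>lim: "\<epsilon> \<longlonglongrightarrow> 0"
    using LIMSEQ_inverse_real_of_nat by (simp add: \<epsilon>_def[abs_def] inverse_eq_divide)
  define H where "H n t = flat (\<epsilon> n) 1 (t - a) *\<^sub>R (flat (\<epsilon> n) 1 (b - t) *\<^sub>R P t)" for n t
  have Hs: "smooth_on UNIV (H n)" for n
  proof -
    have "smooth_on UNIV (\<lambda>t. flat (\<epsilon> n) 1 (t - a))"
      using smooth_on_lift[where e = "1 :: real" and \<sigma> = 1 and \<tau> = "- a", OF smooth_on_flat[OF \<epsilon>]] by simp
    moreover have "smooth_on UNIV (\<lambda>t. flat (\<epsilon> n) 1 (b - t))"
      using smooth_on_lift[where e = "1 :: real" and \<sigma> = "-1" and \<tau> = b, OF smooth_on_flat[OF \<epsilon>]] by simp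
    moreover have "smooth_on UNIV P" using P(1) by (intro smooth_on_polynomial) (simp add: real_polynomial_function_eq)
    ultimately show ?thesis unfolding H_def by (intro smooth_on_scaleR)
  qed
  have Hz: "H n t = 0" if "t \<notin> {a<..<b}" for n t
    using that by (auto simp: H_def flat_def)
  define E1 E2 where "E1 n t = exp (- \<epsilon> n / (t - a))" and "E2 n t = exp (- \<epsilon> n / (b - t))" for n t
  define D where "D n t = E1 n t * E2 n t * p t + (\<epsilon> n / (t - a)\<^sup>2 * E1 n t) * E2 n t * P t
      - E1 n t * (\<epsilon> n / (b - t)\<^sup>2 * E2 n t) * P t" for n t
  have pdH: "pd 1 (H n) t = D n t" if t: "t \<in> {a<..<b}" for n t
  proof -
    have "((\<lambda>t. E1 n t * (E2 n t * P t)) has_real_derivative D n t) (at t)"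
      using t unfolding E1_def E2_def D_def
      by (auto intro!: derivative_eq_intros P(2) simp: power2_eq_square field_simps)
    then have "(H n has_real_derivative D n t) (at t)"
      by (rule has_field_derivative_transform_within_open[of _ _ _ "{a<..<b}"])
         (use t in \<open>auto simp: H_def flat_def E1_def E2_def\<close>)
    then have "(H n has_vector_derivative D n t) (at t)"
      by (simp add: has_real_derivative_iff_has_vector_derivative)
    then show ?thesis using smooth_on_real_derivative(1)[OF Hs] vector_derivative_unique_at by blast
  qed
  have bound: "\<bar>D n t\<bar> \<le> 3 * L" if t: "t \<in> {a<..<b}" for n t
  proof -
    have E: "0 \<le> E1 n t" "E1 n t \<le> 1" "0 \<le> E2 n t" "E2 n t \<le> 1"
      using t \<epsilon>[of n] by (auto simp: E1_def E2_def)
    have cancel: "A / x\<^sup>2 * E * (L * x) = A / x * E * L" if "x \<noteq> 0" for A x E :: real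
      using that by (simp add: power2_eq_square)
    have b1: "\<bar>E1 n t * E2 n t * p t\<bar> \<le> (1 * 1) * L"
      unfolding abs_mult using E L[of t] t by (intro mult_mono) auto
    have b2: "\<bar>(\<epsilon> n / (t - a)\<^sup>2 * E1 n t) * E2 n t * P t\<bar> \<le> L"
    proof -
      have "\<bar>P t\<bar> \<le> L * (t - a)" using lip[of t a] P(3) t by auto
      then have "\<bar>(\<epsilon> n / (t - a)\<^sup>2 * E1 n t) * E2 n t * P t\<bar> \<le> (\<epsilon> n / (t - a)\<^sup>2 * E1 n t) * 1 * (L * (t - a))"
        unfolding abs_mult using E \<epsilon>[of n] t by (intro mult_mono) (auto simp: abs_mult)
      also have "\<dots> = (\<epsilon> n / (t - a) * exp (- (\<epsilon> n / (t - a)))) * L"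
        using cancel[of "t - a"] t by (simp add: E1_def)
      also have "\<dots> \<le> 1 * L" using L0 by (intro mult_right_mono x_exp_minus_le)
      finally show ?thesis by simp
    qed
    have b3: "\<bar>E1 n t * (\<epsilon> n / (b - t)\<^sup>2 * E2 n t) * P t\<bar> \<le> L"
    proof -
      have "\<bar>P t\<bar> \<le> L * (b - t)" using lip[of t b] P(4) t by auto
      then have "\<bar>E1 n t * (\<epsilon> n / (b - t)\<^sup>2 * E2 n t) * P t\<bar> \<le> 1 * (\<epsilon> n / (b - t)\<^sup>2 * E2 n t) * (L * (b - t))"
        unfolding abs_mult using E \<epsilon>[of n] t by (intro mult_mono) (auto simp: abs_mult)
      also have "\<dots> = (\<epsilon> n / (b - t) * exp (- (\<epsilon> n / (b - t)))) * L"
        using cancel[of "b - t"] t by (simp add: E2_def)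
      also have "\<dots> \<le> 1 * L" using L0 by (intro mult_right_mono x_exp_minus_le)
      finally show ?thesis by simp
    qed
    have "\<bar>x + y - z\<bar> \<le> 3 * L" if "\<bar>x\<bar> \<le> (1 * 1) * L" "\<bar>y\<bar> \<le> L" "\<bar>z\<bar> \<le> L" for x y z
      using that by simp
    from this[OF b1 b2 b3] show ?thesis unfolding D_def .
  qed
  have lim: "(\<lambda>n. D n t) \<longlonglongrightarrow> p t" if t: "t \<in> {a<..<b}" for t
  proof -
    have "(\<lambda>n. D n t) \<longlonglongrightarrow> exp (- 0 / (t - a)) * exp (- 0 / (b - t)) * p t
        + (0 / (t - a)\<^sup>2 * exp (- 0 / (t - a))) * exp (- 0 / (b - t)) * P t
        - exp (- 0 / (t - a)) * (0 / (b - t)\<^sup>2 * exp (- 0 / (b - t))) * P t"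
      unfolding D_def E1_def E2_def using t by (intro tendsto_intros \<epsilon>lim) auto
    then show ?thesis by simp
  qed
  have "(\<lambda>n. LINT t|LI a b. pd 1 (H n) t *\<^sub>R w t) \<longlonglongrightarrow> (LINT t|LI a b. p t *\<^sub>R w t)"
  proof (rule integral_dominated_convergence)
    show "(\<lambda>t. p t *\<^sub>R w t) \<in> borel_measurable (LI a b)"
      by (intro borel_measurable_scaleR[OF _ L2_measurable[OF w]] continuous_measurable_lebesgue_on pc)
    show "(\<lambda>t. pd 1 (H n) t *\<^sub>R w t) \<in> borel_measurable (LI a b)" for n
      by (intro borel_measurable_scaleR[OF _ L2_measurable[OF w]] continuous_measurable_lebesgue_on
            smooth_on_pd_continuous[OF Hs]) simp
    show "integrable (LI a b) (\<lambda>t. 3 * L * cmod (w t))"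
      using integrable_norm[OF L2_LI_integrable[OF w]] by simp
    show "AE t in LI a b. (\<lambda>n. pd 1 (H n) t *\<^sub>R w t) \<longlonglongrightarrow> p t *\<^sub>R w t"
      by (rule AE_I2) (use lim pdH in \<open>auto intro!: tendsto_intros\<close>)
    show "AE t in LI a b. norm (pd 1 (H n) t *\<^sub>R w t) \<le> 3 * L * cmod (w t)" for n
    proof (rule AE_I2)
      fix t assume "t \<in> space (LI a b)"
      then have "t \<in> {a<..<b}" by simp
      then show "norm (pd 1 (H n) t *\<^sub>R w t) \<le> 3 * L * cmod (w t)"
        using bound[of t n] pdH[of t n] by (simp add: mult_right_mono)
    qed
  qed
  moreover have "(LINT t|LI a b. pd 1 (H n) t *\<^sub>R w t) = 0" for n
    by (rule weak_derivative_zero_imp_orthogonal[OF w zero Hs Hz])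
  ultimately show ?thesis by (simp add: LIMSEQ_const_iff)
qed

text \<open>
  A polynomial with mean \<open>0\<close> has a primitive that vanishes at both ends.  Hence \<open>w\<close> minus its mean is
  orthogonal to all polynomials.
\<close>

lemma weak_derivative_zero_imp_const:
  fixes w :: "real \<Rightarrow> complex"
  assumes w: "w \<in> L2 (LI a b)"
    and zero: "\<And>\<eta>. test_function \<Omega> \<eta> \<Longrightarrow> (LINT t|LI a b. pd e \<eta> (t *\<^sub>R e) *\<^sub>R w t) = 0"
  obtains c where "AE t in LI a b. w t = c"
proof -
  interpret finite_measure "LI a b" by (rule finite_measure_LI)
  define c where "c = (LINT t|LI a b. w t) / of_real (b - a)"
  have cL: "(\<lambda>t. c) \<in> L2 (LI a b)" by (simp add: L2_def)
  have "AE t in LI a b. (w - (\<lambda>t. c)) t = 0"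
  proof (rule L2_orthogonal_to_polynomials[OF L2_diff[OF w cL] less_imp_le[OF ab]])
    fix p :: "real \<Rightarrow> real" assume p: "real_polynomial_function p"
    obtain P0 where P0: "real_polynomial_function P0" "\<And>t. (P0 has_real_derivative p t) (at t)"
      using real_polynomial_antiderivative[OF p] by blast
    define \<mu> where "\<mu> = (P0 b - P0 a) / (b - a)"
    define P where "P t = P0 t - P0 a - (t - a) * \<mu>" for t
    have pc: "continuous_on S p" for S
      using p continuous_on_polymonial_function by (auto simp: real_polynomial_function_eq)
    have iw: "integrable (LI a b) w" by (rule L2_LI_integrable[OF w])
    have ip: "integrable (LI a b) (\<lambda>t. p t *\<^sub>R w t)"
    proof -
      have "(\<lambda>t. complex_of_real (p t)) \<in> L2 (LI a b)"
        using ab by (intro continuous_L2 continuous_intros pc) auto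
      from L2_Cauchy_Schwarz(1)[OF this w] show ?thesis by (simp add: scaleR_conv_of_real)
    qed
    have "(LINT t|LI a b. (p t - \<mu>) *\<^sub>R w t) = 0"
    proof (rule weak_derivative_zero_orthogonal_polynomial[OF w zero])
      show "real_polynomial_function P" unfolding P_def
        by (intro real_polynomial_function_diff P0 real_polynomial_function.intros bounded_linear_ident)
      show "real_polynomial_function (\<lambda>t. p t - \<mu>)"
        by (intro real_polynomial_function_diff p real_polynomial_function.intros)
      show "(P has_real_derivative p t - \<mu>) (at t)" for t
        unfolding P_def by (auto intro!: derivative_eq_intros P0)
      show "P a = 0" "P b = 0" using ab by (auto simp: P_def \<mu>_def)
    qed
    then have 1: "(LINT t|LI a b. p t *\<^sub>R w t) = \<mu> *\<^sub>R (LINT t|LI a b. w t)"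
      using ip iw by (simp add: scaleR_diff_left)
    have "primitive_on a b (\<lambda>t. complex_of_real (P0 t)) (\<lambda>t. complex_of_real (p t))"
    proof (rule primitive_on_C1)
      show "((\<lambda>t. complex_of_real (P0 t)) has_vector_derivative complex_of_real (p t)) (at t within {a..b})" for t
        by (rule has_vector_derivative_of_real[OF has_field_derivative_at_within[OF P0(2)]])
    qed (use ab in \<open>auto intro!: continuous_intros pc\<close>)
    from primitive_on_eq[OF this, of b] ab
    have "complex_of_real (P0 b - P0 a) = (LINT t|LI a b. indicator {a..b} t *\<^sub>R complex_of_real (p t))" by simp
    also have "\<dots> = (LINT t|LI a b. complex_of_real (p t))"
      by (intro Bochner_Integration.integral_cong) (auto simp: indicator_def)
    finally have 2: "(LINT t|LI a b. complex_of_real (p t)) = complex_of_real (P0 b - P0 a)" by simp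
    have ic: "integrable (LI a b) (\<lambda>t. complex_of_real (p t))"
      using ab by (intro L2_LI_integrable continuous_L2 continuous_intros pc) auto
    have "(LINT t|LI a b. p t *\<^sub>R (w - (\<lambda>t. c)) t) = (LINT t|LI a b. p t *\<^sub>R w t - complex_of_real (p t) * c)"
      by (intro Bochner_Integration.integral_cong refl) (simp add: scaleR_conv_of_real right_diff_distrib)
    also have "\<dots> = (LINT t|LI a b. p t *\<^sub>R w t) - (LINT t|LI a b. complex_of_real (p t)) * c"
      using ip ic by simp
    also have "\<dots> = 0" unfolding 1 2 c_def \<mu>_def using ab by (simp add: scaleR_conv_of_real)
    finally show "(LINT t|LI a b. p t *\<^sub>R (w - (\<lambda>t. c)) t) = 0" .
  qed
  then have "AE t in LI a b. w t = c" by eventually_elim simp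
  then show thesis by (rule that)
qed

text \<open>
  Integration by parts: the product of a primitive with a test function is again a primitive, and it
  vanishes at both ends.
\<close>

lemma primitive_imp_has_weak_pd:
  assumes u: "u \<in> borel_measurable M" "AE t in LI a b. u (t *\<^sub>R e) = U t"
    and U: "primitive_on a b U (\<lambda>t. g (t *\<^sub>R e))"
  shows "has_weak_pd \<Omega> e u g"
proof -
  let ?g = "\<lambda>t. g (t *\<^sub>R e)"
  have g: "g \<in> L2 M" using primitive_onD[OF U] by (simp add: L2_M_iff[of g])
  have UL: "U \<in> L2 (LI a b)" using primitive_on_L2[OF U] ab by simp
  have "(LINT x|M. pd e \<eta> x *\<^sub>R u x) = - (LINT x|M. \<eta> x *\<^sub>R g x)" if \<eta>: "test_function \<Omega> \<eta>" for \<eta>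
  proof -
    note s = smooth_embed_derivative[OF test_function_smooth[OF \<eta>]]
    have c\<eta>: "continuous_on UNIV (\<lambda>t. \<eta> (t *\<^sub>R e))"
      using s(1) by (auto intro!: continuous_at_imp_continuous_on has_vector_derivative_continuous)
    have "primitive_on a b (\<lambda>t. complex_of_real (\<eta> (t *\<^sub>R e)) * U t)
        (\<lambda>t. complex_of_real (\<eta> (t *\<^sub>R e)) * ?g t + complex_of_real (pd e \<eta> (t *\<^sub>R e)) * U t)"
    proof (rule primitive_on_mult_C1[where G = "\<lambda>t. complex_of_real (\<eta> (t *\<^sub>R e))"
          and g = "\<lambda>t. complex_of_real (pd e \<eta> (t *\<^sub>R e))", OF U])
      show "((\<lambda>t. complex_of_real (\<eta> (t *\<^sub>R e))) has_vector_derivative complex_of_real (pd e \<eta> (t *\<^sub>R e))) (at t within {a..b})" for t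
        by (rule has_vector_derivative_of_real[OF has_field_derivative_at_within])
          (use s(1) in \<open>simp add: has_real_derivative_iff_has_vector_derivative\<close>)
      show "continuous_on {a..b} (\<lambda>t. complex_of_real (pd e \<eta> (t *\<^sub>R e)))"
        by (intro continuous_intros continuous_on_subset[OF s(2)]) auto
    qed (use ab in simp)
    from primitive_on_eq[OF this, of b] ab test_function_endpoints[OF \<eta>, of a] test_function_endpoints[OF \<eta>, of b]
    have "0 = (LINT t|LI a b. indicator {a..b} t *\<^sub>R (complex_of_real (\<eta> (t *\<^sub>R e)) * ?g t + complex_of_real (pd e \<eta> (t *\<^sub>R e)) * U t))"
      by simp
    also have "\<dots> = (LINT t|LI a b. \<eta> (t *\<^sub>R e) *\<^sub>R ?g t + pd e \<eta> (t *\<^sub>R e) *\<^sub>R U t)"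
      by (intro Bochner_Integration.integral_cong) (auto simp: indicator_def scaleR_conv_of_real)
    also have "\<dots> = (LINT t|LI a b. \<eta> (t *\<^sub>R e) *\<^sub>R ?g t) + (LINT t|LI a b. pd e \<eta> (t *\<^sub>R e) *\<^sub>R U t)"
    proof (rule Bochner_Integration.integral_add)
      have "(\<lambda>t. complex_of_real (\<eta> (t *\<^sub>R e))) \<in> L2 (LI a b)"
        using ab by (intro continuous_L2 continuous_intros continuous_on_subset[OF c\<eta>]) auto
      from L2_Cauchy_Schwarz(1)[OF this primitive_onD[OF U]]
      show "integrable (LI a b) (\<lambda>t. \<eta> (t *\<^sub>R e) *\<^sub>R ?g t)" by (simp add: scaleR_conv_of_real)
      have "(\<lambda>t. complex_of_real (pd e \<eta> (t *\<^sub>R e))) \<in> L2 (LI a b)"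
        using ab by (intro continuous_L2 continuous_intros continuous_on_subset[OF s(2)]) auto
      from L2_Cauchy_Schwarz(1)[OF this UL]
      show "integrable (LI a b) (\<lambda>t. pd e \<eta> (t *\<^sub>R e) *\<^sub>R U t)" by (simp add: scaleR_conv_of_real)
    qed
    also have "(LINT t|LI a b. pd e \<eta> (t *\<^sub>R e) *\<^sub>R U t) = (LINT t|LI a b. pd e \<eta> (t *\<^sub>R e) *\<^sub>R u (t *\<^sub>R e))"
    proof (rule integral_cong_AE)
      have m: "(\<lambda>t. pd e \<eta> (t *\<^sub>R e)) \<in> borel_measurable (LI a b)"
        by (rule continuous_measurable_lebesgue_on[OF s(2)])
      show "(\<lambda>t. pd e \<eta> (t *\<^sub>R e) *\<^sub>R U t) \<in> borel_measurable (LI a b)"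
        by (rule borel_measurable_scaleR[OF m L2_measurable[OF UL]])
      show "(\<lambda>t. pd e \<eta> (t *\<^sub>R e) *\<^sub>R u (t *\<^sub>R e)) \<in> borel_measurable (LI a b)"
        using u(1) by (intro borel_measurable_scaleR[OF m]) (simp add: measurable_M_iff[of u])
      show "AE t in LI a b. pd e \<eta> (t *\<^sub>R e) *\<^sub>R U t = pd e \<eta> (t *\<^sub>R e) *\<^sub>R u (t *\<^sub>R e)"
        using u(2) by eventually_elim simp
    qed
    also have "\<dots> = (LINT x|M. pd e \<eta> x *\<^sub>R u x)"
      by (rule integral_M[symmetric, OF borel_measurable_scaleR[OF continuous_measurable_lebesgue_on u(1)]])
        (rule smooth_on_pd_continuous[OF test_function_smooth[OF \<eta>]], simp add: Basis)
    also have "(LINT t|LI a b. \<eta> (t *\<^sub>R e) *\<^sub>R ?g t) = (LINT x|M. \<eta> x *\<^sub>R g x)"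
    proof (intro integral_M[symmetric] borel_measurable_scaleR L2_measurable[OF g] continuous_measurable_lebesgue_on)
      show "continuous_on UNIV \<eta>"
        using smooth_onD[OF test_function_smooth[OF \<eta>]]
        by (auto intro!: continuous_at_imp_continuous_on differentiable_imp_continuous_within)
    qed
    finally show ?thesis by (metis add_eq_0_iff)
  qed
  then show ?thesis using g by (simp add: has_weak_pd_def)
qed

text \<open>
  The difference between \<open>u\<close> and any primitive of \<open>g\<close> has weak derivative \<open>0\<close>, hence is constant.
\<close>

lemma has_weak_pd_imp_primitive:
  assumes u: "u \<in> L2 M" and g: "has_weak_pd \<Omega> e u g"
  obtains U where "primitive_on a b U (\<lambda>t. g (t *\<^sub>R e))" "AE t in LI a b. u (t *\<^sub>R e) = U t"
proof -
  have gL: "(\<lambda>t. g (t *\<^sub>R e)) \<in> L2 (LI a b)" using has_weak_pdD[OF g] by (simp add: L2_M_iff[of g])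
  have uL: "(\<lambda>t. u (t *\<^sub>R e)) \<in> L2 (LI a b)" using u by (simp add: L2_M_iff[of u])
  obtain V where V: "primitive_on a b V (\<lambda>t. g (t *\<^sub>R e))"
    using primitive_on_exists[OF gL, of 0] ab by auto
  have VL: "V \<in> L2 (LI a b)" using primitive_on_L2[OF V] ab by simp
  define v where "v x = V (x \<bullet> e)" for x
  have vm: "v \<in> borel_measurable M" using L2_measurable[OF VL] by (simp add: measurable_M_iff[of v] v_def)
  have vg: "has_weak_pd \<Omega> e v g"
    by (rule primitive_imp_has_weak_pd[OF vm _ V]) (simp add: v_def)
  define w where "w t = u (t *\<^sub>R e) - V t" for t
  have wL: "w \<in> L2 (LI a b)" using L2_diff[OF uL VL] by (simp add: w_def[abs_def] fun_diff_def)
  have "(LINT t|LI a b. pd e \<eta> (t *\<^sub>R e) *\<^sub>R w t) = 0" if \<eta>: "test_function \<Omega> \<eta>" for \<eta>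
  proof -
    note s = smooth_embed_derivative[OF test_function_smooth[OF \<eta>]]
    have "(\<lambda>t. complex_of_real (pd e \<eta> (t *\<^sub>R e))) \<in> L2 (LI a b)"
      using ab by (intro continuous_L2 continuous_intros continuous_on_subset[OF s(2)]) auto
    from L2_Cauchy_Schwarz(1)[OF this uL] L2_Cauchy_Schwarz(1)[OF this VL]
    have i: "integrable (LI a b) (\<lambda>t. pd e \<eta> (t *\<^sub>R e) *\<^sub>R u (t *\<^sub>R e))" "integrable (LI a b) (\<lambda>t. pd e \<eta> (t *\<^sub>R e) *\<^sub>R V t)"
      by (simp_all add: scaleR_conv_of_real)
    have m: "(\<lambda>x. pd e \<eta> x *\<^sub>R h x) \<in> borel_measurable M" if "h \<in> borel_measurable M" for h :: "'a \<Rightarrow> complex"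
      by (rule borel_measurable_scaleR[OF continuous_measurable_lebesgue_on that])
        (rule smooth_on_pd_continuous[OF test_function_smooth[OF \<eta>]], simp add: Basis)
    have "(LINT x|M. pd e \<eta> x *\<^sub>R u x) = (LINT x|M. pd e \<eta> x *\<^sub>R v x)"
      using g vg \<eta> by (simp add: has_weak_pd_def)
    then have "(LINT t|LI a b. pd e \<eta> (t *\<^sub>R e) *\<^sub>R u (t *\<^sub>R e)) = (LINT t|LI a b. pd e \<eta> (t *\<^sub>R e) *\<^sub>R V t)"
      unfolding integral_M[OF m[OF L2_measurable[OF u]]] integral_M[OF m[OF vm]] by (simp add: v_def)
    then show ?thesis using i by (simp add: w_def scaleR_diff_right)
  qed
  then obtain c where c: "AE t in LI a b. w t = c" using weak_derivative_zero_imp_const[OF wL] by blast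
  have "primitive_on a b (\<lambda>t. V t + c) (\<lambda>t. g (t *\<^sub>R e) + 0)"
    by (rule primitive_on_add[OF V primitive_on_const])
  moreover have "AE t in LI a b. u (t *\<^sub>R e) = V t + c"
    using c by eventually_elim (simp add: w_def algebra_simps)
  ultimately show thesis using that by simp
qed

end

text \<open>
  Integration by parts against \<open>(t - a) (b - t) p(t)\<close> shows that \<open>(t - a) (b - t) f(t)\<close> is orthogonal to
  every polynomial \<open>p\<close>.
\<close>

lemma primitive_on_zero:
  assumes F: "primitive_on a b F f" and ab: "a < b" and zero: "AE t in LI a b. F t = 0"
  shows "AE t in LI a b. f t = 0" and "t \<in> {a..b} \<Longrightarrow> F t = 0"
proof -
  have ab': "a \<le> b" using ab by simp
  have f: "f \<in> L2 (LI a b)" using F by (rule primitive_onD)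
  define m where "m t = complex_of_real ((t - a) * (b - t))" for t
  have mc: "continuous_on S m" for S unfolding m_def by (intro continuous_intros)
  have mf: "(\<lambda>t. m t * f t) \<in> L2 (LI a b)"
  proof -
    have "bounded (m ` {a..b})" by (intro compact_imp_bounded compact_continuous_image mc) auto
    then obtain C where C: "\<And>t. t \<in> {a..b} \<Longrightarrow> cmod (m t) \<le> C" unfolding bounded_pos by blast
    show ?thesis by (rule L2_norm_mult_continuous_le(1)[OF f mc C])
  qed
  have "AE t in LI a b. m t * f t = 0"
  proof (rule L2_orthogonal_to_polynomials[OF mf ab'])
    fix p :: "real \<Rightarrow> real" assume p: "real_polynomial_function p"
    define P where "P t = complex_of_real ((t - a) * (b - t) * p t)" for t
    have "real_polynomial_function (\<lambda>t. (t - a) * (b - t) * p t)"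
      by (intro real_polynomial_function.intros real_polynomial_function_diff p bounded_linear_ident)
    then obtain q where q: "real_polynomial_function q"
      "\<And>t. ((\<lambda>t. (t - a) * (b - t) * p t) has_real_derivative q t) (at t)"
      using has_real_derivative_polynomial_function by blast
    have qc: "continuous_on S q" for S
      using q(1) continuous_on_polymonial_function by (auto simp: real_polynomial_function_eq)
    have prim: "primitive_on a b (\<lambda>t. P t * F t) (\<lambda>t. P t * f t + complex_of_real (q t) * F t)"
    proof (rule primitive_on_mult_C1[OF F ab'])
      show "(P has_vector_derivative complex_of_real (q t)) (at t within {a..b})" for t
        unfolding P_def by (rule has_vector_derivative_of_real[OF has_field_derivative_at_within[OF q(2)]])
      show "continuous_on {a..b} (\<lambda>t. complex_of_real (q t))" by (intro continuous_intros qc)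
    qed
    have "P a = 0" "P b = 0" by (auto simp: P_def)
    then have "0 = (LINT t|LI a b. indicator {a..b} t *\<^sub>R (P t * f t + complex_of_real (q t) * F t))"
      using primitive_on_eq[OF prim, of b] ab' by simp
    also have "\<dots> = (LINT t|LI a b. p t *\<^sub>R (m t * f t))"
    proof (rule integral_cong_AE)
      show "(\<lambda>t. indicator {a..b} t *\<^sub>R (P t * f t + complex_of_real (q t) * F t)) \<in> borel_measurable (LI a b)"
        using integrable_indicator_interval[OF primitive_onD[OF prim]] by (rule borel_measurable_integrable)
      show "(\<lambda>t. p t *\<^sub>R (m t * f t)) \<in> borel_measurable (LI a b)"
        using p continuous_on_polymonial_function
        by (intro borel_measurable_scaleR[OF continuous_measurable_lebesgue_on L2_measurable[OF mf]])
           (auto simp: real_polynomial_function_eq)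
      have "AE t in LI a b. t \<in> {a<..<b}" by (rule AE_I2) simp
      with zero show "AE t in LI a b. indicator {a..b} t *\<^sub>R (P t * f t + complex_of_real (q t) * F t) = p t *\<^sub>R (m t * f t)"
        by eventually_elim (simp add: P_def m_def scaleR_conv_of_real)
    qed
    finally show "(LINT t|LI a b. p t *\<^sub>R (m t * f t)) = 0" by simp
  qed
  moreover have "AE t in LI a b. t \<in> {a<..<b}" by (rule AE_I2) simp
  ultimately show f0: "AE t in LI a b. f t = 0"
    by eventually_elim (auto simp: m_def)
  have "L2_norm (LI a b) f = 0" using f f0 by (simp add: L2_norm_eq_0_iff)
  moreover have "L2_norm (LI a b) F = 0" using primitive_on_L2[OF F ab'] zero by (simp add: L2_norm_eq_0_iff)
  ultimately show "F t = 0" if "t \<in> {a..b}"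
    using primitive_on_sup_le[OF F ab that] by simp
qed

context interval_domain
begin

lemma ab': "a \<le> b" using ab by simp

text \<open>
  The elements of \<open>H\<^sup>1\<close> are the functions equal almost everywhere to an absolutely continuous
  function \<open>U\<close> with square integrable derivative \<open>g\<close>; the values of \<open>U\<close> at the end points are the trace.
\<close>

definition represented :: "('a \<Rightarrow> complex) \<Rightarrow> (real \<Rightarrow> complex) \<Rightarrow> (real \<Rightarrow> complex) \<Rightarrow> bool"
  where "represented u U g \<longleftrightarrow> u \<in> borel_measurable M \<and> primitive_on a b U g \<and> (AE t in LI a b. u (t *\<^sub>R e) = U t)"

lemma represented_unique:
  assumes "represented u U g" "represented u V h"
  shows "t \<in> {a..b} \<Longrightarrow> U t = V t" and "AE t in LI a b. g t = h t"
proof -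
  have p: "primitive_on a b (\<lambda>t. U t - V t) (\<lambda>t. g t - h t)"
    using assms by (intro primitive_on_minus) (auto simp: represented_def)
  have "AE t in LI a b. u (t *\<^sub>R e) = U t" "AE t in LI a b. u (t *\<^sub>R e) = V t"
    using assms by (auto simp: represented_def)
  then have z: "AE t in LI a b. U t - V t = 0" by eventually_elim simp
  show "t \<in> {a..b} \<Longrightarrow> U t = V t" using primitive_on_zero(2)[OF p ab z] by simp
  show "AE t in LI a b. g t = h t" using primitive_on_zero(1)[OF p ab z] by simp
qed

lemma represented_lift:
  assumes "primitive_on a b U g"
  shows "represented (\<lambda>x. U (x \<bullet> e)) U g"
  using assms L2_measurable[OF primitive_on_L2[OF assms ab']]
  by (simp add: represented_def measurable_M_iff[of "\<lambda>x. U (x \<bullet> e)"])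

lemma represented_diff:
  assumes "represented u U g" "represented v V h"
  shows "represented (u - v) (\<lambda>t. U t - V t) (\<lambda>t. g t - h t)"
proof -
  have "AE t in LI a b. u (t *\<^sub>R e) = U t" "AE t in LI a b. v (t *\<^sub>R e) = V t"
    using assms by (auto simp: represented_def)
  then have "AE t in LI a b. (u - v) (t *\<^sub>R e) = U t - V t" by eventually_elim simp
  moreover have "u - v \<in> borel_measurable M"
    using assms unfolding represented_def fun_diff_def by (intro borel_measurable_diff) auto
  ultimately show ?thesis using assms primitive_on_minus unfolding represented_def by blast
qed

lemma represented_scale:
  assumes "represented u U g"
  shows "represented (\<lambda>x. z * u x) (\<lambda>t. z * U t) (\<lambda>t. z * g t)"
proof -
  have "AE t in LI a b. u (t *\<^sub>R e) = U t" using assms by (auto simp: represented_def)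
  then have "AE t in LI a b. z * u (t *\<^sub>R e) = z * U t" by eventually_elim simp
  moreover have "(\<lambda>x. z * u x) \<in> borel_measurable M"
    using assms unfolding represented_def by (intro borel_measurable_times) auto
  ultimately show ?thesis using assms primitive_on_scale unfolding represented_def by blast
qed

lemma H1_represented:
  assumes "u \<in> H1 \<Omega>"
  obtains U where "represented u U (\<lambda>t. weak_pd \<Omega> e u (t *\<^sub>R e))"
proof -
  have g: "has_weak_pd \<Omega> e u (weak_pd \<Omega> e u)" using assms by (rule H1_has_weak_pd) (simp add: Basis)
  obtain U where "primitive_on a b U (\<lambda>t. weak_pd \<Omega> e u (t *\<^sub>R e))" "AE t in LI a b. u (t *\<^sub>R e) = U t"
    by (rule has_weak_pd_imp_primitive[OF H1_L2[OF assms] g])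
  then show thesis using that L2_measurable[OF H1_L2[OF assms]] by (auto simp: represented_def)
qed

lemma represented_L2:
  assumes "represented u U g"
  shows "u \<in> L2 M"
proof -
  have "(\<lambda>t. u (t *\<^sub>R e)) \<in> L2 (LI a b)"
  proof (rule L2_cong_AE)
    show "U \<in> L2 (LI a b)" using assms by (auto simp: represented_def intro: primitive_on_L2[OF _ ab'])
    show "(\<lambda>t. u (t *\<^sub>R e)) \<in> borel_measurable (LI a b)"
      using assms by (simp add: represented_def measurable_M_iff[of u])
    have "AE t in LI a b. u (t *\<^sub>R e) = U t" using assms by (simp add: represented_def)
    then show "AE t in LI a b. U t = u (t *\<^sub>R e)" by eventually_elim simp
  qed
  then show ?thesis by (simp add: L2_M_iff[of u])
qed

lemma represented_has_weak_pd:
  assumes "represented u U g"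
  shows "has_weak_pd \<Omega> e u (\<lambda>x. g (x \<bullet> e))"
  using assms by (intro primitive_imp_has_weak_pd[of u U]) (auto simp: represented_def)

lemma represented_H1: "represented u U g \<Longrightarrow> u \<in> H1 \<Omega>"
  using represented_L2[of u U g] represented_has_weak_pd[of u U g] unfolding H1_def Basis by blast

lemma represented_weak_pd:
  assumes r: "represented u U g"
  shows "AE t in LI a b. weak_pd \<Omega> e u (t *\<^sub>R e) = g t"
proof -
  obtain V where "represented u V (\<lambda>t. weak_pd \<Omega> e u (t *\<^sub>R e))" by (rule H1_represented[OF represented_H1[OF r]])
  then show ?thesis using represented_unique(2)[OF _ r] by blast
qed

lemma weak_pd_measurable: "u \<in> H1 \<Omega> \<Longrightarrow> weak_pd \<Omega> e u \<in> borel_measurable M"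
  using H1_has_weak_pd[of u \<Omega> e] by (auto simp: Basis dest: has_weak_pdD L2_measurable)

lemma represented_norms:
  assumes r: "represented u U g"
  shows "L2_norm M u = L2_norm (LI a b) U" "L2_norm M (weak_pd \<Omega> e u) = L2_norm (LI a b) g"
proof -
  have p: "primitive_on a b U g" and um: "u \<in> borel_measurable M" and ae: "AE t in LI a b. u (t *\<^sub>R e) = U t"
    using r by (auto simp: represented_def)
  have um': "(\<lambda>t. u (t *\<^sub>R e)) \<in> borel_measurable (LI a b)" using um by (simp add: measurable_M_iff[of u])
  show "L2_norm M u = L2_norm (LI a b) U"
    unfolding L2_norm_M[OF um] by (rule L2_norm_cong_AE[OF um' L2_measurable[OF primitive_on_L2[OF p ab']] ae])
  have wm: "weak_pd \<Omega> e u \<in> borel_measurable M" by (rule weak_pd_measurable[OF represented_H1[OF r]])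
  have wm': "(\<lambda>t. weak_pd \<Omega> e u (t *\<^sub>R e)) \<in> borel_measurable (LI a b)"
    using wm by (simp add: measurable_M_iff[of "weak_pd \<Omega> e u"])
  show "L2_norm M (weak_pd \<Omega> e u) = L2_norm (LI a b) g"
    unfolding L2_norm_M[OF wm] by (rule L2_norm_cong_AE[OF wm' L2_measurable[OF primitive_onD[OF p]] represented_weak_pd[OF r]])
qed

lemma represented_H1_norm:
  assumes "represented u U g"
  shows "H1_norm \<Omega> u = sqrt ((L2_norm (LI a b) U)\<^sup>2 + (L2_norm (LI a b) g)\<^sup>2)"
  unfolding H1_norm_def by (simp add: Basis represented_norms[OF assms])

lemma represented_H1_norm_le:
  assumes "represented u U g"
  shows "H1_norm \<Omega> u \<le> L2_norm (LI a b) U + L2_norm (LI a b) g"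
  unfolding represented_H1_norm[OF assms] by (rule sqrt_sum_squares_le_sum) auto

lemma represented_norm_le:
  assumes "represented u U g"
  shows "L2_norm (LI a b) U \<le> H1_norm \<Omega> u" "L2_norm (LI a b) g \<le> H1_norm \<Omega> u"
  unfolding represented_H1_norm[OF assms] by (auto intro: real_le_rsqrt)

definition K where "K = 1 / sqrt (b - a) + sqrt (b - a)"

lemma K_pos: "K > 0" using ab by (simp add: K_def add_pos_pos)

lemma primitive_on_le_K:
  assumes "primitive_on a b F f" "t \<in> {a..b}"
  shows "cmod (F t) \<le> K * (L2_norm (LI a b) F + L2_norm (LI a b) f)"
proof -
  have s: "sqrt (b - a) > 0" using ab by simp
  have "cmod (F t) \<le> 1 / sqrt (b - a) * L2_norm (LI a b) F + sqrt (b - a) * L2_norm (LI a b) f"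
    using primitive_on_sup_le[OF assms(1) ab assms(2)] by simp
  also have "\<dots> \<le> K * L2_norm (LI a b) F + K * L2_norm (LI a b) f"
    using s unfolding K_def by (intro add_mono mult_right_mono) auto
  finally show ?thesis by (simp add: distrib_left)
qed

lemma represented_le_H1_norm:
  assumes r: "represented u U g" and t: "t \<in> {a..b}"
  shows "cmod (U t) \<le> 2 * K * H1_norm \<Omega> u"
proof -
  have "cmod (U t) \<le> K * (L2_norm (LI a b) U + L2_norm (LI a b) g)"
    using r t by (intro primitive_on_le_K) (auto simp: represented_def)
  also have "\<dots> \<le> K * (H1_norm \<Omega> u + H1_norm \<Omega> u)"
    using K_pos represented_norm_le[OF r] by (intro mult_left_mono add_mono) auto
  finally show ?thesis by simp
qed

lemma smooth_primitive_on:
  assumes w: "smooth_on UNIV (w :: 'a \<Rightarrow> complex)"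
  shows "primitive_on a b (\<lambda>t. w (t *\<^sub>R e)) (\<lambda>t. pd e w (t *\<^sub>R e))"
  using smooth_embed_derivative(1,2)[OF w] ab'
  by (intro primitive_on_C1) (auto intro: has_vector_derivative_at_within continuous_on_subset)

lemma smooth_represented:
  assumes w: "smooth_on UNIV (w :: 'a \<Rightarrow> complex)"
  shows "represented w (\<lambda>t. w (t *\<^sub>R e)) (\<lambda>t. pd e w (t *\<^sub>R e))"
  using represented_lift[OF smooth_primitive_on[OF w]] by simp

lemma polynomial_lift:
  fixes P p :: "real \<Rightarrow> complex"
  assumes P: "polynomial_function P" "\<And>t. (P has_vector_derivative p t) (at t)"
  shows "smooth_on UNIV (\<lambda>x. P (x \<bullet> e))" "pd e (\<lambda>x. P (x \<bullet> e)) = (\<lambda>x. p (x \<bullet> e))"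
  using smooth_on_lift[OF smooth_on_polynomial[OF P(1)], of 1 e 0] pd_lift(2)[OF P(2), of e 1 e 0] by simp_all

subsection \<open>The boundary of an interval\<close>

abbreviation S where "S \<equiv> surface_measure \<Omega>"

lemma frontier_\<Omega>: "frontier \<Omega> = {a *\<^sub>R e, b *\<^sub>R e}"
proof -
  have eq: "\<Omega> = (\<lambda>t. t *\<^sub>R e) ` {a<..<b}"
  proof (intro equalityI subsetI)
    fix x assume "x \<in> \<Omega>"
    then show "x \<in> (\<lambda>t. t *\<^sub>R e) ` {a<..<b}" by (intro image_eqI[of _ _ "x \<bullet> e"]) (auto simp: \<Omega>)
  qed (auto simp: \<Omega>)
  have "linear (\<lambda>t. t *\<^sub>R e)" by (intro linearI) (auto simp: scaleR_add_left)
  moreover have "inj (\<lambda>t. t *\<^sub>R e)" by (rule injI) (metis e_e inner_scaleR_left mult.right_neutral)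
  ultimately have "closure \<Omega> = (\<lambda>t. t *\<^sub>R e) ` closure {a<..<b}"
    unfolding eq by (rule closure_injective_linear_image[symmetric])
  then show ?thesis unfolding frontier_def interior_open[OF open_\<Omega>]
    using ab by (auto simp: \<Omega> image_iff)
qed

end

lemma hausdorff_outer_0_singleton: "hausdorff_outer 0 {p :: 'a::euclidean_space} = 1"
proof (rule antisym)
  have le: "hausdorff_content 0 \<delta> {p} \<le> 1" if "\<delta> > 0" for \<delta>
  proof -
    define C where "C i = (if i = 0 then {p} else {})" for i :: nat
    have "hausdorff_content 0 \<delta> {p} \<le> (\<Sum>i. hausdorff_size 0 (C i))"
      unfolding hausdorff_content_alt
      by (rule INF_lower) (use that in \<open>auto simp: C_def diameter_empty diameter_singleton\<close>)
    also have "\<dots> = (\<Sum>i\<in>{0}. hausdorff_size 0 (C i))"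
      by (rule suminf_finite) (auto simp: C_def)
    also have "\<dots> = 1" by (simp add: C_def hausdorff_size_def)
    finally show ?thesis .
  qed
  then show "hausdorff_outer 0 {p} \<le> 1"
    unfolding hausdorff_outer_def by (intro SUP_least) auto
  have "1 \<le> hausdorff_content 0 1 {p}"
    unfolding hausdorff_content_alt
  proof (rule INF_greatest, clarify)
    fix C :: "nat \<Rightarrow> 'a set" assume "{p} \<subseteq> (\<Union>i. C i)"
    then obtain i where "C i \<noteq> {}" by blast
    then have "1 = (\<Sum>j\<in>{i}. hausdorff_size 0 (C j))" by (simp add: hausdorff_size_def)
    also have "\<dots> \<le> (\<Sum>i. hausdorff_size 0 (C i))" by (rule sum_le_suminf) auto
    finally show "1 \<le> (\<Sum>i. hausdorff_size 0 (C i))" .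
  qed
  also have "\<dots> \<le> hausdorff_outer 0 {p}" by (rule hausdorff_content_le_outer) simp
  finally show "1 \<le> hausdorff_outer 0 {p}" .
qed

context interval_domain
begin

lemma ends_distinct: "a *\<^sub>R e \<noteq> b *\<^sub>R e"
  using ab e_e by (metis inner_scaleR_left less_irrefl mult.right_neutral)

lemma surface_measure_eq: "S = count_space {a *\<^sub>R e, b *\<^sub>R e}"
proof (rule measure_eqI_finite)
  have "A \<in> sets borel" if "A \<subseteq> {a *\<^sub>R e, b *\<^sub>R e}" for A :: "'a set"
    using finite_subset[OF that] by (intro borel_closed finite_imp_closed) auto
  then show sets: "sets S = Pow {a *\<^sub>R e, b *\<^sub>R e}"
    unfolding sets_surface_measure by (auto simp: sets_restrict_space frontier_\<Omega>)
  fix p assume p: "p \<in> {a *\<^sub>R e, b *\<^sub>R e}"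
  have "emeasure S {p} = hausdorff_outer (DIM('a) - 1) {p}"
    using p by (intro emeasure_surface_measure) (auto simp: frontier_\<Omega>)
  then show "emeasure S {p} = emeasure (count_space {a *\<^sub>R e, b *\<^sub>R e}) {p}"
    using p by (simp add: DIM hausdorff_outer_0_singleton)
qed auto

lemma S_measurable [simp]: "f \<in> borel_measurable S"
  by (simp add: surface_measure_eq)

lemma AE_S_iff: "(AE p in S. P p) \<longleftrightarrow> P (a *\<^sub>R e) \<and> P (b *\<^sub>R e)"
  unfolding surface_measure_eq by (simp add: AE_count_space)

lemma L2_S [simp]: "f \<in> L2 S"
  by (simp add: L2_def) (simp add: surface_measure_eq integrable_count_space)

lemma L2_norm_S: "L2_norm S f = sqrt ((cmod (f (a *\<^sub>R e)))\<^sup>2 + (cmod (f (b *\<^sub>R e)))\<^sup>2)"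
  unfolding L2_norm_def surface_measure_eq
  using ends_distinct by (subst lebesgue_integral_count_space_finite) auto

lemma L2_norm_S_le: "L2_norm S f \<le> cmod (f (a *\<^sub>R e)) + cmod (f (b *\<^sub>R e))"
  unfolding L2_norm_S by (rule sqrt_sum_squares_le_sum) auto

lemma le_L2_norm_S: "cmod (f (a *\<^sub>R e)) \<le> L2_norm S f" "cmod (f (b *\<^sub>R e)) \<le> L2_norm S f"
  unfolding L2_norm_S by (auto intro: real_le_rsqrt)

lemma frontier_point:
  assumes "p \<in> frontier \<Omega>"
  shows "(p \<bullet> e) *\<^sub>R e = p" "p \<bullet> e \<in> {a..b}" "cmod (f p) \<le> L2_norm S f"
  using assms ab le_L2_norm_S[of f] by (auto simp: frontier_\<Omega>)

subsection \<open>Traces\<close>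

text \<open>
  Point evaluation is bounded by the \<open>H\<^sup>1\<close> norm, so the boundary values of smooth functions that tend
  to \<open>u\<close> tend to those of \<open>U\<close>.  Conversely \<open>U\<close> is the limit of polynomials.
\<close>

lemma has_trace_represented:
  assumes r: "represented u U g"
  shows "has_trace \<Omega> u h \<longleftrightarrow> (\<forall>p\<in>frontier \<Omega>. h p = U (p \<bullet> e))"
proof
  assume "has_trace \<Omega> u h"
  then obtain w :: "nat \<Rightarrow> 'a \<Rightarrow> complex" where w: "\<And>j. smooth_on UNIV (w j)" and 1: "(\<lambda>j. H1_norm \<Omega> (w j - u)) \<longlonglongrightarrow> 0"
    and 2: "(\<lambda>j. L2_norm S (w j - h)) \<longlonglongrightarrow> 0"
    by (auto simp: has_trace_def)
  show "\<forall>p\<in>frontier \<Omega>. h p = U (p \<bullet> e)"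
  proof
    fix p assume p: "p \<in> frontier \<Omega>"
    note fp = frontier_point[OF p]
    have "(\<lambda>j. w j p - U (p \<bullet> e)) \<longlonglongrightarrow> 0"
    proof (rule Lim_null_comparison)
      show "(\<lambda>j. 2 * K * H1_norm \<Omega> (w j - u)) \<longlonglongrightarrow> 0" using tendsto_mult_left[OF 1, of "2 * K"] by simp
      show "\<forall>\<^sub>F j in sequentially. norm (w j p - U (p \<bullet> e)) \<le> 2 * K * H1_norm \<Omega> (w j - u)"
        using represented_le_H1_norm[OF represented_diff[OF smooth_represented[OF w] r] fp(2)] fp(1) by simp
    qed
    moreover have "(\<lambda>j. w j p - h p) \<longlonglongrightarrow> 0"
    proof (rule Lim_null_comparison[OF _ 2], intro always_eventually allI)
      show "norm (w j p - h p) \<le> L2_norm S (w j - h)" for j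
        using frontier_point(3)[OF p, of "w j - h"] by simp
    qed
    ultimately have "(\<lambda>j. (w j p - U (p \<bullet> e)) - (w j p - h p)) \<longlonglongrightarrow> 0 - 0" by (rule tendsto_diff)
    then show "h p = U (p \<bullet> e)" by (simp add: LIMSEQ_const_iff)
  qed
next
  assume h: "\<forall>p\<in>frontier \<Omega>. h p = U (p \<bullet> e)"
  have p: "primitive_on a b U g" using r by (simp add: represented_def)
  obtain P q :: "nat \<Rightarrow> real \<Rightarrow> complex" where P: "\<And>j. polynomial_function (P j)"
    "\<And>j x. (P j has_vector_derivative q j x) (at x)" "\<And>j. primitive_on a b (P j) (q j)"
    and lim: "(\<lambda>j. L2_norm (LI a b) (q j - g)) \<longlonglongrightarrow> 0"
    and close: "\<And>j t. t \<in> {a..b} \<Longrightarrow> cmod (P j t - U t) \<le> sqrt (b - a) * L2_norm (LI a b) (q j - g)"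
    by (rule primitive_on_polynomial_approx[OF p ab']) blast
  define w :: "nat \<Rightarrow> 'a \<Rightarrow> complex" where "w j = (\<lambda>x. P j (x \<bullet> e))" for j
  have smooth: "smooth_on UNIV (w j)" for j unfolding w_def by (rule polynomial_lift(1)[OF P(1,2)])
  have rw: "represented (w j) (P j) (q j)" for j unfolding w_def by (rule represented_lift[OF P(3)])
  have "(\<lambda>j. H1_norm \<Omega> (w j - u)) \<longlonglongrightarrow> 0"
  proof (rule Lim_null_comparison)
    show "(\<lambda>j. (sqrt (b - a) * sqrt (b - a) + 1) * L2_norm (LI a b) (q j - g)) \<longlonglongrightarrow> 0"
      using tendsto_mult_left[OF lim] by simp
    show "\<forall>\<^sub>F j in sequentially. norm (H1_norm \<Omega> (w j - u)) \<le> (sqrt (b - a) * sqrt (b - a) + 1) * L2_norm (LI a b) (q j - g)"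
    proof (intro always_eventually allI)
      fix j
      let ?n = "L2_norm (LI a b) (q j - g)"
      have "L2_norm (LI a b) (\<lambda>t. P j t - U t) \<le> (sqrt (b - a) * ?n) * sqrt (b - a)"
        using close ab' primitive_on_continuous[OF P(3)] primitive_on_continuous[OF p]
        by (intro L2_LI_sup_le(2) continuous_on_diff) auto
      moreover have "H1_norm \<Omega> (w j - u) \<le> L2_norm (LI a b) (\<lambda>t. P j t - U t) + ?n"
        using represented_H1_norm_le[OF represented_diff[OF rw r], of j] by (simp add: fun_diff_def)
      moreover have "(s * n) * s + n = (s * s + 1) * n" for s n :: real by (simp add: algebra_simps)
      ultimately have "H1_norm \<Omega> (w j - u) \<le> (sqrt (b - a) * sqrt (b - a) + 1) * ?n"
        by (smt (verit))
      then show "norm (H1_norm \<Omega> (w j - u)) \<le> (sqrt (b - a) * sqrt (b - a) + 1) * ?n" by simp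
    qed
  qed
  moreover have "(\<lambda>j. L2_norm S (w j - h)) \<longlonglongrightarrow> 0"
  proof (rule Lim_null_comparison)
    show "(\<lambda>j. 2 * sqrt (b - a) * L2_norm (LI a b) (q j - g)) \<longlonglongrightarrow> 0"
      using tendsto_mult_left[OF lim] by simp
    show "\<forall>\<^sub>F j in sequentially. norm (L2_norm S (w j - h)) \<le> 2 * sqrt (b - a) * L2_norm (LI a b) (q j - g)"
    proof (intro always_eventually allI)
      fix j
      show "norm (L2_norm S (w j - h)) \<le> 2 * sqrt (b - a) * L2_norm (LI a b) (q j - g)"
        using L2_norm_S_le[of "w j - h"] close[of a j] close[of b j] h ab by (simp add: w_def frontier_\<Omega>)
    qed
  qed
  ultimately show "has_trace \<Omega> u h"
    using represented_H1[OF r] smooth by (auto simp: has_trace_def)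
qed

lemma boundary_trace_represented:
  assumes r: "represented u U g" and p: "p \<in> frontier \<Omega>"
  shows "boundary_trace \<Omega> u p = U (p \<bullet> e)"
proof -
  have "has_trace \<Omega> u (\<lambda>p. U (p \<bullet> e))" by (simp add: has_trace_represented[OF r])
  then have "has_trace \<Omega> u (boundary_trace \<Omega> u)"
    unfolding boundary_trace_def by (auto intro: someI[where P = "has_trace \<Omega> u"])
  then show ?thesis using p by (simp add: has_trace_represented[OF r])
qed

subsection \<open>The domain of the Laplacian\<close>

text \<open>
  The second Sobolev space: \<open>U\<close> represents \<open>u\<close>, and \<open>V\<close> and \<open>f\<close> are its first and second
  derivatives.
\<close>

definition represented2 :: "('a \<Rightarrow> complex) \<Rightarrow> (real \<Rightarrow> complex) \<Rightarrow> (real \<Rightarrow> complex) \<Rightarrow> (real \<Rightarrow> complex) \<Rightarrow> bool"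
  where "represented2 u U V f \<longleftrightarrow> represented u U V \<and> primitive_on a b V f"

lemma represented2D: "represented2 u U V f \<Longrightarrow> represented u U V" "represented2 u U V f \<Longrightarrow> primitive_on a b V f"
  by (auto simp: represented2_def)

lemma test_function_pd: "test_function \<Omega> \<eta> \<Longrightarrow> test_function \<Omega> (pd e \<eta>)"
proof -
  assume \<eta>: "test_function \<Omega> \<eta>"
  have "{x. pd e \<eta> x \<noteq> 0} \<subseteq> closure {x. \<eta> x \<noteq> 0}"
  proof (intro subsetI, rule ccontr)
    fix x assume "x \<in> {x. pd e \<eta> x \<noteq> 0}" and x: "x \<notin> closure {x. \<eta> x \<noteq> 0}"
    have "(\<eta> has_derivative (\<lambda>h. 0)) (at x)"
      by (rule has_derivative_transform_within_open[of "\<lambda>x. 0" _ _ _ "- closure {x. \<eta> x \<noteq> 0}"])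
         (use x closure_subset[of "{x. \<eta> x \<noteq> 0}"] in auto)
    then have "pd e \<eta> x = 0" by (simp add: pd_def frechet_derivative_at[symmetric])
    then show False using \<open>x \<in> {x. pd e \<eta> x \<noteq> 0}\<close> by simp
  qed
  then have cl: "closure {x. pd e \<eta> x \<noteq> 0} \<subseteq> closure {x. \<eta> x \<noteq> 0}" by (intro closure_minimal) auto
  moreover have "compact (closure {x. pd e \<eta> x \<noteq> 0})"
    using \<eta> by (auto simp: compact_eq_bounded_closed test_function_def intro: bounded_subset[OF _ cl])
  ultimately show ?thesis
    using \<eta> smooth_embed_derivative(3)[of \<eta>] by (auto simp: test_function_def)
qed

text \<open>
  The Laplacian of a test function \<open>\<eta>\<close> is the derivative of the test function \<open>pd e \<eta>\<close>, from which one
  derivative can be moved to \<open>u\<close>.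
\<close>

lemma has_weak_laplacian_iff:
  assumes v: "has_weak_pd \<Omega> e u v"
  shows "has_weak_laplacian \<Omega> u f \<longleftrightarrow> has_weak_pd \<Omega> e v f"
proof -
  have "(LINT x|M. (\<Sum>b\<in>Basis. pd b (pd b \<eta>) x) *\<^sub>R u x) = - (LINT x|M. pd e \<eta> x *\<^sub>R v x)" if "test_function \<Omega> \<eta>" for \<eta>
    using v test_function_pd[OF that] by (simp add: has_weak_pd_def Basis)
  then show ?thesis by (auto simp: has_weak_laplacian_def has_weak_pd_def minus_equation_iff[of _ "LINT x|M. _ x"] equation_minus_iff)
qed

lemma has_weak_pd_lift:
  assumes "represented2 u U V f"
  shows "has_weak_pd \<Omega> e (\<lambda>x. V (x \<bullet> e)) h \<longleftrightarrow> h \<in> borel_measurable M \<and> (AE t in LI a b. h (t *\<^sub>R e) = f t)"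
proof
  let ?v = "\<lambda>x. V (x \<bullet> e)"
  have r: "represented ?v V f" by (rule represented_lift[OF represented2D(2)[OF assms]])
  {
    assume h: "has_weak_pd \<Omega> e ?v h"
    obtain W where "primitive_on a b W (\<lambda>t. h (t *\<^sub>R e))" "AE t in LI a b. ?v (t *\<^sub>R e) = W t"
      by (rule has_weak_pd_imp_primitive[OF represented_L2[OF r] h])
    then have "represented ?v W (\<lambda>t. h (t *\<^sub>R e))" using r by (auto simp: represented_def)
    from represented_unique(2)[OF this r]
    show "h \<in> borel_measurable M \<and> (AE t in LI a b. h (t *\<^sub>R e) = f t)"
      using has_weak_pdD[OF h] by (auto dest: L2_measurable)
  }
  {
    assume h: "h \<in> borel_measurable M \<and> (AE t in LI a b. h (t *\<^sub>R e) = f t)"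
    have "primitive_on a b V (\<lambda>t. h (t *\<^sub>R e))"
    proof (rule primitive_on_cong[OF represented2D(2)[OF assms] refl _ _ ab'])
      show "(\<lambda>t. h (t *\<^sub>R e)) \<in> borel_measurable (LI a b)" using h by (simp add: measurable_M_iff[of h])
      from h have "AE t in LI a b. h (t *\<^sub>R e) = f t" by simp
      then show "AE t in LI a b. f t = h (t *\<^sub>R e)" by eventually_elim simp
    qed
    then show "has_weak_pd \<Omega> e ?v h"
      using r by (intro primitive_imp_has_weak_pd[of ?v V]) (auto simp: represented_def)
  }
qed

lemma has_weak_laplacian_represented2:
  assumes r: "represented2 u U V f"
  shows "has_weak_laplacian \<Omega> u h \<longleftrightarrow> h \<in> borel_measurable M \<and> (AE t in LI a b. h (t *\<^sub>R e) = f t)"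
  unfolding has_weak_laplacian_iff[OF represented_has_weak_pd[OF represented2D(1)[OF r]]]
  by (rule has_weak_pd_lift[OF r])

lemma weak_laplacian_represented2:
  assumes r: "represented2 u U V f"
  shows "weak_laplacian \<Omega> u \<in> borel_measurable M" "AE t in LI a b. weak_laplacian \<Omega> u (t *\<^sub>R e) = f t"
    "L2_norm M (weak_laplacian \<Omega> u) = L2_norm (LI a b) f" "\<exists>h. has_weak_laplacian \<Omega> u h"
proof -
  have f: "f \<in> L2 (LI a b)" by (rule primitive_onD[OF represented2D(2)[OF r]])
  have "(\<lambda>x. f (x \<bullet> e)) \<in> borel_measurable M"
    using L2_measurable[OF f] by (simp add: measurable_M_iff[of "\<lambda>x. f (x \<bullet> e)"])
  then have "has_weak_laplacian \<Omega> u (\<lambda>x. f (x \<bullet> e))" by (simp add: has_weak_laplacian_represented2[OF r])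
  then show "\<exists>h. has_weak_laplacian \<Omega> u h" by blast
  from has_weak_laplacian_weak_laplacian[OF \<open>has_weak_laplacian \<Omega> u (\<lambda>x. f (x \<bullet> e))\<close>]
  show m: "weak_laplacian \<Omega> u \<in> borel_measurable M" and ae: "AE t in LI a b. weak_laplacian \<Omega> u (t *\<^sub>R e) = f t"
    by (simp_all add: has_weak_laplacian_represented2[OF r])
  show "L2_norm M (weak_laplacian \<Omega> u) = L2_norm (LI a b) f"
    unfolding L2_norm_M[OF m] using m
    by (intro L2_norm_cong_AE[OF _ L2_measurable[OF f] ae]) (simp add: measurable_M_iff[of "weak_laplacian \<Omega> u"])
qed

lemma gagliardo_half_le:
  assumes V: "primitive_on a b V f" and g: "AE t in LI a b. g (t *\<^sub>R e) = V t"
  shows "gagliardo_half \<Omega> g \<le> ennreal (16 * (b - a) * (L2_norm (LI a b) f)\<^sup>2)"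
proof -
  define W where "W t = V (max a (min b t))" for t
  have Wc: "continuous_on UNIV W"
    unfolding W_def using ab
    by (intro continuous_on_compose2[OF primitive_on_continuous[OF V]] continuous_intros) auto
  have Wm[measurable]: "W \<in> borel_measurable borel" by (rule borel_measurable_continuous_onI[OF Wc])
  have WV: "W t = V t" if "t \<in> {a<..<b}" for t using that by (simp add: W_def)
  define k where "k s t = ennreal ((cmod (W s - W t))\<^sup>2 / (s - t)\<^sup>2)" for s t
  have km[measurable]: "(\<lambda>(s, t). k s t) \<in> borel_measurable (borel \<Otimes>\<^sub>M borel)"
    unfolding k_def by measurable
  have toreal: "(\<integral>\<^sup>+x. h (x \<bullet> e) \<partial>M) = (\<integral>\<^sup>+t. indicator {a<..<b} t * h t \<partial>lborel)"
    if h: "h \<in> borel_measurable borel" for h :: "real \<Rightarrow> ennreal"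
  proof -
    have hL: "h \<in> borel_measurable (LI a b)"
      using h by (intro measurable_restrict_space1 measurable_completion) simp
    have "(\<integral>\<^sup>+x. h (x \<bullet> e) \<partial>M) = (\<integral>\<^sup>+t. h t \<partial>LI a b)"
      using nn_integral_distr[OF measurable_coord, of h] hL by (simp add: distr_M)
    also have "\<dots> = (\<integral>\<^sup>+t. h t * indicator {a<..<b} t \<partial>lebesgue)" by (rule nn_integral_restrict_space) simp
    finally show ?thesis by (simp add: nn_integral_completion mult.commute)
  qed
  have ae: "AE x in M. g x = W (x \<bullet> e)"
  proof -
    have "AE t in LI a b. t \<in> {a<..<b}" by (rule AE_I2) simp
    with g have "AE t in LI a b. g (t *\<^sub>R e) = W ((t *\<^sub>R e) \<bullet> e)" by eventually_elim (simp add: WV)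
    then show ?thesis unfolding AE_M_iff[of "\<lambda>x. g x = W (x \<bullet> e)"] .
  qed
  have "gagliardo_half \<Omega> g = (\<integral>\<^sup>+x. (\<integral>\<^sup>+y. k (x \<bullet> e) (y \<bullet> e) \<partial>M) \<partial>M)"
    unfolding gagliardo_half_def
  proof (rule nn_integral_cong_AE)
    show "AE x in M. (\<integral>\<^sup>+y. ennreal ((cmod (g x - g y))\<^sup>2 / norm (x - y) ^ (DIM('a) + 1)) \<partial>M) = (\<integral>\<^sup>+y. k (x \<bullet> e) (y \<bullet> e) \<partial>M)"
      using ae
    proof eventually_elim
      case (elim x)
      show ?case
      proof (rule nn_integral_cong_AE)
        show "AE y in M. ennreal ((cmod (g x - g y))\<^sup>2 / norm (x - y) ^ (DIM('a) + 1)) = k (x \<bullet> e) (y \<bullet> e)"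
          using ae by eventually_elim (simp add: elim k_def DIM norm_eq inner_diff_left power2_eq_square)
      qed
    qed
  qed
  also have "\<dots> = (\<integral>\<^sup>+x. (\<integral>\<^sup>+t. indicator {a<..<b} t * k (x \<bullet> e) t \<partial>lborel) \<partial>M)"
    by (intro nn_integral_cong toreal) measurable
  also have "\<dots> = (\<integral>\<^sup>+s. indicator {a<..<b} s * (\<integral>\<^sup>+t. indicator {a<..<b} t * k s t \<partial>lborel) \<partial>lborel)"
    by (rule toreal) measurable
  also have "\<dots> = (\<integral>\<^sup>+s. (\<integral>\<^sup>+t. indicator {a<..<b} s * indicator {a<..<b} t * ennreal ((cmod (V s - V t))\<^sup>2 / (s - t)\<^sup>2) \<partial>lborel) \<partial>lborel)"
  proof (rule nn_integral_cong)
    fix s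
    have "indicator {a<..<b} s * (\<integral>\<^sup>+t. indicator {a<..<b} t * k s t \<partial>lborel) = (\<integral>\<^sup>+t. indicator {a<..<b} s * (indicator {a<..<b} t * k s t) \<partial>lborel)"
      by (intro nn_integral_cmult[symmetric]) measurable
    also have "\<dots> = (\<integral>\<^sup>+t. indicator {a<..<b} s * indicator {a<..<b} t * ennreal ((cmod (V s - V t))\<^sup>2 / (s - t)\<^sup>2) \<partial>lborel)"
      by (intro nn_integral_cong) (auto simp: k_def WV indicator_def)
    finally show "indicator {a<..<b} s * (\<integral>\<^sup>+t. indicator {a<..<b} t * k s t \<partial>lborel)
        = (\<integral>\<^sup>+t. indicator {a<..<b} s * indicator {a<..<b} t * ennreal ((cmod (V s - V t))\<^sup>2 / (s - t)\<^sup>2) \<partial>lborel)" .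
  qed
  also have "\<dots> \<le> ennreal (16 * (b - a) * (L2_norm (LI a b) f)\<^sup>2)"
    by (rule gagliardo_primitive_on[OF V ab'])
  finally show ?thesis .
qed

lemma represented2_gagliardo:
  assumes r: "represented2 u U V f"
  shows "gagliardo_half \<Omega> (weak_pd \<Omega> e u) \<le> ennreal (16 * (b - a) * (L2_norm (LI a b) f)\<^sup>2)"
  by (rule gagliardo_half_le[OF represented2D(2)[OF r] represented_weak_pd[OF represented2D(1)[OF r]]])

lemma represented2_H32_laplacian:
  assumes r: "represented2 u U V f"
  shows "u \<in> H32_laplacian \<Omega>"
  using represented_H1[OF represented2D(1)[OF r]] weak_laplacian_represented2(4)[OF r]
    le_less_trans[OF represented2_gagliardo[OF r] ennreal_less_top]
  by (simp add: H32_laplacian_def H32_def Basis)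

text \<open>
  The weak derivative of \<open>u\<close> has a weak derivative itself, so that the description of \<open>H\<^sup>1\<close> applies to
  \<open>u\<close> and once more to its derivative.
\<close>

lemma H32_laplacian_represented2:
  assumes u: "u \<in> H32_laplacian \<Omega>"
  obtains U V where "represented2 u U V (\<lambda>t. weak_laplacian \<Omega> u (t *\<^sub>R e))"
proof -
  have H: "u \<in> H1 \<Omega>" using u by (simp add: H32_laplacian_def H32_def)
  have g: "has_weak_pd \<Omega> e u (weak_pd \<Omega> e u)" using H by (rule H1_has_weak_pd) (simp add: Basis)
  have "has_weak_laplacian \<Omega> u (weak_laplacian \<Omega> u)"
    using u by (auto simp: H32_laplacian_def intro: has_weak_laplacian_weak_laplacian)
  then have "has_weak_pd \<Omega> e (weak_pd \<Omega> e u) (weak_laplacian \<Omega> u)" by (simp add: has_weak_laplacian_iff[OF g])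
  then obtain V where V: "primitive_on a b V (\<lambda>t. weak_laplacian \<Omega> u (t *\<^sub>R e))"
    and VA: "AE t in LI a b. weak_pd \<Omega> e u (t *\<^sub>R e) = V t"
    by (rule has_weak_pd_imp_primitive[OF has_weak_pdD[OF g]])
  obtain U where U: "represented u U (\<lambda>t. weak_pd \<Omega> e u (t *\<^sub>R e))" by (rule H1_represented[OF H])
  have "primitive_on a b U V"
    using U by (intro primitive_on_cong[OF _ refl L2_measurable[OF primitive_on_L2[OF V ab']] VA ab']) (auto simp: represented_def)
  then have "represented2 u U V (\<lambda>t. weak_laplacian \<Omega> u (t *\<^sub>R e))"
    using U V by (auto simp: represented2_def represented_def)
  then show thesis by (rule that)
qed

lemma represented2_diff:
  assumes "represented2 u U V f" "represented2 w W X g"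
  shows "represented2 (u - w) (\<lambda>t. U t - W t) (\<lambda>t. V t - X t) (\<lambda>t. f t - g t)"
  using assms represented_diff primitive_on_minus unfolding represented2_def by blast

lemma smooth_represented2:
  assumes w: "smooth_on UNIV (w :: 'a \<Rightarrow> complex)"
  shows "represented2 w (\<lambda>t. w (t *\<^sub>R e)) (\<lambda>t. pd e w (t *\<^sub>R e)) (\<lambda>t. pd e (pd e w) (t *\<^sub>R e))"
  using smooth_represented[OF w] smooth_primitive_on[OF smooth_embed_derivative(3)[OF w]]
  by (simp add: represented2_def)

end

section \<open>A boundary value problem on an interval\<close>

text \<open>
  With \<open>P = V - \<mu> U\<close> and \<open>Q = V + \<mu> U\<close> the equation \<open>U'' = \<mu>\<^sup>2 U + q\<close> splits into
  \<open>P' = - \<mu> P + q\<close>, whose solutions decay from left to right, and \<open>Q' = \<mu> Q + q\<close>, whose solutions decay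
  from right to left.  For large \<open>\<mu>\<close> the boundary condition at \<open>a\<close> therefore determines \<open>P a\<close>,
  and the one at \<open>b\<close> determines \<open>Q b\<close>, up to a small coupling.
\<close>

lemma exp_weighted_primitive:
  assumes F: "primitive_on a b F f" and ab: "a \<le> b"
  shows "primitive_on a b (\<lambda>t. complex_of_real (exp (s * (t - c))) * F t)
    (\<lambda>t. complex_of_real (exp (s * (t - c))) * (f t + complex_of_real s * F t))"
proof -
  have "primitive_on a b (\<lambda>t. complex_of_real (exp (s * (t - c))) * F t)
      (\<lambda>t. complex_of_real (exp (s * (t - c))) * f t + complex_of_real (s * exp (s * (t - c))) * F t)"
  proof (rule primitive_on_mult_C1[OF F ab])
    have "((\<lambda>t. exp (s * (t - c))) has_real_derivative s * exp (s * (t - c))) (at t)" for t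
      by (auto intro!: derivative_eq_intros)
    then show "((\<lambda>t. complex_of_real (exp (s * (t - c)))) has_vector_derivative complex_of_real (s * exp (s * (t - c)))) (at t within {a..b})" for t
      by (intro has_vector_derivative_of_real[OF has_field_derivative_at_within])
  qed (intro continuous_intros)
  then show ?thesis by (simp add: algebra_simps)
qed

lemma decay_right:
  assumes P: "primitive_on a b P (\<lambda>t. q t - complex_of_real \<mu> * P t)" and q: "q \<in> L2 (LI a b)"
    and \<mu>: "\<mu> > 0" and t: "t \<in> {a..b}"
  shows "cmod (P t) \<le> exp (- \<mu> * (t - a)) * cmod (P a) + sqrt (b - a) * exp (\<mu> * (b - a)) * L2_norm (LI a b) q"
proof -
  have ab: "a \<le> b" using t by simp
  let ?E = "\<lambda>t. complex_of_real (exp (\<mu> * (t - a)))"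
  have Eq: "L2_norm (LI a b) (\<lambda>t. ?E t * q t) \<le> exp (\<mu> * (b - a)) * L2_norm (LI a b) q"
    using \<mu> by (intro L2_norm_mult_continuous_le(2)[OF q] continuous_intros) auto
  have p: "primitive_on a b (\<lambda>t. ?E t * P t) (\<lambda>t. ?E t * q t)"
    using exp_weighted_primitive[OF P ab, of \<mu> a] by simp
  have "cmod (?E t * P t - ?E a * P a) \<le> sqrt \<bar>t - a\<bar> * L2_norm (LI a b) (\<lambda>t. ?E t * q t)"
    using t by (intro primitive_on_increment[OF p]) auto
  also have "\<dots> \<le> sqrt (b - a) * (exp (\<mu> * (b - a)) * L2_norm (LI a b) q)"
    using t Eq by (intro mult_mono) auto
  finally have le: "cmod (?E t * P t - P a) \<le> sqrt (b - a) * exp (\<mu> * (b - a)) * L2_norm (LI a b) q" by simp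
  have x: "exp (- \<mu> * (t - a)) * exp (\<mu> * (t - a)) = 1" by (simp flip: exp_add)
  have "P t = complex_of_real (exp (- \<mu> * (t - a))) * (?E t * P t)"
    using arg_cong[OF x, of complex_of_real] by (simp add: mult.assoc[symmetric])
  then have "cmod (P t) = exp (- \<mu> * (t - a)) * cmod (P a + (?E t * P t - P a))"
    by (metis add.commute diff_add_cancel norm_mult norm_of_real abs_exp_cancel)
  also have "\<dots> \<le> exp (- \<mu> * (t - a)) * (cmod (P a) + cmod (?E t * P t - P a))"
    by (intro mult_left_mono norm_triangle_ineq) auto
  also have "\<dots> = exp (- \<mu> * (t - a)) * cmod (P a) + exp (- \<mu> * (t - a)) * cmod (?E t * P t - P a)"
    by (simp add: distrib_left)
  also have "exp (- \<mu> * (t - a)) * cmod (?E t * P t - P a) \<le> 1 * (sqrt (b - a) * exp (\<mu> * (b - a)) * L2_norm (LI a b) q)"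
    using t \<mu> le by (intro mult_mono) auto
  finally show ?thesis by simp
qed

lemma decay_left:
  assumes Q: "primitive_on a b Q (\<lambda>t. q t + complex_of_real \<mu> * Q t)" and q: "q \<in> L2 (LI a b)"
    and \<mu>: "\<mu> > 0" and t: "t \<in> {a..b}"
  shows "cmod (Q t) \<le> exp (- \<mu> * (b - t)) * cmod (Q b) + sqrt (b - a) * exp (\<mu> * (b - a)) * L2_norm (LI a b) q"
proof -
  have ab: "a \<le> b" using t by simp
  let ?E = "\<lambda>t. complex_of_real (exp (- \<mu> * (t - b)))"
  have Eq: "L2_norm (LI a b) (\<lambda>t. ?E t * q t) \<le> exp (\<mu> * (b - a)) * L2_norm (LI a b) q"
  proof (rule L2_norm_mult_continuous_le(2)[OF q])
    show "cmod (?E t) \<le> exp (\<mu> * (b - a))" if "t \<in> {a..b}" for t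
    proof -
      have "\<mu> * (b - t) \<le> \<mu> * (b - a)" using that \<mu> by (intro mult_left_mono) auto
      then show ?thesis by (simp add: algebra_simps)
    qed
  qed (auto intro!: continuous_intros)
  have p: "primitive_on a b (\<lambda>t. ?E t * Q t) (\<lambda>t. ?E t * q t)"
    using exp_weighted_primitive[OF Q ab, of "- \<mu>" b] by simp
  have "cmod (?E t * Q t - ?E b * Q b) \<le> sqrt \<bar>t - b\<bar> * L2_norm (LI a b) (\<lambda>t. ?E t * q t)"
    using t by (intro primitive_on_increment[OF p]) auto
  also have "\<dots> \<le> sqrt (b - a) * (exp (\<mu> * (b - a)) * L2_norm (LI a b) q)"
    using t Eq by (intro mult_mono) auto
  finally have le: "cmod (?E t * Q t - Q b) \<le> sqrt (b - a) * exp (\<mu> * (b - a)) * L2_norm (LI a b) q" by simp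
  have x: "exp (- \<mu> * (b - t)) * exp (- \<mu> * (t - b)) = 1" by (simp add: algebra_simps flip: exp_add)
  have "Q t = complex_of_real (exp (- \<mu> * (b - t))) * (?E t * Q t)"
    using arg_cong[OF x, of complex_of_real] by (simp add: mult.assoc[symmetric])
  then have "cmod (Q t) = exp (- \<mu> * (b - t)) * cmod (Q b + (?E t * Q t - Q b))"
    by (metis add.commute diff_add_cancel norm_mult norm_of_real abs_exp_cancel)
  also have "\<dots> \<le> exp (- \<mu> * (b - t)) * (cmod (Q b) + cmod (?E t * Q t - Q b))"
    by (intro mult_left_mono norm_triangle_ineq) auto
  also have "\<dots> = exp (- \<mu> * (b - t)) * cmod (Q b) + exp (- \<mu> * (b - t)) * cmod (?E t * Q t - Q b)"
    by (simp add: distrib_left)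
  also have "exp (- \<mu> * (b - t)) * cmod (?E t * Q t - Q b) \<le> 1 * (sqrt (b - a) * exp (\<mu> * (b - a)) * L2_norm (LI a b) q)"
    using t \<mu> le by (intro mult_mono) auto
  finally show ?thesis by simp
qed

text \<open>The coefficients of the boundary conditions after the change of variables.\<close>

lemma boundary_coefficients:
  fixes \<sigma> \<theta> :: complex and \<mu> :: real
  assumes "cmod \<sigma> = 1" "\<mu> > 0" "cmod \<theta> \<le> \<mu> / 2"
  shows "cmod (\<sigma> / 2 - \<theta> / (2 * complex_of_real \<mu>)) \<ge> 1 / 4" "cmod (\<sigma> / 2 + \<theta> / (2 * complex_of_real \<mu>)) \<ge> 1 / 4"
    "cmod (\<sigma> / 2 - \<theta> / (2 * complex_of_real \<mu>)) \<le> 3 / 4" "cmod (\<sigma> / 2 + \<theta> / (2 * complex_of_real \<mu>)) \<le> 3 / 4"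
proof -
  have 1: "cmod (\<sigma> / 2) = 1 / 2" using assms(1) by (simp add: norm_divide)
  have 2: "cmod (\<theta> / (2 * complex_of_real \<mu>)) \<le> 1 / 4" using assms by (simp add: norm_divide norm_mult field_simps)
  show "cmod (\<sigma> / 2 - \<theta> / (2 * complex_of_real \<mu>)) \<ge> 1 / 4" "cmod (\<sigma> / 2 - \<theta> / (2 * complex_of_real \<mu>)) \<le> 3 / 4"
    using norm_triangle_ineq2[of "\<sigma> / 2" "\<theta> / (2 * complex_of_real \<mu>)"] norm_triangle_ineq4[of "\<sigma> / 2" "\<theta> / (2 * complex_of_real \<mu>)"] 1 2 by linarith+
  show "cmod (\<sigma> / 2 + \<theta> / (2 * complex_of_real \<mu>)) \<ge> 1 / 4" "cmod (\<sigma> / 2 + \<theta> / (2 * complex_of_real \<mu>)) \<le> 3 / 4"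
    using norm_diff_ineq[of "\<sigma> / 2" "\<theta> / (2 * complex_of_real \<mu>)"] norm_triangle_ineq[of "\<sigma> / 2" "\<theta> / (2 * complex_of_real \<mu>)"] 1 2 by linarith+
qed

lemma boundary_split:
  fixes \<mu> \<sigma> \<theta> P Q :: complex
  shows "\<sigma> * ((Q + P) / 2) + \<theta> * ((Q - P) / (2 * \<mu>)) = (\<sigma> / 2 - \<theta> / (2 * \<mu>)) * P + (\<sigma> / 2 + \<theta> / (2 * \<mu>)) * Q"
  by (simp add: algebra_simps add_divide_distrib diff_divide_distrib)

text \<open>
  The numbers \<open>P a\<close> and \<open>Q b\<close> satisfy a linear system whose diagonal entries are at least \<open>1/4\<close> and
  whose off-diagonal entries are at most \<open>3/4 * 1/6 = 1/8\<close>.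
\<close>

lemma boundary_value_estimate:
  assumes U: "primitive_on a b U V" and V: "primitive_on a b V (\<lambda>t. complex_of_real (\<mu>\<^sup>2) * U t + q t)"
    and q: "q \<in> L2 (LI a b)" and ab: "a \<le> b" and \<mu>: "\<mu> > 0" and small: "exp (- \<mu> * (b - a)) \<le> 1 / 6"
    and \<sigma>: "cmod \<sigma>a = 1" "cmod \<sigma>b = 1" and \<theta>: "cmod \<theta>a \<le> \<mu> / 2" "cmod \<theta>b \<le> \<mu> / 2"
    and bc: "\<sigma>a * V a + \<theta>a * U a = \<gamma>a" "\<sigma>b * V b + \<theta>b * U b = \<gamma>b" and t: "t \<in> {a..b}"
  shows "cmod (V t) \<le> 8 * (cmod \<gamma>a + cmod \<gamma>b) + 14 * (sqrt (b - a) * exp (\<mu> * (b - a)) * L2_norm (LI a b) q)"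
    and "\<mu> * cmod (U t) \<le> 8 * (cmod \<gamma>a + cmod \<gamma>b) + 14 * (sqrt (b - a) * exp (\<mu> * (b - a)) * L2_norm (LI a b) q)"
proof -
  define N where "N = sqrt (b - a) * exp (\<mu> * (b - a)) * L2_norm (LI a b) q"
  have N: "N \<ge> 0" using ab by (simp add: N_def)
  define P where "P t = V t - complex_of_real \<mu> * U t" for t
  define Q where "Q t = V t + complex_of_real \<mu> * U t" for t
  have "primitive_on a b P (\<lambda>t. (complex_of_real (\<mu>\<^sup>2) * U t + q t) - complex_of_real \<mu> * V t)"
    unfolding P_def by (intro primitive_on_minus V primitive_on_scale U)
  then have Pp: "primitive_on a b P (\<lambda>t. q t - complex_of_real \<mu> * P t)"
    by (simp add: P_def algebra_simps power2_eq_square)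
  have "primitive_on a b Q (\<lambda>t. (complex_of_real (\<mu>\<^sup>2) * U t + q t) + complex_of_real \<mu> * V t)"
    unfolding Q_def by (intro primitive_on_add V primitive_on_scale U)
  then have Qp: "primitive_on a b Q (\<lambda>t. q t + complex_of_real \<mu> * Q t)"
    by (simp add: Q_def algebra_simps power2_eq_square)
  have UV: "V t = (Q t + P t) / 2" "complex_of_real \<mu> * U t = (Q t - P t) / 2" for t by (simp_all add: P_def Q_def)
  have U': "U t = (Q t - P t) / (2 * complex_of_real \<mu>)" for t using UV(2)[of t] \<mu> by (simp add: field_simps)
  have Pt: "cmod (P t) \<le> exp (- \<mu> * (t - a)) * cmod (P a) + N" if "t \<in> {a..b}" for t
    unfolding N_def by (rule decay_right[OF Pp q \<mu> that])
  have Qt: "cmod (Q t) \<le> exp (- \<mu> * (b - t)) * cmod (Q b) + N" if "t \<in> {a..b}" for t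
    unfolding N_def by (rule decay_left[OF Qp q \<mu> that])
  have Pb: "cmod (P b) \<le> 1 / 6 * cmod (P a) + N"
    using Pt[of b] ab mult_right_mono[OF small, of "cmod (P a)"] by simp
  have Qa: "cmod (Q a) \<le> 1 / 6 * cmod (Q b) + N"
    using Qt[of a] ab mult_right_mono[OF small, of "cmod (Q b)"] by simp
  note ca = boundary_coefficients[OF \<sigma>(1) \<mu> \<theta>(1)] and cb = boundary_coefficients[OF \<sigma>(2) \<mu> \<theta>(2)]
  have "(\<sigma>a / 2 - \<theta>a / (2 * complex_of_real \<mu>)) * P a = \<gamma>a - (\<sigma>a / 2 + \<theta>a / (2 * complex_of_real \<mu>)) * Q a"
    using bc(1) unfolding UV(1) U' boundary_split by (rule eq_diff_eq[THEN iffD2])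
  then have "cmod (\<sigma>a / 2 - \<theta>a / (2 * complex_of_real \<mu>)) * cmod (P a) \<le> cmod \<gamma>a + cmod (\<sigma>a / 2 + \<theta>a / (2 * complex_of_real \<mu>)) * cmod (Q a)"
    by (metis norm_mult norm_triangle_ineq4)
  then have Pa: "1 / 4 * cmod (P a) \<le> cmod \<gamma>a + 3 / 4 * cmod (Q a)"
    using mult_right_mono[OF ca(1), of "cmod (P a)"] mult_right_mono[OF ca(4), of "cmod (Q a)"] by simp
  have "(\<sigma>b / 2 + \<theta>b / (2 * complex_of_real \<mu>)) * Q b = \<gamma>b - (\<sigma>b / 2 - \<theta>b / (2 * complex_of_real \<mu>)) * P b"
    using bc(2) unfolding UV(1) U' boundary_split by (intro eq_diff_eq[THEN iffD2]) (simp only: add.commute)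
  then have "cmod (\<sigma>b / 2 + \<theta>b / (2 * complex_of_real \<mu>)) * cmod (Q b) \<le> cmod \<gamma>b + cmod (\<sigma>b / 2 - \<theta>b / (2 * complex_of_real \<mu>)) * cmod (P b)"
    by (metis norm_mult norm_triangle_ineq4)
  then have Qb: "1 / 4 * cmod (Q b) \<le> cmod \<gamma>b + 3 / 4 * cmod (P b)"
    using mult_right_mono[OF cb(2), of "cmod (Q b)"] mult_right_mono[OF cb(3), of "cmod (P b)"] by simp
  have sum: "cmod (P a) + cmod (Q b) \<le> 8 * (cmod \<gamma>a + cmod \<gamma>b) + 12 * N"
    using Pa Qb Pb Qa by argo
  have e1: "exp (- \<mu> * (t - a)) * cmod (P a) \<le> 1 * cmod (P a)" "exp (- \<mu> * (b - t)) * cmod (Q b) \<le> 1 * cmod (Q b)"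
    using t \<mu> by (intro mult_right_mono; simp)+
  have PQ: "cmod (P t) + cmod (Q t) \<le> 8 * (cmod \<gamma>a + cmod \<gamma>b) + 14 * N"
    using Pt[OF t] Qt[OF t] e1 sum by simp
  have "cmod (V t) \<le> (cmod (Q t) + cmod (P t)) / 2" unfolding UV(1)
    using norm_triangle_ineq[of "Q t" "P t"] by (simp add: norm_divide)
  then show "cmod (V t) \<le> 8 * (cmod \<gamma>a + cmod \<gamma>b) + 14 * (sqrt (b - a) * exp (\<mu> * (b - a)) * L2_norm (LI a b) q)"
    using PQ norm_ge_zero[of "P t"] norm_ge_zero[of "Q t"] unfolding N_def[symmetric] by argo
  have "\<mu> * cmod (U t) = cmod ((Q t - P t) / 2)"
    using arg_cong[OF UV(2)[of t], of cmod] \<mu> by (simp add: norm_mult)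
  then have "\<mu> * cmod (U t) \<le> (cmod (Q t) + cmod (P t)) / 2"
    using norm_triangle_ineq4[of "Q t" "P t"] by (simp add: norm_divide)
  then show "\<mu> * cmod (U t) \<le> 8 * (cmod \<gamma>a + cmod \<gamma>b) + 14 * (sqrt (b - a) * exp (\<mu> * (b - a)) * L2_norm (LI a b) q)"
    using PQ norm_ge_zero[of "P t"] norm_ge_zero[of "Q t"] unfolding N_def[symmetric] by argo
qed

text \<open>
  Variation of constants leaves \<open>P a\<close> and \<open>Q b\<close> free, and the same diagonally dominant system determines
  them from the boundary conditions.
\<close>

lemma boundary_value_exists:
  assumes q: "q \<in> L2 (LI a b)" and ab: "a \<le> b" and \<mu>: "\<mu> > 0" and small: "exp (- \<mu> * (b - a)) \<le> 1 / 6"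
    and \<sigma>: "cmod \<sigma>a = 1" "cmod \<sigma>b = 1" and \<theta>: "cmod \<theta>a \<le> \<mu> / 2" "cmod \<theta>b \<le> \<mu> / 2"
  obtains U V where "primitive_on a b U V" "primitive_on a b V (\<lambda>t. complex_of_real (\<mu>\<^sup>2) * U t + q t)"
    "\<sigma>a * V a + \<theta>a * U a = \<gamma>a" "\<sigma>b * V b + \<theta>b * U b = \<gamma>b"
proof -
  define \<epsilon> where "\<epsilon> = complex_of_real (exp (- \<mu> * (b - a)))"
  have \<epsilon>: "cmod \<epsilon> \<le> 1 / 6" using small by (simp add: \<epsilon>_def)
  let ?E1 = "\<lambda>t. complex_of_real (exp (\<mu> * (t - a)))" and ?E2 = "\<lambda>t. complex_of_real (exp (- \<mu> * (t - b)))"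
  have L: "(\<lambda>t. h t * q t) \<in> L2 (LI a b)" if h: "continuous_on {a..b} h" for h
  proof -
    have "bounded (h ` {a..b})" using h by (intro compact_imp_bounded compact_continuous_image) auto
    then obtain C where C: "\<And>t. t \<in> {a..b} \<Longrightarrow> cmod (h t) \<le> C" unfolding bounded_pos by blast
    show ?thesis by (rule L2_norm_mult_continuous_le(1)[OF q h C])
  qed
  obtain J1 where J1: "primitive_on a b J1 (\<lambda>t. ?E1 t * q t)" "J1 a = 0"
    by (rule primitive_on_exists[OF L ab, of ?E1 0]) (auto intro!: continuous_intros)
  obtain J2' where J2': "primitive_on a b J2' (\<lambda>t. ?E2 t * q t)"
    by (rule primitive_on_exists[OF L ab, of ?E2 0]) (auto intro!: continuous_intros)
  define J2 where "J2 t = J2' t - J2' b" for t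
  have J2: "primitive_on a b J2 (\<lambda>t. ?E2 t * q t)" "J2 b = 0"
    using primitive_on_minus[OF J2' primitive_on_const, of "J2' b"] by (simp_all add: J2_def[abs_def])
  define A1 B1 A2 B2 where "A1 = \<sigma>a / 2 - \<theta>a / (2 * complex_of_real \<mu>)" and "B1 = \<sigma>a / 2 + \<theta>a / (2 * complex_of_real \<mu>)"
    and "A2 = \<sigma>b / 2 + \<theta>b / (2 * complex_of_real \<mu>)" and "B2 = \<sigma>b / 2 - \<theta>b / (2 * complex_of_real \<mu>)"
  have co: "cmod A1 \<ge> 1 / 4" "cmod A2 \<ge> 1 / 4" "cmod B1 \<le> 3 / 4" "cmod B2 \<le> 3 / 4"
    using boundary_coefficients[OF \<sigma>(1) \<mu> \<theta>(1)] boundary_coefficients[OF \<sigma>(2) \<mu> \<theta>(2)]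
    by (simp_all add: A1_def A2_def B1_def B2_def)
  define det where "det = A1 * A2 - \<epsilon> * \<epsilon> * (B1 * B2)"
  have det: "det \<noteq> 0"
  proof
    assume "det = 0"
    then have "cmod (A1 * A2) = cmod (\<epsilon> * \<epsilon> * (B1 * B2))" by (simp add: det_def)
    moreover have "(1 / 4) * (1 / 4) \<le> cmod (A1 * A2)" unfolding norm_mult using co by (intro mult_mono) auto
    moreover have "cmod (\<epsilon> * \<epsilon> * (B1 * B2)) \<le> (1 / 6) * (1 / 6) * ((3 / 4) * (3 / 4))"
      unfolding norm_mult using co \<epsilon> by (intro mult_mono) auto
    ultimately show False by simp
  qed
  define r1 r2 where "r1 = \<gamma>a - B1 * \<epsilon> * J2 a" and "r2 = \<gamma>b - B2 * \<epsilon> * J1 b"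
  define P0 Q0 where "P0 = (r1 * A2 - \<epsilon> * B1 * r2) / det" and "Q0 = (A1 * r2 - \<epsilon> * B2 * r1) / det"
  have s1: "A1 * P0 + \<epsilon> * B1 * Q0 = r1"
  proof -
    have "A1 * P0 + \<epsilon> * B1 * Q0 = (A1 * (r1 * A2 - \<epsilon> * B1 * r2) + \<epsilon> * B1 * (A1 * r2 - \<epsilon> * B2 * r1)) / det"
      by (simp add: P0_def Q0_def add_divide_distrib)
    also have "A1 * (r1 * A2 - \<epsilon> * B1 * r2) + \<epsilon> * B1 * (A1 * r2 - \<epsilon> * B2 * r1) = r1 * det"
      by (simp add: det_def algebra_simps)
    finally show ?thesis using det by simp
  qed
  have s2: "\<epsilon> * B2 * P0 + A2 * Q0 = r2"
  proof -
    have "\<epsilon> * B2 * P0 + A2 * Q0 = (\<epsilon> * B2 * (r1 * A2 - \<epsilon> * B1 * r2) + A2 * (A1 * r2 - \<epsilon> * B2 * r1)) / det"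
      by (simp add: P0_def Q0_def add_divide_distrib)
    also have "\<epsilon> * B2 * (r1 * A2 - \<epsilon> * B1 * r2) + A2 * (A1 * r2 - \<epsilon> * B2 * r1) = r2 * det"
      by (simp add: det_def algebra_simps)
    finally show ?thesis using det by simp
  qed
  define P where "P t = complex_of_real (exp (- \<mu> * (t - a))) * (J1 t + P0)" for t
  define Q where "Q t = complex_of_real (exp (\<mu> * (t - b))) * (J2 t + Q0)" for t
  have "primitive_on a b (\<lambda>t. J1 t + P0) (\<lambda>t. ?E1 t * q t + 0)" by (rule primitive_on_add[OF J1(1) primitive_on_const])
  from exp_weighted_primitive[OF this ab, of "- \<mu>" a]
  have Pp: "primitive_on a b P (\<lambda>t. q t - complex_of_real \<mu> * P t)"
  proof -
    have x: "complex_of_real (exp (- \<mu> * (t - a))) * ?E1 t = 1" for t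
      unfolding of_real_mult[symmetric] by (simp flip: exp_add)
    have eq: "complex_of_real (exp (- \<mu> * (t - a))) * ((?E1 t * q t + 0) + complex_of_real (- \<mu>) * (J1 t + P0))
        = q t - complex_of_real \<mu> * P t" for t
      using x[of t] unfolding P_def distrib_left mult.assoc[symmetric] by (simp only: x) (simp add: algebra_simps)
    show ?thesis using exp_weighted_primitive[OF \<open>primitive_on a b (\<lambda>t. J1 t + P0) (\<lambda>t. ?E1 t * q t + 0)\<close> ab, of "- \<mu>" a]
      unfolding eq by (simp add: P_def[abs_def])
  qed
  have Q1: "primitive_on a b (\<lambda>t. J2 t + Q0) (\<lambda>t. ?E2 t * q t + 0)" by (rule primitive_on_add[OF J2(1) primitive_on_const])
  have Qp: "primitive_on a b Q (\<lambda>t. q t + complex_of_real \<mu> * Q t)"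
  proof -
    have x: "complex_of_real (exp (\<mu> * (t - b))) * ?E2 t = 1" for t
      unfolding of_real_mult[symmetric] by (simp flip: exp_add)
    have eq: "complex_of_real (exp (\<mu> * (t - b))) * ((?E2 t * q t + 0) + complex_of_real \<mu> * (J2 t + Q0))
        = q t + complex_of_real \<mu> * Q t" for t
      using x[of t] unfolding Q_def distrib_left mult.assoc[symmetric] by (simp only: x) (simp add: algebra_simps)
    show ?thesis using exp_weighted_primitive[OF Q1 ab, of \<mu> b] unfolding eq by (simp add: Q_def[abs_def])
  qed
  define U where "U t = 1 / (2 * complex_of_real \<mu>) * (Q t - P t)" for t
  define V where "V t = 1 / 2 * (Q t + P t)" for t
  have "primitive_on a b U (\<lambda>t. 1 / (2 * complex_of_real \<mu>) * ((q t + complex_of_real \<mu> * Q t) - (q t - complex_of_real \<mu> * P t)))"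
    unfolding U_def by (intro primitive_on_scale primitive_on_minus Pp Qp)
  moreover have "1 / (2 * complex_of_real \<mu>) * ((q t + complex_of_real \<mu> * Q t) - (q t - complex_of_real \<mu> * P t)) = V t" for t
  proof -
    have "(q t + complex_of_real \<mu> * Q t) - (q t - complex_of_real \<mu> * P t) = complex_of_real \<mu> * (Q t + P t)"
      by (simp add: algebra_simps)
    then show ?thesis using \<mu> by (simp add: V_def)
  qed
  ultimately have 1: "primitive_on a b U V" by simp
  have pV: "primitive_on a b V (\<lambda>t. 1 / 2 * ((q t + complex_of_real \<mu> * Q t) + (q t - complex_of_real \<mu> * P t)))"
    unfolding V_def by (intro primitive_on_scale primitive_on_add Pp Qp)
  have eV: "1 / 2 * ((q t + complex_of_real \<mu> * Q t) + (q t - complex_of_real \<mu> * P t)) = complex_of_real (\<mu>\<^sup>2) * U t + q t" for t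
  proof -
    have "complex_of_real (\<mu>\<^sup>2) * U t = complex_of_real \<mu> * (Q t - P t) / 2"
      using \<mu> by (simp add: U_def power2_eq_square)
    then show ?thesis by (simp add: algebra_simps add_divide_distrib diff_divide_distrib)
  qed
  have 2: "primitive_on a b V (\<lambda>t. complex_of_real (\<mu>\<^sup>2) * U t + q t)" using pV unfolding eV .
  have ends: "P a = P0" "Q b = Q0" "P b = \<epsilon> * (J1 b + P0)" "Q a = \<epsilon> * (J2 a + Q0)"
    using J1(2) J2(2) by (simp_all add: P_def Q_def \<epsilon>_def algebra_simps)
  have UV: "V t = (Q t + P t) / 2" "U t = (Q t - P t) / (2 * complex_of_real \<mu>)" for t
    by (simp_all add: U_def V_def)
  have "\<sigma>a * V a + \<theta>a * U a = A1 * P a + B1 * Q a"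
    unfolding UV boundary_split A1_def B1_def ..
  also have "\<dots> = (A1 * P0 + \<epsilon> * B1 * Q0) + B1 * \<epsilon> * J2 a" unfolding ends by (simp add: algebra_simps)
  also have "\<dots> = \<gamma>a" unfolding s1 by (simp add: r1_def)
  finally have 3: "\<sigma>a * V a + \<theta>a * U a = \<gamma>a" .
  have "\<sigma>b * V b + \<theta>b * U b = B2 * P b + A2 * Q b"
    unfolding UV boundary_split A2_def B2_def ..
  also have "\<dots> = (\<epsilon> * B2 * P0 + A2 * Q0) + B2 * \<epsilon> * J1 b" unfolding ends by (simp add: algebra_simps)
  also have "\<dots> = \<gamma>b" unfolding s2 by (simp add: r2_def)
  finally have 4: "\<sigma>b * V b + \<theta>b * U b = \<gamma>b" .
  show thesis by (rule that[OF 1 2 3 4])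
qed

context interval_domain
begin

subsection \<open>Normal derivatives\<close>

abbreviation \<nu> where "\<nu> p \<equiv> complex_of_real (outer_normal \<Omega> p \<bullet> e)"

lemma outer_normal_unit:
  assumes sb: "smooth_boundary \<Omega>" and p: "p \<in> frontier \<Omega>"
  shows "cmod (\<nu> p) = 1"
proof -
  obtain W \<psi> where ldf: "local_defining_function \<Omega> p W \<psi>"
    using sb p by (auto simp: smooth_boundary_def)
  then have d: "\<psi> differentiable (at p)" by (auto simp: local_defining_function_def intro: smooth_onD)
  then have "(\<psi> has_derivative frechet_derivative \<psi> (at p)) (at p)" by (simp add: frechet_derivative_works)
  moreover have "frechet_derivative \<psi> (at p) = (\<lambda>h. h \<bullet> (pd e \<psi> p *\<^sub>R e))"
    using frechet_derivative_eq_sum_pd[OF d] by (auto simp: Basis fun_eq_iff)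
  ultimately have "GDERIV \<psi> p :> (pd e \<psi> p *\<^sub>R e)" by (simp add: gderiv_def)
  then have "\<exists>\<nu> W \<psi> G. local_defining_function \<Omega> p W \<psi> \<and> (GDERIV \<psi> p :> G) \<and> \<nu> = sgn G" using ldf by blast
  from someI_ex[OF this] obtain W \<psi> G where "local_defining_function \<Omega> p W \<psi>" "GDERIV \<psi> p :> G"
    and o: "outer_normal \<Omega> p = sgn G" unfolding outer_normal_def by blast
  then have "G \<noteq> 0" by (auto simp: local_defining_function_def)
  then have "norm (outer_normal \<Omega> p) = 1" by (simp add: o norm_sgn)
  then show ?thesis using norm_eq[of "outer_normal \<Omega> p"] by simp
qed

lemma frechet_derivative_outer_normal:
  fixes w :: "'a \<Rightarrow> complex"
  assumes "smooth_on UNIV w"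
  shows "frechet_derivative w (at p) (outer_normal \<Omega> p) = \<nu> p * pd e w p"
  using frechet_derivative_eq_sum_pd[OF smooth_onD[OF assms], of p "outer_normal \<Omega> p"]
  by (simp add: Basis scaleR_conv_of_real)

lemma H32_norm_ge: "H1_norm \<Omega> u \<le> H32_norm \<Omega> u"
  unfolding H32_norm_def by (rule real_le_rsqrt) (auto intro!: sum_nonneg)

lemma represented2_V_le:
  assumes "represented2 u U V f" "t \<in> {a..b}"
  shows "cmod (V t) \<le> K * (H1_norm \<Omega> u + L2_norm M (weak_laplacian \<Omega> u))"
proof -
  have "cmod (V t) \<le> K * (L2_norm (LI a b) V + L2_norm (LI a b) f)"
    by (rule primitive_on_le_K[OF represented2D(2)[OF assms(1)] assms(2)])
  also have "\<dots> \<le> K * (H1_norm \<Omega> u + L2_norm M (weak_laplacian \<Omega> u))"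
    using K_pos represented_norm_le(2)[OF represented2D(1)[OF assms(1)]] weak_laplacian_represented2(3)[OF assms(1)]
    by (intro mult_left_mono add_mono) auto
  finally show ?thesis .
qed

text \<open>
  As for traces, with \<open>V\<close> in place of \<open>U\<close>.  For the converse the polynomials that approximate \<open>V\<close> are
  integrated once more, so that the resulting functions converge to \<open>u\<close> together with two derivatives.
\<close>

lemma has_normal_derivative_represented2:
  assumes sb: "smooth_boundary \<Omega>" and r: "represented2 u U V f"
  shows "has_normal_derivative \<Omega> u h \<longleftrightarrow> (\<forall>p\<in>frontier \<Omega>. h p = \<nu> p * V (p \<bullet> e))"
proof
  assume "has_normal_derivative \<Omega> u h"
  then obtain w :: "nat \<Rightarrow> 'a \<Rightarrow> complex" where w: "\<And>j. smooth_on UNIV (w j)" and 1: "(\<lambda>j. H32_norm \<Omega> (w j - u)) \<longlonglongrightarrow> 0"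
    and 2: "(\<lambda>j. L2_norm M (weak_laplacian \<Omega> (w j - u))) \<longlonglongrightarrow> 0"
    and 3: "(\<lambda>j. L2_norm S (\<lambda>p. frechet_derivative (w j) (at p) (outer_normal \<Omega> p) - h p)) \<longlonglongrightarrow> 0"
    unfolding has_normal_derivative_def by blast
  show "\<forall>p\<in>frontier \<Omega>. h p = \<nu> p * V (p \<bullet> e)"
  proof
    fix p assume p: "p \<in> frontier \<Omega>"
    note fp = frontier_point[OF p]
    have "(\<lambda>j. \<nu> p * pd e (w j) p - \<nu> p * V (p \<bullet> e)) \<longlonglongrightarrow> 0"
    proof (rule Lim_null_comparison)
      show "(\<lambda>j. K * (H32_norm \<Omega> (w j - u) + L2_norm M (weak_laplacian \<Omega> (w j - u)))) \<longlonglongrightarrow> 0"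
        using tendsto_mult_left[OF tendsto_add[OF 1 2], of K] by simp
      show "\<forall>\<^sub>F j in sequentially. norm (\<nu> p * pd e (w j) p - \<nu> p * V (p \<bullet> e))
          \<le> K * (H32_norm \<Omega> (w j - u) + L2_norm M (weak_laplacian \<Omega> (w j - u)))"
      proof (intro always_eventually allI)
        fix j
        have "norm (\<nu> p * pd e (w j) p - \<nu> p * V (p \<bullet> e)) = cmod (pd e (w j) p - V (p \<bullet> e))"
          using outer_normal_unit[OF sb p] by (simp only: right_diff_distrib[symmetric] norm_mult mult_1_left)
        also have "\<dots> \<le> K * (H1_norm \<Omega> (w j - u) + L2_norm M (weak_laplacian \<Omega> (w j - u)))"
          using represented2_V_le[OF represented2_diff[OF smooth_represented2[OF w] r] fp(2), of j] fp(1) by simp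
        also have "\<dots> \<le> K * (H32_norm \<Omega> (w j - u) + L2_norm M (weak_laplacian \<Omega> (w j - u)))"
          using K_pos H32_norm_ge by (intro mult_left_mono add_mono) auto
        finally show "norm (\<nu> p * pd e (w j) p - \<nu> p * V (p \<bullet> e))
          \<le> K * (H32_norm \<Omega> (w j - u) + L2_norm M (weak_laplacian \<Omega> (w j - u)))" .
      qed
    qed
    moreover have "(\<lambda>j. \<nu> p * pd e (w j) p - h p) \<longlonglongrightarrow> 0"
    proof (rule Lim_null_comparison[OF _ 3], intro always_eventually allI)
      fix j
      show "norm (\<nu> p * pd e (w j) p - h p) \<le> L2_norm S (\<lambda>p. frechet_derivative (w j) (at p) (outer_normal \<Omega> p) - h p)"
        using fp(3)[of "\<lambda>p. frechet_derivative (w j) (at p) (outer_normal \<Omega> p) - h p"]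
        by (simp add: frechet_derivative_outer_normal[OF w])
    qed
    ultimately have "(\<lambda>j. (\<nu> p * pd e (w j) p - \<nu> p * V (p \<bullet> e)) - (\<nu> p * pd e (w j) p - h p)) \<longlonglongrightarrow> 0 - 0"
      by (rule tendsto_diff)
    then show "h p = \<nu> p * V (p \<bullet> e)" by (simp add: LIMSEQ_const_iff)
  qed
next
  assume h: "\<forall>p\<in>frontier \<Omega>. h p = \<nu> p * V (p \<bullet> e)"
  have V: "primitive_on a b V f" by (rule represented2D(2)[OF r])
  have U: "primitive_on a b U V" using represented2D(1)[OF r] by (simp add: represented_def)
  obtain P q :: "nat \<Rightarrow> real \<Rightarrow> complex" where P: "\<And>j. polynomial_function (P j)" "\<And>j. polynomial_function (q j)"
    "\<And>j x. (P j has_vector_derivative q j x) (at x)" "\<And>j. primitive_on a b (P j) (q j)"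
    and lim: "(\<lambda>j. L2_norm (LI a b) (q j - f)) \<longlonglongrightarrow> 0"
    and close: "\<And>j t. t \<in> {a..b} \<Longrightarrow> cmod (P j t - V t) \<le> sqrt (b - a) * L2_norm (LI a b) (q j - f)"
    by (rule primitive_on_polynomial_approx[OF V ab']) blast
  have "\<exists>Q. polynomial_function Q \<and> (\<forall>x. (Q has_vector_derivative P j x) (at x)) \<and> Q a = U a" for j
    by (rule polynomial_antiderivative[OF P(1), of j a "U a"]) blast
  then obtain Q where Q: "\<And>j. polynomial_function (Q j)" "\<And>j x. (Q j has_vector_derivative P j x) (at x)"
    "\<And>j. Q j a = U a" by metis
  \<comment> \<open>\<open>Q j\<close> has derivative \<open>P j\<close>, which is close to \<open>V\<close>, and starts at \<open>U a\<close>.\<close>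
  define w :: "nat \<Rightarrow> 'a \<Rightarrow> complex" where "w j = (\<lambda>x. Q j (x \<bullet> e))" for j
  have smooth: "smooth_on UNIV (w j)" and pdw: "pd e (w j) = (\<lambda>x. P j (x \<bullet> e))" for j
    unfolding w_def by (rule polynomial_lift[OF Q(1,2)])+
  have Qp: "primitive_on a b (Q j) (P j)" for j
    by (rule primitive_on_C1[OF has_vector_derivative_at_within[OF Q(2)] continuous_on_polynomial[OF P(1)] ab'])
  have rw: "represented2 (w j) (Q j) (P j) (q j)" for j
    unfolding represented2_def w_def using represented_lift[OF Qp] P(4) by blast
  note rd = represented2_diff[OF rw r]
  define n where "n j = L2_norm (LI a b) (q j - f)" for j
  have n0: "n j \<ge> 0" for j by (simp add: n_def)
  have nlim: "n \<longlonglongrightarrow> 0" using lim by (simp add: n_def[abs_def])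
  define l where "l = sqrt (b - a)"
  have l: "l \<ge> 0" using ab by (simp add: l_def)
  have PV: "L2_norm (LI a b) (\<lambda>t. P j t - V t) \<le> l * n j * l" for j
    unfolding l_def n_def using close ab' primitive_on_continuous[OF P(4)] primitive_on_continuous[OF V]
    by (intro L2_LI_sup_le(2) continuous_on_diff) auto
  have QU: "L2_norm (LI a b) (\<lambda>t. Q j t - U t) \<le> l * (l * n j * l) * l" for j
    unfolding l_def
  proof (rule L2_LI_sup_le(2)[OF _ _ _ ab'])
    show "continuous_on {a..b} (\<lambda>t. Q j t - U t)"
      by (intro continuous_on_diff primitive_on_continuous[OF Qp] primitive_on_continuous[OF U])
    fix t assume t: "t \<in> {a..b}"
    have "cmod ((Q j t - U t) - (Q j a - U a)) \<le> sqrt \<bar>t - a\<bar> * L2_norm (LI a b) (\<lambda>t. P j t - V t)"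
      using t by (intro primitive_on_increment[OF primitive_on_minus[OF Qp U]]) auto
    also have "\<dots> \<le> sqrt (b - a) * (l * n j * l)"
      using t PV[of j] by (intro mult_mono) auto
    finally show "cmod (Q j t - U t) \<le> sqrt (b - a) * (sqrt (b - a) * n j * sqrt (b - a))" by (simp add: Q(3) l_def)
  qed (use n0 ab in simp)
  have H1le: "H1_norm \<Omega> (w j - u) \<le> (l * l * l * l + l * l) * n j" for j
  proof -
    have "H1_norm \<Omega> (w j - u) \<le> L2_norm (LI a b) (\<lambda>t. Q j t - U t) + L2_norm (LI a b) (\<lambda>t. P j t - V t)"
      by (rule represented_H1_norm_le[OF represented2D(1)[OF rd]])
    also have "\<dots> \<le> l * (l * n j * l) * l + l * n j * l" by (intro add_mono QU PV)
    finally show ?thesis by (simp add: algebra_simps)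
  qed
  have gle: "enn2real (gagliardo_half \<Omega> (weak_pd \<Omega> e (w j - u))) \<le> 16 * (b - a) * (n j)\<^sup>2" for j
  proof -
    have "gagliardo_half \<Omega> (weak_pd \<Omega> e (w j - u)) \<le> ennreal (16 * (b - a) * (n j)\<^sup>2)"
      using represented2_gagliardo[OF rd, of j] by (simp add: n_def fun_diff_def)
    then show ?thesis using ab by (intro enn2real_leI) auto
  qed
  have "(\<lambda>j. H32_norm \<Omega> (w j - u)) \<longlonglongrightarrow> 0"
  proof (rule Lim_null_comparison)
    show "(\<lambda>j. sqrt (((l * l * l * l + l * l) * n j)\<^sup>2 + 16 * (b - a) * (n j)\<^sup>2)) \<longlonglongrightarrow> 0"
    proof -
      have "(\<lambda>j. sqrt (((l * l * l * l + l * l) * n j)\<^sup>2 + 16 * (b - a) * (n j)\<^sup>2))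
          \<longlonglongrightarrow> sqrt (((l * l * l * l + l * l) * 0)\<^sup>2 + 16 * (b - a) * 0\<^sup>2)"
        by (intro tendsto_intros nlim)
      then show ?thesis by simp
    qed
    show "\<forall>\<^sub>F j in sequentially. norm (H32_norm \<Omega> (w j - u)) \<le> sqrt (((l * l * l * l + l * l) * n j)\<^sup>2 + 16 * (b - a) * (n j)\<^sup>2)"
    proof (intro always_eventually allI)
      fix j
      have "(H1_norm \<Omega> (w j - u))\<^sup>2 \<le> ((l * l * l * l + l * l) * n j)\<^sup>2" using H1le by (intro power_mono) auto
      then have "H32_norm \<Omega> (w j - u) \<le> sqrt (((l * l * l * l + l * l) * n j)\<^sup>2 + 16 * (b - a) * (n j)\<^sup>2)"
        using gle[of j] unfolding H32_norm_def by (intro real_sqrt_le_mono add_mono) (simp_all add: Basis)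
      moreover have "0 \<le> H32_norm \<Omega> (w j - u)" using order_trans[OF H1_norm_nonneg H32_norm_ge] .
      ultimately show "norm (H32_norm \<Omega> (w j - u)) \<le> sqrt (((l * l * l * l + l * l) * n j)\<^sup>2 + 16 * (b - a) * (n j)\<^sup>2)" by simp
    qed
  qed
  moreover have "(\<lambda>j. L2_norm M (weak_laplacian \<Omega> (w j - u))) \<longlonglongrightarrow> 0"
    using lim weak_laplacian_represented2(3)[OF rd] by (simp add: fun_diff_def)
  moreover have "(\<lambda>j. L2_norm S (\<lambda>p. frechet_derivative (w j) (at p) (outer_normal \<Omega> p) - h p)) \<longlonglongrightarrow> 0"
  proof (rule Lim_null_comparison)
    show "(\<lambda>j. 2 * (l * n j)) \<longlonglongrightarrow> 0" using tendsto_mult_left[OF tendsto_mult_left[OF nlim, of l], of 2] by simp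
    show "\<forall>\<^sub>F j in sequentially. norm (L2_norm S (\<lambda>p. frechet_derivative (w j) (at p) (outer_normal \<Omega> p) - h p)) \<le> 2 * (l * n j)"
    proof (intro always_eventually allI)
      fix j
      have le: "cmod (frechet_derivative (w j) (at p) (outer_normal \<Omega> p) - h p) \<le> l * n j" if p: "p \<in> frontier \<Omega>" for p
      proof -
        have "frechet_derivative (w j) (at p) (outer_normal \<Omega> p) - h p = \<nu> p * (P j (p \<bullet> e) - V (p \<bullet> e))"
          using h p by (simp add: frechet_derivative_outer_normal[OF smooth] pdw right_diff_distrib)
        then show ?thesis using close[OF frontier_point(2)[OF p], of j] outer_normal_unit[OF sb p]
          by (simp only: norm_mult mult_1_left n_def l_def)
      qed
      show "norm (L2_norm S (\<lambda>p. frechet_derivative (w j) (at p) (outer_normal \<Omega> p) - h p)) \<le> 2 * (l * n j)"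
        using L2_norm_S_le[of "\<lambda>p. frechet_derivative (w j) (at p) (outer_normal \<Omega> p) - h p"]
          le[of "a *\<^sub>R e"] le[of "b *\<^sub>R e"] by (simp add: frontier_\<Omega>)
    qed
  qed
  ultimately show "has_normal_derivative \<Omega> u h"
    unfolding has_normal_derivative_def using represented2_H32_laplacian[OF r] smooth L2_S by blast
qed

lemma normal_derivative_represented2:
  assumes sb: "smooth_boundary \<Omega>" and r: "represented2 u U V f" and p: "p \<in> frontier \<Omega>"
  shows "normal_derivative \<Omega> u p = \<nu> p * V (p \<bullet> e)"
proof -
  have "has_normal_derivative \<Omega> u (\<lambda>p. \<nu> p * V (p \<bullet> e))" by (simp add: has_normal_derivative_represented2[OF sb r])
  then have "has_normal_derivative \<Omega> u (normal_derivative \<Omega> u)"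
    unfolding normal_derivative_def by (auto intro: someI[where P = "has_normal_derivative \<Omega> u"])
  then show ?thesis using p by (simp add: has_normal_derivative_represented2[OF sb r])
qed

lemma H1_norm_0: "H1_norm \<Omega> 0 = 0" "H1_norm \<Omega> (\<lambda>x. 0) = 0"
  using represented_H1_norm[OF represented_lift[OF primitive_on_const[of a b 0]]] by (simp_all add: zero_fun_def)

lemma H1_L2_facts:
  assumes "u \<in> H1 \<Omega>"
  shows "(\<lambda>t. u (t *\<^sub>R e)) \<in> L2 (LI a b)" "L2_norm (LI a b) (\<lambda>t. u (t *\<^sub>R e)) \<le> H1_norm \<Omega> u"
  using H1_L2[OF assms] L2_norm_M[OF L2_measurable[OF H1_L2[OF assms]]] L2_norm_le_H1_norm[of \<Omega> u]
  by (simp_all add: L2_M_iff[of u])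

end

section \<open>The acoustic wave operator on an interval\<close>

locale acoustic_interval = interval_domain e a b \<Omega>
  for e :: "'a::euclidean_space" and a b :: real and \<Omega> :: "'a set" +
  fixes c :: real and \<rho> m :: "'a \<Rightarrow> real" and d k :: "'a \<Rightarrow> complex"
  assumes smooth: "smooth_boundary \<Omega>" and c: "c > 0" and m_pos: "\<And>p. p \<in> frontier \<Omega> \<Longrightarrow> m p > 0"
begin

abbreviation r where "r p \<equiv> complex_of_real (\<rho> p / m p)"
abbreviation dm where "dm p \<equiv> d p / complex_of_real (m p)"
abbreviation km where "km p \<equiv> k p / complex_of_real (m p)"
abbreviation T where "T \<equiv> acoustic_op \<Omega> c \<rho> m d k"
abbreviation D where "D \<equiv> acoustic_dom \<Omega> \<rho> m"
abbreviation N where "N \<equiv> state_norm \<Omega>"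

lemma domD:
  assumes "(u, v, x, y) \<in> D"
  obtains U V where "represented2 u U V (\<lambda>t. weak_laplacian \<Omega> u (t *\<^sub>R e))" "v \<in> H1 \<Omega>"
    "\<And>p. p \<in> frontier \<Omega> \<Longrightarrow> y p = \<nu> p * V (p \<bullet> e) + r p * U (p \<bullet> e)"
proof -
  have u: "u \<in> H32_laplacian \<Omega>" and v: "v \<in> H1 \<Omega>" and y: "AE p in S. R_op \<Omega> \<rho> m u p = y p"
    using assms by (auto simp: acoustic_dom_def A_dom_def)
  obtain U V where R: "represented2 u U V (\<lambda>t. weak_laplacian \<Omega> u (t *\<^sub>R e))"
    by (rule H32_laplacian_represented2[OF u])
  have "y p = \<nu> p * V (p \<bullet> e) + r p * U (p \<bullet> e)" if p: "p \<in> frontier \<Omega>" for p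
  proof -
    have "y p = R_op \<Omega> \<rho> m u p" using y p by (auto simp: AE_S_iff frontier_\<Omega>)
    then show ?thesis
      by (simp add: R_op_def normal_derivative_represented2[OF smooth R p] boundary_trace_represented[OF represented2D(1)[OF R] p])
  qed
  then show thesis using that R v by blast
qed

lemma domI:
  assumes R: "represented2 u U V f" and v: "v \<in> H1 \<Omega>"
    and y: "\<And>p. p \<in> frontier \<Omega> \<Longrightarrow> y p = \<nu> p * V (p \<bullet> e) + r p * U (p \<bullet> e)"
  shows "(u, v, x, y) \<in> D"
proof -
  have "R_op \<Omega> \<rho> m u p = y p" if "p \<in> frontier \<Omega>" for p
    using y[OF that] by (simp add: R_op_def normal_derivative_represented2[OF smooth R that]
        boundary_trace_represented[OF represented2D(1)[OF R] that])
  then have "AE p in S. R_op \<Omega> \<rho> m u p = y p" by (simp add: AE_S_iff frontier_\<Omega>)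
  then show ?thesis using represented2_H32_laplacian[OF R] v by (simp add: acoustic_dom_def A_dom_def)
qed

lemma op_boundary:
  assumes R: "represented2 u U V f" and p: "p \<in> frontier \<Omega>"
    and T: "T (u, v, x, y) = (T1, T2, T3, T4)"
  shows "T3 p = \<nu> p * V (p \<bullet> e)" "T4 p = dm p * r p * U (p \<bullet> e) - km p * x p - dm p * y p"
  using T normal_derivative_represented2[OF smooth R p] boundary_trace_represented[OF represented2D(1)[OF R] p]
  by (auto simp: L_op_def B1_op_def B2_op_def B3_op_def B4_op_def)

text \<open>
  Elimination of \<open>x\<close> and \<open>y\<close> from the last two rows of the resolvent equation at a boundary point,
  where \<open>n\<close> is the normal derivative and \<open>U\<close> the boundary value of \<open>u\<close>.
\<close>

lemma boundary_identity:
  fixes \<zeta> \<alpha> n U x r dm km :: complex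
  assumes "\<zeta> \<noteq> 0" "\<alpha> \<noteq> 0" "\<alpha> = \<zeta> + dm + km / \<zeta>"
  shows "\<zeta> * (n + r * U) - (dm * r * U - km * x - dm * (n + r * U)) - km * (\<zeta> * x - n) / \<zeta>
    = \<alpha> * (n + \<zeta> * r / \<alpha> * U)"
proof -
  have "\<alpha> * (n + \<zeta> * r / \<alpha> * U) = (\<zeta> + dm + km / \<zeta>) * n + \<zeta> * r * U"
    unfolding assms(3)[symmetric] using assms(2) by (simp add: distrib_left)
  moreover have "km * (\<zeta> * x - n) / \<zeta> = km * x - km / \<zeta> * n" using assms(1) by (simp add: field_simps)
  ultimately show ?thesis by (simp add: algebra_simps)
qed

text \<open>
  For large real \<open>\<zeta>\<close>, eliminating \<open>v\<close>, \<open>x\<close> and \<open>y\<close> from \<open>\<zeta> U - T U = F\<close> leaves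
  \<open>u'' = (\<zeta> / c)\<^sup>2 u + q\<close> with the boundary conditions \<open>\<partial>\<^sub>\<nu>u + \<theta> u = \<gamma>\<close>, where \<open>\<theta>\<close> stays
  bounded as \<open>\<zeta>\<close> grows.
\<close>

lemma resolvent_set_nonempty:
  "resolvent_set (state_space \<Omega>) N state_scale D T \<noteq> {}"
proof -
  define B where "B = (\<Sum>p\<in>frontier \<Omega>. cmod (dm p) + cmod (km p) + cmod (r p))"
  have le_B: "cmod (dm p) \<le> B" "cmod (km p) \<le> B" "cmod (r p) \<le> B" if p: "p \<in> frontier \<Omega>" for p
  proof -
    have "cmod (dm p) + cmod (km p) + cmod (r p) \<le> B" unfolding B_def
      by (rule member_le_sum[OF p, of "\<lambda>p. cmod (dm p) + cmod (km p) + cmod (r p)"])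
         (auto simp: frontier_\<Omega> simp del: norm_divide of_real_divide)
    then show "cmod (dm p) \<le> B" "cmod (km p) \<le> B" "cmod (r p) \<le> B"
      using norm_ge_zero[of "dm p"] norm_ge_zero[of "km p"] norm_ge_zero[of "r p"] by linarith+
  qed
  have B0: "B \<ge> 0" using le_B(1)[of "a *\<^sub>R e"] order_trans[OF norm_ge_zero] by (auto simp: frontier_\<Omega>)
  \<comment> \<open>The four summands keep \<open>z\<close> away from \<open>0\<close>, \<open>\<alpha>\<close> above \<open>\<zeta> / 2\<close>, \<open>\<theta>\<close> below \<open>\<mu> / 2\<close> and the coupling below \<open>1/6\<close>.\<close>
  define \<zeta> where "\<zeta> = 1 + 4 * B + 4 * B * c + 6 * c / (b - a)"
  have \<zeta>: "\<zeta> \<ge> 1" "\<zeta> \<ge> 4 * B" "\<zeta> \<ge> 4 * B * c" "\<zeta> \<ge> 6 * c / (b - a)"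
    using B0 c ab unfolding \<zeta>_def by (auto intro!: add_increasing add_increasing2)
  define z where "z = complex_of_real \<zeta>"
  have z0: "z \<noteq> 0" "cmod z = \<zeta>" using \<zeta>(1) by (auto simp: z_def)
  define \<mu> where "\<mu> = \<zeta> / c"
  have \<mu>: "\<mu> > 0" using \<zeta>(1) c by (simp add: \<mu>_def)
  have small: "exp (- \<mu> * (b - a)) \<le> 1 / 6"
  proof -
    have "6 \<le> \<mu> * (b - a)" using \<zeta>(4) c ab by (simp add: \<mu>_def field_simps)
    then have "6 \<le> exp (\<mu> * (b - a))" using exp_ge_add_one_self[of "\<mu> * (b - a)"] by linarith
    then show ?thesis by (simp add: exp_minus inverse_eq_divide divide_simps)
  qed
  \<comment> \<open>\<open>\<alpha>\<close> is the coefficient of \<open>y\<close> once \<open>x\<close> has been eliminated.\<close>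
  define \<alpha> where "\<alpha> p = z + dm p + km p / z" for p
  have \<alpha>: "cmod (\<alpha> p) \<ge> \<zeta> / 2" if p: "p \<in> frontier \<Omega>" for p
  proof -
    have "cmod (km p / z) \<le> B / 1" unfolding norm_divide[of "km p" z] z0(2)
      using le_B(2)[OF p] \<zeta>(1) B0 by (intro frac_le) auto
    moreover have "cmod z \<le> cmod (\<alpha> p) + cmod (dm p) + cmod (km p / z)"
      using norm_triangle_ineq4[of "\<alpha> p - dm p" "km p / z"] norm_triangle_ineq4[of "\<alpha> p" "dm p"] by (simp add: \<alpha>_def)
    ultimately show ?thesis using le_B(1)[OF p] \<zeta>(2) z0(2) by linarith
  qed
  have \<alpha>0: "\<alpha> p \<noteq> 0" if "p \<in> frontier \<Omega>" for p using \<alpha>[OF that] \<zeta>(1) by auto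
  define \<theta> where "\<theta> p = z * r p / \<alpha> p" for p
  have \<theta>: "cmod (\<theta> p) \<le> \<mu> / 2" if p: "p \<in> frontier \<Omega>" for p
  proof -
    have "cmod (\<theta> p) = \<zeta> * cmod (r p) / cmod (\<alpha> p)" unfolding \<theta>_def norm_divide[of "z * r p"] norm_mult z0(2) ..
    also have "\<dots> \<le> \<zeta> * B / (\<zeta> / 2)" using \<alpha>[OF p] le_B(3)[OF p] \<zeta>(1) B0 by (intro frac_le mult_left_mono) auto
    also have "\<dots> = 2 * B" using \<zeta>(1) by simp
    also have "\<dots> \<le> \<mu> / 2" using \<zeta>(3) c by (simp add: \<mu>_def field_simps)
    finally show ?thesis .
  qed
  have ends: "a *\<^sub>R e \<in> frontier \<Omega>" "b *\<^sub>R e \<in> frontier \<Omega>" by (simp_all add: frontier_\<Omega>)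
  have \<mu>2: "complex_of_real (\<mu>\<^sup>2) = z * z / complex_of_real (c\<^sup>2)" by (simp add: \<mu>_def z_def power_divide power2_eq_square)
  have c2: "complex_of_real (c\<^sup>2) \<noteq> 0" using c by simp
  have canc: "A - C = A' - C \<Longrightarrow> A = A'" for A A' C :: complex by simp
  have alg: "A * (z * z / A * X + - (1 / A) * Y) = z * z * X - Y" if "A \<noteq> 0" for A X Y :: complex
    using that by (simp add: field_simps)
  have "\<exists>U\<in>D. N (state_scale z U - T U - F) = 0" if F: "F \<in> state_space \<Omega>" for F
  proof -
    obtain F1 F2 F3 F4 where FF: "F = (F1, F2, F3, F4)" by (cases F)
    have F1: "F1 \<in> H1 \<Omega>" and F2: "F2 \<in> L2 M" using F by (auto simp: FF state_space_def)
    define q where "q t = - (1 / complex_of_real (c\<^sup>2)) * (z * F1 (t *\<^sub>R e) + F2 (t *\<^sub>R e))" for t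
    have q: "q \<in> L2 (LI a b)"
      using L2_scale[OF L2_add[OF L2_scale[OF H1_L2_facts(1)[OF F1], of z] F2[unfolded L2_M_iff[of F2]]], of "- (1 / complex_of_real (c\<^sup>2))"]
      by (simp add: q_def[abs_def] plus_fun_def)
    define \<gamma> where "\<gamma> p = (F4 p - km p * F3 p / z) / \<alpha> p" for p
    obtain U V where U: "primitive_on a b U V" and V: "primitive_on a b V (\<lambda>t. complex_of_real (\<mu>\<^sup>2) * U t + q t)"
      and bca: "\<nu> (a *\<^sub>R e) * V a + \<theta> (a *\<^sub>R e) * U a = \<gamma> (a *\<^sub>R e)" and bcb: "\<nu> (b *\<^sub>R e) * V b + \<theta> (b *\<^sub>R e) * U b = \<gamma> (b *\<^sub>R e)"
      by (rule boundary_value_exists[OF q ab' \<mu> small outer_normal_unit[OF smooth ends(1)] outer_normal_unit[OF smooth ends(2)]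
            \<theta>[OF ends(1)] \<theta>[OF ends(2)]])
    define u where "u x = U (x \<bullet> e)" for x
    have R: "represented2 u U V (\<lambda>t. complex_of_real (\<mu>\<^sup>2) * U t + q t)"
      unfolding u_def[abs_def] represented2_def using represented_lift[OF U] V by blast
    define v where "v = (\<lambda>t. z * u t) - F1"
    have ru: "represented u U V" by (rule represented2D(1)[OF R])
    obtain G where G: "represented F1 G (\<lambda>t. weak_pd \<Omega> e F1 (t *\<^sub>R e))" by (rule H1_represented[OF F1])
    have v: "v \<in> H1 \<Omega>" unfolding v_def by (rule represented_H1[OF represented_diff[OF represented_scale[OF ru] G]])
    define y where "y = R_op \<Omega> \<rho> m u"
    define x where "x = (\<lambda>p. (F3 p + L_op \<Omega> u p) / z)"
    have yp: "y p = \<nu> p * V (p \<bullet> e) + r p * U (p \<bullet> e)" if p: "p \<in> frontier \<Omega>" for p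
      by (simp add: y_def R_op_def normal_derivative_represented2[OF smooth R p] boundary_trace_represented[OF ru p])
    have dom: "(u, v, x, y) \<in> D" by (rule domI[OF R v yp])
    obtain E1 E2 E3 E4 where EE: "state_scale z (u, v, x, y) - T (u, v, x, y) - F = (E1, E2, E3, E4)" by (metis prod_cases4)
    have E: "E1 = (\<lambda>t. z * u t) - v - F1" "E2 = (\<lambda>t. z * v t) - A_op \<Omega> c u - F2" "E3 = (\<lambda>t. z * x t) - L_op \<Omega> u - F3"
      "E4 = (\<lambda>t. z * y t) - ((B1_op u + B4_op d m (B2_op \<Omega> \<rho> m u)) + B3_op k m x + B4_op d m y) - F4"
      using EE by (auto simp: FF)
    have "E1 = 0" unfolding E(1) v_def by (simp add: fun_eq_iff)
    then have n1: "H1_norm \<Omega> E1 = 0" by (simp add: H1_norm_0)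
    have wl: "weak_laplacian \<Omega> u \<in> borel_measurable M" "AE t in LI a b. weak_laplacian \<Omega> u (t *\<^sub>R e) = complex_of_real (\<mu>\<^sup>2) * U t + q t"
      using weak_laplacian_represented2[OF R] by auto
    have "AE t in LI a b. E2 (t *\<^sub>R e) = 0"
      using wl(2)
    proof eventually_elim
      case (elim t)
      have "complex_of_real (c\<^sup>2) * weak_laplacian \<Omega> u (t *\<^sub>R e) = z * z * U t - (z * F1 (t *\<^sub>R e) + F2 (t *\<^sub>R e))"
        unfolding elim \<mu>2 q_def by (rule alg[OF c2])
      then show ?case by (simp add: E(2) A_op_def v_def u_def algebra_simps)
    qed
    then have "AE x in M. E2 x = 0" by (simp add: AE_M_iff[of "\<lambda>x. E2 x = 0"])
    moreover have "E2 \<in> borel_measurable M"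
      unfolding E(2) A_op_def fun_diff_def
      using L2_measurable[OF H1_L2[OF v]] wl(1) L2_measurable[OF F2]
      by (intro borel_measurable_diff borel_measurable_times) auto
    ultimately have n2: "L2_norm M E2 = 0" using L2_norm_cong_AE[of E2 M "\<lambda>x. 0"] by simp
    have "E3 = (\<lambda>p. 0)" unfolding E(3) x_def using z0(1) by (simp add: fun_eq_iff)
    then have n3: "L2_norm S E3 = 0" by simp
    define T4 where "T4 = (B1_op u + B4_op d m (B2_op \<Omega> \<rho> m u)) + B3_op k m x + B4_op d m y"
    have T4: "T (u, v, x, y) = (v, A_op \<Omega> c u, L_op \<Omega> u, T4)" by (simp add: T4_def)
    have "E4 p = 0" if p: "p \<in> frontier \<Omega>" for p
    proof -
      have bc: "\<nu> p * V (p \<bullet> e) + \<theta> p * U (p \<bullet> e) = \<gamma> p"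
        using p bca bcb by (auto simp: frontier_\<Omega>)
      have x: "z * x p - \<nu> p * V (p \<bullet> e) = F3 p"
        using z0(1) normal_derivative_represented2[OF smooth R p] by (simp add: x_def L_op_def)
      have "z * y p - (dm p * r p * U (p \<bullet> e) - km p * x p - dm p * y p) - km p * F3 p / z = \<alpha> p * \<gamma> p"
        using boundary_identity[OF z0(1) \<alpha>0[OF p] \<alpha>_def, of "\<nu> p * V (p \<bullet> e)" "r p" "U (p \<bullet> e)" "x p"]
        unfolding yp[OF p] x bc[symmetric] \<theta>_def by simp
      also have "\<dots> = F4 p - km p * F3 p / z" using \<alpha>0[OF p] by (simp add: \<gamma>_def)
      finally have "z * y p - (dm p * r p * U (p \<bullet> e) - km p * x p - dm p * y p) = F4 p" by (rule canc)
      then have "z * y p - T4 p = F4 p" unfolding op_boundary(2)[OF R p T4] .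
      then show ?thesis unfolding E(4) T4_def by simp
    qed
    then have n4: "L2_norm S E4 = 0" by (simp add: L2_norm_S frontier_\<Omega>)
    have "N (state_scale z (u, v, x, y) - T (u, v, x, y) - F) = 0"
      unfolding EE by (simp add: n1 n2 n3 n4)
    then show ?thesis using dom by blast
  qed
  moreover have "\<exists>C. \<forall>U\<in>D. N U \<le> C * N (state_scale z U - T U)"
  proof -
    define s where "s = sqrt (b - a)"
    have s: "s \<ge> 0" using ab by (simp add: s_def)
    define C1 where "C1 = 32 * (1 + B) + 14 * (s * exp (\<mu> * (b - a)) * ((\<zeta> + 1) / c\<^sup>2))"
    have C1: "C1 \<ge> 0" using B0 s \<zeta>(1) by (auto simp: C1_def intro!: add_nonneg_nonneg)
    define C2 where "C2 = C1 / \<mu>"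
    have C2: "C2 \<ge> 0" using C1 \<mu> by (simp add: C2_def)
    have "N X \<le> (((C2 + C1) * s) + (\<zeta> * ((C2 + C1) * s) + 1) + 2 * (1 + C1) + 2 * (C1 + B * C2)) * N (state_scale z X - T X)"
      if X: "X \<in> D" for X
    proof -
      obtain u v x y where XX: "X = (u, v, x, y)" by (cases X)
      obtain U V where R: "represented2 u U V (\<lambda>t. weak_laplacian \<Omega> u (t *\<^sub>R e))" and v: "v \<in> H1 \<Omega>"
        and yp: "\<And>p. p \<in> frontier \<Omega> \<Longrightarrow> y p = \<nu> p * V (p \<bullet> e) + r p * U (p \<bullet> e)"
        by (rule domD[OF X[unfolded XX]]) blast
      have ru: "represented u U V" by (rule represented2D(1)[OF R])
      have Up: "primitive_on a b U V" using ru by (simp add: represented_def)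
      obtain F1 F2 F3 F4 where FF: "state_scale z X - T X = (F1, F2, F3, F4)" by (metis prod_cases4)
      have F: "F1 = (\<lambda>t. z * u t) - v" "F2 = (\<lambda>t. z * v t) - A_op \<Omega> c u" "F3 = (\<lambda>t. z * x t) - L_op \<Omega> u"
        "F4 = (\<lambda>t. z * y t) - ((B1_op u + B4_op d m (B2_op \<Omega> \<rho> m u)) + B3_op k m x + B4_op d m y)"
        using FF by (auto simp: XX)
      define n where "n = N (state_scale z X - T X)"
      have n0: "n \<ge> 0" unfolding n_def by (rule state_norm_nonneg)
      have nF: "H1_norm \<Omega> F1 \<le> n" "L2_norm M F2 \<le> n" "L2_norm S F3 \<le> n" "L2_norm S F4 \<le> n"
        unfolding n_def using state_norm_components[OF FF, of \<Omega>] by auto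
      obtain W where W: "represented v W (\<lambda>t. weak_pd \<Omega> e v (t *\<^sub>R e))" by (rule H1_represented[OF v])
      have F1: "F1 \<in> H1 \<Omega>" unfolding F(1) by (rule represented_H1[OF represented_diff[OF represented_scale[OF ru] W]])
      have AL: "A_op \<Omega> c u \<in> L2 M"
      proof -
        have "weak_laplacian \<Omega> u \<in> L2 M" using primitive_onD[OF represented2D(2)[OF R]] by (simp add: L2_M_iff[of "weak_laplacian \<Omega> u"])
        then show ?thesis unfolding A_op_def by (rule L2_scale)
      qed
      have F2: "F2 \<in> L2 M" unfolding F(2) by (intro L2_diff L2_scale H1_L2[OF v] AL)
      define q where "q t = - (1 / complex_of_real (c\<^sup>2)) * (z * F1 (t *\<^sub>R e) + F2 (t *\<^sub>R e))" for t
      have LF: "(\<lambda>t. z * F1 (t *\<^sub>R e)) \<in> L2 (LI a b)" "(\<lambda>t. F2 (t *\<^sub>R e)) \<in> L2 (LI a b)"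
        using L2_scale[OF H1_L2_facts(1)[OF F1]] F2 by (auto simp: L2_M_iff[of F2])
      have q: "q \<in> L2 (LI a b)"
        using L2_scale[OF L2_add[OF LF], of "- (1 / complex_of_real (c\<^sup>2))"] by (simp add: q_def[abs_def] plus_fun_def)
      have qn: "L2_norm (LI a b) q \<le> (\<zeta> + 1) / c\<^sup>2 * n"
      proof -
        have "L2_norm (LI a b) q = 1 / c\<^sup>2 * L2_norm (LI a b) ((\<lambda>t. z * F1 (t *\<^sub>R e)) + (\<lambda>t. F2 (t *\<^sub>R e)))"
          unfolding q_def[abs_def] plus_fun_def L2_norm_scale by (simp add: norm_divide norm_power)
        also have "\<dots> \<le> 1 / c\<^sup>2 * (\<zeta> * n + n)"
        proof (rule mult_left_mono)
          have "L2_norm (LI a b) (\<lambda>t. z * F1 (t *\<^sub>R e)) \<le> \<zeta> * n"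
            unfolding L2_norm_scale z0(2) using H1_L2_facts(2)[OF F1] nF(1) \<zeta>(1) by (intro mult_left_mono) auto
          moreover have "L2_norm (LI a b) (\<lambda>t. F2 (t *\<^sub>R e)) \<le> n" using nF(2) L2_norm_M[OF L2_measurable[OF F2]] by simp
          ultimately show "L2_norm (LI a b) ((\<lambda>t. z * F1 (t *\<^sub>R e)) + (\<lambda>t. F2 (t *\<^sub>R e))) \<le> \<zeta> * n + n"
            using L2_norm_triangle[OF LF] by linarith
        qed simp
        finally show ?thesis by (simp add: algebra_simps add_divide_distrib)
      qed
      have Vp: "primitive_on a b V (\<lambda>t. complex_of_real (\<mu>\<^sup>2) * U t + q t)"
      proof (rule primitive_on_cong[OF represented2D(2)[OF R] refl _ _ ab'])
        show "(\<lambda>t. complex_of_real (\<mu>\<^sup>2) * U t + q t) \<in> borel_measurable (LI a b)"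
          using L2_measurable[OF primitive_on_L2[OF Up ab']] L2_measurable[OF q]
          by (intro borel_measurable_add borel_measurable_times) auto
        have "AE t in LI a b. u (t *\<^sub>R e) = U t" using ru by (simp add: represented_def)
        then show "AE t in LI a b. weak_laplacian \<Omega> u (t *\<^sub>R e) = complex_of_real (\<mu>\<^sup>2) * U t + q t"
        proof eventually_elim
          case (elim t)
          have "complex_of_real (c\<^sup>2) * (complex_of_real (\<mu>\<^sup>2) * U t + q t) = z * z * U t - (z * F1 (t *\<^sub>R e) + F2 (t *\<^sub>R e))"
            unfolding \<mu>2 q_def by (rule alg[OF c2])
          also have "\<dots> = complex_of_real (c\<^sup>2) * weak_laplacian \<Omega> u (t *\<^sub>R e)"
            by (simp add: F(1,2) A_op_def elim algebra_simps)
          finally show ?case using c2 by simp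
        qed
      qed
      define \<gamma> where "\<gamma> p = (F4 p - km p * F3 p / z) / \<alpha> p" for p
      have bc: "\<nu> p * V (p \<bullet> e) + \<theta> p * U (p \<bullet> e) = \<gamma> p" if p: "p \<in> frontier \<Omega>" for p
      proof -
        have F3p: "F3 p = z * x p - \<nu> p * V (p \<bullet> e)" by (simp add: F(3) L_op_def normal_derivative_represented2[OF smooth R p])
        define T4 where "T4 = (B1_op u + B4_op d m (B2_op \<Omega> \<rho> m u)) + B3_op k m x + B4_op d m y"
        have T4: "T (u, v, x, y) = (v, A_op \<Omega> c u, L_op \<Omega> u, T4)" by (simp add: T4_def)
        have "F4 p = z * y p - T4 p" unfolding F(4) T4_def by simp
        then have F4p: "F4 p = z * y p - (dm p * r p * U (p \<bullet> e) - km p * x p - dm p * y p)"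
          unfolding op_boundary(2)[OF R p T4] .
        have "F4 p - km p * F3 p / z = \<alpha> p * (\<nu> p * V (p \<bullet> e) + \<theta> p * U (p \<bullet> e))"
          using boundary_identity[OF z0(1) \<alpha>0[OF p] \<alpha>_def, of "\<nu> p * V (p \<bullet> e)" "r p" "U (p \<bullet> e)" "x p"]
          unfolding F3p F4p yp[OF p] \<theta>_def .
        then show ?thesis using \<alpha>0[OF p] by (simp add: \<gamma>_def)
      qed
      have \<gamma>n: "cmod (\<gamma> p) \<le> 2 * (1 + B) * n" if p: "p \<in> frontier \<Omega>" for p
      proof -
        have "cmod (F4 p) \<le> n" "cmod (F3 p) \<le> n"
          using frontier_point(3)[OF p, of F4] frontier_point(3)[OF p, of F3] nF by linarith+
        moreover have "cmod (km p * F3 p / z) \<le> B * n / 1"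
          unfolding norm_divide[of "km p * F3 p" z] norm_mult[of "km p"] z0(2) using le_B(2)[OF p] \<open>cmod (F3 p) \<le> n\<close> \<zeta>(1) B0 n0
          by (intro frac_le mult_mono) auto
        ultimately have "cmod (F4 p - km p * F3 p / z) \<le> (1 + B) * n"
          using norm_triangle_ineq4[of "F4 p" "km p * F3 p / z"] by (simp add: algebra_simps)
        then have "cmod (\<gamma> p) \<le> (1 + B) * n / (1 / 2)"
          unfolding \<gamma>_def norm_divide[of _ "\<alpha> p"] using \<alpha>[OF p] \<zeta>(1) B0 n0 by (intro frac_le) auto
        then show ?thesis by (simp add: algebra_simps)
      qed
      note est = boundary_value_estimate[OF Up Vp q ab' \<mu> small outer_normal_unit[OF smooth ends(1)]
          outer_normal_unit[OF smooth ends(2)] \<theta>[OF ends(1)] \<theta>[OF ends(2)]]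
      have rhs: "8 * (cmod (\<gamma> (a *\<^sub>R e)) + cmod (\<gamma> (b *\<^sub>R e))) + 14 * (sqrt (b - a) * exp (\<mu> * (b - a)) * L2_norm (LI a b) q) \<le> C1 * n"
      proof -
        have "sqrt (b - a) * exp (\<mu> * (b - a)) * L2_norm (LI a b) q \<le> s * exp (\<mu> * (b - a)) * ((\<zeta> + 1) / c\<^sup>2 * n)"
          unfolding s_def using ab by (intro mult_left_mono qn) auto
        then have "8 * (cmod (\<gamma> (a *\<^sub>R e)) + cmod (\<gamma> (b *\<^sub>R e))) + 14 * (sqrt (b - a) * exp (\<mu> * (b - a)) * L2_norm (LI a b) q)
            \<le> 8 * (2 * (1 + B) * n + 2 * (1 + B) * n) + 14 * (s * exp (\<mu> * (b - a)) * ((\<zeta> + 1) / c\<^sup>2 * n))"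
          using \<gamma>n[OF ends(1)] \<gamma>n[OF ends(2)] by (intro add_mono mult_left_mono) auto
        also have "\<dots> = C1 * n" by (simp add: C1_def algebra_simps)
        finally show ?thesis .
      qed
      have Vt: "cmod (V t) \<le> C1 * n" and Ut: "cmod (U t) \<le> C2 * n" if t: "t \<in> {a..b}" for t
      proof -
        note est' = est[OF _ _ t, of "\<gamma> (a *\<^sub>R e)" "\<gamma> (b *\<^sub>R e)"]
        have "\<nu> (a *\<^sub>R e) * V a + \<theta> (a *\<^sub>R e) * U a = \<gamma> (a *\<^sub>R e)" "\<nu> (b *\<^sub>R e) * V b + \<theta> (b *\<^sub>R e) * U b = \<gamma> (b *\<^sub>R e)"
          using bc[OF ends(1)] bc[OF ends(2)] by simp_all
        note est'' = est'[OF this]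
        show "cmod (V t) \<le> C1 * n" using est''(1) rhs by linarith
        have "\<mu> * cmod (U t) \<le> C1 * n" using est''(2) rhs by linarith
        then show "cmod (U t) \<le> C2 * n" using \<mu> by (simp add: C2_def field_simps)
      qed
      have Un: "L2_norm (LI a b) U \<le> C2 * n * s" "L2_norm (LI a b) V \<le> C1 * n * s"
        unfolding s_def using Ut Vt C1 C2 n0
        by (intro L2_LI_sup_le(2)[OF primitive_on_continuous[OF Up] _ _ ab'] L2_LI_sup_le(2)[OF primitive_on_continuous[OF Vp] _ _ ab']; simp)+
      have 1: "H1_norm \<Omega> u \<le> (C2 + C1) * s * n"
        using represented_H1_norm_le[OF ru] Un by (simp add: algebra_simps)
      have 2: "L2_norm M v \<le> (\<zeta> * ((C2 + C1) * s) + 1) * n"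
      proof -
        have "v = (\<lambda>t. z * u t) - F1" by (simp add: F(1) fun_eq_iff)
        then have "L2_norm M v \<le> L2_norm M (\<lambda>t. z * u t) + L2_norm M F1"
          using L2_norm_triangle_diff[OF L2_scale[OF represented_L2[OF ru], of z] H1_L2[OF F1]] by simp
        also have "\<dots> \<le> \<zeta> * ((C2 + C1) * s * n) + n"
          unfolding L2_norm_scale z0(2) using 1 L2_norm_le_H1_norm[of \<Omega> u] L2_norm_le_H1_norm[of \<Omega> F1] nF(1) \<zeta>(1)
          by (intro add_mono mult_left_mono) auto
        finally show ?thesis by (simp add: algebra_simps)
      qed
      have xp: "cmod (x p) \<le> (1 + C1) * n" if p: "p \<in> frontier \<Omega>" for p
      proof -
        have "z * x p = F3 p + \<nu> p * V (p \<bullet> e)" by (simp add: F(3) L_op_def normal_derivative_represented2[OF smooth R p])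
        then have "\<zeta> * cmod (x p) \<le> cmod (F3 p) + cmod (\<nu> p * V (p \<bullet> e))" using norm_triangle_ineq z0(2) by (metis norm_mult)
        also have "\<dots> \<le> n + C1 * n"
          using frontier_point(3)[OF p, of F3] nF(3) Vt[OF frontier_point(2)[OF p]] outer_normal_unit[OF smooth p]
          by (intro add_mono) (simp_all only: norm_mult mult_1_left)
        finally have "\<zeta> * cmod (x p) \<le> (1 + C1) * n" by (simp add: algebra_simps)
        moreover have "1 * cmod (x p) \<le> \<zeta> * cmod (x p)" using \<zeta>(1) by (intro mult_right_mono) auto
        ultimately show ?thesis by simp
      qed
      have 3: "L2_norm S x \<le> 2 * (1 + C1) * n" using L2_norm_S_le[of x] xp[OF ends(1)] xp[OF ends(2)] by (simp add: algebra_simps)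
      have ypn: "cmod (y p) \<le> (C1 + B * C2) * n" if p: "p \<in> frontier \<Omega>" for p
      proof -
        have "cmod (y p) \<le> cmod (\<nu> p * V (p \<bullet> e)) + cmod (r p * U (p \<bullet> e))" unfolding yp[OF p] by (rule norm_triangle_ineq)
        also have "cmod (\<nu> p * V (p \<bullet> e)) \<le> C1 * n"
          using Vt[OF frontier_point(2)[OF p]] outer_normal_unit[OF smooth p] by (simp only: norm_mult mult_1_left)
        also have "cmod (r p * U (p \<bullet> e)) \<le> B * (C2 * n)"
          unfolding norm_mult using le_B(3)[OF p] Ut[OF frontier_point(2)[OF p]] B0 by (intro mult_mono) auto
        finally show ?thesis by (simp add: algebra_simps)
      qed
      have 4: "L2_norm S y \<le> 2 * (C1 + B * C2) * n" using L2_norm_S_le[of y] ypn[OF ends(1)] ypn[OF ends(2)] by (simp add: algebra_simps)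
      have "N X \<le> (C2 + C1) * s * n + (\<zeta> * ((C2 + C1) * s) + 1) * n + 2 * (1 + C1) * n + 2 * (C1 + B * C2) * n"
        unfolding XX using state_norm_le_sum[of \<Omega> u v x y] 1 2 3 4 by linarith
      then show ?thesis unfolding n_def[symmetric] by (simp only: distrib_right)
    qed
    then show ?thesis by blast
  qed
  ultimately have "z \<in> resolvent_set (state_space \<Omega>) N state_scale D T" unfolding resolvent_set_def by blast
  then show ?thesis by blast
qed

end

lemma norm_fst_snd_le:
  fixes p :: "'a::real_normed_vector \<times> 'b::real_normed_vector"
  shows "norm (fst p) \<le> norm p" "norm (snd p) \<le> norm p"
  by (cases p; simp add: norm_Pair real_le_rsqrt)+

section \<open>Compactness of the resolvent in dimension one\<close>

context interval_domain
begin

lemma H1_diff_norm_le: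
  assumes "u \<in> H1 \<Omega>" "v \<in> H1 \<Omega>"
  shows "u - v \<in> H1 \<Omega>" "H1_norm \<Omega> (u - v) \<le> 2 * (H1_norm \<Omega> u + H1_norm \<Omega> v)"
proof -
  obtain U where U: "represented u U (\<lambda>t. weak_pd \<Omega> e u (t *\<^sub>R e))" by (rule H1_represented[OF assms(1)])
  obtain V where V: "represented v V (\<lambda>t. weak_pd \<Omega> e v (t *\<^sub>R e))" by (rule H1_represented[OF assms(2)])
  note r = represented_diff[OF U V]
  show "u - v \<in> H1 \<Omega>" by (rule represented_H1[OF r])
  have L: "U \<in> L2 (LI a b)" "V \<in> L2 (LI a b)"
    "(\<lambda>t. weak_pd \<Omega> e u (t *\<^sub>R e)) \<in> L2 (LI a b)" "(\<lambda>t. weak_pd \<Omega> e v (t *\<^sub>R e)) \<in> L2 (LI a b)"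
    using U V by (auto simp: represented_def intro: primitive_on_L2[OF _ ab'] dest: primitive_onD)
  show "H1_norm \<Omega> (u - v) \<le> 2 * (H1_norm \<Omega> u + H1_norm \<Omega> v)"
    using represented_H1_norm_le[OF r] L2_norm_triangle_diff[OF L(1,2)] L2_norm_triangle_diff[OF L(3,4)]
      represented_norm_le[OF U] represented_norm_le[OF V] by (simp add: fun_diff_def)
qed

lemma represented_exists_bounds:
  assumes "v \<in> H1 \<Omega>" "H1_norm \<Omega> v \<le> C"
  obtains W h where "represented v W h" "primitive_on a b W h" "L2_norm (LI a b) W \<le> C" "L2_norm (LI a b) h \<le> C"
proof -
  obtain W where W: "represented v W (\<lambda>t. weak_pd \<Omega> e v (t *\<^sub>R e))" by (rule H1_represented[OF assms(1)])
  show thesis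
    by (rule that[OF W]) (use W represented_norm_le[OF W] assms(2) in \<open>auto simp: represented_def\<close>)
qed

lemma represented_primitive: "represented u U V \<Longrightarrow> primitive_on a b U V"
  by (simp add: represented_def)

text \<open>
  Bounded sequences of primitives are equicontinuous, so the theorem of Arzela and Ascoli applies;
  the constant last component carries along finitely many boundary values.
\<close>

lemma primitives_convergent_subsequence:
  fixes U V W f h :: "nat \<Rightarrow> real \<Rightarrow> complex" and X :: "nat \<Rightarrow> complex \<times> complex \<times> complex \<times> complex"
  assumes U: "\<And>j. primitive_on a b (U j) (V j)" and V: "\<And>j. primitive_on a b (V j) (f j)" and W: "\<And>j. primitive_on a b (W j) (h j)"
    and bd: "\<And>j. L2_norm (LI a b) (U j) \<le> C" "\<And>j. L2_norm (LI a b) (V j) \<le> C" "\<And>j. L2_norm (LI a b) (f j) \<le> C"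
      "\<And>j. L2_norm (LI a b) (W j) \<le> C" "\<And>j. L2_norm (LI a b) (h j) \<le> C" "\<And>j. norm (X j) \<le> C"
  obtains s U' V' W' X' where "strict_mono (s :: nat \<Rightarrow> nat)" "primitive_on a b U' V'" "continuous_on {a..b} V'" "continuous_on {a..b} W'"
    "\<forall>\<epsilon>>0. \<exists>n. \<forall>j\<ge>n. (\<forall>t\<in>{a..b}. cmod (U (s j) t - U' t) < \<epsilon> \<and> cmod (V (s j) t - V' t) < \<epsilon> \<and> cmod (W (s j) t - W' t) < \<epsilon>)
        \<and> norm (X (s j) - X') < \<epsilon>"
proof -
  have C0: "C \<ge> 0" using order_trans[OF norm_ge_zero bd(6)] .
  define A where "A j t = (U j t, V j t, W j t, X j)" for j t
  have sup: "cmod (U j t) \<le> K * (C + C)" "cmod (V j t) \<le> K * (C + C)" "cmod (W j t) \<le> K * (C + C)" if t: "t \<in> {a..b}" for j t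
    using primitive_on_le_K[OF U t, of j] primitive_on_le_K[OF V t, of j] primitive_on_le_K[OF W t, of j]
      mult_left_mono[OF add_mono[OF bd(1)[of j] bd(2)[of j]], of K] mult_left_mono[OF add_mono[OF bd(2)[of j] bd(3)[of j]], of K]
      mult_left_mono[OF add_mono[OF bd(4)[of j] bd(5)[of j]], of K] K_pos by linarith+
  have tuple: "norm (x, y, w, q) \<le> norm x + (norm y + (norm w + norm q))" for x y w :: complex and q :: "complex \<times> complex \<times> complex \<times> complex"
    using norm_Pair_le[of x "(y, w, q)"] norm_Pair_le[of y "(w, q)"] norm_Pair_le[of w q] by linarith
  have inc: "norm (A j t - A j t') \<le> 3 * (C + 1) * sqrt \<bar>t - t'\<bar>" if t: "t \<in> {a..b}" "t' \<in> {a..b}" for j t t'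
  proof -
    have i: "cmod (F t - F t') \<le> sqrt \<bar>t - t'\<bar> * (C + 1)" if "primitive_on a b F g" "L2_norm (LI a b) g \<le> C" for F g
    proof -
      have "cmod (F t - F t') \<le> sqrt \<bar>t - t'\<bar> * L2_norm (LI a b) g" using t by (intro primitive_on_increment[OF that(1)]) auto
      also have "\<dots> \<le> sqrt \<bar>t - t'\<bar> * (C + 1)" using that(2) by (intro mult_left_mono) auto
      finally show ?thesis .
    qed
    have "norm (A j t - A j t') \<le> cmod (U j t - U j t') + (cmod (V j t - V j t') + (cmod (W j t - W j t') + norm (0 :: complex \<times> complex \<times> complex \<times> complex)))"
      unfolding A_def using tuple[of "U j t - U j t'" "V j t - V j t'" "W j t - W j t'" 0] by simp
    also have "\<dots> \<le> sqrt \<bar>t - t'\<bar> * (C + 1) + (sqrt \<bar>t - t'\<bar> * (C + 1) + (sqrt \<bar>t - t'\<bar> * (C + 1) + 0))"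
      by (intro add_mono i[OF U bd(2)] i[OF V bd(3)] i[OF W bd(5)]) simp
    finally show ?thesis by (simp add: algebra_simps)
  qed
  obtain g s where g: "continuous_on {a..b} g" and s: "strict_mono (s :: nat \<Rightarrow> nat)"
    and unif: "\<And>\<epsilon>. 0 < \<epsilon> \<Longrightarrow> \<exists>n. \<forall>j t. j \<ge> n \<and> t \<in> {a..b} \<longrightarrow> norm (A (s j) t - g t) < \<epsilon>"
  proof (rule Arzela_Ascoli[of "{a..b}" A "3 * (K * (C + C)) + C"])
    show "norm (A j t) \<le> 3 * (K * (C + C)) + C" if "t \<in> {a..b}" for j t
      unfolding A_def using tuple[of "U j t" "V j t" "W j t" "X j"] sup[OF that, of j] bd(6)[of j] by linarith
    fix t \<epsilon> :: real assume t: "t \<in> {a..b}" and \<epsilon>: "0 < \<epsilon>"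
    define \<delta> where "\<delta> = (\<epsilon> / (3 * (C + 1)))\<^sup>2"
    have pos: "0 < \<epsilon> / (3 * (C + 1))" using \<epsilon> C0 by simp
    show "\<exists>\<delta>>0. \<forall>j t'. t' \<in> {a..b} \<and> norm (t - t') < \<delta> \<longrightarrow> norm (A j t - A j t') < \<epsilon>"
    proof (intro exI[of _ \<delta>] conjI allI impI)
      show "\<delta> > 0" unfolding \<delta>_def by (rule zero_less_power[OF pos])
      fix j t' assume t': "t' \<in> {a..b} \<and> norm (t - t') < \<delta>"
      then have "sqrt \<bar>t - t'\<bar> < \<epsilon> / (3 * (C + 1))" using pos by (intro real_less_lsqrt) (auto simp: \<delta>_def)
      then have "3 * (C + 1) * sqrt \<bar>t - t'\<bar> < 3 * (C + 1) * (\<epsilon> / (3 * (C + 1)))"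
        using C0 by (intro mult_strict_left_mono) auto
      also have "\<dots> = \<epsilon>" using C0 by simp
      finally show "norm (A j t - A j t') < \<epsilon>" using inc[OF t, of t' j] t' by linarith
    qed
  qed auto
  define U' V' W' where "U' t = fst (g t)" and "V' t = fst (snd (g t))" and "W' t = fst (snd (snd (g t)))" for t
  define X' where "X' = snd (snd (snd (g a)))"
  have comp: "cmod (U (s j) t - U' t) \<le> norm (A (s j) t - g t)" "cmod (V (s j) t - V' t) \<le> norm (A (s j) t - g t)"
    "cmod (W (s j) t - W' t) \<le> norm (A (s j) t - g t)" "norm (X (s j) - snd (snd (snd (g t)))) \<le> norm (A (s j) t - g t)" for j t
  proof -
    define q where "q = A (s j) t - g t"
    have "fst q = U (s j) t - U' t" "fst (snd q) = V (s j) t - V' t" "fst (snd (snd q)) = W (s j) t - W' t"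
      "snd (snd (snd q)) = X (s j) - snd (snd (snd (g t)))" by (simp_all add: q_def A_def U'_def V'_def W'_def)
    moreover have "norm (fst q) \<le> norm q" "norm (fst (snd q)) \<le> norm q" "norm (fst (snd (snd q))) \<le> norm q" "norm (snd (snd (snd q))) \<le> norm q"
      using norm_fst_snd_le[of q] norm_fst_snd_le[of "snd q"] norm_fst_snd_le[of "snd (snd q)"] by linarith+
    ultimately show "cmod (U (s j) t - U' t) \<le> norm (A (s j) t - g t)" "cmod (V (s j) t - V' t) \<le> norm (A (s j) t - g t)"
      "cmod (W (s j) t - W' t) \<le> norm (A (s j) t - g t)" "norm (X (s j) - snd (snd (snd (g t)))) \<le> norm (A (s j) t - g t)"
      by (simp_all add: q_def)
  qed
  have conv: "\<exists>n. \<forall>j\<ge>n. (\<forall>t\<in>{a..b}. cmod (U (s j) t - U' t) < \<epsilon> \<and> cmod (V (s j) t - V' t) < \<epsilon> \<and> cmod (W (s j) t - W' t) < \<epsilon>)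
        \<and> norm (X (s j) - X') < \<epsilon>" if \<epsilon>: "\<epsilon> > 0" for \<epsilon>
  proof -
    obtain n where n: "\<And>j t. j \<ge> n \<Longrightarrow> t \<in> {a..b} \<Longrightarrow> norm (A (s j) t - g t) < \<epsilon>" using unif[OF \<epsilon>] by blast
    show ?thesis
    proof (intro exI[of _ n] allI impI conjI ballI)
      fix j assume j: "n \<le> j"
      show "norm (X (s j) - X') < \<epsilon>" unfolding X'_def by (rule le_less_trans[OF comp(4)[of j a] n[OF j]]) (use ab in simp)
      fix t assume t: "t \<in> {a..b}"
      show "cmod (U (s j) t - U' t) < \<epsilon>" by (rule le_less_trans[OF comp(1)[of j t] n[OF j t]])
      show "cmod (V (s j) t - V' t) < \<epsilon>" by (rule le_less_trans[OF comp(2)[of j t] n[OF j t]])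
      show "cmod (W (s j) t - W' t) < \<epsilon>" by (rule le_less_trans[OF comp(3)[of j t] n[OF j t]])
    qed
  qed
  have cont: "continuous_on {a..b} V'" "continuous_on {a..b} W'"
    unfolding V'_def W'_def by (intro continuous_intros g)+
  have prim: "primitive_on a b U' V'"
  proof (rule primitive_on_limit[where F = "\<lambda>j. U (s j)" and f = "\<lambda>j. V (s j)", OF U _ continuous_L2[OF cont(1) ab'] _ ab'])
    fix t assume t: "t \<in> {a..b}"
    show "(\<lambda>j. U (s j) t) \<longlonglongrightarrow> U' t"
    proof (rule LIMSEQ_I)
      fix \<epsilon> :: real assume "0 < \<epsilon>"
      then show "\<exists>n. \<forall>j\<ge>n. norm (U (s j) t - U' t) < \<epsilon>" using conv[of \<epsilon>] t by blast
    qed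
  next
    show "(\<lambda>j. L2_norm (LI a b) (V (s j) - V')) \<longlonglongrightarrow> 0"
    proof (rule LIMSEQ_I)
      fix \<epsilon> :: real assume \<epsilon>: "0 < \<epsilon>"
      define \<delta> where "\<delta> = \<epsilon> / (sqrt (b - a) + 1)"
      have l: "sqrt (b - a) + 1 > 0" using ab by (simp add: add_nonneg_pos)
      have \<delta>: "\<delta> > 0" using \<epsilon> l by (simp add: \<delta>_def)
      obtain n where n: "\<And>j t. j \<ge> n \<Longrightarrow> t \<in> {a..b} \<Longrightarrow> cmod (V (s j) t - V' t) < \<delta>" using conv[OF \<delta>] by blast
      show "\<exists>n. \<forall>j\<ge>n. norm (L2_norm (LI a b) (V (s j) - V') - 0) < \<epsilon>"
      proof (intro exI[of _ n] allI impI)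
        fix j assume j: "n \<le> j"
        have "L2_norm (LI a b) (V (s j) - V') \<le> \<delta> * sqrt (b - a)"
        proof (rule L2_LI_sup_le(2)[OF _ _ _ ab'])
          show "continuous_on {a..b} (V (s j) - V')" unfolding fun_diff_def
            by (intro continuous_on_diff primitive_on_continuous[OF V] cont(1))
        qed (use n[OF j] \<delta> in \<open>auto intro: less_imp_le\<close>)
        also have "\<dots> < \<delta> * (sqrt (b - a) + 1)" using \<delta> by simp
        also have "\<dots> = \<epsilon>" using l by (simp add: \<delta>_def)
        finally show "norm (L2_norm (LI a b) (V (s j) - V') - 0) < \<epsilon>" by simp
      qed
    qed
  qed
  show thesis by (rule that[OF s prim cont]) (use conv in blast)
qed

end

context acoustic_interval
begin

text \<open>
  A bound for \<open>F\<close> bounds the state \<open>(u, v, x, y)\<close> since \<open>z\<close> lies in the resolvent set.  The first two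
  rows of the equation improve this: \<open>v\<close> is bounded in \<open>H\<^sup>1\<close> and \<open>\<Delta>u\<close> in \<open>L\<^sup>2\<close>.
\<close>

lemma compact_resolvent:
  "has_compact_resolvent (state_space \<Omega>) N state_scale D T"
  unfolding has_compact_resolvent_def
proof (intro conjI ballI allI impI, rule resolvent_set_nonempty)
  fix z and F X :: "nat \<Rightarrow> 'a state"
  assume z: "z \<in> resolvent_set (state_space \<Omega>) N state_scale D T"
    and "(\<forall>j. F j \<in> state_space \<Omega> \<and> is_resolvent_value N state_scale D T z (F j) (X j)) \<and> (\<exists>B. \<forall>j. N (F j) \<le> B)"
  then obtain B where F: "\<And>j. F j \<in> state_space \<Omega>" and XD: "\<And>j. X j \<in> D"
    and res: "\<And>j. N (state_scale z (X j) - T (X j) - F j) = 0" and FB: "\<And>j. N (F j) \<le> B"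
    unfolding is_resolvent_value_def by blast
  obtain C where C: "\<And>U. U \<in> D \<Longrightarrow> N U \<le> C * N (state_scale z U - T U)"
    using z unfolding resolvent_set_def by blast
  have B0: "B \<ge> 0" using order_trans[OF state_norm_nonneg FB] .
  \<comment> \<open>The difference rule doubles the bound for the first component; the other three contribute \<open>B\<close> each.\<close>
  define n where "n = 5 * B"
  define n' where "n' = max C 0 * n"
  define C2 where "C2 = (cmod z * n' * 2 + n) / c\<^sup>2 + (4 * (cmod z * n') + 4 * B) + 4 * n'"
  have n: "n \<ge> 0" "n' \<ge> 0" using B0 by (auto simp: n_def n'_def)
  have "\<exists>u v x y U V f W h. X j = (u, v, x, y) \<and> represented2 u U V f \<and> represented v W h \<and> primitive_on a b W h \<and>
      L2_norm (LI a b) U \<le> C2 \<and> L2_norm (LI a b) V \<le> C2 \<and> L2_norm (LI a b) f \<le> C2 \<and>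
      L2_norm (LI a b) W \<le> C2 \<and> L2_norm (LI a b) h \<le> C2 \<and>
      norm (x (a *\<^sub>R e), x (b *\<^sub>R e), y (a *\<^sub>R e), y (b *\<^sub>R e)) \<le> C2" for j
  proof -
    obtain u v x y where X: "X j = (u, v, x, y)" by (cases "X j")
    obtain F1 F2 F3 F4 where FF: "F j = (F1, F2, F3, F4)" by (cases "F j")
    obtain G1 G2 G3 G4 where G: "state_scale z (X j) - T (X j) = (G1, G2, G3, G4)" by (metis prod_cases4)
    have G12: "G1 = (\<lambda>t. z * u t) - v" "G2 = (\<lambda>t. z * v t) - A_op \<Omega> c u" using G by (auto simp: X)
    obtain U V where R: "represented2 u U V (\<lambda>t. weak_laplacian \<Omega> u (t *\<^sub>R e))" and v: "v \<in> H1 \<Omega>"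
      by (rule domD[OF XD[of j, unfolded X]]) blast
    have ru: "represented u U V" by (rule represented2D(1)[OF R])
    have u: "u \<in> H1 \<Omega>" by (rule represented_H1[OF ru])
    have zu: "(\<lambda>t. z * u t) \<in> H1 \<Omega>" "H1_norm \<Omega> (\<lambda>t. z * u t) \<le> cmod z * 2 * H1_norm \<Omega> u"
    proof -
      show "(\<lambda>t. z * u t) \<in> H1 \<Omega>" by (rule represented_H1[OF represented_scale[OF ru]])
      have "H1_norm \<Omega> (\<lambda>t. z * u t) \<le> cmod z * L2_norm (LI a b) U + cmod z * L2_norm (LI a b) V"
        using represented_H1_norm_le[OF represented_scale[OF ru]] by (simp add: L2_norm_scale)
      also have "\<dots> \<le> cmod z * H1_norm \<Omega> u + cmod z * H1_norm \<Omega> u"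
        using represented_norm_le[OF ru] by (intro add_mono mult_left_mono) auto
      finally show "H1_norm \<Omega> (\<lambda>t. z * u t) \<le> cmod z * 2 * H1_norm \<Omega> u" by simp
    qed
    have G1: "G1 \<in> H1 \<Omega>" unfolding G12(1) by (rule H1_diff_norm_le(1)[OF zu(1) v])
    have wL: "weak_laplacian \<Omega> u \<in> L2 M"
      using primitive_onD[OF represented2D(2)[OF R]] by (simp add: L2_M_iff[of "weak_laplacian \<Omega> u"])
    have G2: "G2 \<in> L2 M" unfolding G12(2) A_op_def by (intro L2_diff L2_scale H1_L2[OF v] wL)
    have F1: "F1 \<in> H1 \<Omega>" and F2: "F2 \<in> L2 M" using F[of j] by (auto simp: FF state_space_def)
    have diff: "state_scale z (X j) - T (X j) - F j = (G1 - F1, G2 - F2, G3 - F3, G4 - F4)" unfolding G FF by simp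
    have zero: "H1_norm \<Omega> (G1 - F1) \<le> 0" "L2_norm M (G2 - F2) \<le> 0" "L2_norm S (G3 - F3) \<le> 0" "L2_norm S (G4 - F4) \<le> 0"
      using state_norm_components[OF diff, of \<Omega>] res[of j] by auto
    have Fn: "H1_norm \<Omega> F1 \<le> B" "L2_norm M F2 \<le> B" "L2_norm S F3 \<le> B" "L2_norm S F4 \<le> B"
      using state_norm_components[OF FF, of \<Omega>] FB[of j] by (auto intro: order_trans)
    have tri: "L2_norm Q f \<le> L2_norm Q g" if "f \<in> L2 Q" "g \<in> L2 Q" "L2_norm Q (f - g) \<le> 0" for f g and Q :: "'a measure"
      using L2_norm_triangle[OF L2_diff[OF that(1,2)] that(2)] that(3) by simp
    have g1: "H1_norm \<Omega> G1 \<le> 2 * B"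
    proof -
      obtain P p where P: "represented G1 P p" "primitive_on a b P p" by (rule represented_exists_bounds[OF G1 order_refl]) blast
      obtain Q q where Q: "represented F1 Q q" "primitive_on a b Q q" "L2_norm (LI a b) Q \<le> B" "L2_norm (LI a b) q \<le> B"
        by (rule represented_exists_bounds[OF F1 Fn(1)])
      have d: "L2_norm (LI a b) (P - Q) \<le> 0" "L2_norm (LI a b) (p - q) \<le> 0"
        using represented_norm_le[OF represented_diff[OF P(1) Q(1)]] zero(1) unfolding fun_diff_def by linarith+
      have tri': "L2_norm (LI a b) f \<le> L2_norm (LI a b) g" if "f \<in> L2 (LI a b)" "g \<in> L2 (LI a b)" "L2_norm (LI a b) (f - g) \<le> 0" for f g
        using L2_norm_triangle[OF L2_diff[OF that(1,2)] that(2)] that(3) by simp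
      have "L2_norm (LI a b) P \<le> B" "L2_norm (LI a b) p \<le> B"
        using tri'[OF primitive_on_L2[OF P(2) ab'] primitive_on_L2[OF Q(2) ab'] d(1)]
          tri'[OF primitive_onD[OF P(2)] primitive_onD[OF Q(2)] d(2)] Q(3,4) by linarith+
      then show ?thesis using represented_H1_norm_le[OF P(1)] by linarith
    qed
    have g2: "L2_norm M G2 \<le> B" "L2_norm S G3 \<le> B" "L2_norm S G4 \<le> B"
      using tri[OF G2 F2 zero(2)] tri[OF L2_S L2_S zero(3)] tri[OF L2_S L2_S zero(4)] Fn by linarith+
    have NG: "N (state_scale z (X j) - T (X j)) \<le> n"
      unfolding G n_def using state_norm_le_sum[of \<Omega> G1 G2 G3 G4] g1 g2 by linarith
    have NX: "N (X j) \<le> n'"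
    proof -
      have "N (X j) \<le> C * N (state_scale z (X j) - T (X j))" by (rule C[OF XD])
      also have "\<dots> \<le> max C 0 * N (state_scale z (X j) - T (X j))" by (intro mult_right_mono state_norm_nonneg) auto
      also have "\<dots> \<le> n'" unfolding n'_def by (intro mult_left_mono NG) auto
      finally show ?thesis .
    qed
    have un: "H1_norm \<Omega> u \<le> n'" "L2_norm M v \<le> n'" "L2_norm S x \<le> n'" "L2_norm S y \<le> n'"
      using state_norm_components[OF X, of \<Omega>] NX by linarith+
    have nn: "0 \<le> (cmod z * n' * 2 + n) / c\<^sup>2" "0 \<le> cmod z * n'" using n by (auto intro!: divide_nonneg_nonneg)
    have "v = (\<lambda>t. z * u t) - G1" by (simp add: G12(1) fun_eq_iff)
    then have "H1_norm \<Omega> v \<le> 2 * (cmod z * 2 * H1_norm \<Omega> u + H1_norm \<Omega> G1)"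
      using H1_diff_norm_le(2)[OF zu(1) G1] zu(2) by simp
    also have "\<dots> \<le> 2 * (cmod z * 2 * n' + 2 * B)" using un(1) g1 by (intro mult_left_mono add_mono) auto
    finally have vn: "H1_norm \<Omega> v \<le> 4 * (cmod z * n') + 4 * B" by simp
    obtain W h where W: "represented v W h" "primitive_on a b W h" "L2_norm (LI a b) W \<le> 4 * (cmod z * n') + 4 * B"
      "L2_norm (LI a b) h \<le> 4 * (cmod z * n') + 4 * B" by (rule represented_exists_bounds[OF v vn])
    have "A_op \<Omega> c u = (\<lambda>t. z * v t) - G2" by (simp add: G12(2) fun_eq_iff)
    then have "L2_norm M (A_op \<Omega> c u) \<le> cmod z * L2_norm M v + L2_norm M G2"
      using L2_norm_triangle_diff[OF L2_scale[OF H1_L2[OF v], of z] G2] by (simp add: L2_norm_scale)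
    also have "\<dots> \<le> cmod z * n' + B" using un(2) g2(1) by (intro add_mono mult_left_mono) auto
    finally have "c\<^sup>2 * L2_norm M (weak_laplacian \<Omega> u) \<le> cmod z * n' + B"
      unfolding A_op_def L2_norm_scale by (simp add: norm_power)
    then have fn: "L2_norm M (weak_laplacian \<Omega> u) \<le> (cmod z * n' + B) / c\<^sup>2" using c by (simp add: field_simps)
    have fn': "L2_norm (LI a b) (\<lambda>t. weak_laplacian \<Omega> u (t *\<^sub>R e)) \<le> (cmod z * n' * 2 + n) / c\<^sup>2"
    proof -
      have "(cmod z * n' + B) / c\<^sup>2 \<le> (cmod z * n' * 2 + n) / c\<^sup>2"
        using nn B0 n_def by (intro divide_right_mono) (linarith, simp)
      then show ?thesis using fn L2_norm_M[OF L2_measurable[OF wL]] by simp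
    qed
    have le: "n' \<le> C2" "4 * n' \<le> C2" "4 * (cmod z * n') + 4 * B \<le> C2" "(cmod z * n' * 2 + n) / c\<^sup>2 \<le> C2"
      using nn n B0 unfolding C2_def by linarith+
    have "norm (x (a *\<^sub>R e), x (b *\<^sub>R e), y (a *\<^sub>R e), y (b *\<^sub>R e)) \<le> 4 * n'"
      using norm_Pair_le[of "x (a *\<^sub>R e)" "(x (b *\<^sub>R e), y (a *\<^sub>R e), y (b *\<^sub>R e))"]
        norm_Pair_le[of "x (b *\<^sub>R e)" "(y (a *\<^sub>R e), y (b *\<^sub>R e))"] norm_Pair_le[of "y (a *\<^sub>R e)" "y (b *\<^sub>R e)"]
        le_L2_norm_S[of x] le_L2_norm_S[of y] un(3,4) by linarith
    then have xy: "norm (x (a *\<^sub>R e), x (b *\<^sub>R e), y (a *\<^sub>R e), y (b *\<^sub>R e)) \<le> C2" using le(2) by linarith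
    have UV: "L2_norm (LI a b) U \<le> C2" "L2_norm (LI a b) V \<le> C2"
      using represented_norm_le[OF ru] un(1) le(1) by linarith+
    show ?thesis
      by (rule exI[of _ u], rule exI[of _ v], rule exI[of _ x], rule exI[of _ y], rule exI[of _ U], rule exI[of _ V],
          rule exI[of _ "\<lambda>t. weak_laplacian \<Omega> u (t *\<^sub>R e)"], rule exI[of _ W], rule exI[of _ h])
        (intro conjI X R W(1,2) UV xy order_trans[OF fn' le(4)] order_trans[OF W(3) le(3)] order_trans[OF W(4) le(3)])
  qed
  then have "\<forall>j. \<exists>u v x y U V f W h. X j = (u, v, x, y) \<and> represented2 u U V f \<and> represented v W h \<and> primitive_on a b W h \<and>
      L2_norm (LI a b) U \<le> C2 \<and> L2_norm (LI a b) V \<le> C2 \<and> L2_norm (LI a b) f \<le> C2 \<and>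
      L2_norm (LI a b) W \<le> C2 \<and> L2_norm (LI a b) h \<le> C2 \<and>
      norm (x (a *\<^sub>R e), x (b *\<^sub>R e), y (a *\<^sub>R e), y (b *\<^sub>R e)) \<le> C2" by (rule allI)
  then obtain u v x y U V f W h where all: "\<forall>j. X j = (u j, v j, x j, y j) \<and> represented2 (u j) (U j) (V j) (f j) \<and> represented (v j) (W j) (h j) \<and> primitive_on a b (W j) (h j) \<and>
      L2_norm (LI a b) (U j) \<le> C2 \<and> L2_norm (LI a b) (V j) \<le> C2 \<and> L2_norm (LI a b) (f j) \<le> C2 \<and>
      L2_norm (LI a b) (W j) \<le> C2 \<and> L2_norm (LI a b) (h j) \<le> C2 \<and>
      norm (x j (a *\<^sub>R e), x j (b *\<^sub>R e), y j (a *\<^sub>R e), y j (b *\<^sub>R e)) \<le> C2"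
    unfolding choice_iff by (elim exE) (rule that)
  have sub: "X j = (u j, v j, x j, y j)" "represented2 (u j) (U j) (V j) (f j)" "represented (v j) (W j) (h j)" "primitive_on a b (W j) (h j)"
      "L2_norm (LI a b) (U j) \<le> C2" "L2_norm (LI a b) (V j) \<le> C2" "L2_norm (LI a b) (f j) \<le> C2"
      "L2_norm (LI a b) (W j) \<le> C2" "L2_norm (LI a b) (h j) \<le> C2"
      "norm (x j (a *\<^sub>R e), x j (b *\<^sub>R e), y j (a *\<^sub>R e), y j (b *\<^sub>R e)) \<le> C2" for j
    using all[rule_format, of j] by blast+
  show "\<exists>V\<in>state_space \<Omega>. \<exists>r. strict_mono r \<and> (\<lambda>j. N (X (r j) - V)) \<longlonglongrightarrow> 0"
  proof -
    let ?Y = "\<lambda>j. (x j (a *\<^sub>R e), x j (b *\<^sub>R e), y j (a *\<^sub>R e), y j (b *\<^sub>R e))"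
    obtain U' V' W' Y' s where s: "strict_mono (s :: nat \<Rightarrow> nat)" and U': "primitive_on a b U' V'"
      and cV: "continuous_on {a..b} V'" and cW: "continuous_on {a..b} W'"
      and conv: "\<forall>\<epsilon>>0. \<exists>n. \<forall>j\<ge>n. (\<forall>t\<in>{a..b}. cmod (U (s j) t - U' t) < \<epsilon> \<and> cmod (V (s j) t - V' t) < \<epsilon> \<and> cmod (W (s j) t - W' t) < \<epsilon>)
        \<and> norm (?Y (s j) - Y') < \<epsilon>"
      by (rule primitives_convergent_subsequence[where U = U and V = V and W = W and f = f and h = h and X = ?Y and C = C2,
            OF represented_primitive[OF represented2D(1)[OF sub(2)]] represented2D(2)[OF sub(2)] sub(4-10)]) (rule that, assumption+)
    define u' v' where "u' p = U' (p \<bullet> e)" and "v' p = W' (p \<bullet> e)" for p :: 'a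
    define xl where "xl p = (if p = a *\<^sub>R e then fst Y' else fst (snd Y'))" for p
    define yl where "yl p = (if p = a *\<^sub>R e then fst (snd (snd Y')) else snd (snd (snd Y')))" for p
    have ru': "represented u' U' V'" unfolding u'_def[abs_def] by (rule represented_lift[OF U'])
    have v': "v' \<in> L2 M" using continuous_L2[OF cW ab'] by (simp add: L2_M_iff[of v'] v'_def)
    have "(u', v', xl, yl) \<in> state_space \<Omega>" using represented_H1[OF ru'] v' by (simp add: state_space_def)
    moreover have "(\<lambda>j. N (X (s j) - (u', v', xl, yl))) \<longlonglongrightarrow> 0"
    proof (rule LIMSEQ_I)
      fix \<epsilon> :: real assume \<epsilon>: "0 < \<epsilon>"
      define l where "l = sqrt (b - a)"
      have l: "l \<ge> 0" using ab by (simp add: l_def)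
      \<comment> \<open>\<open>u\<close>, its derivative and \<open>v\<close> contribute \<open>\<delta> l\<close> each, and the four boundary values \<open>\<delta>\<close> each.\<close>
      define \<delta> where "\<delta> = \<epsilon> / (3 * l + 5)"
      have \<delta>: "\<delta> > 0" using \<epsilon> l by (simp add: \<delta>_def)
      have "\<delta> * (3 * l + 5) = \<epsilon>" using l by (simp add: \<delta>_def)
      then have \<delta>\<epsilon>: "3 * (\<delta> * l) + 4 * \<delta> < \<epsilon>" using \<delta> by (simp add: algebra_simps)
      obtain n0 where n0: "\<And>j. j \<ge> n0 \<Longrightarrow> (\<forall>t\<in>{a..b}. cmod (U (s j) t - U' t) < \<delta> \<and> cmod (V (s j) t - V' t) < \<delta> \<and> cmod (W (s j) t - W' t) < \<delta>)
        \<and> norm (?Y (s j) - Y') < \<delta>" using conv \<delta> by blast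
      show "\<exists>n0. \<forall>j\<ge>n0. norm (N (X (s j) - (u', v', xl, yl)) - 0) < \<epsilon>"
      proof (intro exI[of _ n0] allI impI)
        fix j assume "n0 \<le> j"
        from n0[OF this] have dt: "\<And>t. t \<in> {a..b} \<Longrightarrow> cmod (U (s j) t - U' t) \<le> \<delta>" "\<And>t. t \<in> {a..b} \<Longrightarrow> cmod (V (s j) t - V' t) \<le> \<delta>"
          "\<And>t. t \<in> {a..b} \<Longrightarrow> cmod (W (s j) t - W' t) \<le> \<delta>" and dY: "norm (?Y (s j) - Y') < \<delta>" by (auto intro: less_imp_le)
        note pU = represented_primitive[OF represented2D(1)[OF sub(2)]] and pV = represented2D(2)[OF sub(2)]
        have "L2_norm (LI a b) (\<lambda>t. U (s j) t - U' t) \<le> \<delta> * l" unfolding l_def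
          by (rule L2_LI_sup_le(2)[OF _ dt(1) less_imp_le[OF \<delta>] ab'])
            (intro continuous_on_diff primitive_on_continuous[OF pU] primitive_on_continuous[OF U'])
        moreover have "L2_norm (LI a b) (\<lambda>t. V (s j) t - V' t) \<le> \<delta> * l" unfolding l_def
          by (rule L2_LI_sup_le(2)[OF _ dt(2) less_imp_le[OF \<delta>] ab'])
            (intro continuous_on_diff primitive_on_continuous[OF pV] cV)
        ultimately have 1: "H1_norm \<Omega> (u (s j) - u') \<le> 2 * (\<delta> * l)"
          using represented_H1_norm_le[OF represented_diff[OF represented2D(1)[OF sub(2)] ru'], of "s j"] by linarith
        have rv: "v (s j) \<in> L2 M" by (rule represented_L2[OF sub(3)])
        have m: "v (s j) - v' \<in> borel_measurable M" by (rule L2_measurable[OF L2_diff[OF rv v']])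
        have cWW: "continuous_on {a..b} (\<lambda>t. W (s j) t - W' t)"
          by (intro continuous_on_diff primitive_on_continuous[OF sub(4)] cW)
        have "AE t in LI a b. v (s j) (t *\<^sub>R e) = W (s j) t" using sub(3)[of "s j"] by (simp add: represented_def)
        then have ae: "AE t in LI a b. (v (s j) - v') (t *\<^sub>R e) = W (s j) t - W' t"
          by eventually_elim (simp add: v'_def)
        have mL: "(\<lambda>t. (v (s j) - v') (t *\<^sub>R e)) \<in> borel_measurable (LI a b)" using m unfolding measurable_M_iff[of "v (s j) - v'"] .
        have "L2_norm M (v (s j) - v') = L2_norm (LI a b) (\<lambda>t. W (s j) t - W' t)"
          unfolding L2_norm_M[OF m] by (rule L2_norm_cong_AE[OF mL L2_measurable[OF continuous_L2[OF cWW ab']] ae])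
        also have "\<dots> \<le> \<delta> * l" unfolding l_def by (rule L2_LI_sup_le(2)[OF cWW dt(3) less_imp_le[OF \<delta>] ab'])
        finally have 2: "L2_norm M (v (s j) - v') \<le> \<delta> * l" .
        define q where "q = ?Y (s j) - Y'"
        have comp: "fst q = (x (s j) - xl) (a *\<^sub>R e)" "fst (snd q) = (x (s j) - xl) (b *\<^sub>R e)"
          "fst (snd (snd q)) = (y (s j) - yl) (a *\<^sub>R e)" "snd (snd (snd q)) = (y (s j) - yl) (b *\<^sub>R e)"
          using ends_distinct by (simp_all add: q_def xl_def yl_def)
        have "cmod ((x (s j) - xl) (a *\<^sub>R e)) \<le> \<delta>" "cmod ((x (s j) - xl) (b *\<^sub>R e)) \<le> \<delta>"
          "cmod ((y (s j) - yl) (a *\<^sub>R e)) \<le> \<delta>" "cmod ((y (s j) - yl) (b *\<^sub>R e)) \<le> \<delta>"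
          unfolding comp[symmetric]
          using norm_fst_snd_le[of q] norm_fst_snd_le[of "snd q"] norm_fst_snd_le[of "snd (snd q)"] dY[folded q_def] by linarith+
        then have 3: "L2_norm S (x (s j) - xl) \<le> 2 * \<delta>" "L2_norm S (y (s j) - yl) \<le> 2 * \<delta>"
          using L2_norm_S_le[of "x (s j) - xl"] L2_norm_S_le[of "y (s j) - yl"] by linarith+
        have split: "X (s j) - (u', v', xl, yl) = (u (s j) - u', v (s j) - v', x (s j) - xl, y (s j) - yl)" by (simp add: sub(1))
        have "N (X (s j) - (u', v', xl, yl)) < \<epsilon>"
          unfolding split using state_norm_le_sum[of \<Omega> "u (s j) - u'" "v (s j) - v'" "x (s j) - xl" "y (s j) - yl"] 1 2 3 \<delta>\<epsilon> by linarith
        then show "norm (N (X (s j) - (u', v', xl, yl)) - 0) < \<epsilon>"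
          using state_norm_nonneg[of \<Omega> "X (s j) - (u', v', xl, yl)"] by simp
      qed
    qed
    ultimately show ?thesis using s by blast
  qed
qed

end

section \<open>Intervals as domains in dimension one\<close>

text \<open>
  The coordinates of the points form a bounded connected set of reals, and as this set is open its
  infimum and supremum are not attained.
\<close>

lemma bounded_domain_interval:
  fixes \<Omega> :: "'a::euclidean_space set"
  assumes \<Omega>: "open \<Omega>" "connected \<Omega>" "\<Omega> \<noteq> {}" "bounded \<Omega>" and dim: "DIM('a) = 1"
  obtains e a b where "interval_domain e a b \<Omega>"
proof -
  obtain e where e: "(Basis :: 'a set) = {e}" using dim by (rule card_1_singletonE)
  have ee: "e \<bullet> e = 1" using e by (intro inner_same_Basis) auto
  have rep: "x = (x \<bullet> e) *\<^sub>R e" for x :: 'a using euclidean_representation[of x] by (simp add: e)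
  define T where "T = (\<lambda>x. x \<bullet> e) ` \<Omega>"
  have T: "t \<in> T \<longleftrightarrow> t *\<^sub>R e \<in> \<Omega>" for t
  proof
    assume "t \<in> T"
    then obtain x where "x \<in> \<Omega>" "t = x \<bullet> e" by (auto simp: T_def)
    then show "t *\<^sub>R e \<in> \<Omega>" by (simp only: rep[symmetric])
  next
    assume "t *\<^sub>R e \<in> \<Omega>"
    then show "t \<in> T" unfolding T_def by (rule image_eqI[rotated]) (simp add: ee)
  qed
  have "open ((\<lambda>t. t *\<^sub>R e) -` \<Omega>)" by (intro open_vimage \<Omega>(1) continuous_intros)
  also have "(\<lambda>t. t *\<^sub>R e) -` \<Omega> = T" using T by auto
  finally have opT: "open T" .
  have conT: "connected T" unfolding T_def by (intro connected_continuous_image \<Omega>(2) continuous_intros)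
  have "bounded T" unfolding T_def by (intro bounded_linear_image[OF \<Omega>(4)] bounded_linear_inner_left)
  then have bd: "bdd_above T" "bdd_below T" by (auto intro: bounded_imp_bdd_above bounded_imp_bdd_below)
  have ne: "T \<noteq> {}" using \<Omega>(3) unfolding T_def by blast
  have ex: "\<exists>s\<in>T. s < t" "\<exists>s\<in>T. t < s" if "t \<in> T" for t
  proof -
    obtain r where r: "r > 0" "ball t r \<subseteq> T" using opT \<open>t \<in> T\<close> unfolding open_contains_ball by blast
    have "t - r / 2 \<in> ball t r" "t + r / 2 \<in> ball t r" using r(1) by (auto simp: dist_real_def)
    then have i: "t - r / 2 \<in> T" "t + r / 2 \<in> T" using r(2) by blast+
    show "\<exists>s\<in>T. s < t" by (rule bexI[OF _ i(1)]) (use r(1) in simp)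
    show "\<exists>s\<in>T. t < s" by (rule bexI[OF _ i(2)]) (use r(1) in simp)
  qed
  have in_T: "t \<in> T \<longleftrightarrow> Inf T < t \<and> t < Sup T" for t
  proof
    assume "t \<in> T"
    then obtain s1 s2 where s: "s1 \<in> T" "s1 < t" "s2 \<in> T" "t < s2" using ex by blast
    then show "Inf T < t \<and> t < Sup T"
      using cInf_lower[OF s(1) bd(2)] cSup_upper[OF s(3) bd(1)] by linarith
  next
    assume "Inf T < t \<and> t < Sup T"
    then obtain t1 t2 where "t1 \<in> T" "t1 < t" "t2 \<in> T" "t < t2"
      using cInf_less_iff[OF ne bd(2)] less_cSup_iff[OF ne bd(1)] by blast
    then show "t \<in> T" using connectedD_interval[OF conT, of t1 t2 t] by simp
  qed
  have "interval_domain e (Inf T) (Sup T) \<Omega>"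
  proof
    obtain t where "t \<in> T" using ne by blast
    then show "Inf T < Sup T" using in_T[of t] by linarith
    show "\<Omega> = {x. Inf T < x \<bullet> e \<and> x \<bullet> e < Sup T}"
    proof (rule set_eqI)
      fix x
      have "x \<in> \<Omega> \<longleftrightarrow> (x \<bullet> e) *\<^sub>R e \<in> \<Omega>" by (simp only: rep[symmetric])
      also have "\<dots> \<longleftrightarrow> x \<bullet> e \<in> T" by (rule T[symmetric])
      finally show "x \<in> \<Omega> \<longleftrightarrow> x \<in> {x. Inf T < x \<bullet> e \<and> x \<bullet> e < Sup T}" by (simp only: in_T mem_Collect_eq)
    qed
  qed (rule e)
  then show thesis by (rule that)
qed

theorem corollary3p13:
  fixes \<Omega> :: "(real ^ 'n) set"
    and c :: real
    and \<rho> m :: "real ^ 'n \<Rightarrow> real"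
    and d k :: "real ^ 'n \<Rightarrow> complex"
  assumes "open \<Omega>" and "connected \<Omega>" and "\<Omega> \<noteq> {}" and "bounded \<Omega>"
    and "smooth_boundary \<Omega>"
    and "c > 0"
    and "\<rho> \<in> Linf (surface_measure \<Omega>)" and "m \<in> Linf (surface_measure \<Omega>)"
    and "d \<in> Linf (surface_measure \<Omega>)" and "k \<in> Linf (surface_measure \<Omega>)"
    and "\<exists>m0>0. AE p in surface_measure \<Omega>. m0 \<le> m p"
  shows "has_compact_resolvent (state_space \<Omega>) (state_norm \<Omega>) state_scale
           (acoustic_dom \<Omega> \<rho> m) (acoustic_op \<Omega> c \<rho> m d k)
         \<longleftrightarrow> CARD('n) = 1"
proof
  obtain m0 where m0: "m0 > 0" "AE p in surface_measure \<Omega>. m0 \<le> m p" using assms(11) by blast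
  {
    assume "CARD('n) = 1"
    then have "DIM(real ^ 'n) = 1" by simp
    then obtain e a b where i: "interval_domain e a b \<Omega>" by (rule bounded_domain_interval[OF assms(1-4)])
    interpret interval_domain e a b \<Omega> by (rule i)
    interpret acoustic_interval e a b \<Omega> c \<rho> m d k
    proof
      show "m p > 0" if "p \<in> frontier \<Omega>" for p
        using that m0 by (auto simp: frontier_\<Omega> AE_S_iff)
    qed (rule assms(5,6))+
    show "has_compact_resolvent (state_space \<Omega>) (state_norm \<Omega>) state_scale
           (acoustic_dom \<Omega> \<rho> m) (acoustic_op \<Omega> c \<rho> m d k)" by (rule compact_resolvent)
  next
    assume compact: "has_compact_resolvent (state_space \<Omega>) (state_norm \<Omega>) state_scale
           (acoustic_dom \<Omega> \<rho> m) (acoustic_op \<Omega> c \<rho> m d k)"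
    show "CARD('n) = 1"
    proof (rule ccontr)
      assume "CARD('n) \<noteq> 1"
      then have "CARD('n) \<ge> 2" using zero_less_card_finite[where 'a = 'n] by arith
      then have "DIM(real ^ 'n) \<ge> 2" by simp
      from acoustic_resolvent_not_compact[OF assms(1,3,4,5) this assms(7-10) m0] compact show False by blast
    qed
  }
qed

end
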